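(* Let $d\ge 1$, $X=\mathbb{R}^d/\mathbb{Z}^d$, and let $\alpha\in\mathbb{R}^d$ be such that $f_\alpha:X\to X$, $f_\alpha(x)=x+\alpha$, is ergodic with respect to Lebesgue measure. Let $r\in\{\infty,\omega\}$ and let $A\in C^r(X,\mathrm{SL}(2,\mathbb{R}))$ be non-homotopic to a constant. If $(f_\alpha,A)$ is $C^0$-conjugate to rotations, then it is $C^r$-conjugate to rotations.
   Context: For $A:X\to\mathrm{SL}(2,\mathbb{R})$, the cocycle $(f_\alpha,A)$ is the skew-product $(x,w)\mapsto(x+\alpha,A(x)\cdot w)$ on $X\times\mathbb{R}^2$. The cocycle $(f_\alpha,A)$ is $C^s$-conjugate to rotations ($s=0,\infty,\omega$) if there is $B\in C^s(X,\mathrm{SL}(2,\mathbb{R}))$ with $B(x+\alpha)A(x)B(x)^{-1}\in\mathrm{SO}(2,\mathbb{R})$ for every $x\in X$. $C^\omega$ means real-analytic. "Non-homotopic to a constant" means as a continuous map $X\to\mathrm{SL}(2,\mathbb{R})$. *)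

theory Defs
  imports "HOL-Analysis.Analysis"
begin

section \<open>The torus\<close>

definition lattice_rel :: "real^'d \<Rightarrow> real^'d \<Rightarrow> bool" where
  "lattice_rel v w \<longleftrightarrow> (\<forall>i. v $ i - w $ i \<in> \<int>)"

lemma equivp_lattice_rel: "equivp lattice_rel"
proof (rule equivpI)
  show "reflp lattice_rel"
    by (simp add: reflp_def lattice_rel_def)
  show "symp lattice_rel"
    unfolding symp_def lattice_rel_def by (metis Ints_minus minus_diff_eq)
  show "transp lattice_rel"
    unfolding transp_def lattice_rel_def by (metis Ints_add diff_add_cancel add_diff_eq)
qed

quotient_type 'd torus = "(real, 'd::finite) vec" / lattice_rel
  morphisms torus_rep torus_proj
  by (rule equivp_lattice_rel)

instantiation torus :: (finite) topological_space
begin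

definition open_torus :: "'a torus set \<Rightarrow> bool" where
  "open_torus U \<longleftrightarrow> open (torus_proj -` U)"

instance
proof
  show "open (UNIV :: 'a torus set)"
    by (simp add: open_torus_def)
  show "open (S \<inter> T)" if "open S" "open T" for S T :: "'a torus set"
    using that by (simp add: open_torus_def vimage_Int open_Int)
  show "open (\<Union>K)" if "\<forall>S\<in>K. open S" for K :: "'a torus set set"
    using that by (auto simp: open_torus_def vimage_Union)
qed

end

lift_definition torus_translation :: "real^'d \<Rightarrow> 'd torus \<Rightarrow> 'd torus" is "\<lambda>\<alpha> v. v + \<alpha>"
  by (simp add: lattice_rel_def)

text \<open>Lebesgue measure on the Borel sets of the torus: the image of Lebesgue measure on the
  half-open unit cube, which is a fundamental domain.\<close>

definition torus_lebesgue :: "'d::finite torus measure" where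
  "torus_lebesgue =
     distr (restrict_space lborel {v :: real^'d. \<forall>i. 0 \<le> v $ i \<and> v $ i < 1}) borel torus_proj"

lemma torus_proj_borel_measurable: "torus_proj \<in> borel_measurable borel"
  by (rule borel_measurable_continuous_onI)
     (auto simp: continuous_on_open_vimage open_torus_def)

definition ergodic_map :: "'a measure \<Rightarrow> ('a \<Rightarrow> 'a) \<Rightarrow> bool" where
  "ergodic_map M f \<longleftrightarrow>
     f \<in> measurable M M \<and> distr M M f = M \<and>
     (\<forall>S\<in>sets M. f -` S \<inter> space M = S \<longrightarrow> emeasure M S = 0 \<or> emeasure M (space M - S) = 0)"

section \<open>Regularity classes\<close>

primrec differentiable_Ck ::
    "nat \<Rightarrow> ('a::euclidean_space \<Rightarrow> 'b::real_normed_vector) \<Rightarrow> bool" where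
  "differentiable_Ck 0 f \<longleftrightarrow> continuous_on UNIV f"
| "differentiable_Ck (Suc k) f \<longleftrightarrow>
     (\<forall>x. f differentiable (at x)) \<and>
     (\<forall>v. differentiable_Ck k (\<lambda>x. frechet_derivative f (at x) v))"

definition smooth :: "('a::euclidean_space \<Rightarrow> 'b::real_normed_vector) \<Rightarrow> bool" where
  "smooth f \<longleftrightarrow> (\<forall>k. differentiable_Ck k f)"

text \<open>Local expansion in a convergent power series in several variables; the multi-indices are
  the functions \<open>m :: 'd \<Rightarrow> nat\<close>, and the sum over them is unconditional.\<close>

definition real_analytic :: "(real^'d \<Rightarrow> 'b::real_normed_vector) \<Rightarrow> bool" where
  "real_analytic f \<longleftrightarrow>
     (\<forall>x. \<exists>r>0. \<exists>c :: ('d \<Rightarrow> nat) \<Rightarrow> 'b. \<forall>y\<in>ball x r.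
        ((\<lambda>m. (\<Prod>i\<in>UNIV. (y $ i - x $ i) ^ m i) *\<^sub>R c m) has_sum f y) UNIV)"

datatype regularity = C_zero | C_infinity | C_omega

text \<open>Differentiability and analyticity on the torus are those of the periodic lift.\<close>

fun of_class :: "regularity \<Rightarrow> ('d::finite torus \<Rightarrow> 'b::real_normed_vector) \<Rightarrow> bool" where
  "of_class C_zero F \<longleftrightarrow> continuous_on UNIV F"
| "of_class C_infinity F \<longleftrightarrow> smooth (F \<circ> torus_proj)"
| "of_class C_omega F \<longleftrightarrow> real_analytic (F \<circ> torus_proj)"

section \<open>Cocycles\<close>

definition SL2 :: "(real^2^2) set" where
  "SL2 = {M. det M = 1}"

definition SO2 :: "(real^2^2) set" where
  "SO2 = {M. rotation_matrix M}"

text \<open>\<open>SL2\<close> is a closed analytic submanifold of the space of matrices, so the regularity of a map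
  into it is that of the matrix-valued map.\<close>

definition maps_SL2 :: "regularity \<Rightarrow> ('d::finite torus \<Rightarrow> real^2^2) set" where
  "maps_SL2 s = {A. of_class s A \<and> range A \<subseteq> SL2}"

definition homotopic_to_constant :: "('d::finite torus \<Rightarrow> real^2^2) \<Rightarrow> bool" where
  "homotopic_to_constant A \<longleftrightarrow>
     (\<exists>c\<in>SL2. homotopic_with_canon (\<lambda>_. True) UNIV SL2 A (\<lambda>_. c))"

definition conjugate_to_rotations ::
    "regularity \<Rightarrow> real^'d \<Rightarrow> ('d torus \<Rightarrow> real^2^2) \<Rightarrow> bool" where
  "conjugate_to_rotations s \<alpha> A \<longleftrightarrow>
     (\<exists>B\<in>maps_SL2 s. \<forall>x. B (torus_translation \<alpha> x) ** A x ** matrix_inv (B x) \<in> SO2)"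

end

theory Submission
 imports Defs "HOL-Complex_Analysis.Cauchy_Integral_Formula"
begin

text \<open>
Identify a real matrix with the pair \<open>(p, q)\<close> of complex numbers such that it acts on the plane by
\<open>v \<mapsto> p * v + q * cnj v\<close>. Then \<open>SL2\<close> acts on the unit disc by
\<open>z \<mapsto> (p * z + q) / (cnj q * z + cnj p)\<close>, and the rotations are the pairs with \<open>q = 0\<close>. A conjugacy
\<open>B = (b1, b2)\<close> to rotations amounts to the invariant section \<open>u = - b2 / b1\<close> of the disc bundle, and
conversely \<open>u\<close> gives back a conjugacy with \<open>b1 = (1 - |u|\<^sup>2) powr (-1/2)\<close>, \<open>b2 = - u * b1\<close>. So it suffices
to show that the continuous invariant section \<open>u\<close> is as regular as \<open>A\<close>, and for this it suffices that its
Fourier coefficients decay (\<open>good_coeffs_lift_class\<close>, \<open>conjugacy_from_section\<close>).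

The hypothesis on homotopy enters through the rotation angle \<open>\<phi>\<close> of the conjugated cocycle: on the
universal cover \<open>\<phi> (x + k) = \<phi> x + 2 * pi * (l \<bullet> k)\<close> with an integer vector \<open>l\<close>, and if \<open>l = 0\<close> one can
rotate back continuously and \<open>A\<close> is homotopic to a constant (\<open>degree_zero_homotopic\<close>). Let \<open>w\<close> be a
direction with \<open>l \<bullet> w > 0\<close>. The mean speed of rotation along \<open>w\<close> is then \<open>2 * pi * (l \<bullet> w) > 0\<close>, while the
part of the velocity that is not a rotation averages to zero, uniformly over the torus. Hence some iterate
of the cocycle turns every vector strictly in the positive sense when the base point moves along \<open>w\<close>
(\<open>monotone_iterate\<close>).

Monotonicity becomes contraction in complex time: at \<open>x + \<i> t w\<close> with small \<open>t > 0\<close> the monotone iterate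
maps the closed disc into a disc that is smaller by a factor \<open>1 - c t\<close> (\<open>moebius_contraction\<close>). Start from
a function close to \<open>u\<close>, extended constantly in \<open>t\<close>, and iterate the action. The iterates stay in the
disc, at \<open>t = 0\<close> they stay close to \<open>u\<close>, since there the action is by hyperbolic isometries, and for \<open>t > 0\<close>
the failure of the Cauchy-Riemann equation is contracted away, up to the contribution of the extension of
\<open>A\<close> itself. Solving the differential equation in \<open>t\<close> for a Fourier coefficient now bounds it by
\<open>exp (- a T)\<close> plus that contribution, where \<open>a = - 2 * pi * (k \<bullet> w) \<ge> 0\<close> (\<open>fcoeff_decay_one_sided\<close>). An analytic
\<open>A\<close> has a holomorphic extension, and the decay is exponential; a smooth \<open>A\<close> has extensions with error of
every order \<open>t ^ J\<close>, and the decay is faster than every power. The inverse cocycle gives the opposite half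
space, and finitely many such \<open>w\<close> span all directions (\<open>section_good_coeffs\<close>).

Functions on the torus are treated as functions on the universal cover with integer periods, and integrals
over the torus as limits of Birkhoff averages, which converge uniformly because translation orbits are
dense with bounded gaps.
\<close>

section \<open>Integer translations and the torus\<close>

definition int_vec :: "real^'d \<Rightarrow> bool" where
 "int_vec k \<longleftrightarrow> (\<forall>i. k $ i \<in> \<int>)"

definition periodic :: "(real^'d \<Rightarrow> 'a) \<Rightarrow> bool" where
 "periodic f \<longleftrightarrow> (\<forall>x k. int_vec k \<longrightarrow> f (x + k) = f x)"

lemma int_vec_add: "int_vec k ==> int_vec l ==> int_vec (k + l)"
 by (auto simp: int_vec_def)

lemma int_vec_diff: "int_vec k ==> int_vec l ==> int_vec (k - l)"
 by (auto simp: int_vec_def)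

lemma int_vec_minus: "int_vec k ==> int_vec (- k)"
 by (auto simp: int_vec_def)

lemma int_vec_axis: "int_vec (axis i 1)"
 by (auto simp: int_vec_def axis_def)

lemma periodicD: "periodic f ==> int_vec k ==> f (x + k) = f x"
 by (auto simp: periodic_def)

lemma periodic_shift: "periodic f ==> periodic (\<lambda>x. f (x + b))"
 by (simp add: periodic_def add.assoc add.commute[of b])
   (metis add.assoc add.commute)

lemma torus_proj_eq: "torus_proj x = torus_proj y \<longleftrightarrow> int_vec (x - y)"
 by (simp add: torus.abs_eq_iff lattice_rel_def int_vec_def)

lemma torus_proj_surj: "\<exists>x. torus_proj x = X"
 by (rule exI[of _ "torus_rep X"]) (rule Quotient3_abs_rep[OF Quotient3_torus])

lemma torus_proj_cong: "int_vec k ==> torus_proj (x + k) = torus_proj x"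
 by (simp add: torus_proj_eq)

lemma continuous_torus_proj: "continuous_on UNIV torus_proj"
 by (auto simp: continuous_on_open_vimage open_torus_def)

lemma open_map_torus_proj:
 assumes "open U"
 shows "open (torus_proj ` U)"
proof -
 have "torus_proj -` (torus_proj ` U) = (\<Union>k\<in>Collect int_vec. (+) k ` U)"
 proof (intro set_eqI iffI)
  fix x :: "real^'a" assume "x \<in> torus_proj -` (torus_proj ` U)"
  then obtain y where y: "y \<in> U" "torus_proj x = torus_proj y" by auto
  then have "int_vec (x - y)" by (simp add: torus_proj_eq)
  moreover have "x = (x - y) + y" by simp
  ultimately show "x \<in> (\<Union>k\<in>Collect int_vec. (+) k ` U)" using y by blast
 next
  fix x :: "real^'a" assume "x \<in> (\<Union>k\<in>Collect int_vec. (+) k ` U)"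
  then obtain k y where "int_vec k" "y \<in> U" "x = k + y" by auto
  then show "x \<in> torus_proj -` (torus_proj ` U)"
   by (auto simp: torus_proj_cong add.commute[of k])
 qed
 moreover have "open (\<Union>k\<in>Collect int_vec. (+) k ` U)"
  using assms by (intro open_UN ballI open_translation)
 ultimately show ?thesis by (simp add: open_torus_def)
qed

lemma int_vec_floor_decomp:
 obtains k where "int_vec k" "\<And>i. 0 \<le> (x - k) $ i" "\<And>i. (x - k) $ i < 1"
proof
 show "int_vec (\<chi> i. of_int \<lfloor>x $ i\<rfloor>)" by (auto simp: int_vec_def)
 show "0 \<le> (x - (\<chi> i. of_int \<lfloor>x $ i\<rfloor>)) $ i" for i by simp
 show "(x - (\<chi> i. of_int \<lfloor>x $ i\<rfloor>)) $ i < 1" for i by simp linarith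
qed

section \<open>Orbits of an ergodic translation\<close>

text \<open>A lift of the open set, moved by an integer vector, meets the interior of the unit cube.\<close>

lemma torus_lebesgue_open_pos:
 fixes U :: "'d::finite torus set"
 assumes "open U" "U \<noteq> {}"
 shows "emeasure torus_lebesgue U \<noteq> 0"
proof -
 let ?Q = "{v :: real^'d. \<forall>i. 0 \<le> v $ i \<and> v $ i < 1}"
 let ?P = "torus_proj -` U :: (real^'d) set"
 have oP: "open ?P" using assms by (simp add: open_torus_def)
 obtain x0 where x0: "torus_proj x0 \<in> U" using assms(2) torus_proj_surj by (metis ex_in_conv)
 obtain k where k: "int_vec k" "\<And>i. 0 \<le> (x0 - k) $ i" "\<And>i. (x0 - k) $ i < 1"
  using int_vec_floor_decomp by blast
 define y where "y = x0 - k"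
 have yP: "y \<in> ?P"
 proof -
  have "torus_proj (y + k) = torus_proj y" using k(1) by (rule torus_proj_cong)
  then show ?thesis using x0 by (simp add: y_def)
 qed
 let ?C = "box (0 :: real^'d) (\<chi> i. 1)"
 have Cdef: "?C = {v. \<forall>i. 0 < v $ i \<and> v $ i < 1}"
  by (auto simp: mem_box_cart)
 have "y \<in> closure ?C"
 proof -
  have "?C \<noteq> {}" unfolding Cdef by (rule ex_in_conv[THEN iffD1], rule exI[of _ "\<chi> i. 1/2"]) auto
  then have "closure ?C = cbox 0 (\<chi> i. 1)" by (rule closure_box)
  then show ?thesis using k(2,3) by (auto simp: mem_box_cart y_def less_imp_le)
 qed
 then have ne: "?P \<inter> ?C \<noteq> {}"
  using oP yP by (metis Int_commute closure_iff_nhds_not_empty order_refl)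
 have o: "open (?P \<inter> ?C)" using oP by auto
 have sub: "?P \<inter> ?C \<subseteq> ?P \<inter> ?Q" unfolding Cdef by (auto intro: less_imp_le)
 have Qm: "?Q \<in> sets lborel"
 proof -
  have "?Q = (\<Inter>i. {v. 0 \<le> v $ i} \<inter> {v. v $ i < 1})" by auto
  also have "\<dots> \<in> sets borel" by measurable
  finally show ?thesis by simp
 qed
 have Um: "U \<in> sets borel" using assms by simp
 have "emeasure torus_lebesgue U = emeasure (restrict_space lborel ?Q) (torus_proj -` U \<inter> space (restrict_space lborel ?Q))"
  unfolding torus_lebesgue_def
 proof (rule emeasure_distr)
  show "torus_proj \<in> restrict_space lborel ?Q \<rightarrow>\<^sub>M borel"
   by (rule measurable_restrict_space1) (simp add: torus_proj_borel_measurable)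
 qed (use Um in simp)
 also have "\<dots> = emeasure lborel (?P \<inter> ?Q)"
  using Qm by (subst emeasure_restrict_space) (auto simp: space_restrict_space)
 finally have eq: "emeasure torus_lebesgue U = emeasure lborel (?P \<inter> ?Q)" .
 have "emeasure lborel (?P \<inter> ?C) \<noteq> 0"
 proof
  assume "emeasure lborel (?P \<inter> ?C) = 0"
  then have "?P \<inter> ?C \<in> null_sets lborel" using o by (auto intro: null_setsI)
  then have "negligible (?P \<inter> ?C)" by (simp add: negligible_iff_null_sets null_sets_completionI)
  then show False using o ne open_not_negligible by blast
 qed
 moreover have "emeasure lborel (?P \<inter> ?C) \<le> emeasure lborel (?P \<inter> ?Q)"
  using sub oP Qm by (intro emeasure_mono) auto
 ultimately show ?thesis using eq by auto
qed

text \<open>Every point of the torus is within \<open>\<delta>\<close> of one of the first \<open>K\<close> points of the forward orbit, uniformly: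
the form in which ergodicity enters.\<close>

definition syndetic_orbit :: "real^'d \<Rightarrow> bool" where
 "syndetic_orbit \<alpha> \<longleftrightarrow> (\<forall>\<delta>>0. \<exists>K. \<forall>z. \<exists>n\<le>K. \<exists>k. int_vec k \<and> norm (of_nat n *\<^sub>R \<alpha> + k - z) < \<delta>)"

text \<open>The union of the \<open>\<delta> / 2\<close>-balls around the full orbit of \<open>0\<close> is open and invariant, so by ergodicity its
complement is null and cannot contain an open set.\<close>

lemma ergodic_translation_orbit_dense:
 fixes \<alpha> :: "real^'d"
 assumes erg: "ergodic_map torus_lebesgue (torus_translation \<alpha>)" and "\<delta> > 0"
 shows "\<exists>(n::int) k. int_vec k \<and> norm (of_int n *\<^sub>R \<alpha> + k - z) < \<delta>"
proof -
 have tr: "torus_translation \<alpha> (torus_proj x) = torus_proj (x + \<alpha>)" for x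
  by (simp add: torus_translation.abs_eq)
 let ?U = "\<Union>n::int. ball (of_int n *\<^sub>R \<alpha>) (\<delta>/2)"
 define V where "V = torus_proj ` ?U"
 have oV: "open V" unfolding V_def by (intro open_map_torus_proj open_UN ballI) auto
 have "torus_proj (of_int 0 *\<^sub>R \<alpha>) \<in> V"
  unfolding V_def using \<open>\<delta> > 0\<close> by (intro imageI UN_I[of 0]) auto
 then have neV: "V \<noteq> {}" by blast
 have mU: "x + \<alpha> \<in> ?U \<longleftrightarrow> x \<in> ?U" for x
 proof
  assume "x + \<alpha> \<in> ?U"
  then obtain n :: int where n: "dist (of_int n *\<^sub>R \<alpha>) (x + \<alpha>) < \<delta>/2" by auto
  have "dist (of_int (n - 1) *\<^sub>R \<alpha>) x = dist (of_int n *\<^sub>R \<alpha>) (x + \<alpha>)"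
   by (simp add: dist_norm algebra_simps)
  then show "x \<in> ?U" using n by (intro UN_I[of "n - 1"]) auto
 next
  assume "x \<in> ?U"
  then obtain n :: int where n: "dist (of_int n *\<^sub>R \<alpha>) x < \<delta>/2" by auto
  have "dist (of_int (n + 1) *\<^sub>R \<alpha>) (x + \<alpha>) = dist (of_int n *\<^sub>R \<alpha>) x"
   by (simp add: dist_norm algebra_simps)
  then show "x + \<alpha> \<in> ?U" using n by (intro UN_I[of "n + 1"]) auto
 qed
 have inV: "torus_proj x \<in> V \<longleftrightarrow> (\<exists>k. int_vec k \<and> x + k \<in> ?U)" for x
 proof
  assume "torus_proj x \<in> V"
  then obtain y where y: "y \<in> ?U" "torus_proj x = torus_proj y" unfolding V_def by blast
  then have "int_vec (y - x)" by (metis torus_proj_eq)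
  then show "\<exists>k. int_vec k \<and> x + k \<in> ?U" using y(1) by (intro exI[of _ "y - x"]) auto
 next
  assume "\<exists>k. int_vec k \<and> x + k \<in> ?U"
  then show "torus_proj x \<in> V" unfolding V_def by (metis imageI torus_proj_cong)
 qed
 have inv: "torus_translation \<alpha> -` V = V"
 proof (rule set_eqI)
  fix X :: "'d torus"
  obtain x where X: "X = torus_proj x" using torus_proj_surj by metis
  have "X \<in> torus_translation \<alpha> -` V \<longleftrightarrow> torus_proj (x + \<alpha>) \<in> V" by (simp add: X tr)
  also have "\<dots> \<longleftrightarrow> (\<exists>k. int_vec k \<and> (x + k) + \<alpha> \<in> ?U)" unfolding inV by (simp add: add_ac)
  also have "\<dots> \<longleftrightarrow> X \<in> V" unfolding mU X inV ..
  finally show "X \<in> torus_translation \<alpha> -` V \<longleftrightarrow> X \<in> V" .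
 qed
 have sp: "space torus_lebesgue = (UNIV :: 'd torus set)" and st: "sets torus_lebesgue = sets (borel :: 'd torus measure)"
  by (auto simp: torus_lebesgue_def)
 have "emeasure torus_lebesgue V = 0 \<or> emeasure torus_lebesgue (UNIV - V) = 0"
  using erg oV inv unfolding ergodic_map_def sp st by auto
 then have z: "emeasure torus_lebesgue (UNIV - V) = 0"
  using torus_lebesgue_open_pos[OF oV neV] by blast
 let ?W = "torus_proj ` ball z (\<delta>/2)"
 have oW: "open ?W" by (intro open_map_torus_proj) auto
 have "?W \<inter> V \<noteq> {}"
 proof
  assume "?W \<inter> V = {}"
  then have "?W \<subseteq> UNIV - V" by auto
  then have "emeasure torus_lebesgue ?W \<le> emeasure torus_lebesgue (UNIV - V)"
   using oV by (intro emeasure_mono) (auto simp: st)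
  then have "emeasure torus_lebesgue ?W = 0" using z by simp
  moreover have "?W \<noteq> {}" using \<open>\<delta> > 0\<close> by auto
  ultimately show False using torus_lebesgue_open_pos[OF oW] by blast
 qed
 then obtain y where y: "y \<in> ball z (\<delta>/2)" "torus_proj y \<in> V" by blast
 then obtain k where k: "int_vec k" "y + k \<in> ?U" using inV by blast
 then obtain n :: int where n: "norm (of_int n *\<^sub>R \<alpha> - (y + k)) < \<delta>/2" by (auto simp: dist_norm)
 have "norm (of_int n *\<^sub>R \<alpha> + (- k) - z) = norm ((of_int n *\<^sub>R \<alpha> - (y + k)) + (y - z))"
  by (simp add: algebra_simps)
 also have "\<dots> < \<delta>/2 + \<delta>/2"
  using n y(1) by (intro norm_triangle_lt) (auto simp: dist_norm norm_minus_commute)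
 finally show ?thesis using k(1) int_vec_minus by (intro exI[of _ n] exI[of _ "- k"]) auto
qed

text \<open>By compactness finitely many times suffice for all \<open>z\<close>; a shift of time makes them nonnegative.\<close>

lemma ergodic_translation_syndetic:
 fixes \<alpha> :: "real^'d"
 assumes erg: "ergodic_map torus_lebesgue (torus_translation \<alpha>)"
 shows "syndetic_orbit \<alpha>"
 unfolding syndetic_orbit_def
proof (intro allI impI)
 fix \<delta> :: real assume d: "\<delta> > 0"
 let ?Q = "cbox (0 :: real^'d) (\<chi> i. 1)"
 have "\<forall>z. \<exists>(n::int) k. int_vec k \<and> norm (of_int n *\<^sub>R \<alpha> + k - z) < \<delta>/2"
  using ergodic_translation_orbit_dense[OF erg] d by (meson half_gt_zero)
 then obtain N :: "real^'d \<Rightarrow> int" and k where nk: "\<And>z. int_vec (k z)" "\<And>z. norm (of_int (N z) *\<^sub>R \<alpha> + k z - z) < \<delta>/2"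
  by metis
 have cov: "?Q \<subseteq> (\<Union>z\<in>?Q. ball z (\<delta>/2))" using d by force
 obtain F where F: "F \<subseteq> ?Q" "finite F" "?Q \<subseteq> \<Union>((\<lambda>z. ball z (\<delta>/2)) ` F)"
  using compactE_image[of ?Q ?Q "\<lambda>z. ball z (\<delta>/2)", OF compact_cbox open_ball cov] by blast
 define K where "K = (\<Sum>z\<in>F. nat \<bar>N z\<bar>)"
 have NK: "\<bar>N z\<bar> \<le> int K" if "z \<in> F" for z
 proof -
  have "nat \<bar>N z\<bar> \<le> K" unfolding K_def by (rule member_le_sum) (use that F in auto)
  then show ?thesis by linarith
 qed
 show "\<exists>K. \<forall>z. \<exists>n\<le>K. \<exists>k. int_vec k \<and> norm (of_nat n *\<^sub>R \<alpha> + k - z) < \<delta>"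
 proof (rule exI[of _ "2 * K"], rule allI)
  fix z :: "real^'d"
  obtain j where j: "int_vec j" "\<And>i. 0 \<le> (z - of_nat K *\<^sub>R \<alpha> - j) $ i"
    "\<And>i. (z - of_nat K *\<^sub>R \<alpha> - j) $ i < 1"
   using int_vec_floor_decomp by blast
  define y where "y = z - of_nat K *\<^sub>R \<alpha> - j"
  have "y \<in> ?Q" using j by (auto simp: mem_box_cart y_def less_imp_le)
  then obtain z' where z': "z' \<in> F" "norm (z' - y) < \<delta>/2" using F by (auto simp: dist_norm)
  define n where "n = nat (N z' + int K)"
  have n0: "0 \<le> N z' + int K" and n1: "N z' + int K \<le> 2 * int K" using NK[OF z'(1)] by auto
  have nn: "real n = of_int (N z') + real K" using n0 by (simp add: n_def)
  have "real n *\<^sub>R \<alpha> + (k z' + j) - z = (of_int (N z') *\<^sub>R \<alpha> + k z' - z') + (z' - y)"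
   unfolding nn y_def by (simp add: algebra_simps)
  then have "norm (real n *\<^sub>R \<alpha> + (k z' + j) - z) < \<delta>/2 + \<delta>/2"
   using nk(2)[of z'] z'(2) by (metis norm_triangle_lt add_strict_mono)
  moreover have "n \<le> 2 * K" using n1 by (simp add: n_def)
  moreover have "int_vec (k z' + j)" using nk(1) j(1) by (rule int_vec_add)
  ultimately show "\<exists>n\<le>2 * K. \<exists>k. int_vec k \<and> norm (of_nat n *\<^sub>R \<alpha> + k - z) < \<delta>"
   by auto
 qed
qed

section \<open>Continuous periodic functions and their mean\<close>

text \<open>Two nearby points can be moved by the same integer vector into a compact cube; its side is three because
they need not lie in the same unit cell.\<close>

lemma periodic_uniformly_continuous_param:
 fixes F :: "real^'d \<Rightarrow> 's::metric_space \<Rightarrow> 'a::metric_space"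
 assumes cont: "continuous_on (UNIV \<times> S) (\<lambda>(x, s). F x s)" and S: "compact S"
  and per: "\<And>s. s \<in> S ==> periodic (\<lambda>x. F x s)" and "e > 0"
 obtains d where "d > 0" "\<And>x s x' s'. s \<in> S ==> s' \<in> S ==> dist x x' < d ==> dist s s' < d ==> dist (F x s) (F x' s') < e"
proof -
 let ?Q = "cbox (\<chi> i. -1) (\<chi> i. 2) :: (real^'d) set"
 have "uniformly_continuous_on (?Q \<times> S) (\<lambda>(x, s). F x s)"
  by (intro compact_uniformly_continuous continuous_on_subset[OF cont] compact_Times S compact_cbox) auto
 then obtain d where d: "d > 0" "\<And>p q. p \<in> ?Q \<times> S ==> q \<in> ?Q \<times> S ==> dist q p < d ==>
   dist (case q of (x, s) \<Rightarrow> F x s) (case p of (x, s) \<Rightarrow> F x s) < e"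
  unfolding uniformly_continuous_on_def using \<open>e > 0\<close> by metis
 show ?thesis
 proof (rule that[of "min 1 (d/2)"])
  show "min 1 (d/2) > 0" using d by simp
  fix x x' :: "real^'d" and s s'
  assume s: "s \<in> S" "s' \<in> S" and dx: "dist x x' < min 1 (d/2)" and ds: "dist s s' < min 1 (d/2)"
  obtain k where k: "int_vec k" "\<And>i. 0 \<le> (x - k) $ i" "\<And>i. (x - k) $ i < 1"
   using int_vec_floor_decomp by blast
  have "-1 \<le> (x - k) $ i \<and> (x - k) $ i \<le> 2" for i
   using k(2)[of i] k(3)[of i] by simp
  then have a: "x - k \<in> ?Q" by (simp add: mem_box_cart)
  have "-1 \<le> (x' - k) $ i \<and> (x' - k) $ i \<le> 2" for i
  proof -
   have "\<bar>(x - x') $ i\<bar> < 1"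
    using component_le_norm_cart[of "x - x'" i] dx by (simp add: dist_norm)
   then show ?thesis using k(2)[of i] k(3)[of i] by (simp add: abs_less_iff)
  qed
  then have b: "x' - k \<in> ?Q" by (simp add: mem_box_cart)
  have "dist (x - k, s) (x' - k, s') \<le> dist x x' + dist s s'"
   using sqrt_sum_squares_le_sum[of "dist x x'" "dist s s'"] by (simp add: dist_Pair_Pair dist_norm)
  also have "\<dots> < d" using dx ds by simp
  finally have "dist (F (x - k) s) (F (x' - k) s') < e"
   using d(2)[of "(x' - k, s')" "(x - k, s)"] a b s by simp
  moreover have "F (x - k) s = F x s" "F (x' - k) s' = F x' s'"
   using periodicD[OF per[OF s(1)] k(1), of "x - k"] periodicD[OF per[OF s(2)] k(1), of "x' - k"] by auto
  ultimately show "dist (F x s) (F x' s') < e" by simp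
 qed
qed

lemma periodic_bounded_param:
 fixes F :: "real^'d \<Rightarrow> 's::metric_space \<Rightarrow> 'a::real_normed_vector"
 assumes cont: "continuous_on (UNIV \<times> S) (\<lambda>(x, s). F x s)" and S: "compact S"
  and per: "\<And>s. s \<in> S ==> periodic (\<lambda>x. F x s)"
 obtains C where "C > 0" "\<And>x s. s \<in> S ==> norm (F x s) \<le> C"
proof -
 let ?Q = "cbox 0 (\<chi> i. 1) :: (real^'d) set"
 have "compact ((\<lambda>(x, s). F x s) ` (?Q \<times> S))"
  by (intro compact_continuous_image continuous_on_subset[OF cont] compact_Times S compact_cbox) auto
 then obtain C where C: "C > 0" "\<And>p. p \<in> ?Q \<times> S ==> norm (case p of (x, s) \<Rightarrow> F x s) \<le> C"
  using compact_imp_bounded bounded_pos by (metis (no_types, lifting) imageI)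
 show ?thesis
 proof (rule that[OF C(1)])
  fix x :: "real^'d" and s assume s: "s \<in> S"
  obtain k where k: "int_vec k" "\<And>i. 0 \<le> (x - k) $ i" "\<And>i. (x - k) $ i < 1"
   using int_vec_floor_decomp by blast
  have "x - k \<in> ?Q" using k(2,3) by (auto simp: mem_box_cart less_imp_le)
  then have "norm (F (x - k) s) \<le> C" using C(2)[of "(x - k, s)"] s by simp
  moreover have "F (x - k) s = F x s" using periodicD[OF per[OF s] k(1), of "x - k"] by auto
  ultimately show "norm (F x s) \<le> C" by simp
 qed
qed

lemma continuous_on_param_const:
 fixes f :: "'b::topological_space \<Rightarrow> 'a::topological_space"
 assumes "continuous_on UNIV f"
 shows "continuous_on (UNIV \<times> S) (\<lambda>(x, s). f x)"
 using continuous_on_compose2[OF assms continuous_on_fst[OF continuous_on_id]]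
 by (simp add: case_prod_beta')

lemma periodic_uniformly_continuous:
 fixes f :: "real^'d \<Rightarrow> 'a::metric_space"
 assumes cont: "continuous_on UNIV f" and per: "periodic f" and "e > 0"
 obtains d where "d > 0" "\<And>x x'. dist x x' < d ==> dist (f x) (f x') < e"
proof (rule periodic_uniformly_continuous_param[where F = "\<lambda>x (s::real). f x" and S = "{0}" and e = e])
 show "continuous_on (UNIV \<times> {0::real}) (\<lambda>(x, s). f x)" using cont by (rule continuous_on_param_const)
next
 fix d :: real assume d: "d > 0" "\<And>x s x' s'. s \<in> {0::real} ==> s' \<in> {0} ==> dist x x' < d ==> dist s s' < d ==> dist (f x) (f x') < e"
 show thesis by (rule that[OF d(1)]) (use d(1) d(2)[of 0 0] in auto)
qed (use assms in auto)

lemma periodic_bounded: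
 fixes f :: "real^'d \<Rightarrow> 'a::real_normed_vector"
 assumes cont: "continuous_on UNIV f" and per: "periodic f"
 obtains C where "C > 0" "\<And>x. norm (f x) \<le> C"
proof (rule periodic_bounded_param[where F = "\<lambda>x (s::real). f x" and S = "{0}"])
 show "continuous_on (UNIV \<times> {0::real}) (\<lambda>(x, s). f x)" using cont by (rule continuous_on_param_const)
next
 fix C :: real assume C: "C > 0" "\<And>x s. s \<in> {0::real} ==> norm (f x) \<le> C"
 show thesis by (rule that[OF C(1)]) (rule C(2)[of 0], simp)
qed (use assms in auto)

definition birkhoff :: "real^'d \<Rightarrow> nat \<Rightarrow> (real^'d \<Rightarrow> 'a::real_vector) \<Rightarrow> real^'d \<Rightarrow> 'a" where
 "birkhoff \<alpha> N f x = (1 / real N) *\<^sub>R (\<Sum>n<N. f (x + real n *\<^sub>R \<alpha>))"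

text \<open>The mean over the torus. For continuous periodic \<open>f\<close> it is the integral over a fundamental domain,
here obtained from the orbit of \<open>0\<close>.\<close>

definition mean :: "real^'d \<Rightarrow> (real^'d \<Rightarrow> 'a::real_normed_vector) \<Rightarrow> 'a" where
 "mean \<alpha> f = lim (\<lambda>N. birkhoff \<alpha> N f 0)"

lemma norm_birkhoff_le:
 assumes "\<And>x. norm (f x) \<le> C" "C \<ge> 0"
 shows "norm (birkhoff \<alpha> N f x) \<le> C"
proof (cases "N = 0")
 case False
 have "norm (\<Sum>n<N. f (x + real n *\<^sub>R \<alpha>)) \<le> (\<Sum>n<N. C)"
  by (rule sum_norm_le) (use assms in auto)
 then show ?thesis using False by (simp add: birkhoff_def field_simps)
qed (use assms in \<open>auto simp: birkhoff_def\<close>)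

lemma birkhoff_shift_le:
 assumes "\<And>x. norm (f x) \<le> C" and N: "N > 0"
 shows "norm (birkhoff \<alpha> N f (x + real n *\<^sub>R \<alpha>) - birkhoff \<alpha> N f x) \<le> 2 * real n * C / real N"
proof (induction n)
 case 0 then show ?case by simp
next
 case (Suc n)
 let ?y = "x + real n *\<^sub>R \<alpha>"
 have 1: "(\<Sum>m<N. f (x + real (Suc n) *\<^sub>R \<alpha> + real m *\<^sub>R \<alpha>)) = (\<Sum>m<N. f (?y + real (Suc m) *\<^sub>R \<alpha>))"
  by (intro sum.cong) (auto simp: algebra_simps)
 have "(\<Sum>m<Suc N. f (?y + real m *\<^sub>R \<alpha>)) = f ?y + (\<Sum>m<N. f (?y + real (Suc m) *\<^sub>R \<alpha>))"
  by (simp only: sum.lessThan_Suc_shift) simp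
 then have "(\<Sum>m<N. f (?y + real (Suc m) *\<^sub>R \<alpha>)) - (\<Sum>m<N. f (?y + real m *\<^sub>R \<alpha>)) = f (?y + real N *\<^sub>R \<alpha>) - f ?y"
  by (simp add: algebra_simps)
 then have "birkhoff \<alpha> N f (x + real (Suc n) *\<^sub>R \<alpha>) - birkhoff \<alpha> N f ?y = (1 / real N) *\<^sub>R (f (?y + real N *\<^sub>R \<alpha>) - f ?y)"
  unfolding birkhoff_def 1 by (metis scaleR_diff_right)
 moreover have b: "norm (f (?y + real N *\<^sub>R \<alpha>) - f ?y) \<le> 2 * C"
  using assms(1)[of "?y + real N *\<^sub>R \<alpha>"] assms(1)[of ?y] norm_triangle_ineq4[of "f (?y + real N *\<^sub>R \<alpha>)" "f ?y"] by linarith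
 ultimately have "norm (birkhoff \<alpha> N f (x + real (Suc n) *\<^sub>R \<alpha>) - birkhoff \<alpha> N f ?y) \<le> 2 * C / real N"
  using divide_right_mono[OF b, of "real N"] by simp
 then have "norm (birkhoff \<alpha> N f (x + real (Suc n) *\<^sub>R \<alpha>) - birkhoff \<alpha> N f x) \<le> 2 * C / real N + 2 * real n * C / real N"
  using Suc norm_triangle_ineq[of "birkhoff \<alpha> N f (x + real (Suc n) *\<^sub>R \<alpha>) - birkhoff \<alpha> N f ?y" "birkhoff \<alpha> N f ?y - birkhoff \<alpha> N f x"] by simp
 also have "\<dots> = 2 * real (Suc n) * C / real N" by (simp add: algebra_simps add_divide_distrib)
 finally show ?case .
qed

text \<open>Any \<open>y\<close> is close, modulo integers, to a point \<open>x + n \<alpha>\<close> with bounded \<open>n\<close>, and shifting an average of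
length \<open>N\<close> by \<open>n\<close> changes it by \<open>O(n / N)\<close> only.\<close>

lemma birkhoff_oscillation:
 fixes f :: "real^'d \<Rightarrow> 'a::real_normed_vector"
 assumes syn: "syndetic_orbit \<alpha>" and cont: "continuous_on UNIV f" and per: "periodic f" and "e > 0"
 obtains N0 where "N0 > 0" "\<And>N x y. N \<ge> N0 ==> norm (birkhoff \<alpha> N f x - birkhoff \<alpha> N f y) \<le> e"
proof -
 obtain C where C: "C > 0" "\<And>x. norm (f x) \<le> C" using periodic_bounded[OF cont per] by blast
 obtain d where d: "d > 0" "\<And>x x'. dist x x' < d ==> dist (f x) (f x') < e/2"
  using periodic_uniformly_continuous[OF cont per, of "e/2"] \<open>e > 0\<close> by auto
 obtain K where K: "\<And>z. \<exists>n\<le>K. \<exists>k. int_vec k \<and> norm (real n *\<^sub>R \<alpha> + k - z) < d"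
  using syn d(1) unfolding syndetic_orbit_def by metis
 obtain N0 :: nat where N0: "real N0 > 4 * real K * C / e" using reals_Archimedean2 by blast
 show ?thesis
 proof (rule that[of "Suc N0"])
  fix N x y assume N: "N \<ge> Suc N0"
  obtain n k where nk: "n \<le> K" "int_vec k" "norm (real n *\<^sub>R \<alpha> + k - (x - y)) < d" using K by blast
  let ?y = "y + real n *\<^sub>R \<alpha>"
  have "norm (f (x + real m *\<^sub>R \<alpha>) - f (?y + real m *\<^sub>R \<alpha>)) \<le> e/2" for m
  proof -
   have "dist (x + real m *\<^sub>R \<alpha>) (?y + real m *\<^sub>R \<alpha> + k) = norm (real n *\<^sub>R \<alpha> + k - (x - y))"
    by (subst dist_commute) (simp add: dist_norm algebra_simps)
   then have "dist (f (x + real m *\<^sub>R \<alpha>)) (f (?y + real m *\<^sub>R \<alpha> + k)) < e/2" using nk d by auto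
   then show ?thesis using periodicD[OF per nk(2)] by (simp add: dist_norm)
  qed
  then have "norm (\<Sum>m<N. (f (x + real m *\<^sub>R \<alpha>) - f (?y + real m *\<^sub>R \<alpha>))) \<le> (\<Sum>m<N. e/2)"
   by (intro sum_norm_le) auto
  then have "norm (\<Sum>m<N. (f (x + real m *\<^sub>R \<alpha>) - f (?y + real m *\<^sub>R \<alpha>))) \<le> real N * (e/2)" by simp
  moreover have "birkhoff \<alpha> N f x - birkhoff \<alpha> N f ?y = (1 / real N) *\<^sub>R (\<Sum>m<N. (f (x + real m *\<^sub>R \<alpha>) - f (?y + real m *\<^sub>R \<alpha>)))"
   by (simp add: birkhoff_def sum_subtractf scaleR_diff_right)
  ultimately have 1: "norm (birkhoff \<alpha> N f x - birkhoff \<alpha> N f ?y) \<le> e/2"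
   using N by (simp add: field_simps)
  have 2: "norm (birkhoff \<alpha> N f ?y - birkhoff \<alpha> N f y) \<le> 2 * real n * C / real N"
   using birkhoff_shift_le[of f C N, OF C(2)] N by simp
  have "2 * real n * C / real N \<le> 2 * real K * C / real N"
   using nk(1) C(1) by (intro divide_right_mono mult_right_mono) auto
  also have "\<dots> \<le> e/2"
  proof -
   have "4 * real K * C / e < real N" using N0 N by linarith
   then show ?thesis using \<open>e > 0\<close> N by (simp add: field_simps)
  qed
  finally show "norm (birkhoff \<alpha> N f x - birkhoff \<alpha> N f y) \<le> e"
   using 1 2 norm_triangle_ineq[of "birkhoff \<alpha> N f x - birkhoff \<alpha> N f ?y" "birkhoff \<alpha> N f ?y - birkhoff \<alpha> N f y"] by simp
 qed simp
qed

lemma birkhoff_mult: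
 assumes "N > 0" "M > 0"
 shows "birkhoff \<alpha> (M * N) f x = (1 / real M) *\<^sub>R (\<Sum>m<M. birkhoff \<alpha> N f (x + real (m * N) *\<^sub>R \<alpha>))"
proof -
 have "(\<Sum>n<M * N. f (x + real n *\<^sub>R \<alpha>)) = (\<Sum>m<M. \<Sum>n<N. f (x + real (m * N + n) *\<^sub>R \<alpha>))"
 proof -
  have "(\<Sum>n<N. f (x + real (m * N + n) *\<^sub>R \<alpha>)) = (\<Sum>n\<in>{m * N..<m * N + N}. f (x + real n *\<^sub>R \<alpha>))" for m
   by (subst sum.atLeastLessThan_shift_0) (simp add: o_def atLeast0LessThan)
  then show ?thesis by (simp only: sum.nat_group)
 qed
 moreover have "real (m * N + n) *\<^sub>R \<alpha> = real (m * N) *\<^sub>R \<alpha> + real n *\<^sub>R \<alpha>" for m n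
  by (simp add: algebra_simps)
 ultimately have "(\<Sum>n<M * N. f (x + real n *\<^sub>R \<alpha>)) = (\<Sum>m<M. \<Sum>n<N. f (x + real (m * N) *\<^sub>R \<alpha> + real n *\<^sub>R \<alpha>))"
  by (simp only: add.assoc)
 then show ?thesis
  by (simp only: birkhoff_def scaleR_sum_right[symmetric] scaleR_scaleR) simp
qed

text \<open>Averages of length \<open>M N\<close> are averages of averages of length \<open>N\<close>, so small oscillation makes the sequence Cauchy.\<close>

lemma birkhoff_tendsto_mean:
 fixes f :: "real^'d \<Rightarrow> 'a::banach"
 assumes syn: "syndetic_orbit \<alpha>" and cont: "continuous_on UNIV f" and per: "periodic f" and "e > 0"
 obtains N0 where "N0 > 0" "\<And>N x. N \<ge> N0 ==> norm (birkhoff \<alpha> N f x - mean \<alpha> f) \<le> e"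
proof -
 let ?a = "\<lambda>N. birkhoff \<alpha> N f 0"
 have key: "norm (birkhoff \<alpha> (M * N) f 0 - ?a N) \<le> e"
  if "M > 0" "N > 0" "\<And>x y. norm (birkhoff \<alpha> N f x - birkhoff \<alpha> N f y) \<le> e" for M N e
 proof -
  have "birkhoff \<alpha> (M * N) f 0 - ?a N = (1 / real M) *\<^sub>R (\<Sum>m<M. (birkhoff \<alpha> N f (0 + real (m * N) *\<^sub>R \<alpha>) - ?a N))"
   unfolding birkhoff_mult[OF that(2,1)] using that(1)
   by (simp add: sum_subtractf scaleR_diff_right sum_constant_scaleR del: sum_constant)
  moreover have "norm (\<Sum>m<M. (birkhoff \<alpha> N f (0 + real (m * N) *\<^sub>R \<alpha>) - ?a N)) \<le> (\<Sum>m<M. e)"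
   by (rule sum_norm_le) (rule that)
  ultimately show ?thesis using that(1) by (simp add: field_simps)
 qed
 have close: "norm (?a M - ?a N) \<le> 2 * e"
  if "M > 0" "N > 0" "\<And>x y. norm (birkhoff \<alpha> N f x - birkhoff \<alpha> N f y) \<le> e"
    "\<And>x y. norm (birkhoff \<alpha> M f x - birkhoff \<alpha> M f y) \<le> e" for M N e
  using key[of M N e] key[of N M e] that norm_triangle_ineq4[of "birkhoff \<alpha> (M * N) f 0 - ?a N" "birkhoff \<alpha> (M * N) f 0 - ?a M"]
  by (simp add: mult.commute)
 have "Cauchy ?a"
 proof (rule metric_CauchyI)
  fix e :: real assume e: "e > 0"
  obtain N0 where N0: "N0 > 0" "\<And>N x y. N \<ge> N0 ==> norm (birkhoff \<alpha> N f x - birkhoff \<alpha> N f y) \<le> e/4"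
   using birkhoff_oscillation[OF syn cont per, of "e/4"] e by auto
  have "dist (?a m) (?a n) < e" if "m \<ge> N0" "n \<ge> N0" for m n
   using close[of m n "e/4"] N0 that e by (simp add: dist_norm)
  then show "\<exists>M. \<forall>m\<ge>M. \<forall>n\<ge>M. dist (?a m) (?a n) < e" by blast
 qed
 then have lim: "?a \<longlonglongrightarrow> mean \<alpha> f" unfolding mean_def
  using Cauchy_convergent_iff convergent_LIMSEQ_iff by blast
 obtain N0 where N0: "N0 > 0" "\<And>N x y. N \<ge> N0 ==> norm (birkhoff \<alpha> N f x - birkhoff \<alpha> N f y) \<le> e/2"
  using birkhoff_oscillation[OF syn cont per, of "e/2"] \<open>e > 0\<close> by auto
 obtain N1 where N1: "\<And>N. N \<ge> N1 ==> norm (?a N - mean \<alpha> f) < e/2"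
  using LIMSEQ_D[OF lim, of "e/2"] \<open>e > 0\<close> by auto
 show ?thesis
 proof (rule that[of "max N0 N1"])
  fix N x assume "N \<ge> max N0 N1"
  then show "norm (birkhoff \<alpha> N f x - mean \<alpha> f) \<le> e"
   using N0(2)[of N x 0] N1[of N] norm_triangle_ineq[of "birkhoff \<alpha> N f x - ?a N" "?a N - mean \<alpha> f"] by simp
 qed (use N0 in auto)
qed

lemma birkhoff_LIMSEQ:
 fixes f :: "real^'d \<Rightarrow> 'a::banach"
 assumes "syndetic_orbit \<alpha>" "continuous_on UNIV f" "periodic f"
 shows "(\<lambda>N. birkhoff \<alpha> N f x) \<longlonglongrightarrow> mean \<alpha> f"
proof (rule LIMSEQ_I)
 fix e :: real assume "e > 0"
 then obtain N0 where "\<And>N x. N \<ge> N0 ==> norm (birkhoff \<alpha> N f x - mean \<alpha> f) \<le> e/2"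
  using birkhoff_tendsto_mean[OF assms, of "e/2"] by (metis half_gt_zero)
 then show "\<exists>no. \<forall>n\<ge>no. norm (birkhoff \<alpha> n f x - mean \<alpha> f) < e"
  using \<open>e > 0\<close> by (metis field_sum_of_halves le_less_trans less_add_same_cancel1 half_gt_zero)
qed

lemma mean_unique:
 fixes f :: "real^'d \<Rightarrow> 'a::banach"
 assumes "(\<lambda>N. birkhoff \<alpha> N f 0) \<longlonglongrightarrow> L"
 shows "mean \<alpha> f = L"
 using assms by (simp add: mean_def limI)

lemma mean_add:
 fixes f g :: "real^'d \<Rightarrow> 'a::banach"
 assumes "syndetic_orbit \<alpha>" "continuous_on UNIV f" "periodic f" "continuous_on UNIV g" "periodic g"
 shows "mean \<alpha> (\<lambda>x. f x + g x) = mean \<alpha> f + mean \<alpha> g"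
proof (rule mean_unique)
 have "birkhoff \<alpha> N (\<lambda>x. f x + g x) 0 = birkhoff \<alpha> N f 0 + birkhoff \<alpha> N g 0" for N
  by (simp add: birkhoff_def sum.distrib scaleR_add_right)
 then show "(\<lambda>N. birkhoff \<alpha> N (\<lambda>x. f x + g x) 0) \<longlonglongrightarrow> mean \<alpha> f + mean \<alpha> g"
  using tendsto_add[OF birkhoff_LIMSEQ[OF assms(1-3)] birkhoff_LIMSEQ[OF assms(1,4,5)]] by simp
qed

lemma mean_linear:
 fixes f :: "real^'d \<Rightarrow> 'a::banach" and L :: "'a \<Rightarrow> 'b::banach"
 assumes "syndetic_orbit \<alpha>" "continuous_on UNIV f" "periodic f" "bounded_linear L"
 shows "mean \<alpha> (\<lambda>x. L (f x)) = L (mean \<alpha> f)"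
proof (rule mean_unique)
 interpret bounded_linear L by fact
 have "birkhoff \<alpha> N (\<lambda>x. L (f x)) 0 = L (birkhoff \<alpha> N f 0)" for N
  by (simp add: birkhoff_def scaleR sum)
 then show "(\<lambda>N. birkhoff \<alpha> N (\<lambda>x. L (f x)) 0) \<longlonglongrightarrow> L (mean \<alpha> f)"
  using tendsto[OF birkhoff_LIMSEQ[OF assms(1-3)]] by simp
qed

lemma norm_mean_le:
 fixes f :: "real^'d \<Rightarrow> 'a::banach"
 assumes "syndetic_orbit \<alpha>" "continuous_on UNIV f" "periodic f" "\<And>x. norm (f x) \<le> C"
 shows "norm (mean \<alpha> f) \<le> C"
proof (rule Lim_norm_ubound[OF _ birkhoff_LIMSEQ[OF assms(1-3), of 0]])
 have "C \<ge> 0" using assms(4)[of 0] norm_ge_zero order_trans by blast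
 then show "\<forall>\<^sub>F N in sequentially. norm (birkhoff \<alpha> N f 0) \<le> C"
  by (intro always_eventually allI norm_birkhoff_le assms(4))
qed simp

lemma mean_shift:
 fixes f :: "real^'d \<Rightarrow> 'a::banach"
 assumes "syndetic_orbit \<alpha>" "continuous_on UNIV f" "periodic f"
 shows "mean \<alpha> (\<lambda>x. f (x + h)) = mean \<alpha> f"
proof (rule mean_unique)
 have "birkhoff \<alpha> N (\<lambda>x. f (x + h)) 0 = birkhoff \<alpha> N f h" for N
  by (simp add: birkhoff_def add.commute)
 then show "(\<lambda>N. birkhoff \<alpha> N (\<lambda>x. f (x + h)) 0) \<longlonglongrightarrow> mean \<alpha> f"
  using birkhoff_LIMSEQ[OF assms] by simp
qed

lemma mean_const:
 fixes c :: "'a::banach" shows "mean \<alpha> (\<lambda>x. c) = c"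
proof (rule mean_unique)
 have "eventually (\<lambda>N. birkhoff \<alpha> N (\<lambda>x. c) 0 = c) sequentially"
  by (rule eventually_mono[OF eventually_gt_at_top[of 0]]) (simp add: birkhoff_def sum_constant_scaleR del: sum_constant)
 then show "(\<lambda>N. birkhoff \<alpha> N (\<lambda>x. c) 0) \<longlonglongrightarrow> c" by (rule tendsto_eventually)
qed

lemma mean_mono:
 fixes f g :: "real^'d \<Rightarrow> real"
 assumes "syndetic_orbit \<alpha>" "continuous_on UNIV f" "periodic f" "continuous_on UNIV g" "periodic g"
  "\<And>x. f x \<le> g x"
 shows "mean \<alpha> f \<le> mean \<alpha> g"
proof (rule LIMSEQ_le[OF birkhoff_LIMSEQ[OF assms(1-3), of 0] birkhoff_LIMSEQ[OF assms(1,4,5), of 0]])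
 show "\<exists>N. \<forall>n\<ge>N. birkhoff \<alpha> n f 0 \<le> birkhoff \<alpha> n g 0"
  by (auto simp: birkhoff_def intro!: mult_left_mono sum_mono assms(6) divide_right_mono)
qed

text \<open>The orbit visits the neighbourhood where \<open>f\<close> is large with a frequency bounded below.\<close>

lemma mean_pos:
 fixes f :: "real^'d \<Rightarrow> real"
 assumes syn: "syndetic_orbit \<alpha>" and cont: "continuous_on UNIV f" and per: "periodic f"
  and nn: "\<And>x. f x \<ge> 0" and pos: "f z > 0"
 shows "mean \<alpha> f > 0"
proof -
 obtain d where d: "d > 0" "\<And>x x'. dist x x' < d ==> dist (f x) (f x') < f z / 2"
  using periodic_uniformly_continuous[OF cont per, of "f z / 2"] pos by auto
 obtain K where K: "\<And>z. \<exists>n\<le>K. \<exists>k. int_vec k \<and> norm (real n *\<^sub>R \<alpha> + k - z) < d"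
  using syn d(1) unfolding syndetic_orbit_def by metis
 let ?M = "Suc K"
 have 1: "birkhoff \<alpha> ?M f x \<ge> f z / 2 / real ?M" for x
 proof -
  obtain n k where nk: "n \<le> K" "int_vec k" "norm (real n *\<^sub>R \<alpha> + k - (z - x)) < d" using K by blast
  have "dist (x + real n *\<^sub>R \<alpha> + k) z < d" using nk(3) by (simp add: dist_norm algebra_simps)
  then have "dist (f (x + real n *\<^sub>R \<alpha> + k)) (f z) < f z / 2" by (rule d(2))
  then have "\<bar>f (x + real n *\<^sub>R \<alpha>) - f z\<bar> < f z / 2" using periodicD[OF per nk(2)] by (simp add: dist_real_def)
  then have "f (x + real n *\<^sub>R \<alpha>) \<ge> f z / 2" by linarith
  also have "f (x + real n *\<^sub>R \<alpha>) \<le> (\<Sum>n<?M. f (x + real n *\<^sub>R \<alpha>))"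
   by (rule member_le_sum[of n "{..<?M}" "\<lambda>n. f (x + real n *\<^sub>R \<alpha>)"]) (use nk nn in auto)
  finally have h: "f z / 2 \<le> (\<Sum>n<?M. f (x + real n *\<^sub>R \<alpha>))" .
  show ?thesis using divide_right_mono[OF h, of "real ?M"]
   by (simp add: birkhoff_def del: sum.lessThan_Suc of_nat_Suc)
 qed
 have c: "continuous_on UNIV (birkhoff \<alpha> ?M f)" unfolding birkhoff_def[abs_def]
  by (intro continuous_intros continuous_on_compose2[OF cont]) auto
 have p: "periodic (birkhoff \<alpha> ?M f)" unfolding birkhoff_def[abs_def]
  using periodic_shift[OF per] unfolding periodic_def by auto
 have "mean \<alpha> (\<lambda>x. f z / 2 / real ?M) \<le> mean \<alpha> (birkhoff \<alpha> ?M f)"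
  by (rule mean_mono[OF syn _ _ c p 1]) (auto simp: periodic_def)
 moreover have "mean \<alpha> (birkhoff \<alpha> ?M f) = mean \<alpha> f"
 proof (rule mean_unique)
  have "(\<lambda>N. (1 / real ?M) *\<^sub>R (\<Sum>m<?M. birkhoff \<alpha> N f (0 + real m *\<^sub>R \<alpha>))) \<longlonglongrightarrow> (1 / real ?M) *\<^sub>R (\<Sum>m<?M. mean \<alpha> f)"
   by (intro tendsto_intros birkhoff_LIMSEQ assms)
  moreover have "birkhoff \<alpha> N (birkhoff \<alpha> ?M f) 0 = (1 / real ?M) *\<^sub>R (\<Sum>m<?M. birkhoff \<alpha> N f (0 + real m *\<^sub>R \<alpha>))" for N
   unfolding birkhoff_def scaleR_sum_right sum_distrib_left
   by (subst sum.swap) (auto simp: add_ac mult.commute intro!: sum.cong)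
  ultimately show "(\<lambda>N. birkhoff \<alpha> N (birkhoff \<alpha> ?M f) 0) \<longlonglongrightarrow> mean \<alpha> f"
   by (simp del: sum.lessThan_Suc of_nat_Suc)
 qed
 moreover have "f z / 2 / real ?M > 0" using pos by simp
 ultimately show ?thesis by (simp add: mean_const del: of_nat_Suc)
qed

section \<open>Almost holomorphic extensions along a direction\<close>

definition cper :: "real \<Rightarrow> (real^'d \<Rightarrow> real \<Rightarrow> 'a::real_normed_vector) \<Rightarrow> bool" where
 "cper T F \<longleftrightarrow> continuous_on (UNIV \<times> {0..T}) (\<lambda>(x, t). F x t) \<and> (\<forall>t\<in>{0..T}. periodic (\<lambda>x. F x t))"

text \<open>\<open>F x t\<close> stands for an extension of a function of \<open>x\<close> to the complex point \<open>x + \<i> t w\<close>. \<open>Fw\<close> is its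
derivative along \<open>w\<close>, and \<open>e\<close> its defect in the Cauchy-Riemann equation; the extension is holomorphic
if \<open>e = 0\<close>. Separate arguments for \<open>Fw\<close> and \<open>e\<close> let their bounds be tracked through products and compositions.\<close>

definition dbar_ext :: "real^'d \<Rightarrow> real \<Rightarrow> (real^'d \<Rightarrow> real \<Rightarrow> complex) \<Rightarrow> (real^'d \<Rightarrow> real \<Rightarrow> complex)
  \<Rightarrow> (real^'d \<Rightarrow> real \<Rightarrow> complex) \<Rightarrow> bool" where
 "dbar_ext w T F Fw e \<longleftrightarrow> cper T F \<and> cper T Fw \<and> cper T e \<and>
   (\<forall>x. \<forall>t\<in>{0..T}. ((\<lambda>s. F (x + s *\<^sub>R w) t) has_vector_derivative Fw x t) (at 0)) \<and>
   (\<forall>x. \<forall>t\<in>{0..T}. ((\<lambda>s. F x s) has_vector_derivative (\<i> * Fw x t + e x t)) (at t within {0..T}))"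

lemma cper_const: "cper T (\<lambda>x t. c)"
 by (simp add: cper_def periodic_def case_prod_beta)

lemma cper_add: "cper T F ==> cper T G ==> cper T (\<lambda>x t. F x t + G x t)"
 by (auto simp: cper_def case_prod_beta intro!: continuous_intros) (simp add: periodic_def)

lemma cper_minus: "cper T F ==> cper T (\<lambda>x t. - F x t)"
 by (auto simp: cper_def case_prod_beta intro!: continuous_intros) (simp add: periodic_def)

lemma cper_mult:
 fixes F G :: "real^'d \<Rightarrow> real \<Rightarrow> 'a::real_normed_algebra"
 shows "cper T F ==> cper T G ==> cper T (\<lambda>x t. F x t * G x t)"
 by (auto simp: cper_def case_prod_beta intro!: continuous_intros) (simp add: periodic_def)

lemma cper_base: "continuous_on UNIV f ==> periodic f ==> cper T (\<lambda>x t. f x)"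
 by (simp add: cper_def continuous_on_param_const)

lemma cper_compose:
 assumes "cper T F" "continuous_on S h" "\<And>x t. t \<in> {0..T} ==> F x t \<in> S"
 shows "cper T (\<lambda>x t. h (F x t))"
proof -
 have "continuous_on (UNIV \<times> {0..T}) (\<lambda>p. h ((\<lambda>(x, t). F x t) p))"
  by (rule continuous_on_compose2[OF assms(2)]) (use assms(1,3) in \<open>auto simp: cper_def\<close>)
 moreover have "periodic (\<lambda>x. h (F x t))" if "t \<in> {0..T}" for t
  using assms(1) that by (simp add: cper_def periodic_def)
 ultimately show ?thesis by (simp add: cper_def case_prod_beta)
qed

lemma cper_shift: "cper T F ==> cper T (\<lambda>x t. F (x + b) t)"
proof -
 assume F: "cper T F"
 have "continuous_on (UNIV \<times> {0..T}) (\<lambda>p. (\<lambda>(x, t). F x t) (fst p + b, snd p))"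
  by (rule continuous_on_compose2[of "UNIV \<times> {0..T}" "\<lambda>(x, t). F x t"])
    (use F in \<open>auto simp: cper_def intro!: continuous_intros\<close>)
 then show ?thesis using F periodic_shift[of "\<lambda>x. F x t" b for t]
  by (auto simp: cper_def case_prod_beta)
qed

lemma cper_subset: "cper T F ==> T' \<le> T ==> cper T' F"
 by (auto simp: cper_def elim!: continuous_on_subset)

lemma cper_slice:
 assumes "cper T F" "t \<in> {0..T}"
 shows "continuous_on UNIV (\<lambda>x. F x t)" "periodic (\<lambda>x. F x t)"
proof -
 have "continuous_on UNIV (\<lambda>x. (\<lambda>(x, t). F x t) (x, t))"
  by (rule continuous_on_compose2[of "UNIV \<times> {0..T}" "\<lambda>(x, t). F x t"])
    (use assms in \<open>auto simp: cper_def intro!: continuous_intros\<close>)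
 then show "continuous_on UNIV (\<lambda>x. F x t)" by simp
qed (use assms in \<open>auto simp: cper_def\<close>)

lemma cper_bounded:
 assumes "cper T F"
 obtains C where "C > 0" "\<And>x t. t \<in> {0..T} ==> norm (F x t) \<le> C"
proof -
 have 1: "continuous_on (UNIV \<times> {0..T}) (\<lambda>(x, t). F x t)" and 2: "\<And>t. t \<in> {0..T} ==> periodic (\<lambda>x. F x t)"
  using assms unfolding cper_def by auto
 show thesis using periodic_bounded_param[OF 1 compact_Icc 2] that by blast
qed

lemma cper_uniform:
 assumes "cper T F" "e > 0"
 obtains d where "d > 0"
  "\<And>x t x' t'. t \<in> {0..T} ==> t' \<in> {0..T} ==> dist x x' < d ==> dist t t' < d ==> dist (F x t) (F x' t') < e"
proof -
 have 1: "continuous_on (UNIV \<times> {0..T}) (\<lambda>(x, t). F x t)" and 2: "\<And>t. t \<in> {0..T} ==> periodic (\<lambda>x. F x t)"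
  using assms unfolding cper_def by auto
 show thesis using periodic_uniformly_continuous_param[OF 1 compact_Icc 2 assms(2)] that by blast
qed

lemma dbar_extD:
 assumes "dbar_ext w T F Fw e"
 shows "cper T F" "cper T Fw" "cper T e"
  "\<And>x t. t \<in> {0..T} ==> ((\<lambda>s. F (x + s *\<^sub>R w) t) has_vector_derivative Fw x t) (at 0)"
  "\<And>x t. t \<in> {0..T} ==> ((\<lambda>s. F x s) has_vector_derivative (\<i> * Fw x t + e x t)) (at t within {0..T})"
 using assms by (auto simp: dbar_ext_def)

lemma dbar_ext_const: "dbar_ext w T (\<lambda>x t. c) (\<lambda>x t. 0) (\<lambda>x t. 0)"
 by (auto simp: dbar_ext_def cper_const)

lemma dbar_ext_add:
 assumes "dbar_ext w T F Fw e" "dbar_ext w T G Gw e'"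
 shows "dbar_ext w T (\<lambda>x t. F x t + G x t) (\<lambda>x t. Fw x t + Gw x t) (\<lambda>x t. e x t + e' x t)"
proof -
 note F = dbar_extD[OF assms(1)] and G = dbar_extD[OF assms(2)]
 show ?thesis unfolding dbar_ext_def
  using has_vector_derivative_add[OF F(4) G(4)] has_vector_derivative_add[OF F(5) G(5)]
  by (auto intro!: cper_add F G simp: algebra_simps)
qed

lemma dbar_ext_mult:
 assumes "dbar_ext w T F Fw e" "dbar_ext w T G Gw e'"
 shows "dbar_ext w T (\<lambda>x t. F x t * G x t) (\<lambda>x t. F x t * Gw x t + Fw x t * G x t)
   (\<lambda>x t. F x t * e' x t + e x t * G x t)"
proof -
 note F = dbar_extD[OF assms(1)] and G = dbar_extD[OF assms(2)]
 have "((\<lambda>s. F (x + s *\<^sub>R w) t * G (x + s *\<^sub>R w) t) has_vector_derivative (F x t * Gw x t + Fw x t * G x t)) (at 0)"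
  if "t \<in> {0..T}" for x t
  using has_vector_derivative_mult[OF F(4)[OF that, of x] G(4)[OF that, of x]] by simp
 moreover have "((\<lambda>s. F x s * G x s) has_vector_derivative
   (\<i> * (F x t * Gw x t + Fw x t * G x t) + (F x t * e' x t + e x t * G x t))) (at t within {0..T})"
  if "t \<in> {0..T}" for x t
  using has_vector_derivative_mult[OF F(5)[OF that, of x] G(5)[OF that, of x]] by (simp add: algebra_simps)
 ultimately show ?thesis unfolding dbar_ext_def
  by (auto intro!: cper_add cper_mult F G)
qed

text \<open>A holomorphic outer function multiplies the defect by its derivative and adds none of its own.\<close>

lemma dbar_ext_compose:
 assumes F: "dbar_ext w T F Fw e" and S: "\<And>x t. t \<in> {0..T} ==> F x t \<in> S"
  and h: "\<And>z. z \<in> S ==> (h has_field_derivative h' z) (at z)" and h': "continuous_on S h'"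
 shows "dbar_ext w T (\<lambda>x t. h (F x t)) (\<lambda>x t. Fw x t * h' (F x t)) (\<lambda>x t. e x t * h' (F x t))"
proof -
 note F' = dbar_extD[OF F]
 have ch: "continuous_on S h"
  using h by (meson DERIV_isCont continuous_at_imp_continuous_on)
 have "((\<lambda>s. h (F (x + s *\<^sub>R w) t)) has_vector_derivative (Fw x t * h' (F x t))) (at 0)"
  if "t \<in> {0..T}" for x t
  using field_vector_diff_chain_at[OF F'(4)[OF that, of x], of h "h' (F x t)"] h[OF S[OF that]]
  by (simp add: o_def)
 moreover have "((\<lambda>s. h (F x s)) has_vector_derivative
   (\<i> * (Fw x t * h' (F x t)) + e x t * h' (F x t))) (at t within {0..T})"
  if "t \<in> {0..T}" for x t
  using field_vector_diff_chain_within[OF F'(5)[OF that, of x], of h "h' (F x t)"]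
   has_field_derivative_at_within[OF h[OF S[OF that]]]
  by (simp add: o_def algebra_simps)
 ultimately show ?thesis unfolding dbar_ext_def
  by (auto intro!: cper_mult F' cper_compose[OF F'(1) ch] cper_compose[OF F'(1) h'] S)
qed

lemma dbar_ext_shift:
 assumes "dbar_ext w T F Fw e"
 shows "dbar_ext w T (\<lambda>x t. F (x + b) t) (\<lambda>x t. Fw (x + b) t) (\<lambda>x t. e (x + b) t)"
proof -
 note F = dbar_extD[OF assms]
 have "((\<lambda>s. F (x + s *\<^sub>R w + b) t) has_vector_derivative Fw (x + b) t) (at 0)" if "t \<in> {0..T}" for x t
  using F(4)[OF that, of "x + b"] by (simp add: add_ac)
 then show ?thesis unfolding dbar_ext_def
  by (auto intro!: cper_shift F)
qed

lemma dbar_ext_subset: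
 assumes "dbar_ext w T F Fw e" "T' \<le> T"
 shows "dbar_ext w T' F Fw e"
proof -
 note F = dbar_extD[OF assms(1)]
 have "{0..T'} \<subseteq> {0..T}" using assms(2) by auto
 then show ?thesis unfolding dbar_ext_def
  using assms(2) F(4) has_vector_derivative_within_subset[OF F(5)]
  by (auto intro!: cper_subset[OF _ assms(2)] F)
qed

text \<open>A derivative at \<open>0\<close> for every base point is a derivative everywhere on the line.\<close>

lemma line_derivative_at:
 fixes G :: "real^'d \<Rightarrow> 'a::real_normed_vector"
 assumes "\<And>x. ((\<lambda>s. G (x + s *\<^sub>R w)) has_vector_derivative Gw x) (at 0)"
 shows "((\<lambda>s. G (x + s *\<^sub>R w)) has_vector_derivative Gw (x + s *\<^sub>R w)) (at s)"
proof -
 have "((\<lambda>t. t - s) has_vector_derivative 1) (at s)"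
  by (auto intro!: derivative_eq_intros)
 moreover have "((\<lambda>t. G ((x + s *\<^sub>R w) + t *\<^sub>R w)) has_vector_derivative Gw (x + s *\<^sub>R w)) (at (s - s))"
  using assms by simp
 ultimately have "((\<lambda>t. G ((x + s *\<^sub>R w) + t *\<^sub>R w)) \<circ> (\<lambda>t. t - s) has_vector_derivative 1 *\<^sub>R Gw (x + s *\<^sub>R w)) (at s)"
  by (rule vector_diff_chain_at)
 then show ?thesis by (simp add: o_def algebra_simps)
qed

text \<open>The integral of \<open>Gw\<close> over a segment of the line is a difference of shifted values of \<open>G\<close>, whose mean vanishes.\<close>

lemma mean_directional_derivative:
 fixes G :: "real^'d \<Rightarrow> 'a::banach"
 assumes syn: "syndetic_orbit \<alpha>"
  and G: "continuous_on UNIV G" "periodic G" and Gw: "continuous_on UNIV Gw" "periodic Gw"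
  and der: "\<And>x. ((\<lambda>s. G (x + s *\<^sub>R w)) has_vector_derivative Gw x) (at 0)"
 shows "mean \<alpha> Gw = 0"
proof -
 have "norm (mean \<alpha> Gw) \<le> e" if e: "e > 0" for e
 proof -
  obtain d where d: "d > 0" "\<And>x x'. dist x x' < d ==> dist (Gw x) (Gw x') < e"
   using periodic_uniformly_continuous[OF Gw e] by blast
  define h where "h = (d / 2) / (norm w + 1)"
  have h: "h > 0" using d by (simp add: h_def add_nonneg_pos)
  have hw: "h * norm w < d"
  proof -
   have "h * norm w \<le> h * (norm w + 1)" using h by simp
   also have "\<dots> = d / 2"
   proof -
    have "norm w + 1 \<noteq> 0" using norm_ge_zero[of w] by linarith
    then show ?thesis by (metis h_def nonzero_eq_divide_eq)
   qed
   finally show ?thesis using d by simp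
  qed
  have bd: "norm (G (x + h *\<^sub>R w) + (- G x) + (- h) *\<^sub>R Gw x) \<le> h * e" for x
  proof -
   have "norm (G (x + h *\<^sub>R w) - G (x + 0 *\<^sub>R w) - (h - 0) *\<^sub>R Gw (x + 0 *\<^sub>R w)) \<le> norm (h - 0) * e"
   proof (rule vector_differentiable_bound_linearization[where S = "{0..h}" and f' = "\<lambda>s. Gw (x + s *\<^sub>R w)" and ?x0.0 = 0])
    show "((\<lambda>s. G (x + s *\<^sub>R w)) has_vector_derivative Gw (x + s *\<^sub>R w)) (at s within {0..h})" for s
     by (rule has_vector_derivative_at_within) (rule line_derivative_at[OF der])
    show "norm (Gw (x + s *\<^sub>R w) - Gw (x + 0 *\<^sub>R w)) \<le> e" if "s \<in> {0..h}" for s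
    proof -
     have "s * norm w \<le> h * norm w" using that by (intro mult_right_mono) auto
     then have "dist (x + s *\<^sub>R w) (x + 0 *\<^sub>R w) < d" using that hw by (simp add: dist_norm)
     then show ?thesis using d(2) by (metis dist_norm less_imp_le)
    qed
   qed (use h in \<open>auto simp: closed_segment_eq_real_ivl\<close>)
   then show ?thesis using h by simp
  qed
  have G1: "continuous_on UNIV (\<lambda>x. G (x + h *\<^sub>R w))" "periodic (\<lambda>x. G (x + h *\<^sub>R w))"
   by (auto intro!: continuous_on_compose2[OF G(1)] continuous_intros periodic_shift G)
  have G2: "continuous_on UNIV (\<lambda>x. - G x)" "periodic (\<lambda>x. - G x)"
   using G by (auto intro!: continuous_intros simp: periodic_def)
  have G12: "continuous_on UNIV (\<lambda>x. G (x + h *\<^sub>R w) + (- G x))" "periodic (\<lambda>x. G (x + h *\<^sub>R w) + (- G x))"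
   using G1 G2 G by (auto intro!: continuous_intros simp: periodic_def)
  have G3: "continuous_on UNIV (\<lambda>x. (- h) *\<^sub>R Gw x)" "periodic (\<lambda>x. (- h) *\<^sub>R Gw x)"
   using Gw by (auto intro!: continuous_intros simp: periodic_def)
  have "mean \<alpha> (\<lambda>x. G (x + h *\<^sub>R w) + (- G x) + (- h) *\<^sub>R Gw x) = mean \<alpha> G + (- mean \<alpha> G) + (- h) *\<^sub>R mean \<alpha> Gw"
   unfolding mean_add[OF syn G12 G3] mean_add[OF syn G1 G2] mean_shift[OF syn G]
   using mean_linear[OF syn G bounded_linear_minus[OF bounded_linear_ident]] mean_linear[OF syn Gw bounded_linear_scaleR_right[of "- h"]]
   by simp
  moreover have "norm (mean \<alpha> (\<lambda>x. G (x + h *\<^sub>R w) + (- G x) + (- h) *\<^sub>R Gw x)) \<le> h * e"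
   by (rule norm_mean_le[OF syn _ _ bd]) (use G12 G3 Gw in \<open>auto intro!: continuous_intros simp: periodic_def\<close>)
  ultimately have "h * norm (mean \<alpha> Gw) \<le> h * e" using h by simp
  then show ?thesis using h by simp
 qed
 then have "norm (mean \<alpha> Gw) \<le> 0" by (rule field_le_epsilon[of _ 0, simplified]) auto
 then show ?thesis by simp
qed

lemma mean_param_derivative:
 fixes G :: "real^'d \<Rightarrow> real \<Rightarrow> 'a::banach"
 assumes syn: "syndetic_orbit \<alpha>" and G: "cper T G" and Gt: "cper T Gt"
  and der: "\<And>x t. t \<in> {0..T} ==> ((\<lambda>s. G x s) has_vector_derivative Gt x t) (at t within {0..T})"
  and t: "t \<in> {0..T}"
 shows "((\<lambda>s. mean \<alpha> (\<lambda>x. G x s)) has_vector_derivative mean \<alpha> (\<lambda>x. Gt x t)) (at t within {0..T})"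
 unfolding has_vector_derivative_def has_derivative_within_alt
proof (intro conjI allI impI)
 show "bounded_linear (\<lambda>x. x *\<^sub>R mean \<alpha> (\<lambda>x. Gt x t))" by (rule bounded_linear_scaleR_left)
 fix e :: real assume e: "e > 0"
 obtain d where d: "d > 0"
  "\<And>x t x' t'. t \<in> {0..T} ==> t' \<in> {0..T} ==> dist x x' < d ==> dist t t' < d ==> dist (Gt x t) (Gt x' t') < e"
  using cper_uniform[OF Gt e] by blast
 show "\<exists>d>0. \<forall>y\<in>{0..T}. norm (y - t) < d \<longrightarrow>
   norm (mean \<alpha> (\<lambda>x. G x y) - mean \<alpha> (\<lambda>x. G x t) - (y - t) *\<^sub>R mean \<alpha> (\<lambda>x. Gt x t)) \<le> e * norm (y - t)"
 proof (intro exI[of _ d] conjI ballI impI d(1))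
  fix y assume y: "y \<in> {0..T}" "norm (y - t) < d"
  have bd: "norm (G x y + (- G x t) + (- (y - t)) *\<^sub>R Gt x t) \<le> e * norm (y - t)" for x
  proof -
   have sub: "closed_segment t y \<subseteq> {0..T}" using t y by (auto simp: closed_segment_eq_real_ivl split: if_splits)
   have "norm (G x y - G x t - (y - t) *\<^sub>R Gt x t) \<le> norm (y - t) * e"
   proof (rule vector_differentiable_bound_linearization[where S = "closed_segment t y" and f' = "Gt x" and ?x0.0 = t])
    show "((\<lambda>s. G x s) has_vector_derivative Gt x s) (at s within closed_segment t y)" if "s \<in> closed_segment t y" for s
     using has_vector_derivative_within_subset[OF der sub] that sub by blast
    show "norm (Gt x s - Gt x t) \<le> e" if s: "s \<in> closed_segment t y" for s
    proof -
     have "dist s t < d" using s y(2) by (auto simp: closed_segment_eq_real_ivl dist_real_def split: if_splits)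
     then show ?thesis using d(2)[of s t x x] s sub t d(1) by (auto simp: dist_norm)
    qed
   qed auto
   then show ?thesis by (simp add: mult.commute algebra_simps)
  qed
  note Gy = cper_slice[OF G y(1)] and G0 = cper_slice[OF G t] and Gt0 = cper_slice[OF Gt t]
  have G2: "continuous_on UNIV (\<lambda>x. - G x t)" "periodic (\<lambda>x. - G x t)"
   using G0 by (auto intro!: continuous_intros simp: periodic_def)
  have G12: "continuous_on UNIV (\<lambda>x. G x y + (- G x t))" "periodic (\<lambda>x. G x y + (- G x t))"
   using Gy G0 G2 by (auto intro!: continuous_intros simp: periodic_def)
  have G3: "continuous_on UNIV (\<lambda>x. (- (y - t)) *\<^sub>R Gt x t)" "periodic (\<lambda>x. (- (y - t)) *\<^sub>R Gt x t)"
   using Gt0 by (auto intro!: continuous_intros simp: periodic_def)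
  have "mean \<alpha> (\<lambda>x. G x y + (- G x t) + (- (y - t)) *\<^sub>R Gt x t)
    = mean \<alpha> (\<lambda>x. G x y) + (- mean \<alpha> (\<lambda>x. G x t)) + (- (y - t)) *\<^sub>R mean \<alpha> (\<lambda>x. Gt x t)"
   unfolding mean_add[OF syn G12 G3] mean_add[OF syn Gy G2]
   using mean_linear[OF syn G0 bounded_linear_minus[OF bounded_linear_ident]] mean_linear[OF syn Gt0 bounded_linear_scaleR_right[of "- (y - t)"]]
   by simp
  moreover have "norm (mean \<alpha> (\<lambda>x. G x y + (- G x t) + (- (y - t)) *\<^sub>R Gt x t)) \<le> e * norm (y - t)"
   by (rule norm_mean_le[OF syn _ _ bd]) (use G12 G3 Gt0 in \<open>auto intro!: continuous_intros simp: periodic_def\<close>)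
  ultimately have "norm (mean \<alpha> (\<lambda>x. G x y) + (- mean \<alpha> (\<lambda>x. G x t)) + (- (y - t)) *\<^sub>R mean \<alpha> (\<lambda>x. Gt x t)) \<le> e * norm (y - t)"
   by metis
  moreover have "mean \<alpha> (\<lambda>x. G x y) + (- mean \<alpha> (\<lambda>x. G x t)) + (- (y - t)) *\<^sub>R mean \<alpha> (\<lambda>x. Gt x t)
    = mean \<alpha> (\<lambda>x. G x y) - mean \<alpha> (\<lambda>x. G x t) - (y - t) *\<^sub>R mean \<alpha> (\<lambda>x. Gt x t)"
   by (simp add: algebra_simps)
  ultimately show "norm (mean \<alpha> (\<lambda>x. G x y) - mean \<alpha> (\<lambda>x. G x t) - (y - t) *\<^sub>R mean \<alpha> (\<lambda>x. Gt x t)) \<le> e * norm (y - t)"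
   by metis
 qed
qed

section \<open>Fourier coefficients\<close>

definition chi :: "real^'d \<Rightarrow> real^'d \<Rightarrow> complex" where
 "chi k x = cis (2 * pi * (k \<bullet> x))"

definition fcoeff :: "real^'d \<Rightarrow> (real^'d \<Rightarrow> complex) \<Rightarrow> real^'d \<Rightarrow> complex" where
 "fcoeff \<alpha> f k = mean \<alpha> (\<lambda>x. f x * chi (- k) x)"

lemma norm_chi [simp]: "norm (chi k x) = 1"
 by (simp add: chi_def)

lemma chi_add: "chi k (x + y) = chi k x * chi k y"
 by (simp add: chi_def inner_add_right distrib_left cis_mult)

lemma chi_mult: "chi k x * chi l x = chi (k + l) x"
 by (simp add: chi_def inner_add_left distrib_left cis_mult)

lemma chi_int:
 assumes "int_vec k" "int_vec n" shows "chi k n = 1"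
proof -
 have "k \<bullet> n \<in> \<int>" using assms unfolding inner_vec_def int_vec_def by (auto intro!: Ints_sum Ints_mult)
 then obtain m where "k \<bullet> n = of_int m" by (auto elim: Ints_cases)
 then show ?thesis by (simp add: chi_def cis_conv_exp exp_eq_1 mult.commute)
qed

lemma periodic_chi: "int_vec k ==> periodic (chi k)"
 by (simp add: periodic_def chi_add chi_int)

lemma continuous_chi: "continuous_on S (chi k)"
 unfolding chi_def[abs_def] by (intro continuous_intros)

lemma chi_line_derivative:
 "((\<lambda>s. chi k (x + s *\<^sub>R w)) has_vector_derivative (2 * pi * \<i> * (k \<bullet> w) * chi k x)) (at 0)"
proof -
 have "((\<lambda>s. exp (\<i> * of_real (2 * pi * (k \<bullet> x)) + of_real s * (\<i> * of_real (2 * pi * (k \<bullet> w)))) :: complex) has_vector_derivative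
   (\<i> * of_real (2 * pi * (k \<bullet> w))) * exp (\<i> * of_real (2 * pi * (k \<bullet> x)))) (at 0)"
  by (rule has_vector_derivative_real_field) (auto intro!: derivative_eq_intros)
 then show ?thesis
  by (simp add: chi_def cis_conv_exp inner_add_right algebra_simps)
qed

lemma norm_fcoeff_le:
 assumes "syndetic_orbit \<alpha>" "continuous_on UNIV f" "periodic f" "int_vec k" "\<And>x. norm (f x) \<le> C"
 shows "norm (fcoeff \<alpha> f k) \<le> C"
 unfolding fcoeff_def
 by (rule norm_mean_le)
   (use assms periodicD[OF periodic_chi[OF int_vec_minus[OF assms(4)]]] in
    \<open>auto intro!: continuous_intros continuous_chi simp: periodic_def norm_mult\<close>)

lemma fcoeff_diff_le:
 assumes "syndetic_orbit \<alpha>" "continuous_on UNIV f" "periodic f" "continuous_on UNIV g" "periodic g" "int_vec k" "\<And>x. norm (f x - g x) \<le> C"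
 shows "norm (fcoeff \<alpha> f k - fcoeff \<alpha> g k) \<le> C"
proof -
 note p = periodicD[OF periodic_chi[OF int_vec_minus[OF assms(6)]]]
 let ?d = "\<lambda>x. f x - g x"
 have d: "continuous_on UNIV ?d" "periodic ?d" using assms by (auto intro!: continuous_intros simp: periodic_def)
 have "mean \<alpha> (\<lambda>x. ?d x * chi (- k) x + g x * chi (- k) x) = fcoeff \<alpha> ?d k + fcoeff \<alpha> g k"
  unfolding fcoeff_def
  by (rule mean_add) (use assms d p in \<open>auto intro!: continuous_intros continuous_chi simp: periodic_def\<close>)
 then have "fcoeff \<alpha> f k = fcoeff \<alpha> ?d k + fcoeff \<alpha> g k" by (simp add: fcoeff_def algebra_simps)
 then show ?thesis using norm_fcoeff_le[OF assms(1) d assms(6,7)] by simp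
qed

text \<open>The \<open>k\<close>-th coefficient \<open>y\<close> of \<open>F\<close> at height \<open>t\<close> satisfies \<open>y' = a * y + \<close> (coefficient of \<open>e\<close>), because the mean of a
derivative along \<open>w\<close> vanishes. Hence \<open>exp (- a * t) * y\<close> changes at a rate controlled by \<open>e\<close> alone.\<close>

lemma fcoeff_dbar_bound:
 fixes w k :: "real^'d"
 assumes syn: "syndetic_orbit \<alpha>" and F: "dbar_ext w T F Fw e" and T: "T > 0" and k: "int_vec k"
  and a: "a = - (2 * pi * (k \<bullet> w))" and M: "\<And>x. norm (F x T) \<le> M"
  and g: "\<And>t. t \<in> {0..T} ==> (g has_vector_derivative g' t) (at t within {0..T})"
  and bnd: "\<And>x t. t \<in> {0..T} ==> exp (- a * t) * norm (e x t) \<le> g' t"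
 shows "norm (fcoeff \<alpha> (\<lambda>x. F x 0) k) \<le> exp (- a * T) * M + (g T - g 0)"
proof -
 note F' = dbar_extD[OF F]
 let ?E = "chi (- k)"
 have k': "int_vec (- k)" using k by (rule int_vec_minus)
 have cE: "cper T (\<lambda>x t. ?E x)" by (intro cper_base continuous_chi periodic_chi k')
 define I where "I = (\<lambda>t. fcoeff \<alpha> (\<lambda>x. F x t) k)"
 define J where "J = (\<lambda>t. fcoeff \<alpha> (\<lambda>x. e x t) k)"
 have I': "(I has_vector_derivative (of_real a * I t + J t)) (at t within {0..T})" if t: "t \<in> {0..T}" for t
 proof -
  have c1: "cper T (\<lambda>x t. F x t * ?E x)" "cper T (\<lambda>x t. (\<i> * Fw x t + e x t) * ?E x)"
   by (intro cper_mult cper_add cper_const F' cE)+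
  have "((\<lambda>s. F x s * ?E x) has_vector_derivative ((\<i> * Fw x t + e x t) * ?E x)) (at t within {0..T})"
   if "t \<in> {0..T}" for x t
   using has_vector_derivative_mult[OF F'(5)[OF that, of x] has_vector_derivative_const[of "?E x"]] by simp
  then have d: "(I has_vector_derivative mean \<alpha> (\<lambda>x. (\<i> * Fw x t + e x t) * ?E x)) (at t within {0..T})"
   unfolding I_def fcoeff_def by (rule mean_param_derivative[OF syn c1 _ t])
  let ?c = "2 * pi * \<i> * (k \<bullet> w)"
  have c2: "cper T (\<lambda>x t. F x t * (- ?c * ?E x) + Fw x t * ?E x)"
   by (intro cper_mult cper_add cper_const F' cE)
  have "mean \<alpha> (\<lambda>x. F x t * (- ?c * ?E x) + Fw x t * ?E x) = 0"
  proof (rule mean_directional_derivative[OF syn cper_slice[OF c1(1) t] cper_slice[OF c2 t]])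
   show "((\<lambda>s. F (x + s *\<^sub>R w) t * ?E (x + s *\<^sub>R w)) has_vector_derivative (F x t * (- ?c * ?E x) + Fw x t * ?E x)) (at 0)" for x
    using has_vector_derivative_mult[OF F'(4)[OF t, of x] chi_line_derivative[of "- k" x w]] by simp
  qed
  then have z: "\<i> * mean \<alpha> (\<lambda>x. F x t * (- ?c * ?E x) + Fw x t * ?E x) = 0" by simp
  have c3: "cper T (\<lambda>x t. F x t * ?E x)" "cper T (\<lambda>x t. e x t * ?E x)" "cper T (\<lambda>x t. of_real a * (F x t * ?E x))"
    "cper T (\<lambda>x t. \<i> * (F x t * (- ?c * ?E x) + Fw x t * ?E x))" "cper T (\<lambda>x t. of_real a * (F x t * ?E x) + e x t * ?E x)"
   by (intro cper_mult cper_add cper_const F' cE)+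
  have "(\<i> * Fw x t + e x t) * ?E x = (of_real a * (F x t * ?E x) + e x t * ?E x) + \<i> * (F x t * (- ?c * ?E x) + Fw x t * ?E x)" for x
   by (simp add: a algebra_simps)
  then have "mean \<alpha> (\<lambda>x. (\<i> * Fw x t + e x t) * ?E x) =
    mean \<alpha> (\<lambda>x. (of_real a * (F x t * ?E x) + e x t * ?E x) + \<i> * (F x t * (- ?c * ?E x) + Fw x t * ?E x))"
   by (simp only:)
  also have "\<dots> = mean \<alpha> (\<lambda>x. of_real a * (F x t * ?E x) + e x t * ?E x) + mean \<alpha> (\<lambda>x. \<i> * (F x t * (- ?c * ?E x) + Fw x t * ?E x))"
   by (rule mean_add[OF syn cper_slice[OF c3(5) t] cper_slice[OF c3(4) t]])
  also have "mean \<alpha> (\<lambda>x. \<i> * (F x t * (- ?c * ?E x) + Fw x t * ?E x)) = \<i> * mean \<alpha> (\<lambda>x. F x t * (- ?c * ?E x) + Fw x t * ?E x)"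
   by (rule mean_linear[OF syn cper_slice[OF c2 t] bounded_linear_mult_right])
  also have "mean \<alpha> (\<lambda>x. of_real a * (F x t * ?E x) + e x t * ?E x) = mean \<alpha> (\<lambda>x. of_real a * (F x t * ?E x)) + J t"
   unfolding J_def fcoeff_def by (rule mean_add[OF syn cper_slice[OF c3(3) t] cper_slice[OF c3(2) t]])
  also have "mean \<alpha> (\<lambda>x. of_real a * (F x t * ?E x)) = of_real a * I t"
   unfolding I_def fcoeff_def by (rule mean_linear[OF syn cper_slice[OF c3(1) t] bounded_linear_mult_right])
  finally show ?thesis using d z by simp
 qed
 define y where "y = (\<lambda>t. exp (- a * t) *\<^sub>R I t)"
 have y': "(y has_vector_derivative (exp (- a * t) *\<^sub>R J t)) (at t within {0..T})" if t: "t \<in> {0..T}" for t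
 proof -
  have "((\<lambda>t. exp (- a * t)) has_real_derivative (- a * exp (- a * t))) (at t within {0..T})"
   by (auto intro!: derivative_eq_intros)
  from has_vector_derivative_scaleR[OF this I'[OF t]] show ?thesis
   unfolding y_def by (simp add: scaleR_conv_of_real algebra_simps)
 qed
 have "norm (y T - y 0) \<le> g T - g 0"
 proof (rule differentiable_bound_general[OF T, of y g "\<lambda>t. exp (- a * t) *\<^sub>R J t" g'])
  show "continuous_on {0..T} y" "continuous_on {0..T} g"
   unfolding continuous_on_eq_continuous_within using y' g has_vector_derivative_continuous by blast+
  fix t assume t: "0 < t" "t < T"
  then show "(y has_vector_derivative exp (- a * t) *\<^sub>R J t) (at t)" "(g has_vector_derivative g' t) (at t)"
   using y'[of t] g[of t] at_within_Icc_at[of 0 t T] by auto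
  have t': "t \<in> {0..T}" using t by auto
  have "norm (J t) \<le> exp (a * t) * g' t" unfolding J_def
  proof (rule norm_fcoeff_le[OF syn cper_slice[OF F'(3) t'] k])
   fix x
   have "exp (a * t) * (exp (- a * t) * norm (e x t)) \<le> exp (a * t) * g' t"
    using bnd[OF t'] by (intro mult_left_mono) auto
   then show "norm (e x t) \<le> exp (a * t) * g' t" by (simp add: mult.assoc[symmetric] exp_add[symmetric])
  qed
  then have "exp (- a * t) * norm (J t) \<le> exp (- a * t) * (exp (a * t) * g' t)" by (intro mult_left_mono) auto
  then show "norm (exp (- a * t) *\<^sub>R J t) \<le> g' t" by (simp add: mult.assoc[symmetric] exp_add[symmetric])
 qed
 moreover have "norm (y T) \<le> exp (- a * T) * M"
 proof -
  have "T \<in> {0..T}" using T by simp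
  from norm_fcoeff_le[OF syn cper_slice[OF F'(1) this] k M] have "norm (I T) \<le> M" by (simp add: I_def)
  then show ?thesis by (simp add: y_def)
 qed
 moreover have "norm (y 0) \<le> norm (y T) + norm (y T - y 0)"
  using norm_triangle_ineq4[of "y T" "y T - y 0"] by simp
 moreover have "y 0 = fcoeff \<alpha> (\<lambda>x. F x 0) k" by (simp add: y_def I_def)
 ultimately have "norm (y 0) \<le> exp (- a * T) * M + (g T - g 0)" by linarith
 then show ?thesis by (simp add: y_def I_def)
qed

section \<open>Mollification along a direction\<close>

text \<open>Averaging over a short segment in the direction \<open>w\<close> makes a function differentiable along \<open>w\<close>.\<close>

lemma mollify_along:
 fixes f :: "real^'d \<Rightarrow> 'a::euclidean_space"
 assumes f: "continuous_on UNIV f" "periodic f" and b: "\<And>x. norm (f x) \<le> \<theta>" and e: "e > 0"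
 obtains z z' where "continuous_on UNIV z" "periodic z" "continuous_on UNIV z'" "periodic z'"
  "\<And>x. ((\<lambda>s. z (x + s *\<^sub>R w)) has_vector_derivative z' x) (at 0)"
  "\<And>x. norm (z x) \<le> \<theta>" "\<And>x. norm (z x - f x) \<le> e"
proof -
 obtain d where d: "d > 0" "\<And>x x'. dist x x' < d ==> dist (f x) (f x') < e"
  using periodic_uniformly_continuous[OF f e] by blast
 define h where "h = (d / 2) / (norm w + 1)"
 have nw: "norm w + 1 > 0" using norm_ge_zero[of w] by linarith
 have h: "h > 0" using d nw by (simp add: h_def)
 have hw: "s * norm w < d" if "s \<in> {0..h}" for s
 proof -
  have "s * norm w \<le> h * (norm w + 1)" using that by (intro mult_mono) auto
  also have "\<dots> = d / 2" using nw by (metis h_def nonzero_eq_divide_eq less_irrefl)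
  finally show ?thesis using d by simp
 qed
 define z where "z x = (1 / h) *\<^sub>R integral {0..h} (\<lambda>s. f (x + s *\<^sub>R w))" for x
 define z' where "z' x = (1 / h) *\<^sub>R (f (x + h *\<^sub>R w) - f x)" for x
 have int: "(\<lambda>s. f (x + s *\<^sub>R w)) integrable_on {0..h}" for x
  by (intro integrable_continuous_interval continuous_on_compose2[OF f(1)] continuous_intros) auto
 show ?thesis
 proof (rule that[of z z'])
  have "continuous_on UNIV (\<lambda>x. integral (cbox 0 h) (\<lambda>s. f (x + s *\<^sub>R w)))"
   by (rule integral_continuous_on_param)
     (auto simp: case_prod_beta intro!: continuous_on_compose2[OF f(1)] continuous_intros)
  then show "continuous_on UNIV z" unfolding z_def by (auto intro!: continuous_intros)
  show "periodic z" using periodic_shift[OF f(2)] unfolding z_def periodic_def by auto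
  show "continuous_on UNIV z'" unfolding z'_def
   by (intro continuous_intros continuous_on_compose2[OF f(1)]) auto
  show "periodic z'" using periodic_shift[OF f(2)] f(2) unfolding z'_def periodic_def by auto
  show "norm (z x) \<le> \<theta>" for x
  proof -
   have "norm (integral {0..h} (\<lambda>s. f (x + s *\<^sub>R w))) \<le> \<theta> * (h - 0)"
    by (rule integral_bound) (use h b in \<open>auto intro!: continuous_on_compose2[OF f(1)] continuous_intros\<close>)
   then show ?thesis using h by (simp add: z_def field_simps)
  qed
  show "norm (z x - f x) \<le> e" for x
  proof -
   have "norm (integral {0..h} (\<lambda>s. f (x + s *\<^sub>R w) - f x)) \<le> e * (h - 0)"
   proof (rule integral_bound)
    show "norm (f (x + s *\<^sub>R w) - f x) \<le> e" if "s \<in> {0..h}" for s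
     using d(2)[of "x + s *\<^sub>R w" x] hw[OF that] that by (simp add: dist_norm)
   qed (use h in \<open>auto intro!: continuous_on_compose2[OF f(1)] continuous_intros\<close>)
   moreover have "integral {0..h} (\<lambda>s. f (x + s *\<^sub>R w) - f x) = h *\<^sub>R (z x - f x)"
    using h Henstock_Kurzweil_Integration.integral_diff[OF int[of x] integrable_continuous_interval[OF continuous_on_const[of "{0..h}" "f x"]]]
    by (simp add: z_def scaleR_diff_right)
   ultimately show ?thesis using h by simp
  qed
  show "((\<lambda>s. z (x + s *\<^sub>R w)) has_vector_derivative z' x) (at 0)" for x
  proof -
   let ?l = "\<lambda>s. f (x + s *\<^sub>R w)"
   have "continuous_on {-1..h+1} ?l"
    by (intro continuous_on_compose2[OF f(1)] continuous_intros) auto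
   then obtain H where H: "\<And>s. s \<in> {-1..h+1} ==> (H has_vector_derivative ?l s) (at s within {-1..h+1})"
    using antiderivative_continuous by metis
   have H': "(H has_vector_derivative ?l s) (at s)" if "-1 < s" "s < h + 1" for s
    using H[of s] that at_within_Icc_at[of "-1" s "h+1"] by auto
   have zH: "z (x + s *\<^sub>R w) = (1 / h) *\<^sub>R (H (h + s) - H s)" if s: "\<bar>s\<bar> < 1" for s
   proof -
    have "((\<lambda>r. ?l (r + s)) has_integral (H (h + s) - H (0 + s))) {0..h}"
    proof (rule fundamental_theorem_of_calculus)
     fix r assume r: "r \<in> {0..h}"
     have a: "((\<lambda>r. r + s) has_vector_derivative 1) (at r)"
      by (auto intro!: derivative_eq_intros)
     have "(H has_vector_derivative ?l (r + s)) (at (r + s))"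
      using r s by (intro H') auto
     from vector_diff_chain_at[OF a this]
     have "((\<lambda>r. H (r + s)) has_vector_derivative 1 *\<^sub>R ?l (r + s)) (at r)"
      by (simp add: o_def)
     then show "((\<lambda>r. H (r + s)) has_vector_derivative ?l (r + s)) (at r within {0..h})"
      by (simp add: has_vector_derivative_at_within)
    qed (use h in auto)
    then have "integral {0..h} (\<lambda>r. ?l (r + s)) = H (h + s) - H s" by (simp add: integral_unique)
    moreover have "(\<lambda>r. f (x + s *\<^sub>R w + r *\<^sub>R w)) = (\<lambda>r. ?l (r + s))" by (simp add: algebra_simps)
    ultimately show ?thesis by (simp add: z_def)
   qed
   have "((\<lambda>s. H (h + s)) has_vector_derivative 1 *\<^sub>R ?l h) (at 0)"
   proof -
    have a: "((\<lambda>s. h + s) has_vector_derivative 1) (at 0)"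
     by (auto intro!: derivative_eq_intros)
    have "(H has_vector_derivative ?l h) (at (h + 0))" using H'[of h] h by simp
    from vector_diff_chain_at[OF a this] show ?thesis by (simp add: o_def)
   qed
   moreover have "(H has_vector_derivative ?l 0) (at 0)" using H'[of 0] h by simp
   ultimately have "((\<lambda>s. (1 / h) *\<^sub>R (H (h + s) - H s)) has_vector_derivative (1 / h) *\<^sub>R (?l h - ?l 0)) (at 0)"
    by (auto intro!: derivative_eq_intros)
   then have "((\<lambda>s. (1 / h) *\<^sub>R (H (h + s) - H s)) has_vector_derivative z' x) (at 0)" by (simp add: z'_def)
   then show ?thesis
    by (rule has_vector_derivative_transform_within_open[of _ _ _ "{-1<..<1}"]) (auto simp: zH abs_less_iff)
  qed
 qed
qed

section \<open>Contraction\<close>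

lemma cper_diff: "cper T F ==> cper T G ==> cper T (\<lambda>x t. F x t - G x t)"
 using cper_add[of T F "\<lambda>x t. - G x t"] cper_minus[of T G] by simp

text \<open>Differentiability in \<open>t\<close> alone, with continuous derivative; unlike \<open>dbar_ext\<close> it is stable under conjugation.\<close>

definition tder :: "real \<Rightarrow> (real^'d \<Rightarrow> real \<Rightarrow> complex) \<Rightarrow> (real^'d \<Rightarrow> real \<Rightarrow> complex) \<Rightarrow> bool" where
 "tder T F F' \<longleftrightarrow> cper T F \<and> cper T F' \<and>
  (\<forall>x. \<forall>t\<in>{0..T}. ((\<lambda>s. F x s) has_vector_derivative F' x t) (at t within {0..T}))"

lemma tder_dbar: "dbar_ext w T F Fw e ==> tder T F (\<lambda>x t. \<i> * Fw x t + e x t)"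
 unfolding tder_def dbar_ext_def by (intro conjI cper_add cper_mult cper_const) auto

lemma tder_diff: "tder T F F' ==> tder T G G' ==> tder T (\<lambda>x t. F x t - G x t) (\<lambda>x t. F' x t - G' x t)"
 unfolding tder_def
 by (intro conjI cper_diff) (auto intro!: has_vector_derivative_diff)

lemma tder_mult: "tder T F F' ==> tder T G G' ==> tder T (\<lambda>x t. F x t * G x t) (\<lambda>x t. F x t * G' x t + F' x t * G x t)"
 unfolding tder_def
 by (intro conjI cper_add cper_mult) (auto intro!: has_vector_derivative_mult)

lemma cper_cnj: "cper T F ==> cper T (\<lambda>x t. cnj (F x t))"
 by (rule cper_compose[where S = UNIV]) (auto intro!: continuous_intros)

lemma tder_cnj: "tder T F F' ==> tder T (\<lambda>x t. cnj (F x t)) (\<lambda>x t. cnj (F' x t))"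
 unfolding tder_def
 by (intro conjI cper_cnj) (auto intro!: has_vector_derivative_cnj)

text \<open>Uniform continuity of the \<open>t\<close>-derivative makes the first order expansion uniform in \<open>x\<close>.\<close>

lemma tder_linearization:
 assumes F: "tder T F F'" and "T > 0" "e > 0"
 obtains T' where "0 < T'" "T' \<le> T" "\<And>x t. t \<in> {0..T'} ==> cmod (F x t - F x 0 - of_real t * F' x 0) \<le> e * t"
proof -
 have c: "cper T F'" and der: "\<And>x t. t \<in> {0..T} ==> ((\<lambda>s. F x s) has_vector_derivative F' x t) (at t within {0..T})"
  using F by (auto simp: tder_def)
 obtain d where d: "d > 0"
  "\<And>x t x' t'. t \<in> {0..T} ==> t' \<in> {0..T} ==> dist x x' < d ==> dist t t' < d ==> dist (F' x t) (F' x' t') < e"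
  using cper_uniform[OF c \<open>e > 0\<close>] by blast
 show ?thesis
 proof (rule that[of "min T (d/2)"])
  fix x t assume t: "t \<in> {0..min T (d/2)}"
  have "cmod (F x t - F x 0 - (t - 0) *\<^sub>R F' x 0) \<le> norm (t - 0) * e"
  proof (rule vector_differentiable_bound_linearization[where S = "{0..t}" and f' = "F' x" and ?x0.0 = 0])
   show "((\<lambda>s. F x s) has_vector_derivative F' x s) (at s within {0..t})" if "s \<in> {0..t}" for s
    using has_vector_derivative_within_subset[OF der, of s "{0..t}"] that t by auto
   show "cmod (F' x s - F' x 0) \<le> e" if "s \<in> {0..t}" for s
    using d(2)[of s 0 x x] that t d(1) by (auto simp: dist_norm)
  qed (use t in \<open>auto simp: closed_segment_eq_real_ivl\<close>)
  then show "cmod (F x t - F x 0 - of_real t * F' x 0) \<le> e * t"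
   using t by (simp add: scaleR_conv_of_real mult.commute)
 qed (use \<open>T > 0\<close> d in auto)
qed

lemma moebius_expand:
 fixes P Q R S v :: complex
 shows "(cmod (R * v + S))\<^sup>2 - (cmod (P * v + Q))\<^sup>2 =
   Re (S * cnj S - Q * cnj Q) + 2 * Re ((cnj S * R - cnj Q * P) * v) + Re (R * cnj R - P * cnj P) * (cmod v)\<^sup>2"
 unfolding cmod_power2 by (simp add: algebra_simps power2_eq_square)

text \<open>At \<open>t = 0\<close> the left hand side of the contraction estimate is exactly \<open>1 - |v|\<^sup>2\<close>. Since \<open>e = 0\<close> there, the
\<open>t\<close>-derivatives of \<open>P\<close>, \<open>Q\<close>, \<open>R\<close>, \<open>S\<close> are \<open>\<i>\<close> times the derivatives along \<open>w\<close>, and the derivative of the left hand side is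
the form of the logarithmic derivative along \<open>w\<close>, bounded below on the closed disc by monotonicity. The
determinant is stationary to first order.\<close>

lemma moebius_contraction:
 fixes P :: "real^'d \<Rightarrow> real \<Rightarrow> complex"
 assumes P: "dbar_ext w T P Pw eP" and Q: "dbar_ext w T Q Qw eQ"
  and R: "dbar_ext w T R Rw eR" and S: "dbar_ext w T S Sw eS" and T: "T > 0"
  and e0: "\<And>x. eP x 0 = 0" "\<And>x. eQ x 0 = 0" "\<And>x. eR x 0 = 0" "\<And>x. eS x 0 = 0"
  and real0: "\<And>x. S x 0 = cnj (P x 0)" "\<And>x. R x 0 = cnj (Q x 0)"
  and det0: "\<And>x. (cmod (P x 0))\<^sup>2 - (cmod (Q x 0))\<^sup>2 = 1"
  and c: "c > 0"
  and mono: "\<And>x. Im (cnj (P x 0) * Pw x 0 - Q x 0 * cnj (Qw x 0)) - cmod (cnj (P x 0) * Qw x 0 - Q x 0 * cnj (Pw x 0)) \<ge> c"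
 obtains T' where "0 < T'" "T' \<le> T" "c * T' \<le> 1"
  "\<And>x t v. t \<in> {0..T'} ==> cmod v \<le> 1 ==>
    (cmod (R x t * v + S x t))\<^sup>2 - (cmod (P x t * v + Q x t))\<^sup>2 \<ge> 1 - (cmod v)\<^sup>2 + c * t"
  "\<And>x t. t \<in> {0..T'} ==> cmod (P x t * S x t - Q x t * R x t) \<le> 1 + c / 4 * t"
proof -
 have T0: "0 \<in> {0..T}" using T by simp
 have Sw: "Sw x 0 = cnj (Pw x 0)" and Rw: "Rw x 0 = cnj (Qw x 0)" for x
 proof -
  have "((\<lambda>s. S (x + s *\<^sub>R w) 0) has_vector_derivative cnj (Pw x 0)) (at 0)"
   unfolding real0 by (rule has_vector_derivative_cnj) (rule dbar_extD(4)[OF P T0])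
  then show "Sw x 0 = cnj (Pw x 0)" using dbar_extD(4)[OF S T0] vector_derivative_unique_at by blast
  have "((\<lambda>s. R (x + s *\<^sub>R w) 0) has_vector_derivative cnj (Qw x 0)) (at 0)"
   unfolding real0 by (rule has_vector_derivative_cnj) (rule dbar_extD(4)[OF Q T0])
  then show "Rw x 0 = cnj (Qw x 0)" using dbar_extD(4)[OF R T0] vector_derivative_unique_at by blast
 qed
 have det: "P x 0 * cnj (P x 0) - Q x 0 * cnj (Q x 0) = 1" for x
  using det0[of x] by (metis complex_norm_square of_real_diff of_real_1)
 have ddet: "P x 0 * cnj (Pw x 0) + Pw x 0 * cnj (P x 0) - (Q x 0 * cnj (Qw x 0) + Qw x 0 * cnj (Q x 0)) = 0" for x
 proof -
  note Pd = dbar_extD(4)[OF P T0, of x] and Qd = dbar_extD(4)[OF Q T0, of x]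
  have "((\<lambda>s. P (x + s *\<^sub>R w) 0 * cnj (P (x + s *\<^sub>R w) 0) - Q (x + s *\<^sub>R w) 0 * cnj (Q (x + s *\<^sub>R w) 0))
    has_vector_derivative (P x 0 * cnj (Pw x 0) + Pw x 0 * cnj (P x 0) - (Q x 0 * cnj (Qw x 0) + Qw x 0 * cnj (Q x 0)))) (at 0)"
   using has_vector_derivative_diff[OF has_vector_derivative_mult[OF Pd has_vector_derivative_cnj[OF Pd]]
     has_vector_derivative_mult[OF Qd has_vector_derivative_cnj[OF Qd]]] by simp
  then show ?thesis unfolding det using vector_derivative_unique_at has_vector_derivative_const by blast
 qed
 note tP = tder_dbar[OF P] and tQ = tder_dbar[OF Q] and tR = tder_dbar[OF R] and tS = tder_dbar[OF S]
 define A0 where "A0 = (\<lambda>x t. S x t * cnj (S x t) - Q x t * cnj (Q x t))"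
 define A1 where "A1 = (\<lambda>x t. cnj (S x t) * R x t - cnj (Q x t) * P x t)"
 define A2 where "A2 = (\<lambda>x t. R x t * cnj (R x t) - P x t * cnj (P x t))"
 define A3 where "A3 = (\<lambda>x t. P x t * S x t - Q x t * R x t)"
 define \<sigma> where "\<sigma> x = Im (cnj (P x 0) * Pw x 0 - Q x 0 * cnj (Qw x 0))" for x
 define \<zeta> where "\<zeta> x = cnj (P x 0) * Qw x 0 - Q x 0 * cnj (Pw x 0)" for x
 have c4: "c / 4 > 0" using c by simp
 note lin = tder_linearization[OF _ T c4]
 obtain T0 where T0: "0 < T0" "T0 \<le> T" and L0: "\<And>x t. t \<in> {0..T0} ==> cmod (A0 x t - A0 x 0 - of_real t *
   (S x 0 * cnj (\<i> * Sw x 0 + eS x 0) + (\<i> * Sw x 0 + eS x 0) * cnj (S x 0) - (Q x 0 * cnj (\<i> * Qw x 0 + eQ x 0) + (\<i> * Qw x 0 + eQ x 0) * cnj (Q x 0)))) \<le> c / 4 * t"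
  using lin[OF tder_diff[OF tder_mult[OF tS tder_cnj[OF tS]] tder_mult[OF tQ tder_cnj[OF tQ]]]] unfolding A0_def by blast
 obtain T1 where T1: "0 < T1" "T1 \<le> T" and L1: "\<And>x t. t \<in> {0..T1} ==> cmod (A1 x t - A1 x 0 - of_real t *
   (cnj (S x 0) * (\<i> * Rw x 0 + eR x 0) + cnj (\<i> * Sw x 0 + eS x 0) * R x 0 - (cnj (Q x 0) * (\<i> * Pw x 0 + eP x 0) + cnj (\<i> * Qw x 0 + eQ x 0) * P x 0))) \<le> c / 4 * t"
  using lin[OF tder_diff[OF tder_mult[OF tder_cnj[OF tS] tR] tder_mult[OF tder_cnj[OF tQ] tP]]] unfolding A1_def by blast
 obtain T2 where T2: "0 < T2" "T2 \<le> T" and L2: "\<And>x t. t \<in> {0..T2} ==> cmod (A2 x t - A2 x 0 - of_real t *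
   (R x 0 * cnj (\<i> * Rw x 0 + eR x 0) + (\<i> * Rw x 0 + eR x 0) * cnj (R x 0) - (P x 0 * cnj (\<i> * Pw x 0 + eP x 0) + (\<i> * Pw x 0 + eP x 0) * cnj (P x 0)))) \<le> c / 4 * t"
  using lin[OF tder_diff[OF tder_mult[OF tR tder_cnj[OF tR]] tder_mult[OF tP tder_cnj[OF tP]]]] unfolding A2_def by blast
 obtain T3 where T3: "0 < T3" "T3 \<le> T" and L3: "\<And>x t. t \<in> {0..T3} ==> cmod (A3 x t - A3 x 0 - of_real t *
   (P x 0 * (\<i> * Sw x 0 + eS x 0) + (\<i> * Pw x 0 + eP x 0) * S x 0 - (Q x 0 * (\<i> * Rw x 0 + eR x 0) + (\<i> * Qw x 0 + eQ x 0) * R x 0))) \<le> c / 4 * t"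
  using lin[OF tder_diff[OF tder_mult[OF tP tS] tder_mult[OF tQ tR]]] unfolding A3_def by blast
 have B0: "\<bar>Re (A0 x t) - 1 - 2 * t * \<sigma> x\<bar> \<le> c / 4 * t" if "t \<in> {0..T0}" for x t
 proof -
  have 1: "Re (A0 x 0) = 1" using det[of x] by (simp add: A0_def real0 mult.commute)
  define z where "z = S x 0 * cnj (\<i> * Sw x 0 + eS x 0) + (\<i> * Sw x 0 + eS x 0) * cnj (S x 0) - (Q x 0 * cnj (\<i> * Qw x 0 + eQ x 0) + (\<i> * Qw x 0 + eQ x 0) * cnj (Q x 0))"
  have 2: "Re z = 2 * \<sigma> x" by (simp add: z_def e0 real0 Sw \<sigma>_def algebra_simps)
  have "\<bar>Re (A0 x t - A0 x 0 - of_real t * z)\<bar> \<le> c / 4 * t"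
   using abs_Re_le_cmod L0[OF that, of x, folded z_def] order_trans by blast
  moreover have "Re (A0 x t - A0 x 0 - of_real t * z) = Re (A0 x t) - 1 - 2 * t * \<sigma> x" by (simp add: 1 2)
  ultimately show ?thesis by metis
 qed
 have B2: "\<bar>Re (A2 x t) + 1 - 2 * t * \<sigma> x\<bar> \<le> c / 4 * t" if "t \<in> {0..T2}" for x t
 proof -
  have 1: "Re (A2 x 0) = - 1" using arg_cong[OF det[of x], of Re] by (simp add: A2_def real0)
  define z where "z = R x 0 * cnj (\<i> * Rw x 0 + eR x 0) + (\<i> * Rw x 0 + eR x 0) * cnj (R x 0) - (P x 0 * cnj (\<i> * Pw x 0 + eP x 0) + (\<i> * Pw x 0 + eP x 0) * cnj (P x 0))"
  have 2: "Re z = 2 * \<sigma> x" by (simp add: z_def e0 real0 Rw \<sigma>_def algebra_simps)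
  have "\<bar>Re (A2 x t - A2 x 0 - of_real t * z)\<bar> \<le> c / 4 * t"
   using abs_Re_le_cmod L2[OF that, of x, folded z_def] order_trans by blast
  moreover have "Re (A2 x t - A2 x 0 - of_real t * z) = Re (A2 x t) + 1 - 2 * t * \<sigma> x" by (simp add: 1 2)
  ultimately show ?thesis by metis
 qed
 have B1: "cmod (A1 x t - of_real t * (2 * \<i> * cnj (\<zeta> x))) \<le> c / 4 * t" if "t \<in> {0..T1}" for x t
 proof -
  have 1: "A1 x 0 = 0" by (simp add: A1_def real0)
  have 2: "cnj (S x 0) * (\<i> * Rw x 0 + eR x 0) + cnj (\<i> * Sw x 0 + eS x 0) * R x 0 - (cnj (Q x 0) * (\<i> * Pw x 0 + eP x 0) + cnj (\<i> * Qw x 0 + eQ x 0) * P x 0)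
    = 2 * \<i> * cnj (\<zeta> x)" by (simp add: e0 real0 Rw Sw \<zeta>_def algebra_simps)
  show ?thesis using L1[OF that, of x] unfolding 1 2 by simp
 qed
 have B3: "cmod (A3 x t - 1) \<le> c / 4 * t" if "t \<in> {0..T3}" for x t
 proof -
  have 1: "A3 x 0 = 1" using det[of x] by (simp add: A3_def real0)
  have "P x 0 * (\<i> * Sw x 0 + eS x 0) + (\<i> * Pw x 0 + eP x 0) * S x 0 - (Q x 0 * (\<i> * Rw x 0 + eR x 0) + (\<i> * Qw x 0 + eQ x 0) * R x 0)
    = \<i> * (P x 0 * cnj (Pw x 0) + Pw x 0 * cnj (P x 0) - (Q x 0 * cnj (Qw x 0) + Qw x 0 * cnj (Q x 0)))"
   by (simp add: e0 real0 Rw Sw algebra_simps)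
  then have 2: "P x 0 * (\<i> * Sw x 0 + eS x 0) + (\<i> * Pw x 0 + eP x 0) * S x 0 - (Q x 0 * (\<i> * Rw x 0 + eR x 0) + (\<i> * Qw x 0 + eQ x 0) * R x 0) = 0"
   unfolding ddet by simp
  show ?thesis using L3[OF that, of x] unfolding 1 2 by simp
 qed
 define T' where "T' = min (min (min T0 T1) (min T2 T3)) (1 / c)"
 show ?thesis
 proof (rule that[of T'])
  show "0 < T'" "T' \<le> T" using T0 T1 T2 T3 c by (auto simp: T'_def)
  show "c * T' \<le> 1"
  proof -
   have "c * T' \<le> c * (1 / c)" unfolding T'_def using c by (intro mult_left_mono) auto
   then show ?thesis using c by simp
  qed
  show "cmod (P x t * S x t - Q x t * R x t) \<le> 1 + c / 4 * t" if t: "t \<in> {0..T'}" for x t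
  proof -
   have "cmod (A3 x t) \<le> cmod (A3 x t - 1) + 1" using norm_triangle_ineq[of "A3 x t - 1" 1] by simp
   moreover have "cmod (A3 x t - 1) \<le> c / 4 * t" by (rule B3) (use t in \<open>auto simp: T'_def\<close>)
   ultimately show ?thesis unfolding A3_def by linarith
  qed
  fix x t and v :: complex assume t: "t \<in> {0..T'}" and v: "cmod v \<le> 1"
  define n where "n = cmod v"
  have n: "0 \<le> n" "n \<le> 1" "n\<^sup>2 \<le> 1" using v by (auto simp: n_def power_le_one)
  have t0: "t \<ge> 0" using t by simp
  have b0: "Re (A0 x t) \<ge> 1 + 2 * t * \<sigma> x - c / 4 * t"
  proof -
   have "\<bar>Re (A0 x t) - 1 - 2 * t * \<sigma> x\<bar> \<le> c / 4 * t" by (rule B0) (use t in \<open>auto simp: T'_def\<close>)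
   then show ?thesis by linarith
  qed
  have b2: "Re (A2 x t) \<ge> - 1 + 2 * t * \<sigma> x - c / 4 * t"
  proof -
   have "\<bar>Re (A2 x t) + 1 - 2 * t * \<sigma> x\<bar> \<le> c / 4 * t" by (rule B2) (use t in \<open>auto simp: T'_def\<close>)
   then show ?thesis by linarith
  qed
  have b1: "Re (A1 x t * v) \<ge> - (2 * t * cmod (\<zeta> x) * n) - c / 4 * t"
  proof -
   have "cmod (A1 x t) \<le> cmod (A1 x t - of_real t * (2 * \<i> * cnj (\<zeta> x))) + cmod (of_real t * (2 * \<i> * cnj (\<zeta> x)))"
    using norm_triangle_ineq[of "A1 x t - of_real t * (2 * \<i> * cnj (\<zeta> x))" "of_real t * (2 * \<i> * cnj (\<zeta> x))"] by simp
   also have "\<dots> \<le> c / 4 * t + 2 * t * cmod (\<zeta> x)"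
   proof -
    have "cmod (A1 x t - of_real t * (2 * \<i> * cnj (\<zeta> x))) \<le> c / 4 * t" by (rule B1) (use t in \<open>auto simp: T'_def\<close>)
    then show ?thesis using t0 by (simp add: norm_mult)
   qed
   finally have "cmod (A1 x t) * n \<le> (c / 4 * t + 2 * t * cmod (\<zeta> x)) * n" using n by (intro mult_right_mono)
   also have "\<dots> \<le> c / 4 * t + 2 * t * cmod (\<zeta> x) * n"
   proof -
    have "c / 4 * t * n \<le> c / 4 * t * 1" using n t0 c by (intro mult_left_mono) auto
    then show ?thesis by (simp add: algebra_simps)
   qed
   finally have "cmod (A1 x t * v) \<le> c / 4 * t + 2 * t * cmod (\<zeta> x) * n" by (simp add: norm_mult n_def)
   then show ?thesis using abs_Re_le_cmod[of "A1 x t * v"] by linarith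
  qed
  have "Re (A2 x t) * n\<^sup>2 \<ge> (- 1 + 2 * t * \<sigma> x - c / 4 * t) * n\<^sup>2" using b2 by (intro mult_right_mono) auto
  moreover have "c / 4 * t * n\<^sup>2 \<le> c / 4 * t" using n t0 c mult_left_mono[of "n\<^sup>2" 1 "c / 4 * t"] by simp
  ultimately have b2': "Re (A2 x t) * n\<^sup>2 \<ge> - n\<^sup>2 + 2 * t * \<sigma> x * n\<^sup>2 - c / 4 * t" by (simp add: algebra_simps)
  have "2 * n \<le> 1 + n\<^sup>2" using sum_squares_bound[of n 1] by simp
  then have "2 * t * cmod (\<zeta> x) * (2 * n) \<le> 2 * t * cmod (\<zeta> x) * (1 + n\<^sup>2)" using t0 by (intro mult_left_mono) auto
  moreover have "2 * t * (1 + n\<^sup>2) * c \<le> 2 * t * (1 + n\<^sup>2) * (\<sigma> x - cmod (\<zeta> x))"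
   using mono[of x] t0 by (intro mult_left_mono) (auto simp: \<sigma>_def \<zeta>_def)
  moreover have "2 * t * c \<le> 2 * t * (1 + n\<^sup>2) * c" using t0 c by (intro mult_right_mono) (auto simp: algebra_simps)
  ultimately have "2 * t * c \<le> 2 * t * \<sigma> x + 2 * t * \<sigma> x * n\<^sup>2 - 2 * (2 * t * cmod (\<zeta> x) * n)"
   by (simp add: algebra_simps)
  then have "Re (A0 x t) + 2 * Re (A1 x t * v) + Re (A2 x t) * n\<^sup>2 \<ge> 1 - n\<^sup>2 + 2 * t * c - 4 * (c / 4 * t)"
   using b0 b1 b2' by linarith
  then show "(cmod (R x t * v + S x t))\<^sup>2 - (cmod (P x t * v + Q x t))\<^sup>2 \<ge> 1 - (cmod v)\<^sup>2 + c * t"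
   unfolding moebius_expand A0_def[symmetric]
   by (simp add: A0_def A1_def A2_def n_def algebra_simps)
 qed
qed

lemma periodic_norm_less_one_uniform:
 fixes u :: "real^'d \<Rightarrow> complex"
 assumes "continuous_on UNIV u" "periodic u" "\<And>x. cmod (u x) < 1"
 obtains \<theta> where "0 \<le> \<theta>" "\<theta> < 1" "\<And>x. cmod (u x) \<le> \<theta>"
proof -
 have "continuous_on UNIV (\<lambda>x. inverse (1 - cmod (u x)))"
 proof (intro continuous_intros assms(1) ballI)
  show "1 - cmod (u x) \<noteq> 0" for x using assms(3)[of x] by simp
 qed
 moreover have "periodic (\<lambda>x. inverse (1 - cmod (u x)))" using assms(2) by (simp add: periodic_def)
 ultimately obtain C where C: "C > 0" "\<And>x. norm (inverse (1 - cmod (u x))) \<le> C"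
  using periodic_bounded by blast
 have le: "cmod (u x) \<le> 1 - inverse C" for x
 proof -
  have p: "1 - cmod (u x) > 0" using assms(3)[of x] by simp
  then have "inverse (1 - cmod (u x)) \<le> C" using C(2)[of x] by simp
  then have "inverse C \<le> 1 - cmod (u x)"
   using p C(1) by (metis inverse_inverse_eq le_imp_inverse_le positive_imp_inverse_positive)
  then show ?thesis by simp
 qed
 show ?thesis
 proof (rule that[of "1 - inverse C"])
  show "0 \<le> 1 - inverse C" using le[of 0] norm_ge_zero order_trans by blast
 qed (use C le in auto)
qed

text \<open>The action \<open>v \<mapsto> (P * v + Q) / (R * v + S)\<close> over the translation by \<open>\<beta>\<close>, contracting for \<open>t > 0\<close>,
real for \<open>t = 0\<close>, and with continuous invariant section \<open>u\<close>. The defects of the coefficients are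
bounded by \<open>t\<^sup>2 * g t\<close>; the two extra powers of \<open>t\<close> pay for summing the geometric series of contractions,
whose ratio is \<open>1 - O(t)\<close>.\<close>

locale contracting_moebius =
 fixes \<alpha> w \<beta> :: "real^'d" and T c C M :: real and g :: "real \<Rightarrow> real"
  and P Pw eP Q Qw eQ R Rw eR S Sw eS :: "real^'d \<Rightarrow> real \<Rightarrow> complex"
  and u :: "real^'d \<Rightarrow> complex"
 assumes syn: "syndetic_orbit \<alpha>"
  and P: "dbar_ext w T P Pw eP" and Q: "dbar_ext w T Q Qw eQ"
  and R: "dbar_ext w T R Rw eR" and S: "dbar_ext w T S Sw eS"
  and T: "T > 0" and c: "c > 0" and cT: "c * T \<le> 1" and C: "C \<ge> 0" and g: "\<And>t. t \<in> {0..T} ==> g t \<ge> 0"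
  and err: "\<And>x t. t \<in> {0..T} ==> cmod (eP x t) \<le> C * t\<^sup>2 * g t" "\<And>x t. t \<in> {0..T} ==> cmod (eQ x t) \<le> C * t\<^sup>2 * g t"
   "\<And>x t. t \<in> {0..T} ==> cmod (eR x t) \<le> C * t\<^sup>2 * g t" "\<And>x t. t \<in> {0..T} ==> cmod (eS x t) \<le> C * t\<^sup>2 * g t"
  and M: "\<And>x t. t \<in> {0..T} ==> cmod (R x t) + cmod (S x t) \<le> M"
  and contr: "\<And>x t v. t \<in> {0..T} ==> cmod v \<le> 1 ==>
    (cmod (R x t * v + S x t))\<^sup>2 - (cmod (P x t * v + Q x t))\<^sup>2 \<ge> 1 - (cmod v)\<^sup>2 + c * t"
  and detb: "\<And>x t. t \<in> {0..T} ==> cmod (P x t * S x t - Q x t * R x t) \<le> 1 + c / 4 * t"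
  and real0: "\<And>x. S x 0 = cnj (P x 0)" "\<And>x. R x 0 = cnj (Q x 0)"
  and det0: "\<And>x. (cmod (P x 0))\<^sup>2 - (cmod (Q x 0))\<^sup>2 = 1"
  and u: "continuous_on UNIV u" "periodic u" "\<And>x. cmod (u x) < 1"
  and inv: "\<And>x. P x 0 * u x + Q x 0 = u (x + \<beta>) * (R x 0 * u x + S x 0)"
begin

text \<open>The factor by which one step of the action reduces the relative defect at height \<open>t\<close>.\<close>

definition lam :: "real \<Rightarrow> real" where "lam t = inverse (1 + c / 2 * t)"

lemma ct: "t \<in> {0..T} ==> 0 \<le> c * t \<and> c * t \<le> 1"
proof -
 assume t: "t \<in> {0..T}"
 then have "c * t \<le> c * T" using c by (intro mult_left_mono) auto
 then have "c * t \<le> 1" using cT by linarith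
 moreover have "0 \<le> c * t" using c t by simp
 ultimately show ?thesis by blast
qed

lemma M_nonneg: "M \<ge> 0"
proof -
 have "cmod (R 0 0) + cmod (S 0 0) \<le> M" using M[of 0 0] T by simp
 then show ?thesis using norm_ge_zero[of "R 0 0"] norm_ge_zero[of "S 0 0"] by linarith
qed

lemma lam_pos: "t \<in> {0..T} ==> 0 < lam t"
 using ct[of t] unfolding lam_def by (intro positive_imp_inverse_positive) (auto simp: field_simps)

lemma one_minus_lam: "t \<in> {0..T} ==> c * t / 4 \<le> 1 - lam t"
proof -
 assume t: "t \<in> {0..T}"
 let ?s = "c * t"
 have s: "0 \<le> ?s" "?s \<le> 1" using ct[OF t] by auto
 have e: "1 - lam t = (?s / 2) / (1 + ?s / 2)" using s by (simp add: lam_def field_simps)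
 have "?s / 4 * (1 + ?s / 2) \<le> ?s / 4 * 2" using s by (intro mult_left_mono) auto
 then have "?s / 4 \<le> (?s / 2) / (1 + ?s / 2)" using s by (subst pos_le_divide_eq) auto
 then show ?thesis using e by simp
qed

lemma det_le_lam:
 assumes t: "t \<in> {0..T}" and h: "0 \<le> h" "h \<le> 1" and \<Phi>: "\<Phi> \<ge> h + c * t"
 shows "(1 + c / 4 * t) * h \<le> lam t * \<Phi>"
proof -
 define s where "s = c * t"
 have s: "0 \<le> s" "s \<le> 1" using ct[OF t] by (auto simp: s_def)
 have "s * s \<le> s * 1" using s by (intro mult_left_mono) auto
 then have "(3 * s / 4 + s * s / 8) * h \<le> s * h" using s h by (intro mult_right_mono) auto
 also have "\<dots> \<le> s * 1" using s h by (intro mult_left_mono) auto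
 finally have "(3 * s / 4 + s * s / 8) * h \<le> s" by simp
 then have "(1 + s / 4) * h * (1 + s / 2) \<le> h + s" by (simp add: field_simps)
 then have "(1 + s / 4) * h \<le> (h + s) * inverse (1 + s / 2)"
  using s by (subst divide_inverse[symmetric], subst pos_le_divide_eq) auto
 also have "\<dots> = lam t * (h + s)" by (simp add: lam_def s_def mult.commute)
 also have "\<dots> \<le> lam t * \<Phi>" using \<Phi> lam_pos[OF t] unfolding s_def by (intro mult_left_mono) auto
 finally show ?thesis by (simp add: s_def)
qed

text \<open>The defect is measured relative to \<open>1 - |V|\<^sup>2\<close>, that is, in the hyperbolic metric. The derivative of the
Moebius map in \<open>v\<close> then contracts the old defect by \<open>lam t\<close>, and the coefficients add a new one.\<close>

lemma moebius_step:
 assumes V: "dbar_ext w T V Vw e" and V1: "\<And>x t. t \<in> {0..T} ==> cmod (V x t) < 1"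
  and e: "\<And>x t. t \<in> {0..T} ==> cmod (e x t) \<le> \<epsilon> t * (1 - (cmod (V x t))\<^sup>2)"
  and \<epsilon>: "\<And>t. t \<in> {0..T} ==> \<epsilon> t \<ge> 0"
 obtains V' Vw' e' where "dbar_ext w T V' Vw' e'" "\<And>x t. t \<in> {0..T} ==> cmod (V' x t) < 1"
  "\<And>x t. t \<in> {0..T} ==> cmod (e' x t) \<le> (lam t * \<epsilon> t + 4 * M * C / c * t * g t) * (1 - (cmod (V' x t))\<^sup>2)"
  "\<And>x. V' (x + \<beta>) 0 = (P x 0 * V x 0 + Q x 0) / (R x 0 * V x 0 + S x 0)"
proof -
 define N where "N x t = P x t * V x t + Q x t" for x t
 define D where "D x t = R x t * V x t + S x t" for x t
 define eN where "eN x t = P x t * e x t + eP x t * V x t + eQ x t" for x t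
 define eD where "eD x t = R x t * e x t + eR x t * V x t + eS x t" for x t
 have dN: "dbar_ext w T N (\<lambda>x t. P x t * Vw x t + Pw x t * V x t + Qw x t) eN"
  unfolding N_def[abs_def] eN_def[abs_def] by (rule dbar_ext_add[OF dbar_ext_mult[OF P V] Q])
 have dD: "dbar_ext w T D (\<lambda>x t. R x t * Vw x t + Rw x t * V x t + Sw x t) eD"
  unfolding D_def[abs_def] eD_def[abs_def] by (rule dbar_ext_add[OF dbar_ext_mult[OF R V] S])
 have V2: "(cmod (V x t))\<^sup>2 < 1" if "t \<in> {0..T}" for x t
  using V1[OF that, of x] by (simp add: power_less_one_iff abs_square_less_1)
 have \<Phi>: "(cmod (D x t))\<^sup>2 - (cmod (N x t))\<^sup>2 \<ge> 1 - (cmod (V x t))\<^sup>2 + c * t" if "t \<in> {0..T}" for x t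
  unfolding N_def D_def using V1[OF that, of x] by (intro contr that) auto
 have D0: "D x t \<noteq> 0" if "t \<in> {0..T}" for x t
 proof
  assume "D x t = 0"
  then show False using \<Phi>[OF that, of x] V2[OF that, of x] ct[OF that] zero_le_power2[of "cmod (N x t)"]
   by simp
 qed
 have dI: "dbar_ext w T (\<lambda>x t. inverse (D x t)) (\<lambda>x t. (R x t * Vw x t + Rw x t * V x t + Sw x t) * (- (inverse (D x t))\<^sup>2))
   (\<lambda>x t. eD x t * (- (inverse (D x t))\<^sup>2))"
  by (rule dbar_ext_compose[OF dD, where S = "- {0}"])
    (auto simp: D0 power2_eq_square intro!: continuous_intros derivative_eq_intros)
 let ?b = "- \<beta>"
 define V' where "V' x t = N (x + ?b) t * inverse (D (x + ?b) t)" for x t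
 define e'0 where "e'0 x t = N x t * (eD x t * (- (inverse (D x t))\<^sup>2)) + eN x t * inverse (D x t)" for x t
 define e' where "e' x t = e'0 (x + ?b) t" for x t
 obtain Vw' where ext: "dbar_ext w T V' Vw' e'"
  using dbar_ext_shift[OF dbar_ext_mult[OF dN dI], of ?b]
  unfolding V'_def[abs_def] e'_def[abs_def] e'0_def[abs_def] by blast
 have ND: "cmod (N x t) < cmod (D x t)" if "t \<in> {0..T}" for x t
 proof -
  have "(cmod (N x t))\<^sup>2 < (cmod (D x t))\<^sup>2" using \<Phi>[OF that, of x] V2[OF that, of x] ct[OF that] by linarith
  then show ?thesis by (simp add: power_less_imp_less_base)
 qed
 have V'1: "cmod (V' x t) < 1" if "t \<in> {0..T}" for x t
  using ND[OF that, of "x + ?b"] D0[OF that, of "x + ?b"]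
  by (simp add: V'_def norm_divide divide_inverse[symmetric])
 have bound: "cmod (e'0 x t) \<le> (lam t * \<epsilon> t + 4 * M * C / c * t * g t) * (1 - (cmod (N x t * inverse (D x t)))\<^sup>2)"
  if t: "t \<in> {0..T}" for x t
 proof -
  let ?h = "1 - (cmod (V x t))\<^sup>2" and ?F = "(cmod (D x t))\<^sup>2 - (cmod (N x t))\<^sup>2"
  let ?a = "eP x t * V x t + eQ x t" and ?b = "eR x t * V x t + eS x t" and ?E = "C * t\<^sup>2 * g t"
  have E0: "?E \<ge> 0" using C g[OF t] by simp
  have Dn: "cmod (D x t) > 0" using D0[OF t] by simp
  have DM: "cmod (D x t) \<le> M"
  proof -
   have "cmod (D x t) \<le> cmod (R x t) * cmod (V x t) + cmod (S x t)"
    unfolding D_def by (metis norm_mult norm_triangle_ineq)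
   also have "cmod (R x t) * cmod (V x t) \<le> cmod (R x t) * 1"
    using V1[OF t, of x] by (intro mult_left_mono) auto
   finally show ?thesis using M[OF t, of x] by simp
  qed
  have ab: "cmod ?a \<le> 2 * ?E" "cmod ?b \<le> 2 * ?E"
  proof -
   have 1: "cmod (z * V x t + z') \<le> 2 * ?E" if "cmod z \<le> ?E" "cmod z' \<le> ?E" for z z'
   proof -
    have "cmod (z * V x t) \<le> ?E * 1" unfolding norm_mult
     using that V1[OF t, of x] E0 by (intro mult_mono) auto
    then show ?thesis using that norm_triangle_ineq[of "z * V x t" z'] by simp
   qed
   show "cmod ?a \<le> 2 * ?E" "cmod ?b \<le> 2 * ?E" using 1 err[OF t] by blast+
  qed
  have "e'0 x t * (D x t)\<^sup>2 = eN x t * D x t - N x t * eD x t"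
   using D0[OF t, of x] by (simp add: e'0_def power2_eq_square field_simps)
  also have "\<dots> = (P x t * S x t - Q x t * R x t) * e x t + ?a * D x t - N x t * ?b"
   by (simp add: eN_def eD_def N_def D_def algebra_simps)
  finally have "cmod (e'0 x t) * (cmod (D x t))\<^sup>2 = cmod ((P x t * S x t - Q x t * R x t) * e x t + ?a * D x t - N x t * ?b)"
   by (metis norm_mult norm_power)
  also have "\<dots> \<le> cmod (P x t * S x t - Q x t * R x t) * cmod (e x t) + cmod ?a * cmod (D x t) + cmod (N x t) * cmod ?b"
   unfolding norm_mult[symmetric]
   using norm_triangle_ineq4[of "(P x t * S x t - Q x t * R x t) * e x t + ?a * D x t" "N x t * ?b"]
    norm_triangle_ineq[of "(P x t * S x t - Q x t * R x t) * e x t" "?a * D x t"] by linarith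
  also have "\<dots> \<le> (1 + c / 4 * t) * (\<epsilon> t * ?h) + (2 * ?E) * M + M * (2 * ?E)"
   using detb[OF t, of x] e[OF t, of x] ab DM ND[OF t, of x] E0 Dn V2[OF t, of x] \<epsilon>[OF t] ct[OF t]
   by (intro add_mono mult_mono) (auto simp: M_nonneg)
  also have "\<dots> = \<epsilon> t * ((1 + c / 4 * t) * ?h) + 4 * M * C / c * t * g t * (c * t)"
   using c by (simp add: field_simps power2_eq_square)
  also have "\<dots> \<le> \<epsilon> t * (lam t * ?F) + 4 * M * C / c * t * g t * ?F"
  proof (intro add_mono mult_left_mono)
   show "(1 + c / 4 * t) * ?h \<le> lam t * ?F"
    by (rule det_le_lam[OF t]) (use V2[OF t, of x] \<Phi>[OF t, of x] in auto)
   show "c * t \<le> ?F" using \<Phi>[OF t, of x] V2[OF t, of x] by linarith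
   show "0 \<le> 4 * M * C / c * t * g t" using M_nonneg C c g[OF t] t by (auto intro!: divide_nonneg_pos mult_nonneg_nonneg)
  qed (use \<epsilon>[OF t] in auto)
  also have "\<dots> = (lam t * \<epsilon> t + 4 * M * C / c * t * g t) * ?F" by (simp add: algebra_simps)
  also have "?F = (1 - (cmod (N x t * inverse (D x t)))\<^sup>2) * (cmod (D x t))\<^sup>2"
   using Dn by (simp add: divide_inverse[symmetric] norm_divide power_divide field_simps)
  finally show ?thesis using Dn by (simp add: mult.assoc[symmetric])
 qed
 show ?thesis
 proof (rule that[OF ext V'1])
  show "cmod (e' x t) \<le> (lam t * \<epsilon> t + 4 * M * C / c * t * g t) * (1 - (cmod (V' x t))\<^sup>2)" if "t \<in> {0..T}" for x t
   unfolding e'_def V'_def by (rule bound[OF that])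
  show "V' (x + \<beta>) 0 = (P x 0 * V x 0 + Q x 0) / (R x 0 * V x 0 + S x 0)" for x
   by (simp add: V'_def N_def D_def divide_inverse)
 qed
qed

text \<open>\<open>|v - u|\<^sup>2 / ((1 - |v|\<^sup>2) * (1 - |u|\<^sup>2))\<close> is a function of the hyperbolic distance, which the real action preserves.\<close>

lemma hyperbolic_isometry_step:
 assumes v: "cmod v < 1" and r: "(cmod (v - u x))\<^sup>2 \<le> r * (1 - (cmod v)\<^sup>2) * (1 - (cmod (u x))\<^sup>2)"
 defines "v' \<equiv> (P x 0 * v + Q x 0) / (R x 0 * v + S x 0)"
 shows "(cmod (v' - u (x + \<beta>)))\<^sup>2 \<le> r * (1 - (cmod v')\<^sup>2) * (1 - (cmod (u (x + \<beta>)))\<^sup>2)"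
proof -
 have T0: "0 \<in> {0..T}" using T by simp
 let ?N = "\<lambda>v. P x 0 * v + Q x 0" and ?D = "\<lambda>v. R x 0 * v + S x 0"
 have det: "P x 0 * S x 0 - Q x 0 * R x 0 = 1"
  unfolding real0 using det0[of x] by (metis complex_norm_square of_real_diff of_real_1)
 have F: "(cmod (?D z))\<^sup>2 - (cmod (?N z))\<^sup>2 = 1 - (cmod z)\<^sup>2" for z
 proof -
  have a: "Re (S x 0 * cnj (S x 0) - Q x 0 * cnj (Q x 0)) = 1"
   using arg_cong[OF det, of Re] by (simp add: real0 mult.commute)
  have b: "Re (R x 0 * cnj (R x 0) - P x 0 * cnj (P x 0)) = - 1"
   using arg_cong[OF det, of Re] by (simp add: real0 mult.commute)
  have d: "cnj (S x 0) * R x 0 - cnj (Q x 0) * P x 0 = 0" by (simp add: real0 mult.commute)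
  show ?thesis unfolding moebius_expand a b d by simp
 qed
 have nz: "?D z \<noteq> 0" if "cmod z < 1" for z
 proof
  assume "?D z = 0"
  then have "- (cmod (?N z))\<^sup>2 = 1 - (cmod z)\<^sup>2" using F[of z] by simp
  moreover have "(cmod z)\<^sup>2 < 1" using that by (simp add: abs_square_less_1)
  ultimately show False using zero_le_power2[of "cmod (?N z)"] by linarith
 qed
 have ux: "u (x + \<beta>) = ?N (u x) / ?D (u x)"
  using inv[of x] nz[OF u(3)[of x]] by (simp add: field_simps)
 have h: "1 - (cmod (?N z / ?D z))\<^sup>2 = (1 - (cmod z)\<^sup>2) / (cmod (?D z))\<^sup>2" if "cmod z < 1" for z
  using F[of z] nz[OF that] by (simp add: norm_divide power_divide diff_divide_distrib[symmetric] field_simps)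
 have "v' - u (x + \<beta>) = (?N v * ?D (u x) - ?N (u x) * ?D v) / (?D v * ?D (u x))"
  unfolding v'_def ux using nz[OF v] nz[OF u(3)] by (simp add: diff_frac_eq)
 also have "?N v * ?D (u x) - ?N (u x) * ?D v = (P x 0 * S x 0 - Q x 0 * R x 0) * (v - u x)"
  by (simp add: algebra_simps)
 finally have "v' - u (x + \<beta>) = (v - u x) / (?D v * ?D (u x))" unfolding det by simp
 then have "(cmod (v' - u (x + \<beta>)))\<^sup>2 = (cmod (v - u x))\<^sup>2 / ((cmod (?D v))\<^sup>2 * (cmod (?D (u x)))\<^sup>2)"
  by (simp add: norm_divide norm_mult power_divide power_mult_distrib)
 also have "\<dots> \<le> (r * (1 - (cmod v)\<^sup>2) * (1 - (cmod (u x))\<^sup>2)) / ((cmod (?D v))\<^sup>2 * (cmod (?D (u x)))\<^sup>2)"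
  by (rule divide_right_mono[OF r]) auto
 also have "\<dots> = r * (1 - (cmod v')\<^sup>2) * (1 - (cmod (u (x + \<beta>)))\<^sup>2)"
  unfolding v'_def ux h[OF v] h[OF u(3)] by simp
 finally show ?thesis .
qed

text \<open>The new defects of all steps add up to a geometric series with ratio \<open>lam t\<close>, of sum \<open>O(1 / t)\<close>.\<close>

lemma iterates:
 assumes V: "dbar_ext w T V Vw e" and V1: "\<And>x t. t \<in> {0..T} ==> cmod (V x t) < 1"
  and e: "\<And>x t. t \<in> {0..T} ==> cmod (e x t) \<le> E * (1 - (cmod (V x t))\<^sup>2)" and E: "E \<ge> 0"
  and r: "\<And>x. (cmod (V x 0 - u x))\<^sup>2 \<le> r * (1 - (cmod (V x 0))\<^sup>2) * (1 - (cmod (u x))\<^sup>2)"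
 shows "\<exists>V Vw e. dbar_ext w T V Vw e \<and> (\<forall>x. \<forall>t\<in>{0..T}. cmod (V x t) < 1 \<and>
    cmod (e x t) \<le> (E * lam t ^ n + 16 * M * C / c\<^sup>2 * g t) * (1 - (cmod (V x t))\<^sup>2)) \<and>
   (\<forall>x. (cmod (V x 0 - u x))\<^sup>2 \<le> r * (1 - (cmod (V x 0))\<^sup>2) * (1 - (cmod (u x))\<^sup>2))"
proof (induction n)
 case 0
 have MC: "M \<ge> 0" by (rule M_nonneg)
 have "cmod (e x t) \<le> (E * lam t ^ 0 + 16 * M * C / c\<^sup>2 * g t) * (1 - (cmod (V x t))\<^sup>2)" if t: "t \<in> {0..T}" for x t
 proof -
  have "(cmod (V x t))\<^sup>2 < 1" using V1[OF t, of x] by (simp add: abs_square_less_1)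
  then have "E * (1 - (cmod (V x t))\<^sup>2) \<le> (E * lam t ^ 0 + 16 * M * C / c\<^sup>2 * g t) * (1 - (cmod (V x t))\<^sup>2)"
   using MC C g[OF t] by (intro mult_right_mono) auto
  then show ?thesis using e[OF t, of x] by linarith
 qed
 then show ?case using V V1 r by blast
next
 case (Suc n)
 have T0: "0 \<in> {0..T}" using T by simp
 have MC: "M \<ge> 0" by (rule M_nonneg)
 obtain V Vw e where V: "dbar_ext w T V Vw e" and V1: "\<And>x t. t \<in> {0..T} ==> cmod (V x t) < 1"
  and e: "\<And>x t. t \<in> {0..T} ==> cmod (e x t) \<le> (E * lam t ^ n + 16 * M * C / c\<^sup>2 * g t) * (1 - (cmod (V x t))\<^sup>2)"
  and r: "\<And>x. (cmod (V x 0 - u x))\<^sup>2 \<le> r * (1 - (cmod (V x 0))\<^sup>2) * (1 - (cmod (u x))\<^sup>2)"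
  using Suc by blast
 have nn: "E * lam t ^ n + 16 * M * C / c\<^sup>2 * g t \<ge> 0" if "t \<in> {0..T}" for t
  using E lam_pos[OF that] MC C g[OF that] by auto
 obtain V' Vw' e' where V': "dbar_ext w T V' Vw' e'" and V'1: "\<And>x t. t \<in> {0..T} ==> cmod (V' x t) < 1"
  and e': "\<And>x t. t \<in> {0..T} ==> cmod (e' x t) \<le> (lam t * (E * lam t ^ n + 16 * M * C / c\<^sup>2 * g t) + 4 * M * C / c * t * g t) * (1 - (cmod (V' x t))\<^sup>2)"
  and V'0: "\<And>x. V' (x + \<beta>) 0 = (P x 0 * V x 0 + Q x 0) / (R x 0 * V x 0 + S x 0)"
  using moebius_step[OF V V1 e nn] by blast
 have "cmod (e' x t) \<le> (E * lam t ^ Suc n + 16 * M * C / c\<^sup>2 * g t) * (1 - (cmod (V' x t))\<^sup>2)" if t: "t \<in> {0..T}" for x t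
 proof -
  define K where "K = 16 * M * C / c\<^sup>2"
  define X where "X = 4 * M * C / c * t * g t"
  have "K * g t * (c * t / 4) \<le> K * g t * (1 - lam t)"
   unfolding K_def using one_minus_lam[OF t] MC C g[OF t] by (intro mult_left_mono) auto
  moreover have "K * g t * (c * t / 4) = X"
   using c by (simp add: K_def X_def field_simps power2_eq_square)
  ultimately have "lam t * (E * lam t ^ n + K * g t) + X \<le> E * lam t ^ Suc n + K * g t"
   by (simp add: algebra_simps)
  then have le: "lam t * (E * lam t ^ n + 16 * M * C / c\<^sup>2 * g t) + 4 * M * C / c * t * g t \<le> E * lam t ^ Suc n + 16 * M * C / c\<^sup>2 * g t"
   unfolding K_def X_def .
  have "(cmod (V' x t))\<^sup>2 < 1" using V'1[OF t, of x] by (simp add: abs_square_less_1)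
  then show ?thesis using e'[OF t, of x] mult_right_mono[OF le, of "1 - (cmod (V' x t))\<^sup>2"] by linarith
 qed
 moreover have "(cmod (V' x 0 - u x))\<^sup>2 \<le> r * (1 - (cmod (V' x 0))\<^sup>2) * (1 - (cmod (u x))\<^sup>2)" for x
  using hyperbolic_isometry_step[OF V1[OF T0] r, of "x - \<beta>"] V'0[of "x - \<beta>"] by simp
 ultimately show ?case using V' V'1 by blast
qed

text \<open>Apply the coefficient bound to the iterates. The initial defect contributes the integral of \<open>E * lam t ^ n\<close>,
which tends to \<open>0\<close> with \<open>n\<close> although the integrand does not shrink at \<open>t = 0\<close>.\<close>

lemma fcoeff_decay_one_sided:
 assumes k: "int_vec k" and a: "a = - (2 * pi * (k \<bullet> w))" and G: "G \<ge> 0"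
  and Gb: "\<And>t. t \<in> {0..T} ==> exp (- a * t) * g t \<le> G" and a0: "a \<ge> 0"
 shows "cmod (fcoeff \<alpha> u k) \<le> exp (- a * T) + 16 * M * C / c\<^sup>2 * T * G"
proof (rule field_le_epsilon)
 fix \<delta> :: real assume \<delta>: "\<delta> > 0"
 have T0: "0 \<in> {0..T}" using T by simp
 obtain \<theta> where \<theta>: "0 \<le> \<theta>" "\<theta> < 1" "\<And>x. cmod (u x) \<le> \<theta>"
  using periodic_norm_less_one_uniform[OF u] by blast
 have \<theta>2: "1 - \<theta>\<^sup>2 > 0" using \<theta> by (simp add: abs_square_less_1)
 have \<theta>le: "1 - \<theta>\<^sup>2 \<le> 1 - (cmod z)\<^sup>2" if "cmod z \<le> \<theta>" for z using that by (simp add: power_mono)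
 define d where "d = \<delta> / 2 * (1 - \<theta>\<^sup>2)"
 have d: "d > 0" using \<delta> \<theta>2 by (simp add: d_def)
 obtain z z' where z: "continuous_on UNIV z" "periodic z" and z': "continuous_on UNIV z'" "periodic z'"
  and zd: "\<And>x. ((\<lambda>s. z (x + s *\<^sub>R w)) has_vector_derivative z' x) (at 0)"
  and zb: "\<And>x. norm (z x) \<le> \<theta>" and zu: "\<And>x. norm (z x - u x) \<le> d"
  using mollify_along[OF u(1,2) \<theta>(3) d] by metis
 obtain B where B: "B > 0" "\<And>x. norm (z' x) \<le> B" using periodic_bounded[OF z'] by blast
 define E where "E = B / (1 - \<theta>\<^sup>2)"
 have E: "E \<ge> 0" using B \<theta>2 by (simp add: E_def)
 define e0 where "e0 = (\<lambda>x (t::real). - \<i> * z' x)"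
 have V: "dbar_ext w T (\<lambda>x t. z x) (\<lambda>x t. z' x) e0"
  unfolding dbar_ext_def e0_def
  by (intro conjI cper_mult cper_const cper_base z z') (auto simp: zd)
 have V1: "cmod (z x) < 1" for x using zb[of x] \<theta>(2) by linarith
 have e: "cmod (e0 x t) \<le> E * (1 - (cmod (z x))\<^sup>2)" for x t
 proof -
  have "cmod (e0 x t) \<le> E * (1 - \<theta>\<^sup>2)" using B(2)[of x] \<theta>2 by (simp add: e0_def E_def norm_mult)
  also have "\<dots> \<le> E * (1 - (cmod (z x))\<^sup>2)" using \<theta>le[OF zb] E by (intro mult_left_mono)
  finally show ?thesis .
 qed
 have r: "(cmod (z x - u x))\<^sup>2 \<le> (\<delta> / 2)\<^sup>2 * (1 - (cmod (z x))\<^sup>2) * (1 - (cmod (u x))\<^sup>2)" for x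
 proof -
  have "(cmod (z x - u x))\<^sup>2 \<le> d\<^sup>2" using zu by (intro power_mono) auto
  also have "\<dots> = (\<delta> / 2)\<^sup>2 * (1 - \<theta>\<^sup>2) * (1 - \<theta>\<^sup>2)" by (simp add: d_def power2_eq_square)
  also have "\<dots> \<le> (\<delta> / 2)\<^sup>2 * (1 - (cmod (z x))\<^sup>2) * (1 - (cmod (u x))\<^sup>2)"
   using \<theta>le[OF zb, of x] \<theta>le[OF \<theta>(3), of x] \<theta>2 by (intro mult_mono mult_nonneg_nonneg) auto
  finally show ?thesis .
 qed
 define K where "K = 16 * M * C / c\<^sup>2"
 have MC: "M \<ge> 0" by (rule M_nonneg)
 have K: "K \<ge> 0" using MC C by (simp add: K_def)
 obtain n :: nat where n: "real n > 4 * E / (c * \<delta>)" using reals_Archimedean2 by blast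
 obtain V Vw e where V: "dbar_ext w T V Vw e" and V1: "\<And>x t. t \<in> {0..T} ==> cmod (V x t) < 1"
  and e: "\<And>x t. t \<in> {0..T} ==> cmod (e x t) \<le> (E * lam t ^ (n + 2) + K * g t) * (1 - (cmod (V x t))\<^sup>2)"
  and r: "\<And>x. (cmod (V x 0 - u x))\<^sup>2 \<le> (\<delta> / 2)\<^sup>2 * (1 - (cmod (V x 0))\<^sup>2) * (1 - (cmod (u x))\<^sup>2)"
  using iterates[OF V V1 e E r, of "n + 2"] unfolding K_def by blast
 \<comment> \<open>an antiderivative of \<open>E * lam t ^ (n + 2) + K * G\<close>\<close>
 define gg where "gg = (\<lambda>t. - (2 * E / (c * real (Suc n))) * lam t ^ Suc n + K * G * t)"
 have "cmod (fcoeff \<alpha> (\<lambda>x. V x 0) k) \<le> exp (- a * T) * 1 + (gg T - gg 0)"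
 proof (rule fcoeff_dbar_bound[OF syn V T k a])
  show "cmod (V x T) \<le> 1" for x using V1[of T x] T by simp
  show "(gg has_vector_derivative (E * lam t ^ (n + 2) + K * G)) (at t within {0..T})" if t: "t \<in> {0..T}" for t
  proof -
   have nz: "1 + c / 2 * t \<noteq> 0" using ct[OF t] by auto
   have "(lam has_real_derivative (- (c / 2) * (lam t)\<^sup>2)) (at t within {0..T})"
    unfolding lam_def[abs_def] using nz by (auto intro!: derivative_eq_intros simp: power2_eq_square)
   note [derivative_intros] = this
   have "(gg has_real_derivative (- (2 * E / (c * real (Suc n))) * (real (Suc n) * lam t ^ n * (- (c / 2) * (lam t)\<^sup>2)) + K * G)) (at t within {0..T})"
    unfolding gg_def by (rule derivative_eq_intros refl | simp)+
   moreover have "- (2 * E / (c * real (Suc n))) * (real (Suc n) * lam t ^ n * (- (c / 2) * (lam t)\<^sup>2)) = E * lam t ^ (n + 2)"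
    using c by (simp add: power_add power2_eq_square field_simps del: of_nat_Suc)
   ultimately show ?thesis by (simp add: has_real_derivative_iff_has_vector_derivative)
  qed
  show "exp (- a * t) * cmod (e x t) \<le> E * lam t ^ (n + 2) + K * G" if t: "t \<in> {0..T}" for x t
  proof -
   have L: "E * lam t ^ (n + 2) \<ge> 0" using E lam_pos[OF t] by simp
   have KG: "K * g t \<ge> 0" using K g[OF t] by simp
   have "cmod (e x t) \<le> (E * lam t ^ (n + 2) + K * g t) * 1"
    using e[OF t, of x] L KG mult_left_mono[of "1 - (cmod (V x t))\<^sup>2" 1 "E * lam t ^ (n + 2) + K * g t"] by simp
   then have "exp (- a * t) * cmod (e x t) \<le> exp (- a * t) * (E * lam t ^ (n + 2) + K * g t)"
    by (intro mult_left_mono) auto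
   also have "\<dots> = exp (- a * t) * (E * lam t ^ (n + 2)) + K * (exp (- a * t) * g t)" by (simp add: algebra_simps)
   also have "\<dots> \<le> 1 * (E * lam t ^ (n + 2)) + K * G"
    using Gb[OF t] K L a0 t by (intro add_mono mult_right_mono mult_left_mono) auto
   finally show ?thesis by simp
  qed
 qed
 also have "gg T - gg 0 \<le> 2 * E / (c * real (Suc n)) + K * T * G"
 proof -
  have "2 * E / (c * real (Suc n)) * lam T ^ Suc n \<ge> 0" using E c lam_pos[of T] T by simp
  moreover have "lam 0 = 1" by (simp add: lam_def)
  ultimately show ?thesis by (simp add: gg_def algebra_simps)
 qed
 also have "2 * E / (c * real (Suc n)) \<le> \<delta> / 2"
 proof -
  have "4 * E / (c * \<delta>) \<le> real (Suc n)" using n by simp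
  then have "4 * E \<le> real (Suc n) * (c * \<delta>)" using c \<delta> by (simp add: pos_divide_le_eq del: of_nat_Suc)
  then show ?thesis using c \<delta> by (subst pos_divide_le_eq) (auto simp: algebra_simps simp del: of_nat_Suc)
 qed
 finally have 1: "cmod (fcoeff \<alpha> (\<lambda>x. V x 0) k) \<le> exp (- a * T) + (\<delta> / 2 + K * T * G)" by simp
 have "cmod (V x 0 - u x) \<le> \<delta> / 2" for x
 proof -
  have "(cmod (V x 0))\<^sup>2 < 1" "(cmod (u x))\<^sup>2 < 1" using V1[OF T0, of x] u(3)[of x] by (auto simp: abs_square_less_1)
  then have "(1 - (cmod (V x 0))\<^sup>2) * (1 - (cmod (u x))\<^sup>2) \<le> 1 * 1"
   by (intro mult_mono) simp_all
  then have "(\<delta> / 2)\<^sup>2 * ((1 - (cmod (V x 0))\<^sup>2) * (1 - (cmod (u x))\<^sup>2)) \<le> (\<delta> / 2)\<^sup>2 * 1"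
   by (intro mult_left_mono) simp_all
  moreover have "(cmod (V x 0 - u x))\<^sup>2 \<le> (\<delta> / 2)\<^sup>2 * ((1 - (cmod (V x 0))\<^sup>2) * (1 - (cmod (u x))\<^sup>2))"
   using r[of x] by (simp only: mult.assoc)
  ultimately have "(cmod (V x 0 - u x))\<^sup>2 \<le> (\<delta> / 2)\<^sup>2" by linarith
  then show ?thesis by (rule power2_le_imp_le) (use \<delta> in simp)
 qed
 then have "cmod (fcoeff \<alpha> (\<lambda>x. V x 0) k - fcoeff \<alpha> u k) \<le> \<delta> / 2"
  by (intro fcoeff_diff_le[OF syn cper_slice[OF dbar_extD(1)[OF V] T0] u(1,2) k])
 then have "cmod (fcoeff \<alpha> u k) \<le> cmod (fcoeff \<alpha> (\<lambda>x. V x 0) k) + \<delta> / 2"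
  using norm_triangle_ineq4[of "fcoeff \<alpha> (\<lambda>x. V x 0) k" "fcoeff \<alpha> (\<lambda>x. V x 0) k - fcoeff \<alpha> u k"] by simp
 then show "cmod (fcoeff \<alpha> u k) \<le> exp (- a * T) + 16 * M * C / c\<^sup>2 * T * G + \<delta>"
  using 1 by (simp add: K_def)
qed

end

section \<open>Real matrices as pairs of complex numbers\<close>

text \<open>Composition of the real linear maps \<open>v \<mapsto> p * v + q * cnj v\<close> coded by pairs \<open>(p, q)\<close>.\<close>

definition cm_mult :: "complex \<times> complex \<Rightarrow> complex \<times> complex \<Rightarrow> complex \<times> complex" (infixl "\<odot>" 70) where
 "X \<odot> Y = (fst X * fst Y + snd X * cnj (snd Y), fst X * snd Y + snd X * cnj (fst Y))"

text \<open>The adjugate, which is the inverse for determinant one.\<close>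

definition cm_inv :: "complex \<times> complex \<Rightarrow> complex \<times> complex" where
 "cm_inv X = (cnj (fst X), - snd X)"

definition cm_det :: "complex \<times> complex \<Rightarrow> real" where
 "cm_det X = (cmod (fst X))\<^sup>2 - (cmod (snd X))\<^sup>2"

definition cm_app :: "complex \<times> complex \<Rightarrow> complex \<Rightarrow> complex" where
 "cm_app X v = fst X * v + snd X * cnj v"

text \<open>The operator norm of the real linear map.\<close>

definition cm_norm :: "complex \<times> complex \<Rightarrow> real" where
 "cm_norm X = cmod (fst X) + cmod (snd X)"

lemma cm_assoc: "X \<odot> Y \<odot> Z = X \<odot> (Y \<odot> Z)"
 by (simp add: cm_mult_def algebra_simps)

lemma cm_one [simp]: "(1, 0) \<odot> X = X" "X \<odot> (1, 0) = X"
 by (simp_all add: cm_mult_def)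

lemma cm_add_left: "(X + Y) \<odot> Z = X \<odot> Z + Y \<odot> Z"
 by (simp add: cm_mult_def plus_prod_def algebra_simps)

lemma cm_add_right: "X \<odot> (Y + Z) = X \<odot> Y + X \<odot> Z"
 by (simp add: cm_mult_def plus_prod_def algebra_simps)

lemma cm_det_complex: "of_real (cm_det X) = fst X * cnj (fst X) - snd X * cnj (snd X)"
 by (simp add: cm_det_def complex_norm_square flip: of_real_power)

lemma cm_inv_right: "cm_det X = 1 ==> X \<odot> cm_inv X = (1, 0)"
 using cm_det_complex[of X] by (simp add: cm_mult_def cm_inv_def mult.commute)

lemma cm_inv_left: "cm_det X = 1 ==> cm_inv X \<odot> X = (1, 0)"
 using cm_det_complex[of X] by (simp add: cm_mult_def cm_inv_def mult.commute)

lemma cm_det_mult: "cm_det (X \<odot> Y) = cm_det X * cm_det Y"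
proof -
 have "complex_of_real (cm_det (X \<odot> Y)) = of_real (cm_det X) * of_real (cm_det Y)"
  unfolding cm_det_complex by (simp add: cm_mult_def algebra_simps)
 then show ?thesis by (metis of_real_eq_iff of_real_mult)
qed

lemma cm_inv_mult: "cm_inv (X \<odot> Y) = cm_inv Y \<odot> cm_inv X"
 by (simp add: cm_mult_def cm_inv_def algebra_simps)

lemma cm_det_inv: "cm_det (cm_inv X) = cm_det X"
 by (simp add: cm_det_def cm_inv_def)

lemma cm_app_mult: "cm_app (X \<odot> Y) v = cm_app X (cm_app Y v)"
 by (simp add: cm_app_def cm_mult_def algebra_simps)

lemma cm_app_one [simp]: "cm_app (1, 0) v = v"
 by (simp add: cm_app_def)

text \<open>Multiplication of areas by the determinant.\<close>

lemma cm_symplectic: "Im (cnj (cm_app X v) * cm_app X v') = cm_det X * Im (cnj v * v')"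
 unfolding cm_app_def cm_det_def cmod_power2 by (simp add: algebra_simps power2_eq_square)

lemma cm_norm_nonneg: "cm_norm X \<ge> 0"
 by (simp add: cm_norm_def)

lemma cm_norm_mult: "cm_norm (X \<odot> Y) \<le> cm_norm X * cm_norm Y"
proof -
 have "cmod (fst X * fst Y + snd X * cnj (snd Y)) \<le> cmod (fst X) * cmod (fst Y) + cmod (snd X) * cmod (snd Y)"
  by (metis norm_triangle_ineq norm_mult complex_mod_cnj)
 moreover have "cmod (fst X * snd Y + snd X * cnj (fst Y)) \<le> cmod (fst X) * cmod (snd Y) + cmod (snd X) * cmod (fst Y)"
  by (metis norm_triangle_ineq norm_mult complex_mod_cnj)
 ultimately show ?thesis by (simp add: cm_norm_def cm_mult_def algebra_simps)
qed

lemma cm_norm_mult_le: "cm_norm X \<le> a ==> cm_norm Y \<le> b ==> cm_norm (X \<odot> Y) \<le> a * b"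
 using cm_norm_mult[of X Y] cm_norm_nonneg[of X] cm_norm_nonneg[of Y] mult_mono[of "cm_norm X" a "cm_norm Y" b]
 by linarith

lemma cm_norm_inv [simp]: "cm_norm (cm_inv X) = cm_norm X"
 by (simp add: cm_norm_def cm_inv_def)

lemma cm_app_norm: "cmod (cm_app X v) \<le> cm_norm X * cmod v"
 unfolding cm_app_def cm_norm_def distrib_right
 by (metis norm_triangle_ineq norm_mult complex_mod_cnj)

lemma cm_app_norm_le: "cm_norm X \<le> a ==> cmod v \<le> b ==> cmod (cm_app X v) \<le> a * b"
 using cm_app_norm[of X v] cm_norm_nonneg[of X] mult_mono[of "cm_norm X" a "cmod v" b] by fastforce

lemma cm_app_diff: "cm_app X v - cm_app Y v = cm_app (X - Y) v"
 by (simp add: cm_app_def algebra_simps)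

lemma cm_norm_le_norm: "cm_norm X \<le> 2 * norm X"
proof -
 have "cmod (fst X) \<le> norm X" "cmod (snd X) \<le> norm X"
  by (metis norm_fst_le prod.collapse, metis norm_snd_le prod.collapse)
 then show ?thesis by (simp add: cm_norm_def)
qed

lemma bounded_bilinear_cm_mult: "bounded_bilinear cm_mult"
 unfolding bilinear_conv_bounded_bilinear[symmetric] bilinear_def
 by (auto intro!: linearI simp: cm_mult_def plus_prod_def scaleR_prod_def algebra_simps)

lemma bounded_linear_cm_inv: "bounded_linear cm_inv"
 unfolding linear_conv_bounded_linear[symmetric]
 by (auto intro!: linearI simp: cm_inv_def plus_prod_def scaleR_prod_def)

lemma continuous_on_cm_mult [continuous_intros]:
 "continuous_on S f ==> continuous_on S g ==> continuous_on S (\<lambda>x. f x \<odot> g x)"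
 by (rule bounded_bilinear.continuous_on[OF bounded_bilinear_cm_mult])

lemma continuous_on_cm_inv [continuous_intros]:
 "continuous_on S f ==> continuous_on S (\<lambda>x. cm_inv (f x))"
 by (rule bounded_linear.continuous_on[OF bounded_linear_cm_inv])

lemma has_vector_derivative_cm_mult:
 "(f has_vector_derivative f') (at x within S) ==> (g has_vector_derivative g') (at x within S) ==>
  ((\<lambda>x. f x \<odot> g x) has_vector_derivative (f x \<odot> g' + f' \<odot> g x)) (at x within S)"
 by (rule bounded_bilinear.has_vector_derivative[OF bounded_bilinear_cm_mult])

section \<open>The area swept by a curve near a circle\<close>

text \<open>A curve that stays close to a point rotating by the angle \<open>\<kappa>\<close> sweeps, around the origin, about the change of angle. The error
is a bounded boundary term plus the relative distance times the length of the curve.\<close>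

lemma swept_area:
 fixes \<delta> :: "real \<Rightarrow> complex" and \<kappa> :: "real \<Rightarrow> real"
 assumes \<tau>: "\<tau> > 0"
  and \<delta>: "\<And>t. t \<in> {0..\<tau>} ==> (\<delta> has_vector_derivative \<delta>' t) (at t within {0..\<tau>})"
  and \<delta>': "continuous_on {0..\<tau>} \<delta>'" and \<kappa>: "continuous_on {0..\<tau>} \<kappa>" and b: "cmod b = 1" and \<epsilon>: "\<epsilon> \<le> 1/4"
  and near: "\<And>t. t \<in> {0..\<tau>} ==> cmod (\<delta> t - cis (\<kappa> t) * b) \<le> \<epsilon>"
  and D: "\<And>t. t \<in> {0..\<tau>} ==> cmod (\<delta>' t) \<le> D"
 shows "\<bar>integral {0..\<tau>} (\<lambda>t. Im (cnj (\<delta> t) * \<delta>' t)) - (\<kappa> \<tau> - \<kappa> 0)\<bar> \<le> 2 + 3 * \<epsilon> * D * \<tau>"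
proof -
 have \<tau>0: "0 \<in> {0..\<tau>}" "\<tau> \<in> {0..\<tau>}" using \<tau> by auto
 have \<epsilon>0: "\<epsilon> \<ge> 0" using near[OF \<tau>0(1)] norm_ge_zero order_trans by blast
 have c\<delta>: "continuous_on {0..\<tau>} \<delta>" unfolding continuous_on_eq_continuous_within
  using \<delta> has_vector_derivative_continuous by blast
 have \<delta>low: "cmod (\<delta> t) \<ge> 3/4" and \<delta>close: "\<bar>cmod (\<delta> t) - 1\<bar> \<le> \<epsilon>" if "t \<in> {0..\<tau>}" for t
 proof -
  have "\<bar>cmod (\<delta> t) - cmod (cis (\<kappa> t) * b)\<bar> \<le> cmod (\<delta> t - cis (\<kappa> t) * b)" by (rule norm_triangle_ineq3)
  then show "\<bar>cmod (\<delta> t) - 1\<bar> \<le> \<epsilon>" using near[OF that] b by (simp add: norm_mult)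
  then show "cmod (\<delta> t) \<ge> 3/4" using \<epsilon> by linarith
 qed
 have nz: "\<delta> t \<noteq> 0" if "t \<in> {0..\<tau>}" for t using \<delta>low[OF that] by auto
 define f where "f t = \<delta>' t / \<delta> t" for t
 have cf: "continuous_on {0..\<tau>} f" unfolding f_def using c\<delta> \<delta>' nz by (intro continuous_intros) auto
 obtain L where L: "\<And>t. t \<in> {0..\<tau>} ==> (L has_vector_derivative f t) (at t within {0..\<tau>})"
  using antiderivative_continuous[OF cf] by blast
 have cL: "continuous_on {0..\<tau>} L" unfolding continuous_on_eq_continuous_within
  using L has_vector_derivative_continuous by blast
 have "((\<lambda>t. \<delta> t * exp (- L t)) has_vector_derivative 0) (at t within {0..\<tau>})" if t: "t \<in> {0..\<tau>}" for t
 proof -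
  have "((\<lambda>t. - L t) has_vector_derivative - f t) (at t within {0..\<tau>})"
   by (rule has_vector_derivative_minus[OF L[OF t]])
  from field_vector_diff_chain_within[OF this, of exp "exp (- L t)"]
  have "((\<lambda>t. exp (- L t)) has_vector_derivative (- f t * exp (- L t))) (at t within {0..\<tau>})"
   by (simp add: o_def DERIV_exp has_field_derivative_at_within)
  from has_vector_derivative_mult[OF \<delta>[OF t] this] show ?thesis
   using nz[OF t] by (simp add: f_def)
 qed
 then obtain E where E: "\<And>t. t \<in> {0..\<tau>} ==> \<delta> t * exp (- L t) = E"
  using has_vector_derivative_zero_constant[of "{0..\<tau>}" "\<lambda>t. \<delta> t * exp (- L t)"] by (metis convex_real_interval(5))
 have \<delta>E: "\<delta> t = E * exp (L t)" if "t \<in> {0..\<tau>}" for t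
  using E[OF that] by (simp add: exp_minus field_simps)
 have E0: "E \<noteq> 0" using nz[OF \<tau>0(1)] \<delta>E[OF \<tau>0(1)] by auto
 define \<eta> where "\<eta> t = Im (L t - L 0) - (\<kappa> t - \<kappa> 0)" for t
 have c\<eta>: "continuous_on {0..\<tau>} \<eta>" unfolding \<eta>_def using cL \<kappa> by (intro continuous_intros)
 have cos\<eta>: "cos (\<eta> t) > 0" if t: "t \<in> {0..\<tau>}" for t
 proof -
  let ?r = "\<lambda>t. \<delta> t * cis (- \<kappa> t)"
  have close: "cmod (?r t - b) \<le> 1/4" if "t \<in> {0..\<tau>}" for t
  proof -
   have "?r t - b = (\<delta> t - cis (\<kappa> t) * b) * cis (- \<kappa> t)" by (simp add: algebra_simps cis_mult)
   then show ?thesis using near[OF that] \<epsilon> by (simp add: norm_mult)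
  qed
  define e1 e0 where "e1 = ?r t - b" and "e0 = ?r 0 - b"
  have e: "cmod e1 \<le> 1/4" "cmod e0 \<le> 1/4" using close[OF t] close[OF \<tau>0(1)] by (auto simp: e1_def e0_def)
  have "?r t * cnj (?r 0) = b * cnj b + (e1 * cnj b + b * cnj e0 + e1 * cnj e0)"
   by (simp add: e1_def e0_def algebra_simps)
  then have "Re (?r t * cnj (?r 0)) = 1 + Re (e1 * cnj b + b * cnj e0 + e1 * cnj e0)"
   using b by (simp only: complex_norm_square[symmetric] plus_complex.sel) simp
  moreover have "cmod (e1 * cnj b + b * cnj e0 + e1 * cnj e0) \<le> 1/4 + 1/4 + 1/4 * (1/4)"
  proof (intro norm_triangle_mono)
   show "cmod (e1 * cnj e0) \<le> 1/4 * (1/4)" using e unfolding norm_mult complex_mod_cnj by (intro mult_mono) auto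
  qed (use e b in \<open>auto simp: norm_mult\<close>)
  ultimately have pos: "Re (?r t * cnj (?r 0)) > 0"
   using abs_Re_le_cmod[of "e1 * cnj b + b * cnj e0 + e1 * cnj e0"] by linarith
  have ex: "exp z = of_real (exp (Re z)) * cis (Im z)" for z by (simp add: exp_eq_polar)
  have "?r t * cnj (?r 0) = (E * cnj E) * (of_real (exp (Re (L t)) * exp (Re (L 0))) * (cis (Im (L t)) * cis (- Im (L 0)) * cis (- \<kappa> t) * cis (\<kappa> 0)))"
   unfolding \<delta>E[OF t] \<delta>E[OF \<tau>0(1)] ex by (simp add: cis_cnj algebra_simps)
  also have "cis (Im (L t)) * cis (- Im (L 0)) * cis (- \<kappa> t) * cis (\<kappa> 0) = cis (\<eta> t)"
   by (simp add: cis_mult \<eta>_def algebra_simps)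
  finally have eq: "Re (?r t * cnj (?r 0)) = (cmod E)\<^sup>2 * (exp (Re (L t)) * exp (Re (L 0))) * cos (\<eta> t)"
   by (simp only: complex_norm_square[symmetric] of_real_power[symmetric] of_real_mult[symmetric] mult.assoc[symmetric]) simp
  have "0 < (cmod E)\<^sup>2 * (exp (Re (L t)) * exp (Re (L 0))) * cos (\<eta> t)" using pos by (simp only: eq)
  moreover have "0 < (cmod E)\<^sup>2 * (exp (Re (L t)) * exp (Re (L 0)))" using E0 by simp
  ultimately show ?thesis by (rule zero_less_mult_pos)
 qed
 have \<eta>2: "\<bar>\<eta> t\<bar> \<le> 2" if t: "t \<in> {0..\<tau>}" for t
 proof (rule ccontr)
  assume "\<not> \<bar>\<eta> t\<bar> \<le> 2"
  then have "pi / 2 \<le> \<bar>\<eta> t\<bar>" using pi_less_4 by linarith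
  moreover have "\<bar>\<eta> 0\<bar> \<le> pi / 2" by (simp add: \<eta>_def)
  moreover have "continuous_on {0..t} (\<lambda>t. \<bar>\<eta> t\<bar>)"
   by (rule continuous_on_subset[of "{0..\<tau>}"]) (use t c\<eta> in \<open>auto intro!: continuous_intros\<close>)
  ultimately obtain s where s: "0 \<le> s" "s \<le> t" "\<bar>\<eta> s\<bar> = pi / 2"
   using IVT'[of "\<lambda>t. \<bar>\<eta> t\<bar>" 0 "pi / 2" t] t by auto
  have "cos (\<eta> s) = cos \<bar>\<eta> s\<bar>" by (simp add: abs_if)
  then have "cos (\<eta> s) = 0" using s(3) by simp
  then show False using cos\<eta>[of s] s t by auto
 qed
 have "(f has_integral (L \<tau> - L 0)) {0..\<tau>}"
  by (rule fundamental_theorem_of_calculus) (use \<tau> L in auto)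
 from has_integral_linear[OF this bounded_linear_Im]
 have If: "((\<lambda>t. Im (f t)) has_integral Im (L \<tau> - L 0)) {0..\<tau>}" by (simp add: o_def)
 have int1: "(\<lambda>t. Im (cnj (\<delta> t) * \<delta>' t)) integrable_on {0..\<tau>}"
  by (intro integrable_continuous_interval continuous_intros c\<delta> \<delta>')
 have "norm (integral {0..\<tau>} (\<lambda>t. Im (cnj (\<delta> t) * \<delta>' t) - Im (f t))) \<le> 3 * \<epsilon> * D * (\<tau> - 0)"
 proof (rule integral_bound)
  show "continuous_on {0..\<tau>} (\<lambda>t. Im (cnj (\<delta> t) * \<delta>' t) - Im (f t))"
   by (intro continuous_intros c\<delta> \<delta>' cf)
  fix t assume t: "t \<in> {0..\<tau>}"
  have "\<delta>' t = f t * \<delta> t" using nz[OF t] by (simp add: f_def)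
  then have eq: "cnj (\<delta> t) * \<delta>' t = of_real ((cmod (\<delta> t))\<^sup>2) * f t"
   unfolding complex_norm_square by (simp only: mult_ac)
  have "Im (cnj (\<delta> t) * \<delta>' t) - Im (f t) = ((cmod (\<delta> t))\<^sup>2 - 1) * Im (f t)"
   unfolding eq times_complex.sel Re_complex_of_real Im_complex_of_real by (simp add: algebra_simps)
  moreover have "\<bar>(cmod (\<delta> t))\<^sup>2 - 1\<bar> \<le> \<epsilon> * (9/4)"
  proof -
   have "(cmod (\<delta> t))\<^sup>2 - 1 = (cmod (\<delta> t) - 1) * (cmod (\<delta> t) + 1)" by (simp add: power2_eq_square algebra_simps)
   moreover have "\<bar>(cmod (\<delta> t) - 1) * (cmod (\<delta> t) + 1)\<bar> \<le> \<epsilon> * (9/4)"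
    unfolding abs_mult using \<delta>close[OF t] \<epsilon> \<epsilon>0 by (intro mult_mono) auto
   ultimately show ?thesis by simp
  qed
  moreover have "\<bar>Im (f t)\<bar> \<le> D * (4/3)"
  proof -
   have "cmod (f t) = cmod (\<delta>' t) / cmod (\<delta> t)" by (simp add: f_def norm_divide)
   also have "\<dots> \<le> D / (3/4)"
   proof (rule frac_le)
    show "0 \<le> D" using D[OF t] norm_ge_zero order_trans by blast
   qed (use D[OF t] \<delta>low[OF t] in auto)
   finally show ?thesis using abs_Im_le_cmod[of "f t"] by simp
  qed
  moreover have "\<bar>((cmod (\<delta> t))\<^sup>2 - 1) * Im (f t)\<bar> \<le> (\<epsilon> * (9/4)) * (D * (4/3))"
   unfolding abs_mult using calculation(2,3) \<epsilon>0 by (intro mult_mono) auto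
  ultimately have "\<bar>Im (cnj (\<delta> t) * \<delta>' t) - Im (f t)\<bar> \<le> (\<epsilon> * (9/4)) * (D * (4/3))"
   by (simp only:)
  moreover have "(\<epsilon> * (9/4)) * (D * (4/3)) = 3 * \<epsilon> * D" by simp
  ultimately show "norm (Im (cnj (\<delta> t) * \<delta>' t) - Im (f t)) \<le> 3 * \<epsilon> * D"
   unfolding real_norm_def by (simp only:)
 qed (use \<tau> in auto)
 moreover have "integral {0..\<tau>} (\<lambda>t. Im (cnj (\<delta> t) * \<delta>' t) - Im (f t)) = integral {0..\<tau>} (\<lambda>t. Im (cnj (\<delta> t) * \<delta>' t)) - Im (L \<tau> - L 0)"
  using Henstock_Kurzweil_Integration.integral_diff[OF int1 has_integral_integrable[OF If]]
  by (simp only: integral_unique[OF If])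
 ultimately have "\<bar>integral {0..\<tau>} (\<lambda>t. Im (cnj (\<delta> t) * \<delta>' t)) - Im (L \<tau> - L 0)\<bar> \<le> 3 * \<epsilon> * D * \<tau>"
  by (simp only: real_norm_def diff_zero)
 moreover have "\<bar>Im (L \<tau> - L 0) - (\<kappa> \<tau> - \<kappa> 0)\<bar> \<le> 2" using \<eta>2[OF \<tau>0(2)] by (simp only: \<eta>_def)
 ultimately show ?thesis by linarith
qed

text \<open>The mean of \<open>F\<close> equals the mean of its averages over segments of length \<open>\<tau>\<close>.\<close>

lemma norm_mean_le_line:
 fixes F :: "real^'d \<Rightarrow> 'a::euclidean_space"
 assumes syn: "syndetic_orbit \<alpha>" and F: "continuous_on UNIV F" "periodic F" and \<tau>: "\<tau> > 0"
  and bd: "\<And>x. norm (integral {0..\<tau>} (\<lambda>t. F (x + t *\<^sub>R w))) \<le> \<tau> * C"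
 shows "norm (mean \<alpha> F) \<le> C"
proof (rule field_le_epsilon)
 fix e :: real assume e: "e > 0"
 obtain N where N0: "N > 0" "\<And>M x. M \<ge> N ==> norm (birkhoff \<alpha> M F x - mean \<alpha> F) \<le> e"
  using birkhoff_tendsto_mean[OF syn F e] by blast
 have N: "N > 0" "\<And>x. norm (birkhoff \<alpha> N F x - mean \<alpha> F) \<le> e" using N0 by simp_all
 have cl: "continuous_on {0..\<tau>} (\<lambda>t. F (x + t *\<^sub>R w))" for x
  by (intro continuous_on_compose2[OF F(1)] continuous_intros) auto
 have cb: "continuous_on {0..\<tau>} (\<lambda>t. birkhoff \<alpha> N F (t *\<^sub>R w))"
  unfolding birkhoff_def by (intro continuous_intros continuous_on_compose2[OF F(1)]) auto
 have "integral {0..\<tau>} (\<lambda>t. birkhoff \<alpha> N F (t *\<^sub>R w)) = (1 / real N) *\<^sub>R (\<Sum>n<N. integral {0..\<tau>} (\<lambda>t. F (real n *\<^sub>R \<alpha> + t *\<^sub>R w)))"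
 proof -
  have "birkhoff \<alpha> N F (t *\<^sub>R w) = (1 / real N) *\<^sub>R (\<Sum>n<N. F (real n *\<^sub>R \<alpha> + t *\<^sub>R w))" for t
   by (simp only: birkhoff_def add.commute)
  then show ?thesis
   by (simp only: integral_cmul integral_sum[OF finite_lessThan integrable_continuous_interval[OF cl]])
 qed
 then have "norm (integral {0..\<tau>} (\<lambda>t. birkhoff \<alpha> N F (t *\<^sub>R w))) = (1 / real N) * norm (\<Sum>n<N. integral {0..\<tau>} (\<lambda>t. F (real n *\<^sub>R \<alpha> + t *\<^sub>R w)))"
  by simp
 also have "\<dots> \<le> (1 / real N) * (\<Sum>n<N. \<tau> * C)"
  by (intro mult_left_mono sum_norm_le bd) auto
 finally have "norm (integral {0..\<tau>} (\<lambda>t. birkhoff \<alpha> N F (t *\<^sub>R w))) \<le> (1 / real N) * (\<Sum>n<N. \<tau> * C)" .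
 then have 1: "norm (integral {0..\<tau>} (\<lambda>t. birkhoff \<alpha> N F (t *\<^sub>R w))) \<le> \<tau> * C"
  using N(1) by simp
 have "norm (integral {0..\<tau>} (\<lambda>t. birkhoff \<alpha> N F (t *\<^sub>R w) - mean \<alpha> F)) \<le> e * (\<tau> - 0)"
  by (rule integral_bound) (use \<tau> N cb in \<open>auto intro!: continuous_intros\<close>)
 moreover have "integral {0..\<tau>} (\<lambda>t. birkhoff \<alpha> N F (t *\<^sub>R w) - mean \<alpha> F) = integral {0..\<tau>} (\<lambda>t. birkhoff \<alpha> N F (t *\<^sub>R w)) - \<tau> *\<^sub>R mean \<alpha> F"
  using Henstock_Kurzweil_Integration.integral_diff[OF integrable_continuous_interval[OF cb] integrable_continuous_interval[OF continuous_on_const[of "{0..\<tau>}" "mean \<alpha> F"]]] \<tau> by simp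
 ultimately have "norm (\<tau> *\<^sub>R mean \<alpha> F) \<le> \<tau> * C + e * \<tau>"
  using 1 norm_triangle_ineq4[of "integral {0..\<tau>} (\<lambda>t. birkhoff \<alpha> N F (t *\<^sub>R w))" "integral {0..\<tau>} (\<lambda>t. birkhoff \<alpha> N F (t *\<^sub>R w)) - \<tau> *\<^sub>R mean \<alpha> F"] by simp
 then have "\<tau> * norm (mean \<alpha> F) \<le> \<tau> * (C + e)" using \<tau> by (simp add: algebra_simps)
 then show "norm (mean \<alpha> F) \<le> C + e" using \<tau> by simp
qed

section \<open>Monotonicity of an iterate\<close>

text \<open>A cocycle \<open>A\<close> over the translation by \<open>\<alpha>\<close>, differentiable along \<open>w\<close>, that a merely continuous \<open>B\<close>
conjugates to the rotation by \<open>\<phi>\<close>, whose degree \<open>l\<close> is positive on \<open>w\<close>.\<close>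

locale rotation_frame =
 fixes \<alpha> w l :: "real^'d" and A A' B :: "real^'d \<Rightarrow> complex \<times> complex" and \<phi> :: "real^'d \<Rightarrow> real"
 assumes syn: "syndetic_orbit \<alpha>"
  and A: "continuous_on UNIV A" "periodic A" and A': "continuous_on UNIV A'" "periodic A'"
  and A_der: "\<And>x. ((\<lambda>s. A (x + s *\<^sub>R w)) has_vector_derivative A' x) (at 0)"
  and detA: "\<And>x. cm_det (A x) = 1"
  and B: "continuous_on UNIV B" "periodic B" and detB: "\<And>x. cm_det (B x) = 1"
  and \<phi>: "continuous_on UNIV \<phi>"
  and frame: "\<And>x. B (x + \<alpha>) \<odot> A x = (cis (\<phi> x), 0) \<odot> B x"
  and \<phi>_per: "\<And>x k. int_vec k ==> \<phi> (x + k) = \<phi> x + 2 * pi * (l \<bullet> k)"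
  and lw: "l \<bullet> w > 0"
begin

primrec iter :: "nat \<Rightarrow> real^'d \<Rightarrow> complex \<times> complex" where
 "iter 0 = (\<lambda>x. (1, 0))"
| "iter (Suc n) = (\<lambda>x. A (x + real n *\<^sub>R \<alpha>) \<odot> iter n x)"

definition angle :: "nat \<Rightarrow> real^'d \<Rightarrow> real" where
 "angle n x = (\<Sum>k<n. \<phi> (x + real k *\<^sub>R \<alpha>))"

text \<open>The infinitesimal motion of \<open>A\<close> along \<open>w\<close>, seen in the frame \<open>B\<close>. It has trace zero; its first component
\<open>\<i> * \<sigma>\<close> is the rotation speed, the second, \<open>\<zeta>\<close>, the hyperbolic part.\<close>

definition velocity :: "real^'d \<Rightarrow> complex \<times> complex" where
 "velocity x = B x \<odot> (cm_inv (A x) \<odot> A' x) \<odot> cm_inv (B x)"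

definition \<sigma> :: "real^'d \<Rightarrow> real" where "\<sigma> x = Im (fst (velocity x))"
definition \<zeta> :: "real^'d \<Rightarrow> complex" where "\<zeta> x = snd (velocity x)"

definition \<sigma>sum :: "nat \<Rightarrow> real^'d \<Rightarrow> real" where
 "\<sigma>sum n x = (\<Sum>k<n. \<sigma> (x + real k *\<^sub>R \<alpha>))"

text \<open>In the frame, transport along the orbit conjugates by a rotation by \<open>angle n x\<close>, which fixes \<open>\<sigma>\<close> and
multiplies \<open>\<zeta>\<close> by the rotation by twice that angle.\<close>

definition twist :: "nat \<Rightarrow> (real^'d \<Rightarrow> complex) \<Rightarrow> real^'d \<Rightarrow> complex" where
 "twist n h x = cis (- 2 * angle n x) * h (x + real n *\<^sub>R \<alpha>)"

definition \<zeta>sum :: "nat \<Rightarrow> real^'d \<Rightarrow> complex" where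
 "\<zeta>sum n x = (\<Sum>k<n. twist k \<zeta> x)"

definition velsum :: "nat \<Rightarrow> real^'d \<Rightarrow> complex \<times> complex" where
 "velsum n x = (\<i> * of_real (\<sigma>sum n x), \<zeta>sum n x)"

text \<open>The derivative of \<open>iter n\<close> along \<open>w\<close>: the product rule makes it a sum of velocities transported to the start of the orbit.\<close>

definition iter' :: "nat \<Rightarrow> real^'d \<Rightarrow> complex \<times> complex" where
 "iter' n x = iter n x \<odot> (cm_inv (B x) \<odot> velsum n x \<odot> B x)"

lemma det_iter: "cm_det (iter n x) = 1"
 by (induction n arbitrary: x) (simp_all add: cm_det_mult detA, simp add: cm_det_def)

lemma iter_frame: "B (x + real n *\<^sub>R \<alpha>) \<odot> iter n x = (cis (angle n x), 0) \<odot> B x"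
proof (induction n)
 case 0 then show ?case by (simp add: angle_def)
next
 case (Suc n)
 have "x + real (Suc n) *\<^sub>R \<alpha> = (x + real n *\<^sub>R \<alpha>) + \<alpha>" by (simp add: algebra_simps)
 then have "B (x + real (Suc n) *\<^sub>R \<alpha>) \<odot> iter (Suc n) x = (B ((x + real n *\<^sub>R \<alpha>) + \<alpha>) \<odot> A (x + real n *\<^sub>R \<alpha>)) \<odot> iter n x"
  by (simp only: iter.simps cm_assoc)
 also have "\<dots> = (cis (\<phi> (x + real n *\<^sub>R \<alpha>)), 0) \<odot> ((cis (angle n x), 0) \<odot> B x)"
  unfolding frame cm_assoc Suc ..
 also have "\<dots> = (cis (angle (Suc n) x), 0) \<odot> B x"
  unfolding cm_assoc[symmetric] by (simp add: cm_mult_def angle_def cis_mult add.commute)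
 finally show ?case .
qed

text \<open>The determinant is constant along \<open>w\<close>, so the trace of the logarithmic derivative vanishes.\<close>

lemma fst_velocity: "Re (fst (velocity x)) = 0"
proof -
 let ?p = "fst (A x)" and ?q = "snd (A x)" and ?p' = "fst (A' x)" and ?q' = "snd (A' x)"
 have fd: "((\<lambda>s. fst (A (x + s *\<^sub>R w))) has_vector_derivative ?p') (at 0)"
  by (rule bounded_linear.has_vector_derivative[OF bounded_linear_fst A_der])
 have sd: "((\<lambda>s. snd (A (x + s *\<^sub>R w))) has_vector_derivative ?q') (at 0)"
  by (rule bounded_linear.has_vector_derivative[OF bounded_linear_snd A_der])
 have "((\<lambda>s. fst (A (x + s *\<^sub>R w)) * cnj (fst (A (x + s *\<^sub>R w))) - snd (A (x + s *\<^sub>R w)) * cnj (snd (A (x + s *\<^sub>R w))))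
   has_vector_derivative (?p * cnj ?p' + ?p' * cnj ?p - (?q * cnj ?q' + ?q' * cnj ?q))) (at 0)"
  using has_vector_derivative_diff[OF has_vector_derivative_mult[OF fd has_vector_derivative_cnj[OF fd]]
    has_vector_derivative_mult[OF sd has_vector_derivative_cnj[OF sd]]] by simp
 then have 0: "?p * cnj ?p' + ?p' * cnj ?p - (?q * cnj ?q' + ?q' * cnj ?q) = 0"
  unfolding cm_det_complex[symmetric] detA using vector_derivative_unique_at has_vector_derivative_const by blast
 have "2 * Re (cnj ?p * ?p' - ?q * cnj ?q') = Re (?p * cnj ?p' + ?p' * cnj ?p - (?q * cnj ?q' + ?q' * cnj ?q))"
  by simp
 then have 1: "Re (fst (cm_inv (A x) \<odot> A' x)) = 0" unfolding 0 by (simp add: cm_mult_def cm_inv_def)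
 have "Re (fst (X \<odot> Y \<odot> cm_inv X)) = cm_det X * Re (fst Y)" for X Y :: "complex \<times> complex"
  unfolding cm_det_def cmod_power2 by (simp add: cm_mult_def cm_inv_def algebra_simps power2_eq_square)
 then show ?thesis unfolding velocity_def using 1 by simp
qed

lemma velocity_eq: "velocity x = (\<i> * of_real (\<sigma> x), \<zeta> x)"
 using fst_velocity[of x] by (simp add: \<sigma>_def \<zeta>_def prod_eq_iff complex_eq_iff)

lemma periodic_orbit: "periodic f ==> int_vec k ==> f (x + k + real n *\<^sub>R \<alpha>) = f (x + real n *\<^sub>R \<alpha>)"
 using periodicD[of f k "x + real n *\<^sub>R \<alpha>"] by (simp add: add_ac)

lemma cont_orbit: "continuous_on UNIV f ==> continuous_on UNIV (\<lambda>x. f (x + real n *\<^sub>R \<alpha>))"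
 by (erule continuous_on_compose2) (auto intro!: continuous_intros)

lemma velocity_cont: "continuous_on UNIV velocity" "periodic velocity"
 unfolding velocity_def[abs_def] using A A' B
 by (auto intro!: continuous_intros simp: periodic_def)

lemma \<sigma>: "continuous_on UNIV \<sigma>" "periodic \<sigma>"
 unfolding \<sigma>_def[abs_def] using velocity_cont by (auto intro!: continuous_intros simp: periodic_def)

lemma \<zeta>: "continuous_on UNIV \<zeta>" "periodic \<zeta>"
 unfolding \<zeta>_def[abs_def] using velocity_cont by (auto intro!: continuous_intros simp: periodic_def)

lemma angle_cont: "continuous_on UNIV (angle n)"
 unfolding angle_def[abs_def] by (intro continuous_intros cont_orbit \<phi>)

lemma cis_\<phi>_per: "int_vec k ==> cis (\<phi> (x + k)) = cis (\<phi> x)"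
proof -
 assume k: "int_vec k"
 have "B ((x + k) + \<alpha>) = B (x + \<alpha>)" using periodicD[OF B(2) k, of "x + \<alpha>"] by (simp add: add_ac)
 then have "(cis (\<phi> (x + k)), 0) \<odot> B (x + k) = (cis (\<phi> x), 0) \<odot> B x"
  using frame[of "x + k"] frame[of x] periodicD[OF A(2) k] by simp
 then have "(cis (\<phi> (x + k)), 0) \<odot> (B x \<odot> cm_inv (B x)) = (cis (\<phi> x), 0) \<odot> (B x \<odot> cm_inv (B x))"
  using periodicD[OF B(2) k] by (metis cm_assoc)
 then show ?thesis by (simp add: cm_inv_right[OF detB])
qed

lemma cis_angle_per: "int_vec k ==> cis (angle n (x + k)) = cis (angle n x)"
 by (induction n)
   (simp_all add: angle_def cis_mult[symmetric] periodic_orbit[of "\<lambda>x. cis (\<phi> x)"] cis_\<phi>_per periodic_def)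

lemma twist:
 assumes "continuous_on UNIV h" "periodic h"
 shows "continuous_on UNIV (twist n h)" "periodic (twist n h)"
proof -
 show "continuous_on UNIV (twist n h)"
  unfolding twist_def[abs_def] by (intro continuous_intros cont_orbit assms angle_cont)
 have "cis (- 2 * angle n x) = (cnj (cis (angle n x)))\<^sup>2" for x
  by (simp add: cis_cnj power2_eq_square cis_mult)
 then show "periodic (twist n h)"
  unfolding twist_def[abs_def] using periodic_orbit[OF assms(2)] cis_angle_per
  by (simp add: periodic_def)
qed

lemma \<sigma>sum: "continuous_on UNIV (\<sigma>sum n)" "periodic (\<sigma>sum n)"
 unfolding \<sigma>sum_def[abs_def] using periodic_orbit[OF \<sigma>(2)]
 by (auto intro!: continuous_intros cont_orbit \<sigma> simp: periodic_def)

lemma \<zeta>sum: "continuous_on UNIV (\<zeta>sum n)" "periodic (\<zeta>sum n)"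
 unfolding \<zeta>sum_def[abs_def] using twist[OF \<zeta>]
 by (auto intro!: continuous_intros simp: periodic_def)

lemma iter: "continuous_on UNIV (iter n)" "periodic (iter n)"
proof -
 show "continuous_on UNIV (iter n)"
  by (induction n) (auto intro!: continuous_intros cont_orbit A)
 show "periodic (iter n)"
  by (induction n) (use periodic_orbit[OF A(2)] in \<open>auto simp: periodic_def\<close>)
qed

lemma iter': "continuous_on UNIV (iter' n)" "periodic (iter' n)"
 unfolding iter'_def[abs_def] velsum_def using iter B \<sigma>sum \<zeta>sum
 by (auto intro!: continuous_intros simp: periodic_def)

lemma iter_der: "((\<lambda>s. iter n (x + s *\<^sub>R w)) has_vector_derivative iter' n x) (at 0)"
proof (induction n)
 case 0
 have "velsum 0 x = 0" by (simp add: velsum_def \<sigma>sum_def \<zeta>sum_def zero_prod_def)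
 then show ?case by (simp add: iter'_def cm_mult_def zero_prod_def[symmetric])
next
 case (Suc n)
 let ?y = "x + real n *\<^sub>R \<alpha>" and ?I = "iter n x"
 let ?R = "(cis (angle n x), 0)" and ?\<Delta> = "(\<i> * of_real (\<sigma> (x + real n *\<^sub>R \<alpha>)), twist n \<zeta> x)"
 have a: "((\<lambda>s. A (x + s *\<^sub>R w + real n *\<^sub>R \<alpha>)) has_vector_derivative A' ?y) (at 0)"
  using A_der[of ?y] by (simp add: add_ac)
 have d: "((\<lambda>s. iter (Suc n) (x + s *\<^sub>R w)) has_vector_derivative (A ?y \<odot> iter' n x + A' ?y \<odot> ?I)) (at 0)"
  using has_vector_derivative_cm_mult[OF a Suc] by simp
 have \<Delta>: "?\<Delta> = cm_inv ?R \<odot> velocity ?y \<odot> ?R"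
  unfolding velocity_eq by (simp add: cm_mult_def cm_inv_def twist_def cis_cnj cis_mult[symmetric] mult_ac)
    (simp add: cis_mult)
 have "cm_inv (B x) \<odot> ?\<Delta> \<odot> B x = cm_inv (?R \<odot> B x) \<odot> velocity ?y \<odot> (?R \<odot> B x)"
  unfolding \<Delta> cm_inv_mult by (simp only: cm_assoc)
 also have "?R \<odot> B x = B ?y \<odot> ?I" by (rule iter_frame[symmetric])
 also have "cm_inv (B ?y \<odot> ?I) \<odot> velocity ?y \<odot> (B ?y \<odot> ?I) =
   cm_inv ?I \<odot> (cm_inv (B ?y) \<odot> B ?y) \<odot> (cm_inv (A ?y) \<odot> A' ?y) \<odot> (cm_inv (B ?y) \<odot> B ?y) \<odot> ?I"
  unfolding cm_inv_mult velocity_def by (simp only: cm_assoc)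
 also have "\<dots> = cm_inv ?I \<odot> (cm_inv (A ?y) \<odot> A' ?y) \<odot> ?I" by (simp add: cm_inv_left[OF detB])
 finally have "A ?y \<odot> ?I \<odot> (cm_inv (B x) \<odot> ?\<Delta> \<odot> B x) = A ?y \<odot> (?I \<odot> cm_inv ?I) \<odot> cm_inv (A ?y) \<odot> A' ?y \<odot> ?I"
  by (simp only: cm_assoc)
 also have "\<dots> = A' ?y \<odot> ?I" by (simp add: cm_inv_right detA det_iter)
 finally have k: "A' ?y \<odot> ?I = A ?y \<odot> ?I \<odot> (cm_inv (B x) \<odot> ?\<Delta> \<odot> B x)" ..
 have v: "velsum (Suc n) x = velsum n x + ?\<Delta>"
  by (simp add: velsum_def \<sigma>sum_def \<zeta>sum_def plus_prod_def algebra_simps)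
 have "A ?y \<odot> iter' n x + A' ?y \<odot> ?I = iter' (Suc n) x"
  unfolding k iter'_def v cm_add_left cm_add_right iter.simps by (simp only: cm_assoc)
 then show ?case using d by simp
qed

lemma frame_bounds:
 obtains b C where "b \<ge> 1" "\<And>x. cm_norm (B x) \<le> b" "C > 0" "\<And>x. \<bar>\<sigma> x\<bar> \<le> C" "\<And>x. cmod (\<zeta> x) \<le> C"
proof -
 obtain b0 where b0: "b0 > 0" "\<And>x. norm (B x) \<le> b0" using periodic_bounded[OF B] by blast
 obtain C1 where C1: "C1 > 0" "\<And>x. norm (\<sigma> x) \<le> C1" using periodic_bounded[OF \<sigma>] by blast
 obtain C2 where C2: "C2 > 0" "\<And>x. norm (\<zeta> x) \<le> C2" using periodic_bounded[OF \<zeta>] by blast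
 show ?thesis
 proof (rule that[of "max 1 (2 * b0)" "max C1 C2"])
  show "cm_norm (B x) \<le> max 1 (2 * b0)" for x
   using cm_norm_le_norm[of "B x"] b0(2)[of x] by linarith
  show "\<bar>\<sigma> x\<bar> \<le> max C1 C2" for x using C1(2)[of x] by simp
  show "cmod (\<zeta> x) \<le> max C1 C2" for x using C2(2)[of x] by simp
 qed (use C1 in auto)
qed

lemma norm_sums:
 assumes "\<And>x. \<bar>\<sigma> x\<bar> \<le> C" "\<And>x. cmod (\<zeta> x) \<le> C"
 shows "\<bar>\<sigma>sum n x\<bar> \<le> real n * C" "cmod (\<zeta>sum n x) \<le> real n * C"
proof -
 have "norm (\<sigma>sum n x) \<le> (\<Sum>k<n. C)" unfolding \<sigma>sum_def by (rule sum_norm_le) (use assms in auto)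
 then show "\<bar>\<sigma>sum n x\<bar> \<le> real n * C" by simp
 have "norm (\<zeta>sum n x) \<le> (\<Sum>k<n. C)" unfolding \<zeta>sum_def twist_def
  by (rule sum_norm_le) (use assms in \<open>auto simp: norm_mult\<close>)
 then show "cmod (\<zeta>sum n x) \<le> real n * C" by simp
qed

text \<open>Move a vector by the iterate at \<open>x + t w\<close> and look at it in the frame at the end point for \<open>t = 0\<close>. On a short segment
\<open>B\<close> hardly changes, so the image nearly rotates by \<open>angle N\<close>, although \<open>B\<close> and \<open>\<phi>\<close> are not differentiable;
on the other hand its area speed is given by the velocity sums.\<close>

lemma line_area:
 assumes b: "b \<ge> 1" "\<And>x. cm_norm (B x) \<le> b" and C: "C > 0" "\<And>x. \<bar>\<sigma> x\<bar> \<le> C" "\<And>x. cmod (\<zeta> x) \<le> C"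
  and \<tau>: "\<tau> > 0" and \<omega>: "0 \<le> \<omega>" "8 * b ^ 3 * \<omega> \<le> 1"
  and osc: "\<And>y t. t \<in> {0..\<tau>} ==> cm_norm (B (y + t *\<^sub>R w) - B y) \<le> \<omega>" and h: "cmod h = 1"
 shows "\<bar>integral {0..\<tau>} (\<lambda>t. \<sigma>sum N (x + t *\<^sub>R w) + Im (\<zeta>sum N (x + t *\<^sub>R w) * (cnj h)\<^sup>2)) -
   (angle N (x + \<tau> *\<^sub>R w) - angle N x)\<bar> \<le> 2 + 20 * C * b ^ 9 * real N * \<omega> * \<tau>"
proof -
 let ?y = "\<lambda>t. x + t *\<^sub>R w" and ?N = "real N *\<^sub>R \<alpha>"
 define v where "v = cm_app (cm_inv (B x)) h"
 define \<delta> where "\<delta> t = cm_app (B (x + ?N) \<odot> iter N (?y t)) v" for t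
 define \<delta>' where "\<delta>' t = cm_app (B (x + ?N) \<odot> iter' N (?y t)) v" for t
 define ht where "ht t = cm_app (B (?y t)) v" for t
 define \<epsilon> where "\<epsilon> = 2 * b ^ 3 * \<omega>"
 define D where "D = 2 * C * b ^ 6 * real N"
 have b1: "1 \<le> b ^ n" for n using b(1) by (rule one_le_power)
 have b0: "b > 0" using b(1) by simp
 have vb: "cmod v \<le> b" unfolding v_def using cm_app_norm_le[of "cm_inv (B x)" b h 1] b(2) h by simp
 have Bv: "cm_app (B x) v = h" unfolding v_def cm_app_mult[symmetric] cm_inv_right[OF detB] by simp
 have ht: "cmod (ht t - h) \<le> \<omega> * b" if "t \<in> {0..\<tau>}" for t
  unfolding ht_def Bv[symmetric] cm_app_diff by (rule cm_app_norm_le[OF osc[OF that] vb])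
 have htb: "cmod (ht t) \<le> b * b" for t unfolding ht_def by (rule cm_app_norm_le[OF b(2) vb])
 have iter_eq: "iter N z = cm_inv (B (z + ?N)) \<odot> ((cis (angle N z), 0) \<odot> B z)" for z
  unfolding iter_frame[symmetric] cm_assoc[symmetric] cm_inv_left[OF detB] by simp
 have \<delta>_eq: "\<delta> t = cm_app (B (x + ?N) \<odot> cm_inv (B (?y t + ?N))) (cis (angle N (?y t)) * ht t)" for t
  unfolding \<delta>_def iter_eq cm_app_mult ht_def by (simp add: cm_app_def)
 have near: "cmod (\<delta> t - cis (angle N (?y t)) * h) \<le> \<epsilon>" if t: "t \<in> {0..\<tau>}" for t
 proof -
  let ?g = "cis (angle N (?y t)) * ht t"
  have g: "?g = cm_app (B (?y t + ?N) \<odot> cm_inv (B (?y t + ?N))) ?g"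
   by (simp add: cm_inv_right[OF detB])
  have yN: "?y t + ?N = (x + ?N) + t *\<^sub>R w" by (simp add: algebra_simps)
  have "\<delta> t - ?g = cm_app (B (x + ?N) - B (?y t + ?N)) (cm_app (cm_inv (B (?y t + ?N))) ?g)"
   by (subst g) (simp only: \<delta>_eq cm_app_mult cm_app_diff)
  moreover have "cm_norm (B (x + ?N) - B (?y t + ?N)) \<le> \<omega>"
   using osc[OF t, of "x + ?N"] unfolding yN by (simp add: cm_norm_def norm_minus_commute)
  moreover have "cmod (cm_app (cm_inv (B (?y t + ?N))) ?g) \<le> b * (b * b)"
   by (rule cm_app_norm_le) (use b(2) htb in \<open>auto simp: norm_mult\<close>)
  ultimately have 1: "cmod (\<delta> t - ?g) \<le> \<omega> * (b * (b * b))" by (metis cm_app_norm_le)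
  have "?g - cis (angle N (?y t)) * h = cis (angle N (?y t)) * (ht t - h)" by (simp add: algebra_simps)
  then have 2: "cmod (?g - cis (angle N (?y t)) * h) \<le> \<omega> * b" using ht[OF t] by (simp add: norm_mult)
  have "\<omega> * b \<le> \<omega> * b ^ 3"
   using b(1) \<omega>(1) power_increasing[of 1 3 b] by (intro mult_left_mono) auto
  then show ?thesis using 1 2 norm_triangle_ineq[of "\<delta> t - ?g" "?g - cis (angle N (?y t)) * h"]
   by (simp add: \<epsilon>_def power3_eq_cube mult_ac)
 qed
 have \<epsilon>: "\<epsilon> \<le> 1/4" using \<omega>(2) by (simp add: \<epsilon>_def)
 have D: "cmod (\<delta>' t) \<le> D" for t
 proof -
  have vs: "cm_norm (velsum N (?y t)) \<le> 2 * (real N * C)"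
   using norm_sums[OF C(2,3), of N "?y t"] by (simp add: cm_norm_def velsum_def norm_mult)
  have it: "cm_norm (iter N (?y t)) \<le> b * (1 * b)"
   unfolding iter_eq by (intro cm_norm_mult_le) (use b(2) in \<open>auto simp: cm_norm_def[of "(_, 0)"]\<close>)
  have "cm_norm (B (x + ?N) \<odot> iter' N (?y t)) \<le> b * ((b * (1 * b)) * ((b * (2 * (real N * C))) * b))"
   unfolding iter'_def by (intro cm_norm_mult_le it vs) (use b(2) in auto)
  then have "cmod (\<delta>' t) \<le> b * ((b * (1 * b)) * ((b * (2 * (real N * C))) * b)) * b"
   unfolding \<delta>'_def using vb by (rule cm_app_norm_le)
  then show ?thesis by (simp add: D_def power_def numeral_eq_Suc mult_ac)
 qed
 have ly: "continuous_on S ?y" for S by (intro continuous_intros)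
 have lc: "continuous_on S (\<lambda>t. f (?y t))" if "continuous_on UNIV f" for S and f :: "real^'d \<Rightarrow> 'z::topological_space"
  by (rule continuous_on_compose2[OF that ly]) auto
 have c\<delta>': "continuous_on {0..\<tau>} \<delta>'" unfolding \<delta>'_def cm_app_def
  by (intro continuous_intros lc iter')
 have d: "(\<delta> has_vector_derivative \<delta>' t) (at t within {0..\<tau>})" for t
 proof -
  have "((\<lambda>s. iter N (?y s)) has_vector_derivative iter' N (?y t)) (at t)"
   by (rule line_derivative_at[OF iter_der])
  then have 1: "((\<lambda>s. B (x + ?N) \<odot> iter N (?y s)) has_vector_derivative B (x + ?N) \<odot> iter' N (?y t)) (at t)"
   by (rule bounded_linear.has_vector_derivative[OF bounded_bilinear.bounded_linear_right[OF bounded_bilinear_cm_mult]])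
  have "((\<lambda>s. fst (B (x + ?N) \<odot> iter N (?y s))) has_vector_derivative fst (B (x + ?N) \<odot> iter' N (?y t))) (at t)"
   "((\<lambda>s. snd (B (x + ?N) \<odot> iter N (?y s))) has_vector_derivative snd (B (x + ?N) \<odot> iter' N (?y t))) (at t)"
   using bounded_linear.has_vector_derivative[OF bounded_linear_fst 1] bounded_linear.has_vector_derivative[OF bounded_linear_snd 1] by auto
  from has_vector_derivative_add[OF has_vector_derivative_mult_left[OF this(1), of v] has_vector_derivative_mult_left[OF this(2), of "cnj v"]]
  have "(\<delta> has_vector_derivative \<delta>' t) (at t)"
   unfolding \<delta>_def[abs_def] \<delta>'_def cm_app_def by simp
  then show ?thesis by (rule has_vector_derivative_at_within)
 qed
 define f where "f t = \<sigma>sum N (?y t) + Im (\<zeta>sum N (?y t) * (cnj h)\<^sup>2)" for t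
 have eqI: "Im (cnj (\<delta> t) * \<delta>' t) = \<sigma>sum N (?y t) * (cmod (ht t))\<^sup>2 + Im (\<zeta>sum N (?y t) * (cnj (ht t))\<^sup>2)" for t
 proof -
  have \<delta>'_eq: "\<delta>' t = cm_app (B (x + ?N) \<odot> iter N (?y t)) (cm_app (cm_inv (B (?y t)) ) (cm_app (velsum N (?y t)) (ht t)))"
   unfolding \<delta>'_def iter'_def ht_def cm_app_mult ..
  have v_eq: "v = cm_app (cm_inv (B (?y t))) (ht t)"
   unfolding ht_def cm_app_mult[symmetric] cm_inv_left[OF detB] by simp
  have "Im (cnj (\<delta> t) * \<delta>' t) = Im (cnj v * cm_app (cm_inv (B (?y t))) (cm_app (velsum N (?y t)) (ht t)))"
   unfolding \<delta>_def \<delta>'_eq cm_symplectic by (simp add: cm_det_mult detB det_iter)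
  also have "\<dots> = Im (cnj (ht t) * cm_app (velsum N (?y t)) (ht t))"
   by (subst v_eq) (simp only: cm_symplectic cm_det_inv detB mult_1)
  also have "cnj (ht t) * cm_app (velsum N (?y t)) (ht t) = \<i> * of_real (\<sigma>sum N (?y t)) * (ht t * cnj (ht t)) + \<zeta>sum N (?y t) * (cnj (ht t))\<^sup>2"
   by (simp add: cm_app_def velsum_def power2_eq_square algebra_simps)
  finally show ?thesis unfolding complex_norm_square[symmetric] by simp
 qed
 have main: "\<bar>integral {0..\<tau>} (\<lambda>t. Im (cnj (\<delta> t) * \<delta>' t)) - (angle N (?y \<tau>) - angle N (?y 0))\<bar> \<le> 2 + 3 * \<epsilon> * D * \<tau>"
  by (rule swept_area[OF \<tau> d c\<delta>' lc[OF angle_cont] h \<epsilon> near D])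
 have i1: "continuous_on {0..\<tau>} (\<lambda>t. Im (cnj (\<delta> t) * \<delta>' t))"
 proof -
  have "continuous_on {0..\<tau>} \<delta>" unfolding continuous_on_eq_continuous_within
   using d has_vector_derivative_continuous by blast
  then show ?thesis by (intro continuous_intros c\<delta>')
 qed
 have i2: "continuous_on {0..\<tau>} f" unfolding f_def by (intro continuous_intros lc \<sigma>sum \<zeta>sum)
 have "norm (integral {0..\<tau>} (\<lambda>t. Im (cnj (\<delta> t) * \<delta>' t) - f t)) \<le> (4 * C * b ^ 3 * real N * \<omega>) * (\<tau> - 0)"
 proof (rule integral_bound)
  show "continuous_on {0..\<tau>} (\<lambda>t. Im (cnj (\<delta> t) * \<delta>' t) - f t)" by (intro continuous_intros i1 i2)
  fix t assume t: "t \<in> {0..\<tau>}"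
  have s: "cmod (ht t) + cmod h \<le> 2 * b ^ 2" using htb[of t] h b1[of 2] by (simp add: power2_eq_square)
  have w2: "\<omega> * b * (2 * b\<^sup>2) = 2 * b ^ 3 * \<omega>" by (simp add: power3_eq_cube power2_eq_square)
  have A1: "\<bar>(cmod (ht t))\<^sup>2 - 1\<bar> \<le> 2 * b ^ 3 * \<omega>"
  proof -
   have "\<bar>cmod (ht t) - cmod h\<bar> \<le> \<omega> * b" using norm_triangle_ineq3[of "ht t" h] ht[OF t] by linarith
   then have "\<bar>cmod (ht t) - cmod h\<bar> * (cmod (ht t) + cmod h) \<le> \<omega> * b * (2 * b\<^sup>2)"
    using s \<omega>(1) b0 by (intro mult_mono) auto
   moreover have "(cmod (ht t))\<^sup>2 - 1 = (cmod (ht t) - cmod h) * (cmod (ht t) + cmod h)"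
    using h by (simp add: power2_eq_square algebra_simps)
   ultimately show ?thesis unfolding w2 by (simp add: abs_mult)
  qed
  have A2: "cmod ((cnj (ht t))\<^sup>2 - (cnj h)\<^sup>2) \<le> 2 * b ^ 3 * \<omega>"
  proof -
   have "(cnj (ht t))\<^sup>2 - (cnj h)\<^sup>2 = cnj ((ht t - h) * (ht t + h))" by (simp add: power2_eq_square algebra_simps)
   then have "cmod ((cnj (ht t))\<^sup>2 - (cnj h)\<^sup>2) = cmod (ht t - h) * cmod (ht t + h)"
    by (simp only: complex_mod_cnj norm_mult)
   also have "\<dots> \<le> \<omega> * b * (2 * b\<^sup>2)"
    using ht[OF t] s norm_triangle_ineq[of "ht t" h] \<omega>(1) b0 by (intro mult_mono) auto
   finally show ?thesis unfolding w2 .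
  qed
  have "Im (cnj (\<delta> t) * \<delta>' t) - f t = \<sigma>sum N (?y t) * ((cmod (ht t))\<^sup>2 - 1) + Im (\<zeta>sum N (?y t) * ((cnj (ht t))\<^sup>2 - (cnj h)\<^sup>2))"
   unfolding eqI f_def by (simp add: algebra_simps)
  moreover have "\<bar>\<sigma>sum N (?y t) * ((cmod (ht t))\<^sup>2 - 1)\<bar> \<le> real N * C * (2 * b ^ 3 * \<omega>)"
   unfolding abs_mult using norm_sums[OF C(2,3), of N "?y t"] A1 C(1) by (intro mult_mono) auto
  moreover have "cmod (\<zeta>sum N (?y t) * ((cnj (ht t))\<^sup>2 - (cnj h)\<^sup>2)) \<le> real N * C * (2 * b ^ 3 * \<omega>)"
   unfolding norm_mult using norm_sums[OF C(2,3), of N "?y t"] A2 C(1) by (intro mult_mono) auto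
  moreover have "real N * C * (2 * b ^ 3 * \<omega>) + real N * C * (2 * b ^ 3 * \<omega>) = 4 * C * b ^ 3 * real N * \<omega>" by simp
  ultimately show "norm (Im (cnj (\<delta> t) * \<delta>' t) - f t) \<le> 4 * C * b ^ 3 * real N * \<omega>"
   using abs_Im_le_cmod[of "\<zeta>sum N (?y t) * ((cnj (ht t))\<^sup>2 - (cnj h)\<^sup>2)"] unfolding real_norm_def by linarith
 qed (use \<tau> in auto)
 moreover have "integral {0..\<tau>} (\<lambda>t. Im (cnj (\<delta> t) * \<delta>' t) - f t) = integral {0..\<tau>} (\<lambda>t. Im (cnj (\<delta> t) * \<delta>' t)) - integral {0..\<tau>} f"
  by (rule Henstock_Kurzweil_Integration.integral_diff[OF integrable_continuous_interval[OF i1] integrable_continuous_interval[OF i2]])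
 ultimately have "\<bar>integral {0..\<tau>} f - (angle N (?y \<tau>) - angle N x)\<bar> \<le> 2 + 3 * \<epsilon> * D * \<tau> + 4 * C * b ^ 3 * real N * \<omega> * \<tau>"
  using main unfolding real_norm_def by (simp only: scale_zero_left add_0_right diff_zero)
 moreover have "3 * \<epsilon> * D * \<tau> = 12 * C * b ^ 9 * real N * \<omega> * \<tau>"
 proof -
  have "b ^ 3 * b ^ 6 = b ^ 9" by (simp add: power_add[symmetric])
  then show ?thesis unfolding \<epsilon>_def D_def by (simp add: mult_ac)
 qed
 moreover have "4 * C * b ^ 3 * real N * \<omega> * \<tau> \<le> 8 * C * b ^ 9 * real N * \<omega> * \<tau>"
 proof -
  have "b ^ 3 \<le> b ^ 9" using b(1) by (intro power_increasing) auto
  then have "(4 * C * real N * \<omega> * \<tau>) * b ^ 3 \<le> (8 * C * real N * \<omega> * \<tau>) * b ^ 9"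
   using C \<omega> \<tau> b0 by (intro mult_mono mult_right_mono mult_nonneg_nonneg) auto
  then show ?thesis by (simp add: mult_ac)
 qed
 ultimately have "\<bar>integral {0..\<tau>} f - (angle N (?y \<tau>) - angle N x)\<bar> \<le> 2 + 20 * C * b ^ 9 * real N * \<omega> * \<tau>"
  by linarith
 then show ?thesis unfolding f_def .
qed

section \<open>The mean speed of rotation\<close>

text \<open>The form \<open>\<sigma>sum + Im (\<zeta>sum * (cnj h)\<^sup>2)\<close> is known for all unit vectors \<open>h\<close>; suitable combinations of several \<open>h\<close>
isolate \<open>\<sigma>sum\<close> and \<open>\<zeta>sum\<close>.\<close>

lemma line_integrals:
 assumes e: "e > 0"
 shows "\<exists>\<tau>0>0. \<forall>\<tau> N x. 0 < \<tau> \<longrightarrow> \<tau> \<le> \<tau>0 \<longrightarrow>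
   \<bar>integral {0..\<tau>} (\<lambda>t. \<sigma>sum N (x + t *\<^sub>R w)) - (angle N (x + \<tau> *\<^sub>R w) - angle N x)\<bar> \<le> 2 + e * real N * \<tau> \<and>
   cmod (integral {0..\<tau>} (\<lambda>t. \<zeta>sum N (x + t *\<^sub>R w))) \<le> 4 + 2 * e * real N * \<tau>"
proof -
 obtain b C where b: "b \<ge> 1" "\<And>x. cm_norm (B x) \<le> b" and C: "C > 0" "\<And>x. \<bar>\<sigma> x\<bar> \<le> C" "\<And>x. cmod (\<zeta> x) \<le> C"
  using frame_bounds by blast
 have b0: "b > 0" using b by simp
 define \<omega> where "\<omega> = min (1 / (8 * b ^ 3)) (e / (20 * C * b ^ 9))"
 have \<omega>: "\<omega> > 0" using b0 C e by (simp add: \<omega>_def)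
 have \<omega>1: "8 * b ^ 3 * \<omega> \<le> 1"
 proof -
  have "8 * b ^ 3 * \<omega> \<le> 8 * b ^ 3 * (1 / (8 * b ^ 3))" using b0 by (intro mult_left_mono) (auto simp: \<omega>_def)
  then show ?thesis using b0 by simp
 qed
 have \<omega>2: "20 * C * b ^ 9 * \<omega> \<le> e"
 proof -
  have "20 * C * b ^ 9 * \<omega> \<le> 20 * C * b ^ 9 * (e / (20 * C * b ^ 9))" using b0 C by (intro mult_left_mono) (auto simp: \<omega>_def)
  then show ?thesis using b0 C by simp
 qed
 have "\<omega> / 2 > 0" using \<omega> by simp
 then obtain d where d: "d > 0" "\<And>x x'. dist x x' < d ==> dist (B x) (B x') < \<omega> / 2"
  using periodic_uniformly_continuous[OF B] by blast
 have nw: "norm w + 1 > 0" using norm_ge_zero[of w] by linarith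
 define \<tau>0 where "\<tau>0 = (d / 2) / (norm w + 1)"
 have \<tau>0: "\<tau>0 > 0" using d nw by (simp add: \<tau>0_def)
 have osc: "cm_norm (B (y + t *\<^sub>R w) - B y) \<le> \<omega>" if "0 \<le> t" "t \<le> \<tau>0" for y t
 proof -
  have "t * norm w \<le> \<tau>0 * (norm w + 1)" using that by (intro mult_mono) auto
  also have "\<dots> = d / 2" using nw by (metis \<tau>0_def nonzero_eq_divide_eq less_irrefl)
  finally have "dist (y + t *\<^sub>R w) y < d" using d(1) that by (simp add: dist_norm)
  then have "norm (B (y + t *\<^sub>R w) - B y) < \<omega> / 2" using d(2) by (metis dist_norm)
  then show ?thesis using cm_norm_le_norm[of "B (y + t *\<^sub>R w) - B y"] by linarith
 qed
 have key: "\<bar>integral {0..\<tau>} (\<lambda>t. \<sigma>sum N (x + t *\<^sub>R w)) + Im (integral {0..\<tau>} (\<lambda>t. \<zeta>sum N (x + t *\<^sub>R w)) * (cnj h)\<^sup>2) -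
   (angle N (x + \<tau> *\<^sub>R w) - angle N x)\<bar> \<le> 2 + e * real N * \<tau>"
  if \<tau>: "0 < \<tau>" "\<tau> \<le> \<tau>0" and h: "cmod h = 1" for \<tau> N x h
 proof -
  have lc: "continuous_on {0..\<tau>} (\<lambda>t. f (x + t *\<^sub>R w))" if "continuous_on UNIV f" for f :: "real^'d \<Rightarrow> 'z::topological_space"
   by (rule continuous_on_compose2[OF that]) (auto intro!: continuous_intros)
  have i1: "(\<lambda>t. \<sigma>sum N (x + t *\<^sub>R w)) integrable_on {0..\<tau>}" and i2: "(\<lambda>t. \<zeta>sum N (x + t *\<^sub>R w)) integrable_on {0..\<tau>}"
   by (rule integrable_continuous_interval, rule lc, rule \<sigma>sum, rule integrable_continuous_interval, rule lc, rule \<zeta>sum)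
  have bl: "bounded_linear (\<lambda>z. Im (z * (cnj h)\<^sup>2))"
   by (intro bounded_linear_compose[OF bounded_linear_Im bounded_linear_mult_left])
  have hi: "((\<lambda>t. Im (\<zeta>sum N (x + t *\<^sub>R w) * (cnj h)\<^sup>2)) has_integral Im (integral {0..\<tau>} (\<lambda>t. \<zeta>sum N (x + t *\<^sub>R w)) * (cnj h)\<^sup>2)) {0..\<tau>}"
   using has_integral_linear[OF integrable_integral[OF i2] bl] by (simp only: o_def)
  have "integral {0..\<tau>} (\<lambda>t. \<sigma>sum N (x + t *\<^sub>R w) + Im (\<zeta>sum N (x + t *\<^sub>R w) * (cnj h)\<^sup>2))
    = integral {0..\<tau>} (\<lambda>t. \<sigma>sum N (x + t *\<^sub>R w)) + Im (integral {0..\<tau>} (\<lambda>t. \<zeta>sum N (x + t *\<^sub>R w)) * (cnj h)\<^sup>2)"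
   by (rule integral_unique[OF has_integral_add[OF integrable_integral[OF i1] hi]])
  moreover have "\<bar>integral {0..\<tau>} (\<lambda>t. \<sigma>sum N (x + t *\<^sub>R w) + Im (\<zeta>sum N (x + t *\<^sub>R w) * (cnj h)\<^sup>2)) -
    (angle N (x + \<tau> *\<^sub>R w) - angle N x)\<bar> \<le> 2 + 20 * C * b ^ 9 * real N * \<omega> * \<tau>"
   by (rule line_area[OF b C \<tau>(1) less_imp_le[OF \<omega>] \<omega>1 osc h]) (use \<tau>(2) in auto)
  moreover have "20 * C * b ^ 9 * real N * \<omega> * \<tau> \<le> e * real N * \<tau>"
  proof -
   have "(20 * C * b ^ 9 * \<omega>) * (real N * \<tau>) \<le> e * (real N * \<tau>)" using \<omega>2 \<tau> by (intro mult_right_mono) auto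
   then show ?thesis by (simp only: mult_ac)
  qed
  ultimately show ?thesis by linarith
 qed
 show ?thesis
 proof (intro exI[of _ \<tau>0] conjI allI impI \<tau>0)
  fix \<tau> N x assume \<tau>: "0 < \<tau>" "\<tau> \<le> \<tau>0"
  let ?S = "integral {0..\<tau>} (\<lambda>t. \<sigma>sum N (x + t *\<^sub>R w))" and ?Z = "integral {0..\<tau>} (\<lambda>t. \<zeta>sum N (x + t *\<^sub>R w))"
  let ?D = "angle N (x + \<tau> *\<^sub>R w) - angle N x" and ?E = "2 + e * real N * \<tau>"
  have 1: "\<bar>?S + Im ?Z - ?D\<bar> \<le> ?E" using key[OF \<tau>, of 1] by simp
  have 2: "\<bar>?S - Im ?Z - ?D\<bar> \<le> ?E" using key[OF \<tau>, of \<i>] by simp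
  have c1: "(cnj (cis (- pi / 4)))\<^sup>2 = \<i>" by (simp add: cis_cnj power2_eq_square cis_mult)
  have c2: "(cnj (cis (pi / 4)))\<^sup>2 = - \<i>"
  proof -
   have "(cnj (cis (pi / 4)))\<^sup>2 = cis (- (pi / 2))" by (simp add: cis_cnj power2_eq_square cis_mult)
   also have "\<dots> = cnj (cis (pi / 2))" by (simp add: cis_cnj)
   finally show ?thesis by simp
  qed
  have 3: "\<bar>?S + Re ?Z - ?D\<bar> \<le> ?E" using key[OF \<tau>, of "cis (- pi / 4)"] unfolding c1 by simp
  have 4: "\<bar>?S - Re ?Z - ?D\<bar> \<le> ?E" using key[OF \<tau>, of "cis (pi / 4)"] unfolding c2 by simp
  show "\<bar>?S - ?D\<bar> \<le> ?E" using 1 2 by linarith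
  have "\<bar>Re ?Z\<bar> \<le> ?E" "\<bar>Im ?Z\<bar> \<le> ?E" using 1 2 3 4 by linarith+
  then show "cmod ?Z \<le> 4 + 2 * e * real N * \<tau>" using cmod_le[of ?Z] by linarith
 qed
qed

lemma \<sigma>sum_birkhoff: "\<sigma>sum N x = real N * birkhoff \<alpha> N \<sigma> x"
 by (simp add: \<sigma>sum_def birkhoff_def)

text \<open>Average the previous estimate over \<open>x\<close>: \<open>\<phi> x - 2 * pi * (l \<bullet> x)\<close> is periodic, so the increment of \<open>\<phi>\<close> over \<open>\<tau> w\<close> has mean
\<open>2 * pi * \<tau> * (l \<bullet> w)\<close>. The bounded error disappears as \<open>N\<close> grows.\<close>

lemma mean_\<sigma>: "mean \<alpha> \<sigma> = 2 * pi * (l \<bullet> w)"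
proof -
 have "\<bar>mean \<alpha> \<sigma> - 2 * pi * (l \<bullet> w)\<bar> \<le> 0 + e" if e0: "e > 0" for e
 proof -
  define e' where "e' = e / 4"
  have e: "e' > 0" using e0 by (simp add: e'_def)
  obtain \<tau> where \<tau>: "\<tau> > 0"
   and "\<forall>\<tau>' N x. 0 < \<tau>' \<longrightarrow> \<tau>' \<le> \<tau> \<longrightarrow> \<bar>integral {0..\<tau>'} (\<lambda>t. \<sigma>sum N (x + t *\<^sub>R w)) - (angle N (x + \<tau>' *\<^sub>R w) - angle N x)\<bar> \<le> 2 + e' * real N * \<tau>' \<and>
   cmod (integral {0..\<tau>'} (\<lambda>t. \<zeta>sum N (x + t *\<^sub>R w))) \<le> 4 + 2 * e' * real N * \<tau>'"
   using line_integrals[OF e] by (elim exE conjE)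
  then have \<tau>': "\<bar>integral {0..\<tau>} (\<lambda>t. \<sigma>sum N (x + t *\<^sub>R w)) - (angle N (x + \<tau> *\<^sub>R w) - angle N x)\<bar> \<le> 2 + e' * real N * \<tau>" for N x
   by simp
  define \<psi> where "\<psi> x = \<phi> x - 2 * pi * (l \<bullet> x)" for x
  have \<psi>: "continuous_on UNIV \<psi>" "periodic \<psi>" unfolding \<psi>_def[abs_def]
   by (intro continuous_intros \<phi>) (simp add: periodic_def \<phi>_per inner_add_right algebra_simps)
  have "e' * \<tau> > 0" using e \<tau> by simp
  then obtain N1 where "N1 > 0" and N1: "\<And>N x y. N \<ge> N1 ==> norm (birkhoff \<alpha> N \<psi> x - birkhoff \<alpha> N \<psi> y) \<le> e' * \<tau>"
   using birkhoff_oscillation[OF syn \<psi>] by blast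
  obtain N2 where "N2 > 0" and N2: "\<And>N x. N \<ge> N2 ==> norm (birkhoff \<alpha> N \<sigma> x - mean \<alpha> \<sigma>) \<le> e'"
   using birkhoff_tendsto_mean[OF syn \<sigma> e] by blast
  obtain N3 :: nat where N3: "real N3 > 2 / (e' * \<tau>)" using reals_Archimedean2 by blast
  define N where "N = Suc (max N1 (max N2 N3))"
  have N: "N \<ge> N1" "N \<ge> N2" "N > 0" "N \<ge> N3" by (auto simp: N_def)
  have N3': "2 \<le> e' * real N * \<tau>"
  proof -
   have "2 / (e' * \<tau>) < real N" using N3 N(4) by linarith
   then show ?thesis using \<open>e' * \<tau> > 0\<close> by (simp add: pos_divide_less_eq mult_ac)
  qed
  have an: "angle N x = real N * birkhoff \<alpha> N \<psi> x + 2 * pi * (\<Sum>k<N. l \<bullet> (x + real k *\<^sub>R \<alpha>))" for x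
   using N(3) by (simp add: angle_def birkhoff_def \<psi>_def sum_subtractf sum_distrib_left algebra_simps)
  have "angle N (0 + \<tau> *\<^sub>R w) - angle N 0 = real N * (birkhoff \<alpha> N \<psi> (0 + \<tau> *\<^sub>R w) - birkhoff \<alpha> N \<psi> 0) + real N * (2 * pi * \<tau> * (l \<bullet> w))"
   unfolding an by (simp add: inner_add_right sum.distrib algebra_simps)
  moreover have "\<bar>real N * (birkhoff \<alpha> N \<psi> (0 + \<tau> *\<^sub>R w) - birkhoff \<alpha> N \<psi> 0)\<bar> \<le> real N * (e' * \<tau>)"
   unfolding abs_mult using N1[OF N(1), of "0 + \<tau> *\<^sub>R w" 0] by (intro mult_mono) auto
  ultimately have 1: "\<bar>integral {0..\<tau>} (\<lambda>t. \<sigma>sum N (0 + t *\<^sub>R w)) - real N * (2 * pi * \<tau> * (l \<bullet> w))\<bar> \<le> real N * (e' * \<tau>) + (2 + e' * real N * \<tau>)"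
   using \<tau>'[of N 0] by linarith
  have cl: "continuous_on {0..\<tau>} (\<lambda>t. \<sigma>sum N (0 + t *\<^sub>R w))"
   by (rule continuous_on_compose2[OF \<sigma>sum(1)]) (auto intro!: continuous_intros)
  have "norm (integral {0..\<tau>} (\<lambda>t. \<sigma>sum N (0 + t *\<^sub>R w) - real N * mean \<alpha> \<sigma>)) \<le> (real N * e') * (\<tau> - 0)"
  proof (rule integral_bound)
   show "continuous_on {0..\<tau>} (\<lambda>t. \<sigma>sum N (0 + t *\<^sub>R w) - real N * mean \<alpha> \<sigma>)" by (intro continuous_intros cl)
   fix t
   have "\<sigma>sum N (0 + t *\<^sub>R w) - real N * mean \<alpha> \<sigma> = real N * (birkhoff \<alpha> N \<sigma> (0 + t *\<^sub>R w) - mean \<alpha> \<sigma>)"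
    unfolding \<sigma>sum_birkhoff by (simp add: algebra_simps)
   then show "norm (\<sigma>sum N (0 + t *\<^sub>R w) - real N * mean \<alpha> \<sigma>) \<le> real N * e'"
    using N2[OF N(2), of "0 + t *\<^sub>R w"] by (simp only: norm_mult) (intro mult_mono, auto)
  qed (use \<tau> in auto)
  moreover have "integral {0..\<tau>} (\<lambda>t. \<sigma>sum N (0 + t *\<^sub>R w) - real N * mean \<alpha> \<sigma>) = integral {0..\<tau>} (\<lambda>t. \<sigma>sum N (0 + t *\<^sub>R w)) - \<tau> * (real N * mean \<alpha> \<sigma>)"
   using Henstock_Kurzweil_Integration.integral_diff[OF integrable_continuous_interval[OF cl] integrable_continuous_interval[OF continuous_on_const[of "{0..\<tau>}" "real N * mean \<alpha> \<sigma>"]]] \<tau> by simp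
  ultimately have 2: "\<bar>integral {0..\<tau>} (\<lambda>t. \<sigma>sum N (0 + t *\<^sub>R w)) - \<tau> * (real N * mean \<alpha> \<sigma>)\<bar> \<le> real N * e' * \<tau>"
   by (simp only: real_norm_def diff_zero)
  have "\<bar>(real N * \<tau>) * (mean \<alpha> \<sigma> - 2 * pi * (l \<bullet> w))\<bar> = \<bar>\<tau> * (real N * mean \<alpha> \<sigma>) - real N * (2 * pi * \<tau> * (l \<bullet> w))\<bar>"
   by (simp add: algebra_simps)
  also have "\<dots> \<le> 4 * (e' * real N * \<tau>)" using 1 2 N3' by (simp only: mult_ac)
  finally have "(real N * \<tau>) * \<bar>mean \<alpha> \<sigma> - 2 * pi * (l \<bullet> w)\<bar> \<le> (real N * \<tau>) * e"
   using \<tau> by (simp add: abs_mult e'_def mult_ac)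
  then show ?thesis using \<tau> N(3) by simp
 qed
 then have "\<bar>mean \<alpha> \<sigma> - 2 * pi * (l \<bullet> w)\<bar> \<le> 0" by (rule field_le_epsilon)
 then show ?thesis by simp
qed

section \<open>Sublinear growth of the hyperbolic part\<close>

definition tavg :: "nat \<Rightarrow> (real^'d \<Rightarrow> complex) \<Rightarrow> real^'d \<Rightarrow> complex" where
 "tavg N h x = (\<Sum>n<N. twist n h x) / of_nat N"

lemma tavg:
 assumes "continuous_on UNIV h" "periodic h"
 shows "continuous_on UNIV (tavg n h)" "periodic (tavg n h)"
proof -
 show "continuous_on UNIV (tavg n h)"
 proof (cases "n = 0")
  case True then show ?thesis by (simp add: tavg_def[abs_def])
 next
  case False then show ?thesis unfolding tavg_def[abs_def]
   by (intro continuous_intros twist assms) auto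
 qed
 show "periodic (tavg n h)"
  unfolding tavg_def[abs_def] using twist(2)[OF assms] by (simp add: periodic_def)
qed

lemma tavg_\<zeta>: "tavg N \<zeta> x = \<zeta>sum N x / of_nat N"
 by (simp add: tavg_def \<zeta>sum_def)

lemma tavg_linear: "tavg N (\<lambda>x. a * g x + b * h x) x = a * tavg N g x + b * tavg N h x"
 by (simp add: tavg_def twist_def sum.distrib sum_distrib_left add_divide_distrib algebra_simps)

lemma norm_tavg_le:
 assumes "\<And>x. cmod (h x) \<le> C" "C \<ge> 0"
 shows "cmod (tavg N h x) \<le> C"
proof (cases "N = 0")
 case False
 have "cmod (\<Sum>n<N. twist n h x) \<le> (\<Sum>n<N. C)"
  by (rule sum_norm_le) (use assms in \<open>auto simp: twist_def norm_mult\<close>)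
 then show ?thesis using False by (simp add: tavg_def norm_divide pos_divide_le_eq mult.commute)
qed (use assms in \<open>auto simp: tavg_def\<close>)

lemma norm_tavg_le_birkhoff: "cmod (tavg N h x) \<le> birkhoff \<alpha> N (\<lambda>x. cmod (h x)) x"
proof -
 have "cmod (\<Sum>n<N. twist n h x) \<le> (\<Sum>n<N. cmod (h (x + real n *\<^sub>R \<alpha>)))"
  by (rule sum_norm_le) (auto simp: twist_def norm_mult)
 then show ?thesis by (simp add: tavg_def birkhoff_def norm_divide divide_right_mono)
qed

lemma twist_twist: "twist n (twist m h) x = twist (n + m) h x"
proof -
 have "angle (n + m) x = angle n x + angle m (x + real n *\<^sub>R \<alpha>)"
 proof (induction m)
  case (Suc m)
  have "x + real (n + m) *\<^sub>R \<alpha> = x + real n *\<^sub>R \<alpha> + real m *\<^sub>R \<alpha>" by (simp add: algebra_simps)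
  then show ?case using Suc by (simp only: angle_def sum.lessThan_Suc add_Suc_right add.assoc)
 qed (simp add: angle_def)
 then have "cis (- 2 * angle (n + m) x) = cis (- 2 * angle n x) * cis (- 2 * angle m (x + real n *\<^sub>R \<alpha>))"
  by (simp add: cis_mult distrib_left)
 moreover have "x + real (n + m) *\<^sub>R \<alpha> = x + real n *\<^sub>R \<alpha> + real m *\<^sub>R \<alpha>" by (simp add: algebra_simps)
 ultimately show ?thesis by (simp only: twist_def mult.assoc)
qed

lemma norm_sum_shift_le:
 fixes f :: "nat \<Rightarrow> 'a::real_normed_vector"
 assumes "\<And>n. norm (f n) \<le> C"
 shows "norm ((\<Sum>n<N. f (n + m)) - (\<Sum>n<N. f n)) \<le> 2 * real m * C"
proof (induction m)
 case (Suc m)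
 have "(\<Sum>n<Suc N. f (n + m)) = f m + (\<Sum>n<N. f (n + Suc m))"
  by (simp only: sum.lessThan_Suc_shift) simp
 then have "(\<Sum>n<N. f (n + Suc m)) - (\<Sum>n<N. f (n + m)) = f (N + m) - f m"
  by (simp add: algebra_simps)
 moreover have "norm (f (N + m) - f m) \<le> 2 * C"
  using norm_triangle_ineq4[of "f (N + m)" "f m"] assms[of "N + m"] assms[of m] by linarith
 ultimately have "norm (((\<Sum>n<N. f (n + Suc m)) - (\<Sum>n<N. f (n + m))) + ((\<Sum>n<N. f (n + m)) - (\<Sum>n<N. f n))) \<le> 2 * C + 2 * real m * C"
  using Suc by (intro norm_triangle_mono) auto
 then show ?case by (simp add: algebra_simps)
qed simp

text \<open>On short segments along \<open>w\<close> a continuous \<open>h\<close> is almost constant and the integral of \<open>\<zeta>sum N\<close> is small compared with \<open>N\<close>.\<close>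

lemma weak_convergence:
 assumes h: "continuous_on UNIV h" "periodic h" and e: "e > 0"
 obtains N0 where "N0 > 0" "\<And>N. N \<ge> N0 ==> cmod (mean \<alpha> (\<lambda>x. cnj (h x) * tavg N \<zeta> x)) \<le> e"
proof -
 obtain b C where "b \<ge> 1" "\<And>x. cm_norm (B x) \<le> b" and C: "C > 0" "\<And>x. \<bar>\<sigma> x\<bar> \<le> C" "\<And>x. cmod (\<zeta> x) \<le> C"
  using frame_bounds by blast
 obtain Ch where Ch: "Ch > 0" "\<And>x. cmod (h x) \<le> Ch" using periodic_bounded[OF h] by blast
 have e2: "e / (2 * C) > 0" using e C by simp
 obtain d where d: "d > 0" "\<And>x x'. dist x x' < d ==> dist (h x) (h x') < e / (2 * C)"
  using periodic_uniformly_continuous[OF h e2] by blast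
 have e1: "e / (8 * Ch) > 0" using e Ch by simp
 obtain \<tau>0 where \<tau>0: "\<tau>0 > 0"
  and "\<forall>\<tau> N x. 0 < \<tau> \<longrightarrow> \<tau> \<le> \<tau>0 \<longrightarrow> \<bar>integral {0..\<tau>} (\<lambda>t. \<sigma>sum N (x + t *\<^sub>R w)) - (angle N (x + \<tau> *\<^sub>R w) - angle N x)\<bar> \<le> 2 + (e / (8 * Ch)) * real N * \<tau> \<and>
   cmod (integral {0..\<tau>} (\<lambda>t. \<zeta>sum N (x + t *\<^sub>R w))) \<le> 4 + 2 * (e / (8 * Ch)) * real N * \<tau>"
  using line_integrals[OF e1] by (elim exE conjE)
 then have \<tau>0': "cmod (integral {0..\<tau>} (\<lambda>t. \<zeta>sum N (x + t *\<^sub>R w))) \<le> 4 + 2 * (e / (8 * Ch)) * real N * \<tau>"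
  if "0 < \<tau>" "\<tau> \<le> \<tau>0" for \<tau> N x
  using that by simp
 have nw: "norm w + 1 > 0" using norm_ge_zero[of w] by linarith
 define \<tau> where "\<tau> = min \<tau>0 ((d / 2) / (norm w + 1))"
 have \<tau>: "\<tau> > 0" "\<tau> \<le> \<tau>0" using d nw \<tau>0 by (auto simp: \<tau>_def)
 have osc: "cmod (h (x + t *\<^sub>R w) - h x) \<le> e / (2 * C)" if "0 \<le> t" "t \<le> \<tau>" for x t
 proof -
  have "t * norm w \<le> \<tau> * (norm w + 1)" using that by (intro mult_mono) auto
  also have "\<dots> \<le> ((d / 2) / (norm w + 1)) * (norm w + 1)" using nw by (intro mult_right_mono) (auto simp: \<tau>_def)
  also have "\<dots> = d / 2" using nw by (metis nonzero_eq_divide_eq less_irrefl)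
  finally have "dist (x + t *\<^sub>R w) x < d" using d(1) that by (simp add: dist_norm)
  then show ?thesis using d(2) by (metis dist_norm less_imp_le)
 qed
 obtain N1 :: nat where N1: "real N1 > 16 * Ch / (\<tau> * e)" using reals_Archimedean2 by blast
 show ?thesis
 proof (rule that[of "Suc N1"])
  fix N assume N: "N \<ge> Suc N1"
  have N0: "real N > 0" using N by simp
  have N1': "4 * Ch / real N \<le> \<tau> * e / 4"
  proof -
   have "16 * Ch / (\<tau> * e) < real N" using N1 N by linarith
   then show ?thesis using \<tau> e N0 by (simp add: pos_divide_less_eq pos_divide_le_eq field_simps)
  qed
  show "cmod (mean \<alpha> (\<lambda>x. cnj (h x) * tavg N \<zeta> x)) \<le> e"
  proof (rule norm_mean_le_line[OF syn _ _ \<tau>(1), of _ w])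
   show "continuous_on UNIV (\<lambda>x. cnj (h x) * tavg N \<zeta> x)" by (intro continuous_intros h tavg \<zeta>)
   show "periodic (\<lambda>x. cnj (h x) * tavg N \<zeta> x)" using h tavg[OF \<zeta>] by (simp add: periodic_def)
   fix x
   let ?y = "\<lambda>t. x + t *\<^sub>R w"
   have lc: "continuous_on {0..\<tau>} (\<lambda>t. f (?y t))" if "continuous_on UNIV f" for f :: "real^'d \<Rightarrow> 'z::topological_space"
    by (rule continuous_on_compose2[OF that]) (auto intro!: continuous_intros)
   have i1: "(\<lambda>t. tavg N \<zeta> (?y t)) integrable_on {0..\<tau>}"
    by (rule integrable_continuous_interval, rule lc, rule tavg, rule \<zeta>, rule \<zeta>)
   have c2: "continuous_on {0..\<tau>} (\<lambda>t. cnj (h (?y t) - h x) * tavg N \<zeta> (?y t))"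
    by (intro continuous_intros lc tavg \<zeta> h)
   have "integral {0..\<tau>} (\<lambda>t. cnj (h (?y t)) * tavg N \<zeta> (?y t)) = integral {0..\<tau>} (\<lambda>t. cnj (h x) * tavg N \<zeta> (?y t) + cnj (h (?y t) - h x) * tavg N \<zeta> (?y t))"
    by (simp add: algebra_simps)
   also have "\<dots> = integral {0..\<tau>} (\<lambda>t. cnj (h x) * tavg N \<zeta> (?y t)) + integral {0..\<tau>} (\<lambda>t. cnj (h (?y t) - h x) * tavg N \<zeta> (?y t))"
    by (rule Henstock_Kurzweil_Integration.integral_add[OF integrable_on_mult_right[OF i1] integrable_continuous_interval[OF c2]])
   also have "integral {0..\<tau>} (\<lambda>t. cnj (h x) * tavg N \<zeta> (?y t)) = cnj (h x) * (integral {0..\<tau>} (\<lambda>t. \<zeta>sum N (?y t)) / of_nat N)"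
    unfolding tavg_\<zeta> by simp
   finally have eq: "integral {0..\<tau>} (\<lambda>t. cnj (h (?y t)) * tavg N \<zeta> (?y t)) =
    cnj (h x) * (integral {0..\<tau>} (\<lambda>t. \<zeta>sum N (?y t)) / of_nat N) + integral {0..\<tau>} (\<lambda>t. cnj (h (?y t) - h x) * tavg N \<zeta> (?y t))" .
   have "cmod (integral {0..\<tau>} (\<lambda>t. cnj (h (?y t) - h x) * tavg N \<zeta> (?y t))) \<le> (e / (2 * C) * C) * (\<tau> - 0)"
   proof (rule integral_bound)
    fix t assume t: "t \<in> {0..\<tau>}"
    show "cmod (cnj (h (?y t) - h x) * tavg N \<zeta> (?y t)) \<le> e / (2 * C) * C"
     unfolding norm_mult complex_mod_cnj using osc[of t x] t norm_tavg_le[OF C(3), of N] C(1) e2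
     by (intro mult_mono) auto
   qed (use \<tau> c2 in auto)
   then have 1: "cmod (integral {0..\<tau>} (\<lambda>t. cnj (h (?y t) - h x) * tavg N \<zeta> (?y t))) \<le> \<tau> * e / 2"
    using C(1) by (simp add: mult.commute)
   have "cmod (cnj (h x) * (integral {0..\<tau>} (\<lambda>t. \<zeta>sum N (?y t)) / of_nat N)) \<le> Ch * ((4 + 2 * (e / (8 * Ch)) * real N * \<tau>) / real N)"
    unfolding norm_mult norm_divide complex_mod_cnj using Ch \<tau>0'[OF \<tau>, of N x] N0
    by (intro mult_mono) (auto intro!: divide_right_mono)
   also have "\<dots> = 4 * Ch / real N + \<tau> * e / 4" using N0 Ch(1) by (simp add: field_simps)
   also have "\<dots> \<le> \<tau> * e / 2" using N1' by simp
   finally show "cmod (integral {0..\<tau>} (\<lambda>t. cnj (h (?y t)) * tavg N \<zeta> (?y t))) \<le> \<tau> * e"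
    unfolding eq using 1 norm_triangle_ineq[of "cnj (h x) * (integral {0..\<tau>} (\<lambda>t. \<zeta>sum N (?y t)) / of_nat N)" "integral {0..\<tau>} (\<lambda>t. cnj (h (?y t) - h x) * tavg N \<zeta> (?y t))"]
    by linarith
  qed
 qed simp
qed

text \<open>The functions that cannot be told from \<open>\<zeta>\<close> by their twisted averages in the limit: a convex set containing
the averages of \<open>\<zeta>\<close> themselves.\<close>

definition same_tavg :: "(real^'d \<Rightarrow> complex) set" where
 "same_tavg = {g. continuous_on UNIV g \<and> periodic g \<and>
   (\<forall>e>0. \<exists>N0. \<forall>N\<ge>N0. \<forall>x. cmod (tavg N g x - tavg N \<zeta> x) \<le> e)}"

text \<open>Averaging twice, the order of the two averages can be exchanged, and a bounded shift of a long average is negligible.\<close>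

lemma tavg_same_tavg:
 assumes M: "M > 0"
 shows "tavg M \<zeta> \<in> same_tavg"
 unfolding same_tavg_def
proof (intro CollectI conjI allI impI tavg \<zeta>)
 fix e :: real assume e: "e > 0"
 obtain b C where "b \<ge> 1" "\<And>x. cm_norm (B x) \<le> b" and C: "C > 0" "\<And>x. \<bar>\<sigma> x\<bar> \<le> C" "\<And>x. cmod (\<zeta> x) \<le> C"
  using frame_bounds by blast
 obtain N0 :: nat where N0: "real N0 > 2 * real M * C / e" using reals_Archimedean2 by blast
 show "\<exists>N0. \<forall>N\<ge>N0. \<forall>x. cmod (tavg N (tavg M \<zeta>) x - tavg N \<zeta> x) \<le> e"
 proof (intro exI[of _ "Suc N0"] allI impI)
  fix N x assume N: "N \<ge> Suc N0"
  have Np: "real N > 0" using N by simp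
  let ?f = "\<lambda>n. twist n \<zeta> x"
  have fb: "cmod (?f n) \<le> C" for n using C(3) by (simp add: twist_def norm_mult)
  have tw: "twist n (tavg M \<zeta>) x = (\<Sum>m<M. ?f (n + m)) / of_nat M" for n
   unfolding twist_twist[symmetric] by (simp add: tavg_def twist_def[of n] sum_distrib_left)
  have "tavg N (tavg M \<zeta>) x - tavg N \<zeta> x = (\<Sum>m<M. ((\<Sum>n<N. ?f (n + m)) - (\<Sum>n<N. ?f n))) / (of_nat M * of_nat N)"
  proof -
   have "tavg N (tavg M \<zeta>) x = (\<Sum>m<M. (\<Sum>n<N. ?f (n + m))) / (of_nat M * of_nat N)"
    unfolding tavg_def[of N] tw sum_divide_distrib[symmetric] by (subst sum.swap) simp
   moreover have "tavg N \<zeta> x = (\<Sum>m<M. (\<Sum>n<N. ?f n)) / (of_nat M * of_nat N)"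
    using M by (simp add: tavg_def)
   ultimately show ?thesis by (simp add: sum_subtractf diff_divide_distrib)
  qed
  moreover have "cmod (\<Sum>m<M. ((\<Sum>n<N. ?f (n + m)) - (\<Sum>n<N. ?f n))) \<le> (\<Sum>m<M. 2 * real M * C)"
  proof (rule sum_norm_le)
   fix m assume m: "m \<in> {..<M}"
   have "2 * real m * C \<le> 2 * real M * C" using m C(1) by (intro mult_right_mono) auto
   then show "cmod ((\<Sum>n<N. ?f (n + m)) - (\<Sum>n<N. ?f n)) \<le> 2 * real M * C"
    using norm_sum_shift_le[of ?f C m N, OF fb] by linarith
  qed
  moreover have "(\<Sum>m<M. 2 * real M * C) = real M * (2 * real M * C)" by simp
  ultimately have "cmod (tavg N (tavg M \<zeta>) x - tavg N \<zeta> x) \<le> (real M * (2 * real M * C)) / (real M * real N)"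
   by (simp only: norm_divide norm_mult norm_of_nat) (intro divide_right_mono, simp_all)
  also have "\<dots> = 2 * real M * C / real N" using M by simp
  also have "\<dots> \<le> e"
  proof -
   have "2 * real M * C / e < real N" using N0 N by linarith
   then show ?thesis using e Np by (simp add: pos_divide_less_eq pos_divide_le_eq mult.commute)
  qed
  finally show "cmod (tavg N (tavg M \<zeta>) x - tavg N \<zeta> x) \<le> e" .
 qed
qed

lemma same_tavgD:
 assumes "g \<in> same_tavg"
 shows "continuous_on UNIV g" "periodic g" "e > 0 ==> \<exists>N0. \<forall>N\<ge>N0. \<forall>x. cmod (tavg N g x - tavg N \<zeta> x) \<le> e"
proof -
 have 1: "continuous_on UNIV g \<and> periodic g \<and> (\<forall>e>0. \<exists>N0. \<forall>N\<ge>N0. \<forall>x. cmod (tavg N g x - tavg N \<zeta> x) \<le> e)"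
  using assms unfolding same_tavg_def mem_Collect_eq .
 show "continuous_on UNIV g" by (rule conjunct1[OF 1])
 show "periodic g" by (rule conjunct1[OF conjunct2[OF 1]])
 show "e > 0 ==> \<exists>N0. \<forall>N\<ge>N0. \<forall>x. cmod (tavg N g x - tavg N \<zeta> x) \<le> e"
  using conjunct2[OF conjunct2[OF 1]] by (elim allE impE)
qed

lemma convex_same_tavg:
 assumes g: "g \<in> same_tavg" and h: "h \<in> same_tavg" and s: "0 \<le> s" "s \<le> 1"
 shows "(\<lambda>x. of_real (1 - s) * g x + of_real s * h x) \<in> same_tavg"
proof -
 have cp: "continuous_on UNIV g" "periodic g" "continuous_on UNIV h" "periodic h"
  by (rule same_tavgD(1)[OF g], rule same_tavgD(2)[OF g], rule same_tavgD(1)[OF h], rule same_tavgD(2)[OF h])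
 show ?thesis
 unfolding same_tavg_def
proof (intro CollectI conjI allI impI)
 show "continuous_on UNIV (\<lambda>x. of_real (1 - s) * g x + of_real s * h x)"
  by (intro continuous_intros cp)
 show "periodic (\<lambda>x. of_real (1 - s) * g x + of_real s * h x)"
  using cp(2,4) by (simp add: periodic_def)
 fix e :: real assume e: "e > 0"
 obtain N1 where N1: "\<And>N x. N \<ge> N1 ==> cmod (tavg N g x - tavg N \<zeta> x) \<le> e" using same_tavgD(3)[OF g e] by (elim exE) blast
 obtain N2 where N2: "\<And>N x. N \<ge> N2 ==> cmod (tavg N h x - tavg N \<zeta> x) \<le> e" using same_tavgD(3)[OF h e] by (elim exE) blast
 show "\<exists>N0. \<forall>N\<ge>N0. \<forall>x. cmod (tavg N (\<lambda>x. of_real (1 - s) * g x + of_real s * h x) x - tavg N \<zeta> x) \<le> e"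
 proof (intro exI[of _ "max N1 N2"] allI impI)
  fix N x assume N: "N \<ge> max N1 N2"
  have "tavg N (\<lambda>x. of_real (1 - s) * g x + of_real s * h x) x - tavg N \<zeta> x
    = of_real (1 - s) * (tavg N g x - tavg N \<zeta> x) + of_real s * (tavg N h x - tavg N \<zeta> x)"
   unfolding tavg_linear by (simp add: algebra_simps)
  also have "cmod \<dots> \<le> (1 - s) * e + s * e"
   using N1[of N x] N2[of N x] N s by (intro norm_triangle_mono) (auto simp: norm_mult simp del: of_real_diff intro!: mult_left_mono)
  finally show "cmod (tavg N (\<lambda>x. of_real (1 - s) * g x + of_real s * h x) x - tavg N \<zeta> x) \<le> e"
   by (simp add: algebra_simps)
 qed
qed
qed

definition energy :: "(real^'d \<Rightarrow> complex) \<Rightarrow> real" where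
 "energy g = mean \<alpha> (\<lambda>x. (cmod (g x))\<^sup>2)"

lemma energy_combination:
 assumes g: "continuous_on UNIV g" "periodic g" and h: "continuous_on UNIV h" "periodic h"
 shows "energy (\<lambda>x. of_real a * g x + of_real b * h x) = a\<^sup>2 * energy g + 2 * a * b * Re (mean \<alpha> (\<lambda>x. cnj (g x) * h x)) + b\<^sup>2 * energy h"
proof -
 have e: "(cmod (of_real a * g x + of_real b * h x))\<^sup>2 = (a\<^sup>2 * (cmod (g x))\<^sup>2 + (2 * a * b) * Re (cnj (g x) * h x)) + b\<^sup>2 * (cmod (h x))\<^sup>2" for x
  unfolding cmod_power2 by (simp add: power2_eq_square algebra_simps)
 have c: "continuous_on UNIV (\<lambda>x. (cmod (g x))\<^sup>2)" "periodic (\<lambda>x. (cmod (g x))\<^sup>2)"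
  "continuous_on UNIV (\<lambda>x. (cmod (h x))\<^sup>2)" "periodic (\<lambda>x. (cmod (h x))\<^sup>2)"
  "continuous_on UNIV (\<lambda>x. cnj (g x) * h x)" "periodic (\<lambda>x. cnj (g x) * h x)"
  using g h by (auto intro!: continuous_intros simp: periodic_def)
 have c': "continuous_on UNIV (\<lambda>x. a\<^sup>2 * (cmod (g x))\<^sup>2)" "periodic (\<lambda>x. a\<^sup>2 * (cmod (g x))\<^sup>2)"
  "continuous_on UNIV (\<lambda>x. b\<^sup>2 * (cmod (h x))\<^sup>2)" "periodic (\<lambda>x. b\<^sup>2 * (cmod (h x))\<^sup>2)"
  "continuous_on UNIV (\<lambda>x. (2 * a * b) * Re (cnj (g x) * h x))" "periodic (\<lambda>x. (2 * a * b) * Re (cnj (g x) * h x))"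
  "continuous_on UNIV (\<lambda>x. a\<^sup>2 * (cmod (g x))\<^sup>2 + (2 * a * b) * Re (cnj (g x) * h x))" "periodic (\<lambda>x. a\<^sup>2 * (cmod (g x))\<^sup>2 + (2 * a * b) * Re (cnj (g x) * h x))"
  using g h by (auto intro!: continuous_intros simp: periodic_def)
 have bl: "bounded_linear (\<lambda>z. (2 * a * b) * Re z)"
  by (intro bounded_linear_compose[OF bounded_linear_mult_right bounded_linear_Re])
 show ?thesis
  unfolding energy_def e mean_add[OF syn c'(7,8,3,4)] mean_add[OF syn c'(1,2,5,6)]
   mean_linear[OF syn c(1,2) bounded_linear_mult_right] mean_linear[OF syn c(3,4) bounded_linear_mult_right]
   mean_linear[OF syn c(5,6) bl] by simp
qed

lemma energy_nonneg:
 assumes "continuous_on UNIV g" "periodic g" shows "energy g \<ge> 0"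
proof -
 have "mean \<alpha> (\<lambda>x. 0::real) \<le> energy g" unfolding energy_def
  by (rule mean_mono[OF syn]) (use assms in \<open>auto intro!: continuous_intros simp: periodic_def\<close>)
 then show ?thesis by (simp add: mean_const)
qed

text \<open>The idea of the mean ergodic theorem: if the infimum of the energy were positive, mixing a nearly
minimal \<open>g\<close> with an average of \<open>\<zeta>\<close> that is nearly orthogonal to \<open>g\<close> would lower the energy below it.\<close>

lemma small_energy:
 assumes e: "e > 0"
 obtains g where "g \<in> same_tavg" "energy g < e"
proof -
 obtain b C where "b \<ge> 1" "\<And>x. cm_norm (B x) \<le> b" and C: "C > 0" "\<And>x. \<bar>\<sigma> x\<bar> \<le> C" "\<And>x. cmod (\<zeta> x) \<le> C"
  using frame_bounds by blast
 define \<beta> where "\<beta> = Inf (energy ` same_tavg)"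
 have cp: "continuous_on UNIV g" "periodic g" if "g \<in> same_tavg" for g by (rule same_tavgD(1)[OF that], rule same_tavgD(2)[OF that])
 have bdd: "bdd_below (energy ` same_tavg)" using energy_nonneg cp by (intro bdd_belowI[of _ 0]) auto
 have ne: "energy ` same_tavg \<noteq> {}" using tavg_same_tavg[of 1] by auto
 have low: "\<beta> \<le> energy g" if "g \<in> same_tavg" for g
  unfolding \<beta>_def using that bdd by (intro cInf_lower) auto
 have attain: "\<exists>g\<in>same_tavg. energy g < y" if "\<beta> < y" for y
  using cInf_lessD[OF ne that[unfolded \<beta>_def]] by blast
 have "\<beta> \<le> 0"
 proof (rule ccontr)
  assume "\<not> \<beta> \<le> 0"
  then have \<beta>: "\<beta> > 0" by simp
  \<comment> \<open>the gain, linear in \<open>s\<close>, has to beat the cost \<open>s\<^sup>2 * C\<^sup>2\<close>\<close>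
  define s where "s = min (1/2) (\<beta> / (2 * C\<^sup>2))"
  have s: "0 < s" "s \<le> 1/2" using \<beta> C by (auto simp: s_def)
  have sC: "s * C\<^sup>2 \<le> \<beta> / 2"
  proof -
   have "s * C\<^sup>2 \<le> \<beta> / (2 * C\<^sup>2) * C\<^sup>2" by (intro mult_right_mono) (auto simp: s_def)
   then show ?thesis using C by simp
  qed
  have "\<beta> < \<beta> + s * \<beta> / 4" using s \<beta> by simp
  then obtain g where g: "g \<in> same_tavg" "energy g < \<beta> + s * \<beta> / 4"
   using attain by blast
  have "\<beta> / 16 > 0" using \<beta> by simp
  then obtain N where N0: "N > 0" "\<And>n. n \<ge> N ==> cmod (mean \<alpha> (\<lambda>x. cnj (g x) * tavg n \<zeta> x)) \<le> \<beta> / 16"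
   using weak_convergence[OF cp[OF g(1)]] by blast
  then have N: "N > 0" "cmod (mean \<alpha> (\<lambda>x. cnj (g x) * tavg N \<zeta> x)) \<le> \<beta> / 16" by blast+
  let ?a = "tavg N \<zeta>"
  have a: "?a \<in> same_tavg" by (rule tavg_same_tavg[OF N(1)])
  have ea: "energy ?a \<le> C\<^sup>2"
  proof -
   have "norm (energy ?a) \<le> C\<^sup>2" unfolding energy_def
   proof (rule norm_mean_le[OF syn])
    show "norm ((cmod (?a x))\<^sup>2) \<le> C\<^sup>2" for x
     using norm_tavg_le[where h = \<zeta> and C = C and N = N and x = x, OF C(3)] C(1) by (simp add: power_mono)
   qed (use cp[OF a] in \<open>auto intro!: continuous_intros simp: periodic_def\<close>)
   then show ?thesis by simp
  qed
  have "\<beta> \<le> energy (\<lambda>x. of_real (1 - s) * g x + of_real s * ?a x)"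
   by (rule low[OF convex_same_tavg[OF g(1) a]]) (use s in auto)
  also have "\<dots> = (1 - s)\<^sup>2 * energy g + 2 * (1 - s) * s * Re (mean \<alpha> (\<lambda>x. cnj (g x) * ?a x)) + s\<^sup>2 * energy ?a"
   by (rule energy_combination[OF cp[OF g(1)] cp[OF a]])
  also have "\<dots> \<le> (1 - s) * (\<beta> + s * \<beta> / 4) + s * (\<beta> / 8) + s * (\<beta> / 2)"
  proof (intro add_mono)
   have "(1 - s)\<^sup>2 \<le> 1 - s" using s by (simp add: power2_eq_square mult_left_le)
   then show "(1 - s)\<^sup>2 * energy g \<le> (1 - s) * (\<beta> + s * \<beta> / 4)"
    using g(2) s energy_nonneg[OF cp[OF g(1)]] by (intro mult_mono) auto
   have r: "Re (mean \<alpha> (\<lambda>x. cnj (g x) * ?a x)) \<le> \<beta> / 16" using N(2) complex_Re_le_cmod order_trans by blast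
   have "2 * (1 - s) * s * Re (mean \<alpha> (\<lambda>x. cnj (g x) * ?a x)) \<le> 2 * (1 - s) * s * (\<beta> / 16)"
    using s r by (intro mult_left_mono) auto
   also have "\<dots> \<le> 2 * 1 * s * (\<beta> / 16)" using s \<beta> by (intro mult_right_mono) auto
   also have "\<dots> = s * (\<beta> / 8)" by simp
   finally show "2 * (1 - s) * s * Re (mean \<alpha> (\<lambda>x. cnj (g x) * ?a x)) \<le> s * (\<beta> / 8)" .
   have "s\<^sup>2 * energy ?a \<le> s\<^sup>2 * C\<^sup>2" using ea by (intro mult_left_mono) auto
   also have "\<dots> = s * (s * C\<^sup>2)" by (simp add: power2_eq_square)
   also have "\<dots> \<le> s * (\<beta> / 2)" using sC s by (intro mult_left_mono) auto
   finally show "s\<^sup>2 * energy ?a \<le> s * (\<beta> / 2)" .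
  qed
  also have "\<dots> = \<beta> - s * \<beta> / 8 - s * s * \<beta> / 4" by (simp add: field_simps)
  also have "\<dots> < \<beta>"
  proof -
   have "s * \<beta> > 0" "s * s * \<beta> > 0" using s \<beta> by auto
   then show ?thesis by linarith
  qed
  finally show False by simp
 qed
 then have "\<beta> < e" using e by linarith
 then show ?thesis using attain that by blast
qed

text \<open>Replace \<open>\<zeta>\<close> by an equivalent \<open>g\<close> of small energy. Its twisted averages are bounded by the Birkhoff averages of
\<open>|g|\<close>, which converge uniformly. This upgrades weak convergence to uniform convergence.\<close>

lemma \<zeta>sum_sublinear:
 assumes e: "e > 0"
 obtains N0 where "\<And>N x. N \<ge> N0 ==> cmod (\<zeta>sum N x) \<le> e * real N"
proof -
 define d where "d = e / 3"
 have d: "d > 0" using e by (simp add: d_def)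
 have "d\<^sup>2 > 0" using d by simp
 then obtain g where g: "g \<in> same_tavg" "energy g < d\<^sup>2" using small_energy by blast
 have cp: "continuous_on UNIV g" "periodic g" by (rule same_tavgD(1)[OF g(1)], rule same_tavgD(2)[OF g(1)])
 have cn: "continuous_on UNIV (\<lambda>x. cmod (g x))" "periodic (\<lambda>x. cmod (g x))"
  using cp by (auto intro!: continuous_intros simp: periodic_def)
 have cq: "continuous_on UNIV (\<lambda>x. (cmod (g x))\<^sup>2)" "periodic (\<lambda>x. (cmod (g x))\<^sup>2)"
  using cp by (auto intro!: continuous_intros simp: periodic_def)
 have cq': "continuous_on UNIV (\<lambda>x. 1 / (2 * d) * (cmod (g x))\<^sup>2)" "periodic (\<lambda>x. 1 / (2 * d) * (cmod (g x))\<^sup>2)"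
  using cq d by (auto intro!: continuous_intros simp: periodic_def)
 have m: "mean \<alpha> (\<lambda>x. cmod (g x)) \<le> d"
 proof -
  have "mean \<alpha> (\<lambda>x. cmod (g x)) \<le> mean \<alpha> (\<lambda>x. 1 / (2 * d) * (cmod (g x))\<^sup>2 + d / 2)"
  proof (rule mean_mono[OF syn cn])
   show "cmod (g x) \<le> 1 / (2 * d) * (cmod (g x))\<^sup>2 + d / 2" for x
    using sum_squares_bound[of "cmod (g x)" d] d by (simp add: field_simps power2_eq_square)
  qed (use cq' in \<open>auto intro!: continuous_intros simp: periodic_def\<close>)
  also have "\<dots> = mean \<alpha> (\<lambda>x. 1 / (2 * d) * (cmod (g x))\<^sup>2) + mean \<alpha> (\<lambda>x. d / 2)"
   by (rule mean_add[OF syn cq']) (auto simp: periodic_def)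
  also have "\<dots> = 1 / (2 * d) * energy g + d / 2"
   unfolding energy_def mean_const mean_linear[OF syn cq bounded_linear_mult_right] ..
  also have "\<dots> \<le> 1 / (2 * d) * d\<^sup>2 + d / 2" using g(2) d by (intro add_right_mono mult_left_mono) auto
  also have "\<dots> = d" using d by (simp add: power2_eq_square)
  finally show ?thesis .
 qed
 obtain N1 where N1: "\<And>N x. N \<ge> N1 ==> cmod (tavg N g x - tavg N \<zeta> x) \<le> d"
  using same_tavgD(3)[OF g(1) d] by (elim exE) blast
 obtain N2 where "N2 > 0" and N2: "\<And>N x. N \<ge> N2 ==> norm (birkhoff \<alpha> N (\<lambda>x. cmod (g x)) x - mean \<alpha> (\<lambda>x. cmod (g x))) \<le> d"
  using birkhoff_tendsto_mean[OF syn cn d] by blast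
 show ?thesis
 proof (rule that[of "Suc (max N1 N2)"])
  fix N x assume N: "N \<ge> Suc (max N1 N2)"
  have "\<bar>birkhoff \<alpha> N (\<lambda>x. cmod (g x)) x - mean \<alpha> (\<lambda>x. cmod (g x))\<bar> \<le> d"
   using N2[of N x] N by simp
  moreover have "cmod (tavg N g x - tavg N \<zeta> x) \<le> d" using N1[of N x] N by simp
  ultimately have "cmod (tavg N \<zeta> x) \<le> 3 * d"
   using norm_tavg_le_birkhoff[of N g x] m norm_triangle_ineq4[of "tavg N g x" "tavg N g x - tavg N \<zeta> x"] by simp
  then show "cmod (\<zeta>sum N x) \<le> e * real N"
   using N by (simp add: tavg_\<zeta> norm_divide d_def pos_divide_le_eq)
 qed
qed

text \<open>The left hand side is the minimum over unit vectors \<open>v\<close> of the speed at which \<open>iter N\<close> turns \<open>v\<close>. In the frame the speed is at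
least \<open>\<sigma>sum N - |\<zeta>sum N|\<close> times the squared length, and the first term grows linearly while the second does not.\<close>

theorem monotone_iterate:
 obtains N c where "N > 0" "c > 0"
  "\<And>x. Im (fst (cm_inv (iter N x) \<odot> iter' N x)) - cmod (snd (cm_inv (iter N x) \<odot> iter' N x)) \<ge> c"
proof -
 obtain b C where b: "b \<ge> 1" "\<And>x. cm_norm (B x) \<le> b"
  and "C > 0" "\<And>x. \<bar>\<sigma> x\<bar> \<le> C" "\<And>x. cmod (\<zeta> x) \<le> C"
  using frame_bounds by blast
 define s where "s = mean \<alpha> \<sigma>"
 have s: "s > 0" using lw by (simp add: s_def mean_\<sigma>)
 have s4: "s / 4 > 0" using s by simp
 obtain N1 where N1: "\<And>N x. N \<ge> N1 ==> cmod (\<zeta>sum N x) \<le> s / 4 * real N" using \<zeta>sum_sublinear[OF s4] by blast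
 obtain N2 where "N2 > 0" and N2: "\<And>N x. N \<ge> N2 ==> norm (birkhoff \<alpha> N \<sigma> x - mean \<alpha> \<sigma>) \<le> s / 4"
  using birkhoff_tendsto_mean[OF syn \<sigma> s4] by blast
 define N where "N = Suc (max N1 N2)"
 have N: "N \<ge> N1" "N \<ge> N2" "real N \<ge> 1" by (auto simp: N_def)
 have pos: "\<sigma>sum N x - cmod (\<zeta>sum N x) \<ge> s / 4" for x
 proof -
  have "birkhoff \<alpha> N \<sigma> x \<ge> 3 * s / 4" using N2[OF N(2), of x] unfolding s_def real_norm_def by linarith
  then have "\<sigma>sum N x \<ge> real N * (3 * s / 4)" unfolding \<sigma>sum_birkhoff by (intro mult_left_mono) auto
  then have "\<sigma>sum N x - cmod (\<zeta>sum N x) \<ge> real N * (s / 2)" using N1[OF N(1), of x] by (simp add: field_simps)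
  moreover have "1 * (s / 4) \<le> real N * (s / 2)" using N(3) s by (intro mult_mono) auto
  ultimately show ?thesis by linarith
 qed
 show ?thesis
 proof (rule that[of N "s / 4 / b\<^sup>2"])
  show "N > 0" by (simp add: N_def)
  show "s / 4 / b\<^sup>2 > 0" using s b by simp
  fix x
  define X where "X = cm_inv (B x) \<odot> velsum N x \<odot> B x"
  have X: "cm_inv (iter N x) \<odot> iter' N x = X"
   unfolding iter'_def X_def cm_assoc[symmetric] by (simp add: cm_inv_left det_iter)
  \<comment> \<open>the direction in which the form \<open>Im (cnj v * cm_app X v)\<close> is smallest\<close>
  define v where "v = cis ((Arg (snd X) + pi / 2) / 2)"
  have v1: "cmod v = 1" by (simp add: v_def)
  have "snd X * (cnj v)\<^sup>2 = of_real (cmod (snd X)) * (cis (Arg (snd X)) * (cnj v)\<^sup>2)"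
   by (metis (no_types) Arg_zero cis_Arg mult.assoc norm_zero of_real_0 rcis_cmod_Arg rcis_def)
  also have "cis (Arg (snd X)) * (cnj v)\<^sup>2 = cis (- (pi / 2))"
   by (simp add: v_def cis_cnj power2_eq_square cis_mult)
  also have "\<dots> = - \<i>" using cis_cnj[of "pi / 2"] by simp
  finally have Xv: "snd X * (cnj v)\<^sup>2 = - \<i> * of_real (cmod (snd X))" by simp
  have Im1: "Im (cnj z * cm_app F z) = Im (fst F) * (cmod z)\<^sup>2 + Im (snd F * (cnj z)\<^sup>2)" if "Re (fst F) = 0" for F z
   unfolding cm_app_def cmod_power2 using that by (simp add: power2_eq_square algebra_simps)
  have reX: "Re (fst X) = 0"
   unfolding X_def cm_mult_def cm_inv_def velsum_def by (simp add: algebra_simps)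
  have a: "Im (fst X) - cmod (snd X) = Im (cnj v * cm_app X v)"
   unfolding Im1[OF reX] Xv v1 by simp
  define h where "h = cm_app (B x) v"
  have vh: "v = cm_app (cm_inv (B x)) h" unfolding h_def cm_app_mult[symmetric] cm_inv_left[OF detB] by simp
  have "cm_app X v = cm_app (cm_inv (B x)) (cm_app (velsum N x) h)" unfolding X_def h_def cm_app_mult ..
  then have "Im (cnj v * cm_app X v) = Im (cnj h * cm_app (velsum N x) h)"
   by (subst (1) vh) (simp only: cm_symplectic cm_det_inv detB mult_1)
  also have "\<dots> = \<sigma>sum N x * (cmod h)\<^sup>2 + Im (\<zeta>sum N x * (cnj h)\<^sup>2)"
   by (subst Im1) (simp_all add: velsum_def)
  also have "\<dots> \<ge> \<sigma>sum N x * (cmod h)\<^sup>2 - cmod (\<zeta>sum N x) * (cmod h)\<^sup>2"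
  proof -
   have "\<bar>Im (\<zeta>sum N x * (cnj h)\<^sup>2)\<bar> \<le> cmod (\<zeta>sum N x) * (cmod h)\<^sup>2"
    using abs_Im_le_cmod[of "\<zeta>sum N x * (cnj h)\<^sup>2"] unfolding norm_mult norm_power complex_mod_cnj .
   then show ?thesis by linarith
  qed
  finally have 1: "Im (fst X) - cmod (snd X) \<ge> (\<sigma>sum N x - cmod (\<zeta>sum N x)) * (cmod h)\<^sup>2"
   unfolding a by (simp add: algebra_simps)
  have "1 \<le> b * cmod h" using cm_app_norm_le[of "cm_inv (B x)" b h "cmod h"] b(2)[of x] v1 vh by simp
  then have "1 \<le> (b * cmod h)\<^sup>2" by simp
  then have "1 / b\<^sup>2 \<le> (cmod h)\<^sup>2" using b(1) by (simp add: pos_divide_le_eq power_mult_distrib mult.commute)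
  then have "s / 4 * (1 / b\<^sup>2) \<le> (\<sigma>sum N x - cmod (\<zeta>sum N x)) * (cmod h)\<^sup>2"
   using pos[of x] s by (intro mult_mono) auto
  then show "s / 4 / b\<^sup>2 \<le> Im (fst (cm_inv (iter N x) \<odot> iter' N x)) - cmod (snd (cm_inv (iter N x) \<odot> iter' N x))"
   unfolding X using 1 by simp
 qed
qed

end

section \<open>Fourier series\<close>

definition l1 :: "real^'d \<Rightarrow> real" where
 "l1 k = (\<Sum>i\<in>UNIV. \<bar>k $ i\<bar>)"

lemma l1_nonneg: "l1 k \<ge> 0"
 by (simp add: l1_def sum_nonneg)

lemma inner_le_l1: "\<bar>k \<bullet> v\<bar> \<le> l1 k * norm v"
proof -
 have "\<bar>k \<bullet> v\<bar> \<le> (\<Sum>i\<in>UNIV. \<bar>k $ i * v $ i\<bar>)" unfolding inner_vec_def by (simp add: sum_abs)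
 also have "\<dots> \<le> (\<Sum>i\<in>UNIV. \<bar>k $ i\<bar> * norm v)"
  by (intro sum_mono) (simp add: abs_mult component_le_norm_cart mult_left_mono)
 finally show ?thesis by (simp add: l1_def sum_distrib_right)
qed

lemma summable_on_int_inverse_square: "(\<lambda>n::int. inverse ((1 + \<bar>real_of_int n\<bar>)\<^sup>2)) summable_on UNIV"
proof -
 let ?f = "\<lambda>n::int. inverse ((1 + \<bar>real_of_int n\<bar>)\<^sup>2)"
 have s: "summable (\<lambda>n. inverse ((real (Suc n)) ^ 2))"
  using inverse_power_summable[of 2, where 'a = real] by (subst summable_Suc_iff) simp
 have 1: "(\<lambda>n::nat. inverse ((1 + real n)\<^sup>2)) summable_on UNIV"
  by (rule norm_summable_imp_summable_on) (use s in \<open>simp add: add.commute\<close>)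
 have 2: "(\<lambda>n::nat. inverse ((2 + real n)\<^sup>2)) summable_on UNIV"
 proof (rule norm_summable_imp_summable_on)
  have "summable (\<lambda>n. inverse ((real (Suc (Suc n))) ^ 2))" using s by (subst summable_Suc_iff)
  then show "summable (\<lambda>n. norm (inverse ((2 + real n)\<^sup>2)))" by (simp add: add.commute)
 qed
 have a: "?f summable_on (int ` UNIV)"
  by (subst summable_on_reindex) (use 1 in \<open>auto simp: o_def\<close>)
 have b: "?f summable_on ((\<lambda>n. - int (Suc n)) ` UNIV)"
  by (subst summable_on_reindex) (use 2 in \<open>auto simp: o_def inj_on_def add_ac\<close>)
 have "UNIV = int ` UNIV \<union> (\<lambda>n. - int (Suc n)) ` UNIV"
  using int_cases by blast
 moreover have "int ` UNIV \<inter> (\<lambda>n. - int (Suc n)) ` UNIV = {}" by auto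
 ultimately show ?thesis using summable_on_Un_disjoint[OF a b] by simp
qed

lemma summable_on_lattice_product:
 fixes a :: "real \<Rightarrow> real"
 assumes a: "(\<lambda>n::int. a (of_int n)) summable_on UNIV" and nn: "\<And>x. a x \<ge> 0"
 shows "(\<lambda>k::real^'d. \<Prod>i\<in>UNIV. a (k $ i)) summable_on Collect int_vec"
proof -
 have "Infinite_Sum.abs_summable_on (\<lambda>n::int. a (of_int n)) UNIV" using a nn by simp
 then have 1: "Infinite_Set_Sum.abs_summable_on (\<lambda>n::int. a (of_int n)) UNIV"
  by (simp only: abs_summable_equivalent)
 have "Infinite_Set_Sum.abs_summable_on (\<lambda>g::'d \<Rightarrow> int. \<Prod>i\<in>UNIV. a (of_int (g i))) (PiE UNIV (\<lambda>_. UNIV))"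
  by (rule abs_summable_on_prod_PiE[where f = "\<lambda>_ n. a (of_int n)"]) (use 1 in auto)
 then have "Infinite_Sum.abs_summable_on (\<lambda>g::'d \<Rightarrow> int. \<Prod>i\<in>UNIV. a (of_int (g i))) UNIV"
  by (simp only: abs_summable_equivalent PiE_UNIV_domain Pi_UNIV)
 then have 2: "(\<lambda>g::'d \<Rightarrow> int. \<Prod>i\<in>UNIV. a (of_int (g i))) summable_on UNIV"
  using nn by (simp add: prod_nonneg)
 have "bij_betw (\<lambda>g::'d \<Rightarrow> int. (\<chi> i. of_int (g i)) :: real^'d) UNIV (Collect int_vec)"
 proof (rule bij_betwI[where g = "\<lambda>k i. \<lfloor>k $ i\<rfloor>"])
  show "(\<lambda>g. \<chi> i. of_int (g i)) \<in> UNIV \<rightarrow> Collect int_vec" by (auto simp: int_vec_def)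
  show "(\<chi> i. of_int \<lfloor>k $ i\<rfloor>) = k" if "k \<in> Collect int_vec" for k :: "real^'d"
   using that by (auto simp: int_vec_def vec_eq_iff elim!: Ints_cases dest!: spec)
 qed auto
 from summable_on_reindex_bij_betw[OF this, of "\<lambda>k. \<Prod>i\<in>UNIV. a (k $ i)"] show ?thesis using 2 by simp
qed

lemma summable_on_lattice_power:
 "(\<lambda>k::real^'d. inverse ((1 + l1 k) ^ (2 * CARD('d)))) summable_on Collect int_vec"
proof (rule summable_on_comparison_test)
 show "(\<lambda>k::real^'d. \<Prod>i\<in>UNIV. inverse ((1 + \<bar>k $ i\<bar>)\<^sup>2)) summable_on Collect int_vec"
  by (rule summable_on_lattice_product[OF summable_on_int_inverse_square]) simp
 fix k :: "real^'d"
 have "(\<Prod>i\<in>UNIV. (1 + \<bar>k $ i\<bar>)\<^sup>2) \<le> (\<Prod>i::'d\<in>UNIV. (1 + l1 k)\<^sup>2)"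
 proof (rule prod_mono, intro conjI power_mono)
  show "1 + \<bar>k $ i\<bar> \<le> 1 + l1 k" for i
   using member_le_sum[of i UNIV "\<lambda>i. \<bar>k $ i\<bar>"] by (simp add: l1_def)
 qed auto
 then have le: "(\<Prod>i\<in>UNIV. (1 + \<bar>k $ i\<bar>)\<^sup>2) \<le> (1 + l1 k) ^ (2 * CARD('d))" by (simp add: power_mult)
 have "(\<Prod>i\<in>UNIV. (1 + \<bar>k $ i\<bar>)\<^sup>2) > 0" by (intro prod_pos) (auto intro!: zero_less_power)
 then show "inverse ((1 + l1 k) ^ (2 * CARD('d))) \<le> (\<Prod>i\<in>UNIV. inverse ((1 + \<bar>k $ i\<bar>)\<^sup>2))"
  using le_imp_inverse_le[OF le] by (simp add: prod_inversef[symmetric] o_def)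
 show "0 \<le> inverse ((1 + l1 k) ^ (2 * CARD('d)))" using l1_nonneg[of k] by simp
qed

lemma summable_on_lattice_decay:
 fixes c :: "real^'d \<Rightarrow> 'a::real_normed_vector"
 assumes "\<And>k. int_vec k ==> (1 + l1 k) ^ (2 * CARD('d)) * norm (c k) \<le> K"
 shows "(\<lambda>k. norm (c k)) summable_on Collect int_vec"
proof (rule summable_on_comparison_test)
 show "(\<lambda>k::real^'d. K * inverse ((1 + l1 k) ^ (2 * CARD('d)))) summable_on Collect int_vec"
  by (intro summable_on_cmult_right summable_on_lattice_power)
 fix k :: "real^'d" assume "k \<in> Collect int_vec"
 moreover have "(1 + l1 k) ^ (2 * CARD('d)) > 0" using l1_nonneg[of k] by (intro zero_less_power) linarith
 ultimately show "norm (c k) \<le> K * inverse ((1 + l1 k) ^ (2 * CARD('d)))"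
  using assms[of k] by (simp add: divide_inverse[symmetric] pos_le_divide_eq mult.commute)
qed simp

definition series :: "(real^'d \<Rightarrow> complex) \<Rightarrow> real^'d \<Rightarrow> complex" where
 "series c x = (\<Sum>\<^sub>\<infinity>k\<in>Collect int_vec. c k * chi k x)"

lemma series_summable:
 assumes "(\<lambda>k. norm (c k)) summable_on Collect int_vec"
 shows "(\<lambda>k. c k * chi k x) summable_on Collect int_vec" "(\<lambda>k. norm (c k * chi k x)) summable_on Collect int_vec"
proof -
 show 1: "(\<lambda>k. norm (c k * chi k x)) summable_on Collect int_vec" using assms by (simp add: norm_mult)
 show "(\<lambda>k. c k * chi k x) summable_on Collect int_vec" by (rule abs_summable_summable[OF 1])
qed

lemma series_uniform:
 assumes "(\<lambda>k. norm (c k)) summable_on Collect int_vec"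
 shows "uniform_limit UNIV (\<lambda>F x. \<Sum>k\<in>F. c k * chi k x) (series c) (finite_subsets_at_top (Collect int_vec))"
 unfolding series_def[abs_def]
 by (rule Weierstrass_m_test_general[OF _ assms]) (simp add: norm_mult)

lemma series_continuous:
 assumes "(\<lambda>k. norm (c k)) summable_on Collect int_vec"
 shows "continuous_on UNIV (series c)"
 by (rule uniform_limit_theorem[OF _ series_uniform[OF assms]])
   (auto intro!: always_eventually continuous_intros continuous_chi)

lemma series_periodic: "periodic (series c)"
 unfolding periodic_def series_def
 by (auto intro!: infsum_cong simp: periodicD[OF periodic_chi])

lemma mean_chi:
 assumes syn: "syndetic_orbit \<alpha>" and k: "int_vec k"
 shows "mean \<alpha> (chi k) = (if k = 0 then 1 else 0)"
proof (cases "k = 0")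
 case True
 then show ?thesis by (simp add: chi_def[abs_def] mean_const)
next
 case False
 define h where "h = (1 / (2 * (k \<bullet> k))) *\<^sub>R k"
 have "k \<bullet> h = 1/2" using False by (simp add: h_def)
 then have "2 * pi * (k \<bullet> h) = pi" by simp
 then have ch: "chi k h = - 1" by (simp only: chi_def cis_pi)
 have "mean \<alpha> (chi k) = mean \<alpha> (\<lambda>x. chi k (x + h))"
  by (rule mean_shift[OF syn continuous_chi periodic_chi[OF k], symmetric])
 also have "\<dots> = mean \<alpha> (\<lambda>x. - chi k x)" by (simp add: chi_add ch)
 also have "\<dots> = - mean \<alpha> (chi k)"
  by (rule mean_linear[OF syn continuous_chi periodic_chi[OF k] bounded_linear_minus[OF bounded_linear_ident]])
 finally show ?thesis using False by simp
qed

lemma fcoeff_series: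
 assumes syn: "syndetic_orbit \<alpha>" and c: "(\<lambda>k. norm (c k)) summable_on Collect int_vec" and k: "int_vec k"
 shows "fcoeff \<alpha> (series c) k = c k"
proof -
 have fin: "fcoeff \<alpha> (\<lambda>x. \<Sum>j\<in>F. c j * chi j x) k = (\<Sum>j\<in>F. if j = k then c j else 0)"
  if "finite F" "F \<subseteq> Collect int_vec" for F
  using that
 proof (induction F rule: finite_induct)
  case empty then show ?case by (simp add: fcoeff_def mean_const)
 next
  case (insert j F)
  let ?S = "\<lambda>x. \<Sum>j\<in>F. c j * chi j x"
  have j: "int_vec j" and F: "F \<subseteq> Collect int_vec" using insert by auto
  have k': "int_vec (- k)" and jk: "int_vec (j - k)" using k j int_vec_minus int_vec_diff by auto
  have "chi j (x + k) = chi j x" if "j \<in> F" "int_vec k" for j x k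
   by (rule periodicD[OF periodic_chi]) (use F that in auto)
  then have p: "periodic ?S" by (simp add: periodic_def)
  have "(\<Sum>j\<in>insert j F. c j * chi j x) * chi (- k) x = c j * chi (j - k) x + ?S x * chi (- k) x" for x
   using insert by (simp add: algebra_simps chi_mult)
  then have "fcoeff \<alpha> (\<lambda>x. \<Sum>j\<in>insert j F. c j * chi j x) k = mean \<alpha> (\<lambda>x. c j * chi (j - k) x + ?S x * chi (- k) x)"
   by (simp only: fcoeff_def)
  also have "\<dots> = mean \<alpha> (\<lambda>x. c j * chi (j - k) x) + fcoeff \<alpha> ?S k"
   unfolding fcoeff_def
   by (rule mean_add[OF syn])
     (use p periodicD[OF periodic_chi[OF jk]] periodicD[OF periodic_chi[OF k']] in
      \<open>auto intro!: continuous_intros continuous_chi simp: periodic_def\<close>)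
  also have "mean \<alpha> (\<lambda>x. c j * chi (j - k) x) = c j * mean \<alpha> (chi (j - k))"
   by (rule mean_linear[OF syn continuous_chi periodic_chi[OF jk] bounded_linear_mult_right])
  finally show ?case using insert F by (auto simp: mean_chi[OF syn jk])
 qed
 have "cmod (fcoeff \<alpha> (series c) k - c k) \<le> 0 + e" if e: "e > 0" for e
 proof -
  have "\<forall>\<^sub>F F in finite_subsets_at_top (Collect int_vec). \<forall>x\<in>UNIV. dist (\<Sum>k\<in>F. c k * chi k x) (series c x) < e"
   by (rule uniform_limitD[OF series_uniform[OF c] e])
  moreover have "\<forall>\<^sub>F F in finite_subsets_at_top (Collect int_vec). finite F \<and> {k} \<subseteq> F \<and> F \<subseteq> Collect int_vec"
   unfolding eventually_finite_subsets_at_top using k by (intro exI[of _ "{k}"]) auto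
  ultimately have "\<forall>\<^sub>F F in finite_subsets_at_top (Collect int_vec). finite F \<and> {k} \<subseteq> F \<and> F \<subseteq> Collect int_vec \<and>
    (\<forall>x\<in>UNIV. dist (\<Sum>k\<in>F. c k * chi k x) (series c x) < e)"
   by eventually_elim auto
  from eventually_happens'[OF finite_subsets_at_top_neq_bot this]
  obtain F where F0: "finite F \<and> {k} \<subseteq> F \<and> F \<subseteq> Collect int_vec \<and> (\<forall>x\<in>UNIV. dist (\<Sum>k\<in>F. c k * chi k x) (series c x) < e)"
   by (elim exE)
  then have F: "finite F" "k \<in> F" "F \<subseteq> Collect int_vec" "dist (\<Sum>k\<in>F. c k * chi k x) (series c x) < e" for x
   by simp_all
  have "cmod (fcoeff \<alpha> (series c) k - fcoeff \<alpha> (\<lambda>x. \<Sum>k\<in>F. c k * chi k x) k) \<le> e"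
  proof (rule fcoeff_diff_le[OF syn series_continuous[OF c] series_periodic _ _ k])
   show "cmod (series c x - (\<Sum>k\<in>F. c k * chi k x)) \<le> e" for x
    using F(4)[of x] by (simp add: dist_norm norm_minus_commute)
   show "periodic (\<lambda>x. \<Sum>k\<in>F. c k * chi k x)"
   proof -
    have "chi j (x + k) = chi j x" if "j \<in> F" "int_vec k" for j x k
     by (rule periodicD[OF periodic_chi]) (use F(3) that in auto)
    then show ?thesis by (simp add: periodic_def)
   qed
  qed (intro continuous_intros continuous_chi)
  moreover have "fcoeff \<alpha> (\<lambda>x. \<Sum>k\<in>F. c k * chi k x) k = c k"
   using fin[OF F(1,3)] F(1,2) by simp
  ultimately show ?thesis by simp
 qed
 then have "cmod (fcoeff \<alpha> (series c) k - c k) \<le> 0" by (rule field_le_epsilon)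
 then show ?thesis by simp
qed

text \<open>If \<open>h z \<noteq> 0\<close>, take a nonnegative trigonometric polynomial \<open>T\<close> that exceeds \<open>1\<close> near \<open>z\<close> and is less than \<open>1\<close> wherever
\<open>h\<close> is far from \<open>h z\<close>. The products \<open>h * T ^ n\<close> all have mean zero, but for large \<open>n\<close> the neighbourhood of \<open>z\<close> dominates.\<close>

lemma fourier_uniqueness:
 fixes h :: "real^'d \<Rightarrow> complex"
 assumes syn: "syndetic_orbit \<alpha>" and h: "continuous_on UNIV h" "periodic h"
  and z: "\<And>k. int_vec k ==> fcoeff \<alpha> h k = 0"
 shows "h z = 0"
proof (rule ccontr)
 assume hz: "h z \<noteq> 0"
 \<comment> \<open>a trigonometric polynomial that vanishes exactly at \<open>z\<close> modulo integers\<close>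
 define D where "D y = (\<Sum>i\<in>UNIV. (1 - cos (2 * pi * ((y - z) $ i))))" for y
 have D0: "D y \<ge> 0" for y unfolding D_def by (intro sum_nonneg) simp
 have D2: "D y \<le> 2 * CARD('d)" for y
 proof -
  have "1 - cos t \<le> 2" for t :: real using cos_ge_minus_one[of t] by linarith
  then have "D y \<le> (\<Sum>i::'d\<in>UNIV. 2)" unfolding D_def by (intro sum_mono)
  then show ?thesis by simp
 qed
 have cD: "continuous_on S D" for S unfolding D_def[abs_def] by (intro continuous_intros)
 have pD: "periodic D"
 proof -
  have "cos (2 * pi * ((x + k - z) $ i)) = cos (2 * pi * ((x - z) $ i))" if "int_vec k" for x k i
  proof -
   have "k $ i \<in> \<int>" using that by (simp add: int_vec_def)
   then obtain n where n: "k $ i = of_int n" by (rule Ints_cases)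
   have "2 * pi * ((x + k - z) $ i) = 2 * pi * ((x - z) $ i) + 2 * pi * of_int n" by (simp add: n algebra_simps)
   then show ?thesis by (simp only: cos_add cos_int_2pin sin_int_2pin mult_1_right mult_zero_right diff_zero)
  qed
  then show ?thesis by (simp add: periodic_def D_def)
 qed
 define R where "R y = Re (cnj (h z) * h y)" for y
 have cR: "continuous_on S R" for S unfolding R_def[abs_def] by (intro continuous_intros continuous_on_subset[OF h(1)]) auto
 have pR: "periodic R" using h(2) by (simp add: periodic_def R_def)
 define q where "q = (cmod (h z))\<^sup>2 / 2"
 have q: "q > 0" using hz by (simp add: q_def)
 have Rz: "R z = 2 * q" unfolding R_def q_def cmod_power2 by (simp add: power2_eq_square)
 obtain c where c: "c > 0" "\<And>y. D y < c ==> R y > q"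
 proof -
  let ?Q = "cbox 0 (\<chi> i. 1) \<inter> {y. R y \<le> q} :: (real^'d) set"
  have "closed {y. R y \<le> q}" using cR[of UNIV] by (intro closed_Collect_le) auto
  then have Qc: "compact ?Q" by (intro compact_Int_closed compact_cbox)
  have Dpos: "D y > 0" if "R y \<le> q" for y
  proof (rule ccontr)
   assume "\<not> D y > 0"
   then have "D y = 0" using D0[of y] by simp
   then have "\<forall>i\<in>UNIV. 1 - cos (2 * pi * ((y - z) $ i)) = 0" unfolding D_def
    by (subst (asm) sum_nonneg_eq_0_iff) auto
   then have "\<forall>i. \<exists>n::int. 2 * pi * ((y - z) $ i) = of_int n * 2 * pi" using cos_one_2pi_int by auto
   then have "int_vec (y - z)" unfolding int_vec_def by (metis Ints_of_int mult.commute mult.assoc mult_cancel_left pi_neq_zero mult_eq_0_iff zero_neq_numeral)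
   then have "R (z + (y - z)) = R z" using periodicD[OF pR] by blast
   then show False using that Rz q by simp
  qed
  obtain c where c: "c > 0" "\<And>y. y \<in> ?Q ==> D y \<ge> c"
  proof (cases "?Q = {}")
   case True then show ?thesis using that[of 1] by auto
  next
   case False
   then obtain y0 where "y0 \<in> ?Q" "\<forall>y\<in>?Q. D y0 \<le> D y" using continuous_attains_inf[OF Qc False cD] by blast
   then show ?thesis using that[of "D y0"] Dpos by auto
  qed
  show ?thesis
  proof (rule that[OF c(1)])
   fix y assume y: "D y < c"
   obtain k where k: "int_vec k" "\<And>i. 0 \<le> (y - k) $ i" "\<And>i. (y - k) $ i < 1" using int_vec_floor_decomp by blast
   have "y - k \<in> cbox 0 (\<chi> i. 1)" using k(2,3) by (auto simp: mem_box_cart less_imp_le)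
   moreover have "D (y - k) = D y" "R (y - k) = R y"
    using periodicD[OF pD k(1), of "y - k"] periodicD[OF pR k(1), of "y - k"] by auto
   ultimately show "R y > q" using c(2)[of "y - k"] y by fastforce
  qed
 qed
 define \<eta> where "\<eta> = 1 / (2 * real CARD('d))"
 have \<eta>: "\<eta> > 0" by (simp add: \<eta>_def)
 define T where "T y = 1 + \<eta> * (c / 2 - D y)" for y
 have T0: "T y \<ge> 0" for y
 proof -
  have "\<eta> * D y \<le> \<eta> * (2 * CARD('d))" using D2 \<eta> by (intro mult_left_mono) auto
  then have "\<eta> * D y \<le> 1" by (simp add: \<eta>_def)
  moreover have "0 \<le> \<eta> * c / 2" using \<eta> c(1) by simp
  ultimately show ?thesis by (simp add: T_def algebra_simps)
 qed
 have cT: "continuous_on S T" for S unfolding T_def[abs_def] by (intro continuous_intros cD)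
 have pT: "periodic T" using pD by (simp add: periodic_def T_def)
 define An where "An = {p :: real^'d \<Rightarrow> complex. continuous_on UNIV p \<and> periodic p \<and> (\<forall>k. int_vec k \<longrightarrow> fcoeff \<alpha> (\<lambda>x. h x * p x) k = 0)}"
 have An_D: "continuous_on UNIV p" "periodic p" "int_vec k ==> fcoeff \<alpha> (\<lambda>x. h x * p x) k = 0" if "p \<in> An" for p k
  using that unfolding An_def by blast+
 have An_lin: "(\<lambda>x. a * p x + b * p' x) \<in> An" if p: "p \<in> An" and p': "p' \<in> An" for p p' a b
 proof -
  have "fcoeff \<alpha> (\<lambda>x. h x * (a * p x + b * p' x)) k = 0" if k: "int_vec k" for k
  proof -
   have k': "int_vec (- k)" using k by (rule int_vec_minus)
   have c0: "continuous_on UNIV (\<lambda>x. h x * p x * chi (- k) x)" "periodic (\<lambda>x. h x * p x * chi (- k) x)"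
     "continuous_on UNIV (\<lambda>x. h x * p' x * chi (- k) x)" "periodic (\<lambda>x. h x * p' x * chi (- k) x)"
    using h(2) An_D(2)[OF p] An_D(2)[OF p'] periodicD[OF periodic_chi[OF k']]
    by (auto intro!: continuous_intros h continuous_chi An_D(1)[OF p] An_D(1)[OF p'] simp: periodic_def)
   have c1: "continuous_on UNIV (\<lambda>x. a * (h x * p x * chi (- k) x))" "periodic (\<lambda>x. a * (h x * p x * chi (- k) x))"
     "continuous_on UNIV (\<lambda>x. b * (h x * p' x * chi (- k) x))" "periodic (\<lambda>x. b * (h x * p' x * chi (- k) x))"
    using c0 by (auto intro!: continuous_on_mult_left simp: periodic_def)
   have "fcoeff \<alpha> (\<lambda>x. h x * (a * p x + b * p' x)) k = mean \<alpha> (\<lambda>x. a * (h x * p x * chi (- k) x) + b * (h x * p' x * chi (- k) x))"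
    by (simp add: fcoeff_def algebra_simps)
   also have "\<dots> = a * fcoeff \<alpha> (\<lambda>x. h x * p x) k + b * fcoeff \<alpha> (\<lambda>x. h x * p' x) k"
    unfolding mean_add[OF syn c1] fcoeff_def
    using mean_linear[OF syn c0(1,2) bounded_linear_mult_right[of a]] mean_linear[OF syn c0(3,4) bounded_linear_mult_right[of b]] by simp
   finally show ?thesis using An_D(3)[OF p k] An_D(3)[OF p' k] by simp
  qed
  moreover have "continuous_on UNIV (\<lambda>x. a * p x + b * p' x)" by (intro continuous_intros An_D(1)[OF p] An_D(1)[OF p'])
  moreover have "periodic (\<lambda>x. a * p x + b * p' x)" using An_D(2)[OF p] An_D(2)[OF p'] by (simp add: periodic_def)
  ultimately show ?thesis unfolding An_def by blast
 qed
 have An_chi: "(\<lambda>x. chi j x * p x) \<in> An" if p: "p \<in> An" and j: "int_vec j" for p j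
 proof -
  have "fcoeff \<alpha> (\<lambda>x. h x * (chi j x * p x)) k = 0" if k: "int_vec k" for k
  proof -
   have e: "h x * (chi j x * p x) * chi (- k) x = h x * p x * chi (- (k - j)) x" for x
   proof -
    have "chi (- (k - j)) x = chi j x * chi (- k) x" by (simp add: chi_mult)
    then show ?thesis by simp
   qed
   have "fcoeff \<alpha> (\<lambda>x. h x * (chi j x * p x)) k = fcoeff \<alpha> (\<lambda>x. h x * p x) (k - j)"
    unfolding fcoeff_def e ..
   then show ?thesis using An_D(3)[OF p int_vec_diff[OF k j]] by simp
  qed
  moreover have "continuous_on UNIV (\<lambda>x. chi j x * p x)" by (intro continuous_intros An_D(1)[OF p] continuous_chi)
  moreover have "periodic (\<lambda>x. chi j x * p x)" using An_D(2)[OF p] periodicD[OF periodic_chi[OF j]] by (simp add: periodic_def)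
  ultimately show ?thesis unfolding An_def by blast
 qed
 have An_cos: "(\<lambda>x. of_real (cos (2 * pi * ((x - z) $ i))) * p x) \<in> An" if p: "p \<in> An" for p i
 proof -
  let ?e = "axis i 1 :: real^'d"
  have e: "int_vec ?e" "int_vec (- ?e)" using int_vec_axis int_vec_minus by auto
  have ip: "?e \<bullet> x = x $ i" for x by (simp add: inner_axis')
  have "of_real (cos (2 * pi * ((x - z) $ i))) = cis (- (2 * pi * z $ i)) / 2 * chi ?e x + cis (2 * pi * z $ i) / 2 * chi (- ?e) x" for x
  proof -
   have "cis (- (2 * pi * z $ i)) * chi ?e x = cis (2 * pi * ((x - z) $ i))"
    by (simp add: chi_def ip cis_mult algebra_simps)
   moreover have "cis (2 * pi * z $ i) * chi (- ?e) x = cis (- (2 * pi * ((x - z) $ i)))"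
    by (simp add: chi_def ip cis_mult algebra_simps)
   ultimately show ?thesis by (simp add: complex_eq_iff)
  qed
  then have eq: "(\<lambda>x. of_real (cos (2 * pi * ((x - z) $ i))) * p x) =
    (\<lambda>x. cis (- (2 * pi * z $ i)) / 2 * (chi ?e x * p x) + cis (2 * pi * z $ i) / 2 * (chi (- ?e) x * p x))"
   by (simp add: algebra_simps)
  show ?thesis unfolding eq by (intro An_lin An_chi p e)
 qed
 have An_sum: "(\<lambda>x. of_real (\<Sum>i\<in>I. cos (2 * pi * ((x - z) $ i))) * p x) \<in> An" if p: "p \<in> An" and "finite I" for p and I :: "'d set"
  using that(2)
 proof (induction I rule: finite_induct)
  case empty then show ?case using An_lin[OF p p, of 0 0] by simp
 next
  case (insert i I)
  then have eq: "(\<lambda>x. of_real (\<Sum>i\<in>insert i I. cos (2 * pi * ((x - z) $ i))) * p x) =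
    (\<lambda>x. 1 * (of_real (cos (2 * pi * ((x - z) $ i))) * p x) + 1 * (of_real (\<Sum>i\<in>I. cos (2 * pi * ((x - z) $ i))) * p x))"
   by (simp add: algebra_simps)
  show ?case unfolding eq by (intro An_lin An_cos p insert.IH)
 qed
 have An_T: "(\<lambda>x. of_real (T x) * p x) \<in> An" if p: "p \<in> An" for p
 proof -
  have Teq: "T x = (1 + \<eta> * c / 2 - \<eta> * CARD('d)) + \<eta> * (\<Sum>i\<in>UNIV. cos (2 * pi * ((x - z) $ i)))" for x
   by (simp add: T_def D_def sum_subtractf algebra_simps)
  have eq: "(\<lambda>x. of_real (T x) * p x) = (\<lambda>x. of_real (1 + \<eta> * c / 2 - \<eta> * CARD('d)) * p x + of_real \<eta> * (of_real (\<Sum>i\<in>UNIV. cos (2 * pi * ((x - z) $ i))) * p x))"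
   by (rule ext) (simp only: Teq of_real_add of_real_mult distrib_right mult.assoc)
  show ?thesis unfolding eq by (intro An_lin An_sum p) auto
 qed
 have An_1: "(\<lambda>x. 1) \<in> An" unfolding An_def using z by (simp add: periodic_def)
 have An_pow: "(\<lambda>x. of_real (T x ^ N)) \<in> An" for N
  by (induction N) (use An_1 An_T in \<open>auto simp: of_real_mult\<close>)
 obtain M where M: "M > 0" "\<And>x. norm (R x) \<le> M" using periodic_bounded[OF cR pR] by blast
 define X where "X y = max 0 (1 - 4 * D y / c)" for y
 have cX: "continuous_on UNIV X" unfolding X_def[abs_def] by (intro continuous_intros cD) (use c in auto)
 have pX: "periodic X" using pD by (simp add: periodic_def X_def)
 define m where "m = mean \<alpha> X"
 have m: "m > 0" unfolding m_def
 proof (rule mean_pos[OF syn cX pX])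
  show "X z > 0" by (simp add: X_def D_def)
 qed (simp add: X_def)
 define b where "b = 1 + \<eta> * c / 4"
 have b: "b > 1" using \<eta> c by (simp add: b_def)
 have bound: "q * b ^ N * m \<le> M" for N
 proof -
  have zero: "mean \<alpha> (\<lambda>x. R x * T x ^ N) = 0"
  proof -
   have cc: "continuous_on UNIV (\<lambda>x. h x * of_real (T x ^ N))" "periodic (\<lambda>x. h x * of_real (T x ^ N))"
    using h(2) pT by (auto intro!: continuous_intros cT h simp: periodic_def)
   have bl: "bounded_linear (\<lambda>y. Re (cnj (h z) * y))"
    by (intro bounded_linear_compose[OF bounded_linear_Re bounded_linear_mult_right])
   have "int_vec (0 :: real^'d)" by (simp add: int_vec_def)
   then have "fcoeff \<alpha> (\<lambda>x. h x * of_real (T x ^ N)) 0 = 0" using An_D(3)[OF An_pow] by blast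
   then have "mean \<alpha> (\<lambda>x. h x * of_real (T x ^ N)) = 0" by (simp add: fcoeff_def chi_def)
   moreover have "R x * T x ^ N = Re (cnj (h z) * (h x * of_real (T x ^ N)))" for x
    unfolding mult.assoc[symmetric] by (simp add: R_def)
   ultimately show ?thesis using mean_linear[OF syn cc bl] by simp
  qed
  have pw: "(q * b ^ N) * X x + (- M) \<le> R x * T x ^ N" for x
  proof (cases "D x < c / 2")
   case True
   then have Rq: "R x > q" using c(2)[of x] c(1) by linarith
   have T1: "T x \<ge> 1" using True \<eta> by (simp add: T_def)
   have "q * b ^ N * X x \<le> q * T x ^ N"
   proof (cases "D x < c / 4")
    case True
    have "\<eta> * (c / 4) \<le> \<eta> * (c / 2 - D x)" using True \<eta> by (intro mult_left_mono) auto
    then have "b \<le> T x" by (simp add: b_def T_def)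
    then have "b ^ N \<le> T x ^ N" using b by (intro power_mono) auto
    moreover have "X x \<le> 1" using D0[of x] c(1) by (simp add: X_def)
    ultimately have "b ^ N * X x \<le> T x ^ N * 1" using b T1 by (intro mult_mono) (auto simp: X_def)
    then show ?thesis using q by (simp add: mult.assoc)
   next
    case False
    then have "X x = 0" using c(1) by (simp add: X_def field_simps)
    then show ?thesis using q T1 by simp
   qed
   also have "q * T x ^ N \<le> R x * T x ^ N" using Rq T1 by (intro mult_right_mono) auto
   finally show ?thesis using M(1) by simp
  next
   case False
   then have "X x = 0" using c(1) by (simp add: X_def field_simps)
   have "\<eta> * (c / 2 - D x) \<le> 0" using False \<eta> by (simp add: mult_le_0_iff)
   then have "T x \<le> 1" by (simp add: T_def)
   then have "T x ^ N \<le> 1" using T0 by (intro power_le_one) auto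
   then have "\<bar>R x * T x ^ N\<bar> \<le> M * 1" unfolding abs_mult using M(2)[of x] T0[of x] by (intro mult_mono) auto
   then show ?thesis using \<open>X x = 0\<close> by simp
  qed
  have c1: "continuous_on UNIV (\<lambda>x. q * b ^ N * X x)" "periodic (\<lambda>x. q * b ^ N * X x)"
   using pX by (auto intro!: continuous_intros cX simp: periodic_def)
  have "mean \<alpha> (\<lambda>x. (q * b ^ N) * X x + (- M)) \<le> mean \<alpha> (\<lambda>x. R x * T x ^ N)"
   by (rule mean_mono[OF syn _ _ _ _ pw]) (use c1 pR pT in \<open>auto intro!: continuous_intros cR cT cX simp: periodic_def\<close>)
  moreover have "mean \<alpha> (\<lambda>x. (q * b ^ N) * X x + (- M)) = mean \<alpha> (\<lambda>x. (q * b ^ N) * X x) + mean \<alpha> (\<lambda>x. - M)"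
   by (rule mean_add[OF syn c1]) (auto simp: periodic_def)
  moreover have "mean \<alpha> (\<lambda>x. (q * b ^ N) * X x) = (q * b ^ N) * m"
   unfolding m_def by (rule mean_linear[OF syn cX pX bounded_linear_mult_right])
  ultimately show ?thesis using zero by (simp add: mean_const)
 qed
 obtain N where "M / (q * m) < b ^ N" using real_arch_pow[OF b] by blast
 then have "M < q * b ^ N * m" using q m by (simp add: pos_divide_less_eq mult_ac)
 then show False using bound[of N] by linarith
qed

lemma fourier_inversion:
 fixes f :: "real^'d \<Rightarrow> complex"
 assumes syn: "syndetic_orbit \<alpha>" and f: "continuous_on UNIV f" "periodic f"
  and c: "(\<lambda>k. norm (fcoeff \<alpha> f k)) summable_on Collect int_vec"
 shows "f = series (fcoeff \<alpha> f)"
proof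
 fix x
 let ?g = "series (fcoeff \<alpha> f)"
 have g: "continuous_on UNIV ?g" "periodic ?g" using series_continuous[OF c] series_periodic by auto
 have "f x - ?g x = 0"
 proof (rule fourier_uniqueness[OF syn])
  show "continuous_on UNIV (\<lambda>x. f x - ?g x)" by (intro continuous_intros f g)
  show "periodic (\<lambda>x. f x - ?g x)" using f g by (simp add: periodic_def)
  fix k :: "real^'d" assume k: "int_vec k"
  note p = periodicD[OF periodic_chi[OF int_vec_minus[OF k]]]
  have c1: "continuous_on UNIV (\<lambda>x. f x * chi (- k) x)" "periodic (\<lambda>x. f x * chi (- k) x)"
   "continuous_on UNIV (\<lambda>x. ?g x * chi (- k) x)" "periodic (\<lambda>x. ?g x * chi (- k) x)"
   using f(2) g(2) p by (auto intro!: continuous_intros f g continuous_chi simp: periodic_def)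
  have c2: "continuous_on UNIV (\<lambda>x. - (?g x * chi (- k) x))" "periodic (\<lambda>x. - (?g x * chi (- k) x))"
   using c1 by (auto intro!: continuous_intros simp: periodic_def)
  have "fcoeff \<alpha> (\<lambda>x. f x - ?g x) k = mean \<alpha> (\<lambda>x. f x * chi (- k) x + - (?g x * chi (- k) x))"
   by (simp add: fcoeff_def algebra_simps)
  also have "\<dots> = fcoeff \<alpha> f k + - fcoeff \<alpha> ?g k"
   unfolding mean_add[OF syn c1(1,2) c2] fcoeff_def[of \<alpha> f k] fcoeff_def[of \<alpha> ?g k]
   using mean_linear[OF syn c1(3,4) bounded_linear_minus[OF bounded_linear_ident]] by simp
  finally show "fcoeff \<alpha> (\<lambda>x. f x - ?g x) k = 0" by (simp add: fcoeff_series[OF syn c k])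
 qed
 then show "f x = ?g x" by simp
qed

section \<open>Regularity of Fourier series\<close>

lemma power_le_fact_exp:
 fixes x :: real assumes "x \<ge> 0" shows "x ^ J \<le> fact J * exp x"
proof -
 have s: "(\<lambda>n. x ^ n / fact n) sums exp x" using exp_converges[of x] by (simp add: divide_inverse mult.commute)
 have "sum (\<lambda>n. x ^ n / fact n) {J} \<le> suminf (\<lambda>n. x ^ n / fact n)"
  by (rule sum_le_suminf) (use s assms in \<open>auto simp: sums_iff\<close>)
 then have "x ^ J / fact J \<le> exp x" using s by (simp add: sums_iff)
 then show ?thesis by (simp add: pos_divide_le_eq mult.commute)
qed

lemma lattice_power_exp_le:
 assumes "s > 0"
 shows "(1 + l1 k) ^ J * exp (- s * l1 k) \<le> fact J * exp s / s ^ J"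
proof -
 have "(s * (1 + l1 k)) ^ J \<le> fact J * exp (s * (1 + l1 k))"
  by (rule power_le_fact_exp) (use assms l1_nonneg[of k] in auto)
 then have "(s * (1 + l1 k)) ^ J * exp (- s * l1 k) \<le> fact J * exp (s * (1 + l1 k)) * exp (- s * l1 k)"
  by (intro mult_right_mono) auto
 also have "\<dots> = fact J * exp s" by (simp add: mult.assoc exp_add[symmetric] algebra_simps)
 finally have "s ^ J * ((1 + l1 k) ^ J * exp (- s * l1 k)) \<le> fact J * exp s"
  by (simp add: power_mult_distrib mult.assoc)
 then show ?thesis using assms by (simp add: pos_le_divide_eq mult.commute)
qed

text \<open>Decay faster than every power, the Fourier side of smoothness.\<close>

definition rapid :: "(real^'d \<Rightarrow> complex) \<Rightarrow> bool" where
 "rapid c \<longleftrightarrow> (\<forall>J. \<exists>K. \<forall>k. int_vec k \<longrightarrow> (1 + l1 k) ^ J * cmod (c k) \<le> K)"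

lemma rapid_summable: "rapid c ==> (\<lambda>k. norm (c k)) summable_on Collect int_vec"
 unfolding rapid_def by (metis summable_on_lattice_decay)

lemma rapid_derivative:
 assumes "rapid c" shows "rapid (\<lambda>k. 2 * pi * \<i> * (k \<bullet> v) * c k)"
 unfolding rapid_def
proof
 fix J
 obtain K where K: "\<And>k. int_vec k ==> (1 + l1 k) ^ Suc J * cmod (c k) \<le> K"
  using assms unfolding rapid_def by blast
 show "\<exists>K. \<forall>k. int_vec k \<longrightarrow> (1 + l1 k) ^ J * cmod (2 * pi * \<i> * (k \<bullet> v) * c k) \<le> K"
 proof (intro exI[of _ "2 * pi * norm v * K"] allI impI)
  fix k :: "real^'a" assume k: "int_vec k"
  have "\<bar>k \<bullet> v\<bar> \<le> (1 + l1 k) * norm v"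
   using inner_le_l1[of k v] by (simp add: algebra_simps add_increasing)
  then have "((1 + l1 k) ^ J * cmod (c k) * (2 * pi)) * \<bar>k \<bullet> v\<bar> \<le> ((1 + l1 k) ^ J * cmod (c k) * (2 * pi)) * ((1 + l1 k) * norm v)"
   using l1_nonneg[of k] by (intro mult_left_mono) auto
  also have "\<dots> = 2 * pi * norm v * ((1 + l1 k) ^ Suc J * cmod (c k))" by simp
  also have "\<dots> \<le> 2 * pi * norm v * K" using K[OF k] by (intro mult_left_mono) auto
  finally show "(1 + l1 k) ^ J * cmod (2 * pi * \<i> * (k \<bullet> v) * c k) \<le> 2 * pi * norm v * K"
   by (simp add: norm_mult mult_ac)
 qed
qed

lemma cis_second_order: "cmod (cis \<theta> - 1 - \<i> * \<theta>) \<le> \<theta>\<^sup>2"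
proof -
 have ci: "cmod (cis t - 1) \<le> \<bar>t\<bar>" for t
 proof -
  have "cmod (cis t - 1) = 2 * \<bar>sin (t / 2)\<bar>" using dist_exp_i_1[of t] by (simp add: cis_conv_exp)
  also have "\<dots> \<le> 2 * \<bar>t / 2\<bar>" using abs_sin_x_le_abs_x[of "t / 2"] by simp
  finally show ?thesis by simp
 qed
 have d: "((\<lambda>s. cis (s * \<theta>)) has_vector_derivative (\<i> * \<theta> * cis (s * \<theta>))) (at s within {0..1})" for s
 proof -
  have "((\<lambda>s. exp (of_real s * (\<i> * of_real \<theta>)) :: complex) has_vector_derivative (\<i> * \<theta> * exp (of_real s * (\<i> * of_real \<theta>)))) (at s within {0..1})"
   by (rule has_vector_derivative_real_field) (auto intro!: derivative_eq_intros)
  then show ?thesis by (simp add: cis_conv_exp mult_ac)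
 qed
 have "cmod (cis (1 * \<theta>) - cis (0 * \<theta>) - (1 - 0) *\<^sub>R (\<i> * \<theta> * cis (0 * \<theta>))) \<le> norm (1 - 0 :: real) * \<theta>\<^sup>2"
 proof (rule vector_differentiable_bound_linearization[where S = "{0..1}" and f' = "\<lambda>s. \<i> * \<theta> * cis (s * \<theta>)" and ?x0.0 = 0])
  show "cmod (\<i> * \<theta> * cis (s * \<theta>) - \<i> * \<theta> * cis (0 * \<theta>)) \<le> \<theta>\<^sup>2" if "s \<in> {0..1}" for s
  proof -
   have "\<i> * \<theta> * cis (s * \<theta>) - \<i> * \<theta> * cis (0 * \<theta>) = \<i> * \<theta> * (cis (s * \<theta>) - 1)" by (simp add: algebra_simps)
   then have "cmod (\<i> * \<theta> * cis (s * \<theta>) - \<i> * \<theta> * cis (0 * \<theta>)) = \<bar>\<theta>\<bar> * cmod (cis (s * \<theta>) - 1)"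
    by (simp add: norm_mult)
   also have "\<dots> \<le> \<bar>\<theta>\<bar> * \<bar>s * \<theta>\<bar>" using ci by (intro mult_left_mono) auto
   also have "\<dots> \<le> \<bar>\<theta>\<bar> * (1 * \<bar>\<theta>\<bar>)" unfolding abs_mult using that by (intro mult_left_mono mult_right_mono) auto
   also have "\<dots> = \<theta>\<^sup>2" by (simp add: power2_eq_square)
   finally show ?thesis .
  qed
 qed (use d in \<open>auto simp: closed_segment_eq_real_ivl\<close>)
 then show ?thesis by simp
qed

lemma chi_second_order: "cmod (chi k (x + v) - chi k x - 2 * pi * \<i> * (k \<bullet> v) * chi k x) \<le> (2 * pi * (k \<bullet> v))\<^sup>2"
proof -
 have "chi k (x + v) - chi k x - 2 * pi * \<i> * (k \<bullet> v) * chi k x = chi k x * (cis (2 * pi * (k \<bullet> v)) - 1 - \<i> * of_real (2 * pi * (k \<bullet> v)))"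
 proof -
  define \<theta> where "\<theta> = 2 * pi * (k \<bullet> v)"
  have e: "2 * pi * \<i> * (k \<bullet> v) = \<i> * of_real \<theta>" by (simp add: \<theta>_def)
  have "chi k v = cis \<theta>" by (simp add: chi_def \<theta>_def)
  then show ?thesis unfolding e chi_add \<theta>_def[symmetric] by (simp add: algebra_simps)
 qed
 then show ?thesis using cis_second_order[of "2 * pi * (k \<bullet> v)"] by (simp only: norm_mult norm_chi mult_1)
qed

lemma has_derivative_quadratic:
 fixes f :: "'a::real_normed_vector \<Rightarrow> 'b::real_normed_vector"
 assumes L: "bounded_linear L" and q: "\<And>v. norm (f (x + v) - f x - L v) \<le> K * (norm v)\<^sup>2"
 shows "(f has_derivative L) (at x)"
 unfolding has_derivative_within_alt
proof (intro conjI allI impI L)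
 fix e :: real assume e: "e > 0"
 show "\<exists>d>0. \<forall>y\<in>UNIV. norm (y - x) < d \<longrightarrow> norm (f y - f x - L (y - x)) \<le> e * norm (y - x)"
 proof (intro exI[of _ "e / (\<bar>K\<bar> + 1)"] conjI ballI impI)
  show "e / (\<bar>K\<bar> + 1) > 0" using e by (simp add: add_nonneg_pos)
  fix y assume y: "norm (y - x) < e / (\<bar>K\<bar> + 1)"
  have "norm (y - x) * (\<bar>K\<bar> + 1) \<le> e" using y by (simp add: pos_less_divide_eq add_nonneg_pos less_imp_le)
  then have "norm (y - x) * \<bar>K\<bar> + norm (y - x) \<le> e" by (simp only: distrib_left mult_1_right)
  then have "\<bar>K\<bar> * norm (y - x) \<le> e" using norm_ge_zero[of "y - x"] by (subst mult.commute) linarith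
  then have "\<bar>K\<bar> * norm (y - x) * norm (y - x) \<le> e * norm (y - x)" by (intro mult_right_mono) auto
  moreover have "K * (norm (y - x))\<^sup>2 \<le> \<bar>K\<bar> * norm (y - x) * norm (y - x)"
   by (simp add: power2_eq_square mult.assoc mult_right_mono)
  moreover have "norm (f y - f x - L (y - x)) \<le> K * (norm (y - x))\<^sup>2" using q[of "y - x"] by simp
  ultimately show "norm (f y - f x - L (y - x)) \<le> e * norm (y - x)" by linarith
 qed
qed

lemma series_add:
 assumes "(\<lambda>k. norm (c k)) summable_on Collect int_vec" "(\<lambda>k. norm (d k)) summable_on Collect int_vec"
 shows "series (\<lambda>k. c k + d k) x = series c x + series d x"
 unfolding series_def using infsum_add[OF series_summable(1)[OF assms(1)] series_summable(1)[OF assms(2)]]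
 by (simp only: distrib_right)

lemma series_cmult: "series (\<lambda>k. a * c k) x = a * series c x"
 unfolding series_def by (simp add: infsum_cmult_right' mult.assoc)

text \<open>The second order Taylor remainder of each exponential is bounded by the square of its frequency, which rapid decay can absorb.\<close>

lemma series_has_derivative:
 assumes c: "rapid c"
 shows "(series c has_derivative (\<lambda>v. series (\<lambda>k. 2 * pi * \<i> * (k \<bullet> v) * c k) x)) (at x)"
proof -
 let ?d = "\<lambda>v k. 2 * pi * \<i> * (k \<bullet> v) * c k"
 obtain K where K: "\<And>k. int_vec k ==> (1 + l1 k) ^ (2 * CARD('a) + 2) * cmod (c k) \<le> K"
  using c unfolding rapid_def by blast
 have s2: "(\<lambda>k. norm (of_real ((1 + l1 k)\<^sup>2) * c k)) summable_on Collect int_vec"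
 proof (rule summable_on_lattice_decay[where K = K])
  fix k :: "real^'a" assume k: "int_vec k"
  have eq: "norm (of_real ((1 + l1 k)\<^sup>2) * c k) = (1 + l1 k)\<^sup>2 * cmod (c k)"
   by (simp only: norm_mult norm_of_real abs_power2)
  show "(1 + l1 k) ^ (2 * CARD('a)) * norm (of_real ((1 + l1 k)\<^sup>2) * c k) \<le> K"
   using K[OF k] unfolding eq power_add by (simp only: mult.assoc)
 qed
 define S where "S = (\<Sum>\<^sub>\<infinity>k\<in>Collect int_vec. norm (of_real ((1 + l1 k)\<^sup>2) * c k))"
 note sc = rapid_summable[OF c] and sd = rapid_summable[OF rapid_derivative[OF c]]
 have lin: "linear (\<lambda>v. series (?d v) x)"
 proof (rule linearI)
  fix v v'
  have "?d (v + v') = (\<lambda>k. ?d v k + ?d v' k)" by (simp add: inner_add_right algebra_simps)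
  then show "series (?d (v + v')) x = series (?d v) x + series (?d v') x" using series_add[OF sd sd] by simp
 next
  fix r v
  have "?d (r *\<^sub>R v) = (\<lambda>k. of_real r * ?d v k)" by (simp add: algebra_simps)
  then show "series (?d (r *\<^sub>R v)) x = r *\<^sub>R series (?d v) x" by (simp only: series_cmult scaleR_conv_of_real)
 qed
 show ?thesis
 proof (rule has_derivative_quadratic[where K = "(2 * pi)\<^sup>2 * S"])
  show "bounded_linear (\<lambda>v. series (?d v) x)" using lin by (simp add: linear_conv_bounded_linear)
  fix v
  let ?t = "\<lambda>k. c k * (chi k (x + v) - chi k x - 2 * pi * \<i> * (k \<bullet> v) * chi k x)"
  have bd: "norm (?t k) \<le> (2 * pi)\<^sup>2 * (norm v)\<^sup>2 * norm (of_real ((1 + l1 k)\<^sup>2) * c k)" for k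
  proof -
   have "\<bar>k \<bullet> v\<bar> \<le> (1 + l1 k) * norm v" using inner_le_l1[of k v] by (simp add: algebra_simps add_increasing)
   then have "\<bar>k \<bullet> v\<bar>\<^sup>2 \<le> ((1 + l1 k) * norm v)\<^sup>2" by (intro power_mono) auto
   then have "(2 * pi)\<^sup>2 * (k \<bullet> v)\<^sup>2 \<le> (2 * pi)\<^sup>2 * ((1 + l1 k)\<^sup>2 * (norm v)\<^sup>2)"
    by (intro mult_left_mono) (auto simp: power_mult_distrib)
   then have "cmod (chi k (x + v) - chi k x - 2 * pi * \<i> * (k \<bullet> v) * chi k x) \<le> (2 * pi)\<^sup>2 * ((1 + l1 k)\<^sup>2 * (norm v)\<^sup>2)"
    using chi_second_order[of k x v] by (simp only: power_mult_distrib)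
   then have "cmod (c k) * cmod (chi k (x + v) - chi k x - 2 * pi * \<i> * (k \<bullet> v) * chi k x) \<le> cmod (c k) * ((2 * pi)\<^sup>2 * ((1 + l1 k)\<^sup>2 * (norm v)\<^sup>2))"
    by (intro mult_left_mono) auto
   then show ?thesis unfolding norm_mult norm_of_real abs_power2 by (simp only: mult_ac)
  qed
  have sb: "(\<lambda>k. (2 * pi)\<^sup>2 * (norm v)\<^sup>2 * norm (of_real ((1 + l1 k)\<^sup>2) * c k)) summable_on Collect int_vec"
   by (rule summable_on_cmult_right[OF s2])
  have st: "(\<lambda>k. norm (?t k)) summable_on Collect int_vec"
   by (rule summable_on_comparison_test[OF sb]) (use bd in auto)
  have eq: "series c (x + v) - series c x - series (?d v) x = (\<Sum>\<^sub>\<infinity>k\<in>Collect int_vec. ?t k)"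
  proof -
   have hs: "((\<lambda>k. f k * chi k y) has_sum series f y) (Collect int_vec)" if "rapid f" for f y
    unfolding series_def by (rule has_sum_infsum[OF series_summable(1)[OF rapid_summable[OF that]]])
   have t: "?t k = (c k * chi k (x + v) + - (c k * chi k x)) + - (?d v k * chi k x)" for k
    by (simp add: right_diff_distrib)
   have "((\<lambda>k. (c k * chi k (x + v) + - (c k * chi k x)) + - (?d v k * chi k x)) has_sum
     (series c (x + v) + - series c x) + - series (?d v) x) (Collect int_vec)"
    by (rule has_sum_add[OF has_sum_add[OF hs[OF c] has_sum_uminusI[OF hs[OF c]]] has_sum_uminusI[OF hs[OF rapid_derivative[OF c]]]])
   from infsumI[OF this] show ?thesis unfolding t by simp
  qed
  have "norm (series c (x + v) - series c x - series (?d v) x) \<le> (\<Sum>\<^sub>\<infinity>k\<in>Collect int_vec. norm (?t k))"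
   unfolding eq by (rule norm_infsum_bound[OF st])
  also have "\<dots> \<le> (\<Sum>\<^sub>\<infinity>k\<in>Collect int_vec. (2 * pi)\<^sup>2 * (norm v)\<^sup>2 * norm (of_real ((1 + l1 k)\<^sup>2) * c k))"
   by (rule infsum_mono[OF st sb bd])
  also have "\<dots> = (2 * pi)\<^sup>2 * S * (norm v)\<^sup>2" unfolding S_def by (simp only: infsum_cmult_right' mult_ac)
  finally show "norm (series c (x + v) - series c x - series (?d v) x) \<le> (2 * pi)\<^sup>2 * S * (norm v)\<^sup>2" .
 qed
qed

lemma differentiable_Ck_series: "rapid c ==> differentiable_Ck n (series c)"
proof (induction n arbitrary: c)
 case 0
 then show ?case using series_continuous[OF rapid_summable] by simp
next
 case (Suc n)
 note d = series_has_derivative[OF Suc.prems]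
 have "series c differentiable (at x)" for x using d differentiable_def by blast
 moreover have "frechet_derivative (series c) (at x) v = series (\<lambda>k. 2 * pi * \<i> * (k \<bullet> v) * c k) x" for x v
  by (simp add: frechet_derivative_at[OF d, symmetric])
 then have "(\<lambda>x. frechet_derivative (series c) (at x) v) = series (\<lambda>k. 2 * pi * \<i> * (k \<bullet> v) * c k)" for v by (rule ext)
 ultimately show ?case using Suc.IH[OF rapid_derivative[OF Suc.prems]] by simp
qed

lemma differentiable_Ck_linear:
 assumes L: "bounded_linear L"
 shows "differentiable_Ck n f ==> differentiable_Ck n (\<lambda>x. L (f x))"
proof (induction n arbitrary: f)
 case 0
 then show ?case using bounded_linear.continuous_on[OF L] by simp
next
 case (Suc n)
 have "f differentiable (at x)" for x using Suc.prems by simp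
 then have d: "(f has_derivative frechet_derivative f (at x)) (at x)" for x
  by (rule frechet_derivative_works[THEN iffD1])
 have dL: "((\<lambda>x. L (f x)) has_derivative (\<lambda>v. L (frechet_derivative f (at x) v))) (at x)" for x
  by (rule bounded_linear.has_derivative[OF L d])
 have "(\<lambda>x. L (f x)) differentiable (at x)" for x using dL differentiable_def by blast
 moreover have "(\<lambda>x. frechet_derivative (\<lambda>x. L (f x)) (at x) v) = (\<lambda>x. L (frechet_derivative f (at x) v))" for v
  by (simp add: frechet_derivative_at[OF dL, symmetric])
 ultimately show ?case using Suc by simp
qed

lemma differentiable_Ck_add:
 "differentiable_Ck n f ==> differentiable_Ck n g ==> differentiable_Ck n (\<lambda>x. f x + g x)"
proof (induction n arbitrary: f g)
 case 0
 then show ?case by (simp add: continuous_on_add)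
next
 case (Suc n)
 have fd: "f differentiable (at x)" and gd: "g differentiable (at x)" for x using Suc.prems by simp_all
 have df: "(f has_derivative frechet_derivative f (at x)) (at x)" for x
  by (rule frechet_derivative_works[THEN iffD1, OF fd])
 have dg: "(g has_derivative frechet_derivative g (at x)) (at x)" for x
  by (rule frechet_derivative_works[THEN iffD1, OF gd])
 have d: "((\<lambda>x. f x + g x) has_derivative (\<lambda>v. frechet_derivative f (at x) v + frechet_derivative g (at x) v)) (at x)" for x
  by (rule has_derivative_add[OF df dg])
 have "(\<lambda>x. f x + g x) differentiable (at x)" for x using d differentiable_def by blast
 moreover have "(\<lambda>x. frechet_derivative (\<lambda>x. f x + g x) (at x) v) = (\<lambda>x. frechet_derivative f (at x) v + frechet_derivative g (at x) v)" for v
  by (simp add: frechet_derivative_at[OF d, symmetric])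
 ultimately show ?case using Suc by simp
qed

lemma prod_exp_has_sum:
 fixes z :: "'d::finite \<Rightarrow> 'a::{real_normed_field,banach,second_countable_topology}"
 shows "((\<lambda>m. \<Prod>i\<in>UNIV. z i ^ m i / fact (m i)) has_sum (\<Prod>i\<in>UNIV. exp (z i))) UNIV"
proof -
 have sn: "(\<lambda>n. norm (x ^ n / fact n)) summable_on UNIV" for x :: 'a
  by (rule norm_summable_imp_summable_on)
    (use summable_norm_exp[of x] in \<open>simp add: norm_divide norm_power divide_inverse norm_mult norm_inverse mult.commute\<close>)
 have hs: "((\<lambda>n. x ^ n / fact n) has_sum exp x) UNIV" for x :: 'a
 proof (rule norm_summable_imp_has_sum)
  show "summable (\<lambda>n. norm (x ^ n / fact n))"
   using summable_norm_exp[of x] by (simp add: norm_divide norm_power divide_inverse norm_mult norm_inverse mult.commute)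
  show "(\<lambda>n. x ^ n / fact n) sums exp x"
   using exp_converges[of x] by (simp add: scaleR_conv_of_real divide_inverse mult.commute of_real_inverse)
 qed
 have "Infinite_Set_Sum.abs_summable_on (\<lambda>n. z i ^ n / fact n) UNIV" for i
  using sn[of "z i"] by (simp only: abs_summable_equivalent)
 then have "Infinite_Set_Sum.abs_summable_on (\<lambda>m. \<Prod>i\<in>UNIV. z i ^ m i / fact (m i)) (PiE UNIV (\<lambda>_. UNIV))"
  by (intro abs_summable_on_prod_PiE[where f = "\<lambda>i n. z i ^ n / fact n"]) auto
 then have "(\<lambda>m. norm (\<Prod>i\<in>UNIV. z i ^ m i / fact (m i))) summable_on UNIV"
  by (simp only: abs_summable_equivalent[symmetric] PiE_UNIV_domain Pi_UNIV)
 then have s: "(\<lambda>m. \<Prod>i\<in>UNIV. z i ^ m i / fact (m i)) summable_on UNIV" by (rule abs_summable_summable)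
 have "infsum (\<lambda>m. \<Prod>i\<in>UNIV. z i ^ m i / fact (m i)) (PiE UNIV (\<lambda>_. UNIV)) = (\<Prod>i\<in>UNIV. infsum (\<lambda>n. z i ^ n / fact n) UNIV)"
  by (rule infsum_prod_PiE_abs[where f = "\<lambda>i n. z i ^ n / fact n"]) (use sn in auto)
 then have "infsum (\<lambda>m. \<Prod>i\<in>UNIV. z i ^ m i / fact (m i)) UNIV = (\<Prod>i\<in>UNIV. exp (z i))"
  using infsumI[OF hs] by (simp add: PiE_UNIV_domain)
 then show ?thesis using has_sum_infsum[OF s] by simp
qed

text \<open>Expand every exponential as a product of one-variable exponential series. Near a point the resulting double family is
absolutely summable because \<open>exp (- \<rho> * l1 k)\<close> beats the majorant of the exponential series, so the order of summation can be exchanged.\<close>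

lemma series_real_analytic:
 fixes c :: "real^'d \<Rightarrow> complex" and L :: "complex \<Rightarrow> 'b::real_normed_vector"
 assumes c: "\<And>k. int_vec k ==> cmod (c k) \<le> K * exp (- \<rho> * l1 k)" and \<rho>: "\<rho> > 0" and L: "bounded_linear L"
 shows "real_analytic (\<lambda>x. L (series c x))"
 unfolding real_analytic_def
proof
 fix x :: "real^'d"
 have K0: "K \<ge> 0"
 proof -
  have "int_vec (0 :: real^'d)" by (simp add: int_vec_def)
  from c[OF this] have "cmod (c 0) \<le> K" by (simp add: l1_def)
  then show ?thesis using norm_ge_zero order_trans by blast
 qed
 let ?Z = "Collect int_vec :: (real^'d) set"
 define r where "r = \<rho> / (4 * pi)"
 have r: "r > 0" using \<rho> by (simp add: r_def)
 have sexp: "(\<lambda>k. exp (- s * l1 k)) summable_on ?Z" if s: "s > 0" for s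
 proof -
  have "(\<lambda>k. norm (exp (- s * l1 k))) summable_on ?Z"
   by (rule summable_on_lattice_decay) (use lattice_power_exp_le[OF s] in auto)
  then show ?thesis by simp
 qed
 define a where "a h k m = c k * chi k x * (\<Prod>i\<in>UNIV. (2 * pi * \<i> * (k $ i) * (h $ i)) ^ m i / fact (m i))"
  for h k :: "real^'d" and m :: "'d \<Rightarrow> nat"
 define b where "b k m = c k * chi k x * (\<Prod>i\<in>UNIV. (2 * pi * \<i> * (k $ i)) ^ m i / fact (m i))"
  for k :: "real^'d" and m :: "'d \<Rightarrow> nat"
 have ab: "a h k m = (\<Prod>i\<in>UNIV. of_real (h $ i) ^ m i) * b k m" for h k m
  unfolding a_def b_def by (simp add: power_mult_distrib prod_dividef prod.distrib mult_ac)
 have expb: "cmod (c k) * (\<Prod>i\<in>UNIV. exp (2 * pi * \<bar>k $ i\<bar> * \<bar>h $ i\<bar>)) \<le> K * exp (- (\<rho> / 2) * l1 k)"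
  if k: "k \<in> ?Z" and h: "\<And>i. \<bar>h $ i\<bar> \<le> r" for h k :: "real^'d"
 proof -
  have "(\<Prod>i\<in>UNIV. exp (2 * pi * \<bar>k $ i\<bar> * \<bar>h $ i\<bar>)) = exp (\<Sum>i\<in>UNIV. 2 * pi * \<bar>k $ i\<bar> * \<bar>h $ i\<bar>)"
   by (simp add: exp_sum)
  also have "\<dots> \<le> exp (\<Sum>i\<in>UNIV. 2 * pi * \<bar>k $ i\<bar> * r)"
   using h by (intro exp_le_cancel_iff[THEN iffD2] sum_mono mult_left_mono) auto
  also have "(\<Sum>i\<in>UNIV. 2 * pi * \<bar>k $ i\<bar> * r) = \<rho> / 2 * l1 k"
   by (simp add: l1_def r_def sum_distrib_left sum_distrib_right[symmetric] sum_divide_distrib[symmetric] mult_ac)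
  finally have "cmod (c k) * (\<Prod>i\<in>UNIV. exp (2 * pi * \<bar>k $ i\<bar> * \<bar>h $ i\<bar>)) \<le> (K * exp (- \<rho> * l1 k)) * exp (\<rho> / 2 * l1 k)"
   using c[of k] k K0 by (intro mult_mono) (auto intro!: prod_nonneg)
  also have "\<dots> = K * exp (- (\<rho> / 2) * l1 k)" by (simp add: mult.assoc exp_add[symmetric] algebra_simps)
  finally show ?thesis .
 qed
 have na: "norm (a h k m) = cmod (c k) * (\<Prod>i\<in>UNIV. (2 * pi * \<bar>k $ i\<bar> * \<bar>h $ i\<bar>) ^ m i / fact (m i))" for h k m
  by (simp add: a_def norm_mult prod_norm[symmetric] norm_divide norm_power abs_mult)
 have sK: "(\<lambda>k. K * exp (- (\<rho> / 2) * l1 k)) summable_on ?Z"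
  by (intro summable_on_cmult_right sexp) (use \<rho> in auto)
 have sa: "(\<lambda>k. a h k m) summable_on ?Z" if h: "\<And>i. \<bar>h $ i\<bar> \<le> r" for h m
 proof (rule abs_summable_summable, rule summable_on_comparison_test[OF sK])
  fix k assume k: "k \<in> ?Z"
  have "(\<Prod>i\<in>UNIV. (2 * pi * \<bar>k $ i\<bar> * \<bar>h $ i\<bar>) ^ m i / fact (m i)) \<le> (\<Prod>i\<in>UNIV. exp (2 * pi * \<bar>k $ i\<bar> * \<bar>h $ i\<bar>))"
   using power_le_fact_exp by (intro prod_mono) (auto simp: pos_divide_le_eq mult.commute)
  then have "norm (a h k m) \<le> cmod (c k) * (\<Prod>i\<in>UNIV. exp (2 * pi * \<bar>k $ i\<bar> * \<bar>h $ i\<bar>))"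
   unfolding na by (intro mult_left_mono) auto
  then show "norm (a h k m) \<le> K * exp (- (\<rho> / 2) * l1 k)" using expb[OF k h] by linarith
 qed simp
 have sb: "(\<lambda>k. b k m) summable_on ?Z" for m
 proof -
  let ?h = "(\<chi> i. r) :: real^'d"
  have "(\<lambda>k. a ?h k m) summable_on ?Z" using r by (intro sa) auto
  then have "(\<lambda>k. inverse (\<Prod>i\<in>UNIV. of_real (?h $ i) ^ m i) * a ?h k m) summable_on ?Z" by (rule summable_on_cmult_right)
  then show ?thesis unfolding ab using r by (simp add: mult.assoc[symmetric])
 qed
 define B where "B m = (\<Sum>\<^sub>\<infinity>k\<in>?Z. b k m)" for m
 have main: "((\<lambda>m. (\<Prod>i\<in>UNIV. of_real (h $ i) ^ m i) * B m) has_sum series c (x + h)) UNIV"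
  if h: "\<And>i. \<bar>h $ i\<bar> \<le> r" for h
 proof -
  have n1: "((\<lambda>m. norm (a h k m)) has_sum (cmod (c k) * (\<Prod>i\<in>UNIV. exp (2 * pi * \<bar>k $ i\<bar> * \<bar>h $ i\<bar>)))) UNIV" for k
   unfolding na by (intro has_sum_cmult_right prod_exp_has_sum)
  have "(\<lambda>k. cmod (c k) * (\<Prod>i\<in>UNIV. exp (2 * pi * \<bar>k $ i\<bar> * \<bar>h $ i\<bar>))) summable_on ?Z"
   by (rule summable_on_comparison_test[OF sK]) (use expb h in \<open>auto intro!: mult_nonneg_nonneg prod_nonneg\<close>)
  then have "(\<lambda>(k, m). norm (a h k m)) summable_on (?Z \<times> UNIV)"
   by (intro summable_on_SigmaI[where g = "\<lambda>k. cmod (c k) * (\<Prod>i\<in>UNIV. exp (2 * pi * \<bar>k $ i\<bar> * \<bar>h $ i\<bar>))"]) (use n1 in auto)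
  then have "(\<lambda>p. norm (case p of (k, m) \<Rightarrow> a h k m)) summable_on (?Z \<times> UNIV)" by (simp only: case_prod_unfold)
  then have s: "(\<lambda>(k, m). a h k m) summable_on (?Z \<times> UNIV)" by (rule abs_summable_summable)
  have i1: "((\<lambda>m. case (k, m) of (k, m) \<Rightarrow> a h k m) has_sum (c k * chi k (x + h))) UNIV" for k
  proof -
   have "(\<Prod>i\<in>UNIV. exp (2 * pi * \<i> * (k $ i) * (h $ i))) = exp (\<Sum>i\<in>UNIV. 2 * pi * \<i> * (k $ i) * (h $ i))"
    by (simp add: exp_sum)
   also have "\<dots> = chi k h"
    by (simp add: chi_def cis_conv_exp inner_vec_def sum_distrib_left mult_ac)
   finally have e: "(\<Prod>i\<in>UNIV. exp (2 * pi * \<i> * (k $ i) * (h $ i))) = chi k h" .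
   have "((\<lambda>m. a h k m) has_sum (c k * chi k x * (\<Prod>i\<in>UNIV. exp (2 * pi * \<i> * (k $ i) * (h $ i))))) UNIV"
    unfolding a_def by (intro has_sum_cmult_right prod_exp_has_sum)
   then show ?thesis unfolding e by (simp add: chi_add mult.assoc)
  qed
  have sser: "(\<lambda>k. norm (c k)) summable_on ?Z"
   by (rule summable_on_comparison_test[OF summable_on_cmult_right[OF sexp[OF \<rho>], of K]]) (use c in auto)
  have "((\<lambda>k. c k * chi k (x + h)) has_sum series c (x + h)) ?Z"
   unfolding series_def by (rule has_sum_infsum[OF series_summable(1)[OF sser]])
  from has_sum_SigmaI[OF i1 this s] have "((\<lambda>(k, m). a h k m) has_sum series c (x + h)) (?Z \<times> UNIV)" .
  then have sw: "((\<lambda>(m, k). a h k m) has_sum series c (x + h)) (UNIV \<times> ?Z)"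
   by (subst has_sum_swap) (simp add: case_prod_unfold)
  show ?thesis
  proof (rule has_sum_SigmaD[OF sw])
   fix m :: "'d \<Rightarrow> nat"
   show "((\<lambda>k. case (m, k) of (m, k) \<Rightarrow> a h k m) has_sum ((\<Prod>i\<in>UNIV. of_real (h $ i) ^ m i) * B m)) ?Z"
    unfolding ab B_def by (simp add: has_sum_cmult_right has_sum_infsum[OF sb])
  qed
 qed
 show "\<exists>r>0. \<exists>c'::('d \<Rightarrow> nat) \<Rightarrow> 'b. \<forall>y\<in>ball x r. ((\<lambda>m. (\<Prod>i\<in>UNIV. (y $ i - x $ i) ^ m i) *\<^sub>R c' m) has_sum L (series c y)) UNIV"
 proof (intro exI[of _ r] exI[of _ "\<lambda>m. L (B m)"] conjI ballI r)
  fix y assume y: "y \<in> ball x r"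
  have "\<bar>(y - x) $ i\<bar> \<le> r" for i
   using component_le_norm_cart[of "y - x" i] y by (simp add: dist_norm norm_minus_commute)
  from has_sum_bounded_linear[OF L main[OF this]]
  have "((\<lambda>m. L ((\<Prod>i\<in>UNIV. of_real ((y - x) $ i) ^ m i) * B m)) has_sum L (series c y)) UNIV" by simp
  moreover have "L ((\<Prod>i\<in>UNIV. of_real ((y - x) $ i) ^ m i) * B m) = (\<Prod>i\<in>UNIV. (y $ i - x $ i) ^ m i) *\<^sub>R L (B m)" for m
  proof -
   have "(\<Prod>i\<in>UNIV. of_real ((y - x) $ i) ^ m i) * B m = (\<Prod>i\<in>UNIV. (y $ i - x $ i) ^ m i) *\<^sub>R B m"
    by (simp add: scaleR_conv_of_real)
   then show ?thesis by (simp add: linear_simps(5)[OF L])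
  qed
  ultimately show "((\<lambda>m. (\<Prod>i\<in>UNIV. (y $ i - x $ i) ^ m i) *\<^sub>R L (B m)) has_sum L (series c y)) UNIV" by simp
 qed
qed

section \<open>Almost holomorphic extensions of regular functions\<close>

text \<open>The partial sums of the Taylor expansion at \<open>x\<close> in the direction \<open>\<i> w\<close>: all defects but that of the last term telescope.\<close>

lemma taylor_extension:
 fixes d :: "nat \<Rightarrow> real^'d \<Rightarrow> complex"
 assumes d: "\<And>j. continuous_on UNIV (d j)" "\<And>j. periodic (d j)"
  and der: "\<And>j x. ((\<lambda>s. d j (x + s *\<^sub>R w)) has_vector_derivative d (Suc j) x) (at 0)"
 shows "dbar_ext w T (\<lambda>x t. \<Sum>j\<le>J. (\<i> * of_real t) ^ j / fact j * d j x)
   (\<lambda>x t. \<Sum>j\<le>J. (\<i> * of_real t) ^ j / fact j * d (Suc j) x)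
   (\<lambda>x t. - \<i> * ((\<i> * of_real t) ^ J / fact J * d (Suc J) x))"
proof (induction J)
 case 0
 have "cper T (\<lambda>x t. - \<i> * d (Suc 0) x)" by (intro cper_mult cper_const cper_base d)
 then show ?case unfolding dbar_ext_def using der
  by (auto intro!: cper_base d)
next
 case (Suc J)
 let ?m = "\<lambda>j t. (\<i> * of_real t) ^ j / fact j :: complex"
 have cm: "cper T (\<lambda>x t. ?m j t)" for j
  by (auto simp: cper_def periodic_def case_prod_beta intro!: continuous_intros)
 have md: "((\<lambda>t. ?m (Suc J) t) has_vector_derivative (\<i> * ?m J t)) (at t within {0..T})" for t
 proof -
  have "((\<lambda>z. (\<i> * z) ^ Suc J / fact (Suc J)) has_field_derivative (of_nat (Suc J) * (\<i> * of_real t) ^ J * \<i>) / fact (Suc J)) (at (of_real t) within of_real ` {0..T})"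
  proof -
   have "((\<lambda>z. \<i> * z) has_field_derivative \<i>) (at (complex_of_real t) within of_real ` {0..T})"
    by (auto intro!: derivative_eq_intros)
   from DERIV_cdivide[OF DERIV_power_Suc[OF this, of J], of "fact (Suc J)"] show ?thesis
    by (simp only: of_nat_Suc mult.commute mult.left_commute)
  qed
  moreover have "(of_nat (Suc J) * (\<i> * of_real t) ^ J * \<i>) / fact (Suc J) = \<i> * ?m J t"
   by (simp add: field_simps del: of_nat_Suc)
  moreover have "(of_real has_vector_derivative 1) (at t within {0..T})"
   using has_vector_derivative_of_real[of "\<lambda>t. t" 1 "at t within {0..T}"] by (auto intro!: derivative_eq_intros)
  ultimately show ?thesis
   using field_vector_diff_chain_within[of of_real 1 t "{0..T}" "\<lambda>z. (\<i> * z) ^ Suc J / fact (Suc J)" "\<i> * ?m J t"]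
   by (simp add: o_def del: power_Suc fact_Suc)
 qed
 have new: "dbar_ext w T (\<lambda>x t. ?m (Suc J) t * d (Suc J) x) (\<lambda>x t. ?m (Suc J) t * d (Suc (Suc J)) x)
   (\<lambda>x t. \<i> * ?m J t * d (Suc J) x + (- \<i>) * (?m (Suc J) t * d (Suc (Suc J)) x))"
  unfolding dbar_ext_def
 proof (intro conjI allI ballI)
  show "cper T (\<lambda>x t. ?m (Suc J) t * d (Suc J) x)" "cper T (\<lambda>x t. ?m (Suc J) t * d (Suc (Suc J)) x)"
   "cper T (\<lambda>x t. \<i> * ?m J t * d (Suc J) x + (- \<i>) * (?m (Suc J) t * d (Suc (Suc J)) x))"
   by (intro cper_add cper_mult cm cper_const cper_base d)+
  fix x t assume "t \<in> {0..T}"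
  show "((\<lambda>s. ?m (Suc J) t * d (Suc J) (x + s *\<^sub>R w)) has_vector_derivative ?m (Suc J) t * d (Suc (Suc J)) x) (at 0)"
   by (rule has_vector_derivative_mult_right[OF der])
  have "((\<lambda>s. ?m (Suc J) s * d (Suc J) x) has_vector_derivative (\<i> * ?m J t) * d (Suc J) x) (at t within {0..T})"
   by (rule has_vector_derivative_mult_left[OF md])
  then show "((\<lambda>s. ?m (Suc J) s * d (Suc J) x) has_vector_derivative
    \<i> * (?m (Suc J) t * d (Suc (Suc J)) x) + (\<i> * ?m J t * d (Suc J) x + (- \<i>) * (?m (Suc J) t * d (Suc (Suc J)) x))) (at t within {0..T})"
   by (simp only: add.left_commute mult_minus_left add.right_inverse add_0_right)
 qed
 have e: "- \<i> * (?m J t * d (Suc J) x) + (\<i> * ?m J t * d (Suc J) x + (- \<i>) * (?m (Suc J) t * d (Suc (Suc J)) x))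
   = - \<i> * (?m (Suc J) t * d (Suc (Suc J)) x)" for x t
  by (simp only: mult.assoc mult_minus_left) simp
 show ?case using dbar_ext_add[OF Suc new] unfolding e by (simp only: sum.atMost_Suc)
qed

lemma dbar_ext_limit:
 assumes ext: "\<And>n. dbar_ext w T (F n) (Fw n) (e n)"
  and F: "uniform_limit (UNIV \<times> {0..T}) (\<lambda>n (x, t). F n x t) (\<lambda>(x, t). F' x t) sequentially"
  and Fw: "uniform_limit (UNIV \<times> {0..T}) (\<lambda>n (x, t). Fw n x t) (\<lambda>(x, t). Fw' x t) sequentially"
  and e: "uniform_limit (UNIV \<times> {0..T}) (\<lambda>n (x, t). e n x t) (\<lambda>(x, t). e' x t) sequentially"
 shows "dbar_ext w T F' Fw' e'"
proof -
 note x = dbar_extD[OF ext]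
 have lim: "cper T G'" if G: "\<And>n. cper T (G n)" and u: "uniform_limit (UNIV \<times> {0..T}) (\<lambda>n (x, t). G n x t) (\<lambda>(x, t). G' x t) sequentially"
  for G :: "nat \<Rightarrow> real^'d \<Rightarrow> real \<Rightarrow> complex" and G'
 proof -
  have "continuous_on (UNIV \<times> {0..T}) (\<lambda>(x, t). G' x t)"
   by (rule uniform_limit_theorem[OF _ u]) (use G in \<open>auto simp: cper_def intro!: always_eventually\<close>)
  moreover have pt: "(\<lambda>n. G n x t) \<longlonglongrightarrow> G' x t" if "t \<in> {0..T}" for x t
   using tendsto_uniform_limitI[OF u, of "(x, t)"] that by simp
  have "periodic (\<lambda>x. G' x t)" if t: "t \<in> {0..T}" for t
   unfolding periodic_def
  proof (intro allI impI)
   fix x k :: "real^'d" assume k: "int_vec k"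
   have "G n (x + k) t = G n x t" for n using G t k by (auto simp: cper_def periodic_def)
   then show "G' (x + k) t = G' x t" using pt[OF t, of "x + k"] pt[OF t, of x] LIMSEQ_unique by auto
  qed
  ultimately show ?thesis by (simp add: cper_def)
 qed
 have pt: "(\<lambda>n. F n x t) \<longlonglongrightarrow> F' x t" if "t \<in> {0..T}" for x t
  using tendsto_uniform_limitI[OF F, of "(x, t)"] that by simp
 have w: "((\<lambda>s. F' (x + s *\<^sub>R w) t) has_vector_derivative Fw' x t) (at 0)" if t: "t \<in> {0..T}" for x t
 proof -
  have "\<exists>g. \<forall>s\<in>UNIV. (\<lambda>n. F n (x + s *\<^sub>R w) t) \<longlonglongrightarrow> g s \<and> (g has_derivative (\<lambda>h. h *\<^sub>R Fw' (x + s *\<^sub>R w) t)) (at s within UNIV)"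
  proof (rule has_derivative_sequence)
   show "((\<lambda>s. F n (x + s *\<^sub>R w) t) has_derivative (\<lambda>h. h *\<^sub>R Fw n (x + s *\<^sub>R w) t)) (at s within UNIV)" for n s
    using line_derivative_at[of "\<lambda>x. F n x t" w "\<lambda>x. Fw n x t", OF x(4)[OF t]] by (simp add: has_vector_derivative_def)
   show "(\<lambda>n. F n (x + 0 *\<^sub>R w) t) \<longlonglongrightarrow> F' x t" using pt[OF t] by simp
   fix \<epsilon> :: real assume "\<epsilon> > 0"
   from uniform_limitD[OF Fw this]
   show "\<forall>\<^sub>F n in sequentially. \<forall>s\<in>UNIV. \<forall>h. norm (h *\<^sub>R Fw n (x + s *\<^sub>R w) t - h *\<^sub>R Fw' (x + s *\<^sub>R w) t) \<le> \<epsilon> * norm h"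
   proof (rule eventually_mono, intro ballI allI)
    fix n s h assume "\<forall>p\<in>UNIV \<times> {0..T}. dist (case p of (x, t) \<Rightarrow> Fw n x t) (case p of (x, t) \<Rightarrow> Fw' x t) < \<epsilon>"
    then have "norm (Fw n (x + s *\<^sub>R w) t - Fw' (x + s *\<^sub>R w) t) \<le> \<epsilon>" using t by (auto simp: dist_norm less_imp_le)
    then have "\<bar>h\<bar> * norm (Fw n (x + s *\<^sub>R w) t - Fw' (x + s *\<^sub>R w) t) \<le> \<bar>h\<bar> * \<epsilon>" by (intro mult_left_mono) auto
    then show "norm (h *\<^sub>R Fw n (x + s *\<^sub>R w) t - h *\<^sub>R Fw' (x + s *\<^sub>R w) t) \<le> \<epsilon> * norm h"
     by (simp add: scaleR_diff_right[symmetric] mult.commute)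
   qed
  qed auto
  then obtain g where g: "\<And>s. (\<lambda>n. F n (x + s *\<^sub>R w) t) \<longlonglongrightarrow> g s" "\<And>s. (g has_derivative (\<lambda>h. h *\<^sub>R Fw' (x + s *\<^sub>R w) t)) (at s)"
   by auto
  have "g = (\<lambda>s. F' (x + s *\<^sub>R w) t)" using LIMSEQ_unique[OF g(1) pt[OF t]] by auto
  then show ?thesis using g(2)[of 0] by (simp add: has_vector_derivative_def)
 qed
 have t: "((\<lambda>s. F' x s) has_vector_derivative (\<i> * Fw' x t + e' x t)) (at t within {0..T})" if t: "t \<in> {0..T}" for x t
 proof -
  have "\<exists>g. \<forall>s\<in>{0..T}. (\<lambda>n. F n x s) \<longlonglongrightarrow> g s \<and> (g has_derivative (\<lambda>h. h *\<^sub>R (\<i> * Fw' x s + e' x s))) (at s within {0..T})"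
  proof (rule has_derivative_sequence)
   show "((\<lambda>s. F n x s) has_derivative (\<lambda>h. h *\<^sub>R (\<i> * Fw n x s + e n x s))) (at s within {0..T})" if "s \<in> {0..T}" for n s
    using x(5)[OF that] by (simp add: has_vector_derivative_def)
   show "(\<lambda>n. F n x t) \<longlonglongrightarrow> F' x t" using pt[OF t] by simp
   fix \<epsilon> :: real assume "\<epsilon> > 0"
   then have e2: "\<epsilon> / 2 > 0" by simp
   show "\<forall>\<^sub>F n in sequentially. \<forall>s\<in>{0..T}. \<forall>h. norm (h *\<^sub>R (\<i> * Fw n x s + e n x s) - h *\<^sub>R (\<i> * Fw' x s + e' x s)) \<le> \<epsilon> * norm h"
    using uniform_limitD[OF Fw e2] uniform_limitD[OF e e2]
   proof (eventually_elim, intro ballI allI)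
    fix n s h assume a: "\<forall>p\<in>UNIV \<times> {0..T}. dist (case p of (x, t) \<Rightarrow> Fw n x t) (case p of (x, t) \<Rightarrow> Fw' x t) < \<epsilon> / 2"
     "\<forall>p\<in>UNIV \<times> {0..T}. dist (case p of (x, t) \<Rightarrow> e n x t) (case p of (x, t) \<Rightarrow> e' x t) < \<epsilon> / 2" and s: "s \<in> {0..T}"
    have "norm (Fw n x s - Fw' x s) \<le> \<epsilon> / 2" "norm (e n x s - e' x s) \<le> \<epsilon> / 2" using a s by (auto simp: dist_norm less_imp_le)
    then have "norm (\<i> * (Fw n x s - Fw' x s) + (e n x s - e' x s)) \<le> \<epsilon> / 2 + \<epsilon> / 2"
     by (intro norm_triangle_mono) (auto simp: norm_mult)
    moreover have "\<i> * (Fw n x s - Fw' x s) + (e n x s - e' x s) = (\<i> * Fw n x s + e n x s) - (\<i> * Fw' x s + e' x s)"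
     by (simp add: algebra_simps)
    ultimately have "\<bar>h\<bar> * norm ((\<i> * Fw n x s + e n x s) - (\<i> * Fw' x s + e' x s)) \<le> \<bar>h\<bar> * \<epsilon>"
     by (intro mult_left_mono) auto
    then show "norm (h *\<^sub>R (\<i> * Fw n x s + e n x s) - h *\<^sub>R (\<i> * Fw' x s + e' x s)) \<le> \<epsilon> * norm h"
     by (simp only: scaleR_diff_right[symmetric] norm_scaleR real_norm_def mult.commute)
   qed
  qed (use t in auto)
  then obtain g where g0: "\<forall>s\<in>{0..T}. (\<lambda>n. F n x s) \<longlonglongrightarrow> g s \<and> (g has_derivative (\<lambda>h. h *\<^sub>R (\<i> * Fw' x s + e' x s))) (at s within {0..T})" ..
  have g: "(\<lambda>n. F n x s) \<longlonglongrightarrow> g s" "(g has_derivative (\<lambda>h. h *\<^sub>R (\<i> * Fw' x s + e' x s))) (at s within {0..T})" if "s \<in> {0..T}" for s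
   using bspec[OF g0 that] by blast+
  have "g s = F' x s" if "s \<in> {0..T}" for s using LIMSEQ_unique[OF g(1)[OF that] pt[OF that]] .
  then have "((\<lambda>s. F' x s) has_derivative (\<lambda>h. h *\<^sub>R (\<i> * Fw' x t + e' x t))) (at t within {0..T})"
   using has_derivative_transform[OF t _ g(2)[OF t]] by simp
  then show ?thesis by (simp add: has_vector_derivative_def)
 qed
 show ?thesis unfolding dbar_ext_def
  using lim[OF x(1) F] lim[OF x(2) Fw] lim[OF x(3) e] w t by blast
qed

text \<open>The full Taylor series converges with its derivatives for \<open>t \<le> 1 / (2 * R)\<close>, and the defects of its partial sums tend to zero.\<close>

lemma holomorphic_extension:
 fixes d :: "nat \<Rightarrow> real^'d \<Rightarrow> complex"
 assumes d: "\<And>j. continuous_on UNIV (d j)" "\<And>j. periodic (d j)"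
  and der: "\<And>j x. ((\<lambda>s. d j (x + s *\<^sub>R w)) has_vector_derivative d (Suc j) x) (at 0)"
  and b: "\<And>j x. cmod (d j x) \<le> K * fact j * R ^ j" and R: "R > 0" and T: "T = 1 / (2 * R)"
 shows "\<exists>F Fw. dbar_ext w T F Fw (\<lambda>x t. 0) \<and> (\<forall>x. F x 0 = d 0 x)"
proof -
 have K: "K \<ge> 0" using b[of 0 0] order_trans[OF norm_ge_zero] by fastforce
 let ?m = "\<lambda>j t. (\<i> * of_real t) ^ j / fact j :: complex"
 define G where "G = (\<lambda>j (x, t). ?m j t * d j x)"
 define H where "H = (\<lambda>j (x, t). ?m j t * d (Suc j) x)"
 have half: "(t * R) ^ j \<le> (1/2) ^ j" if "t \<in> {0..T}" for t j
 proof (rule power_mono)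
  have "t * R \<le> T * R" using that R by (intro mult_right_mono) auto
  then show "t * R \<le> 1/2" using R by (simp add: T)
 qed (use that R in auto)
 have mn: "cmod (?m j t) = t ^ j / fact j" if "t \<in> {0..T}" for j t using that by (simp add: norm_divide norm_power norm_mult)
 have Gb: "norm (G j p) \<le> K * (1/2) ^ j" if "p \<in> UNIV \<times> {0..T}" for j p
 proof -
  obtain x t where p0: "p = (x, t)" by (cases p)
  have p: "p = (x, t)" "t \<in> {0..T}" using that p0 by auto
  have "norm (G j p) \<le> t ^ j / fact j * (K * fact j * R ^ j)"
   unfolding G_def p using mn[OF p(2)] b[of j x] p(2) by (simp only: prod.case norm_mult) (intro mult_left_mono, auto)
  also have "\<dots> = K * (t * R) ^ j" by (simp add: power_mult_distrib)
  also have "\<dots> \<le> K * (1/2) ^ j" using half[OF p(2)] K by (intro mult_left_mono)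
  finally show ?thesis .
 qed
 have Hb: "norm (H j p) \<le> K * R * (real (Suc j) * (1/2) ^ j)" if "p \<in> UNIV \<times> {0..T}" for j p
 proof -
  obtain x t where p0: "p = (x, t)" by (cases p)
  have p: "p = (x, t)" "t \<in> {0..T}" using that p0 by auto
  have "norm (H j p) \<le> t ^ j / fact j * (K * fact (Suc j) * R ^ Suc j)"
   unfolding H_def p using mn[OF p(2)] b[of "Suc j" x] p(2) by (simp only: prod.case norm_mult) (intro mult_left_mono, auto)
  also have "\<dots> = K * R * (real (Suc j) * (t * R) ^ j)" by (simp add: power_mult_distrib del: of_nat_Suc)
  also have "\<dots> \<le> K * R * (real (Suc j) * (1/2) ^ j)" using half[OF p(2)] K R by (intro mult_left_mono) auto
  finally show ?thesis .
 qed
 have s1: "summable (\<lambda>j. K * (1/2::real) ^ j)" by (intro summable_mult summable_geometric) simp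
 have s0: "summable (\<lambda>j. real (Suc j) * (1/2) ^ j)"
  using geometric_deriv_sums[of "1/2 :: real"] by (simp add: sums_iff)
 have s2: "summable (\<lambda>j. K * R * (real (Suc j) * (1/2) ^ j))" by (rule summable_mult[OF s0])
 have uG: "uniform_limit (UNIV \<times> {0..T}) (\<lambda>n p. \<Sum>j<n. G j p) (\<lambda>p. suminf (\<lambda>j. G j p)) sequentially"
  by (rule Weierstrass_m_test[OF Gb s1])
 have uH: "uniform_limit (UNIV \<times> {0..T}) (\<lambda>n p. \<Sum>j<n. H j p) (\<lambda>p. suminf (\<lambda>j. H j p)) sequentially"
  by (rule Weierstrass_m_test[OF Hb s2])
 have uG': "uniform_limit (UNIV \<times> {0..T}) (\<lambda>n p. \<Sum>j\<le>n. G j p) (\<lambda>p. suminf (\<lambda>j. G j p)) sequentially"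
  using filterlim_compose[OF uG filterlim_Suc] by (simp only: lessThan_Suc_atMost)
 have uH': "uniform_limit (UNIV \<times> {0..T}) (\<lambda>n p. \<Sum>j\<le>n. H j p) (\<lambda>p. suminf (\<lambda>j. H j p)) sequentially"
  using filterlim_compose[OF uH filterlim_Suc] by (simp only: lessThan_Suc_atMost)
 have ue: "uniform_limit (UNIV \<times> {0..T}) (\<lambda>n p. - \<i> * H n p) (\<lambda>p. 0) sequentially"
 proof (rule uniform_limitI)
  fix \<epsilon> :: real assume "\<epsilon> > 0"
  from order_tendstoD(2)[OF summable_LIMSEQ_zero[OF s2] this]
  show "\<forall>\<^sub>F n in sequentially. \<forall>p\<in>UNIV \<times> {0..T}. dist (- \<i> * H n p) 0 < \<epsilon>"
  proof (rule eventually_mono, intro ballI)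
   fix n and p :: "(real^'d) \<times> real" assume a: "K * R * (real (Suc n) * (1/2) ^ n) < \<epsilon>" and p: "p \<in> UNIV \<times> {0..T}"
   have "norm (- \<i> * H n p) = norm (H n p)" by (simp only: norm_mult norm_minus_cancel norm_ii mult_1_left)
   then show "dist (- \<i> * H n p) 0 < \<epsilon>" unfolding dist_norm diff_0_right using Hb[OF p, of n] a by linarith
  qed
 qed
 have "dbar_ext w T (\<lambda>x t. suminf (\<lambda>j. G j (x, t))) (\<lambda>x t. suminf (\<lambda>j. H j (x, t))) (\<lambda>x t. 0)"
 proof (rule dbar_ext_limit[where F = "\<lambda>n x t. \<Sum>j\<le>n. ?m j t * d j x"
    and Fw = "\<lambda>n x t. \<Sum>j\<le>n. ?m j t * d (Suc j) x" and e = "\<lambda>n x t. - \<i> * (?m n t * d (Suc n) x)"])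
  show "dbar_ext w T (\<lambda>x t. \<Sum>j\<le>n. ?m j t * d j x) (\<lambda>x t. \<Sum>j\<le>n. ?m j t * d (Suc j) x)
    (\<lambda>x t. - \<i> * (?m n t * d (Suc n) x))" for n by (rule taylor_extension[where d = d, OF d der])
  show "uniform_limit (UNIV \<times> {0..T}) (\<lambda>n (x, t). \<Sum>j\<le>n. ?m j t * d j x) (\<lambda>(x, t). suminf (\<lambda>j. G j (x, t))) sequentially"
   using uG' by (simp add: G_def case_prod_unfold)
  show "uniform_limit (UNIV \<times> {0..T}) (\<lambda>n (x, t). \<Sum>j\<le>n. ?m j t * d (Suc j) x) (\<lambda>(x, t). suminf (\<lambda>j. H j (x, t))) sequentially"
   using uH' by (simp add: H_def case_prod_unfold)
  show "uniform_limit (UNIV \<times> {0..T}) (\<lambda>n (x, t). - \<i> * (?m n t * d (Suc n) x)) (\<lambda>(x, t). 0) sequentially"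
   using ue by (simp add: H_def case_prod_unfold)
 qed
 moreover have "suminf (\<lambda>j. G j (x, 0)) = d 0 x" for x
 proof -
  have e: "(\<lambda>j. G j (x, 0)) = (\<lambda>j. if j = 0 then d 0 x else 0)" by (auto simp: G_def)
  show ?thesis unfolding e by (rule sums_unique[OF sums_single[where i = 0 and f = "\<lambda>_. d 0 x"], symmetric])
 qed
 ultimately show ?thesis by blast
qed

definition dird :: "real^'d \<Rightarrow> (real^'d \<Rightarrow> complex) \<Rightarrow> real^'d \<Rightarrow> complex" where
 "dird w f x = vector_derivative (\<lambda>s. f (x + s *\<^sub>R w)) (at 0)"

lemma periodic_dird: "periodic f ==> periodic (dird w f)"
 unfolding periodic_def dird_def
proof (intro allI impI)
 fix x k :: "real^'a" assume f: "\<forall>x k. int_vec k \<longrightarrow> f (x + k) = f x" and k: "int_vec k"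
 have "f (x + k + s *\<^sub>R w) = f (x + s *\<^sub>R w)" for s using f k by (metis add.commute add.left_commute)
 then show "vector_derivative (\<lambda>s. f (x + k + s *\<^sub>R w)) (at 0) = vector_derivative (\<lambda>s. f (x + s *\<^sub>R w)) (at 0)" by simp
qed

text \<open>Two derivatives with a bound on the second make the difference quotients converge uniformly.\<close>

lemma continuous_directional_derivative:
 fixes f g h :: "real^'d \<Rightarrow> complex"
 assumes f: "continuous_on UNIV f"
  and g: "\<And>x. ((\<lambda>s. f (x + s *\<^sub>R w)) has_vector_derivative g x) (at 0)"
  and h: "\<And>x. ((\<lambda>s. g (x + s *\<^sub>R w)) has_vector_derivative h x) (at 0)"
  and C: "\<And>x. cmod (h x) \<le> C"
 shows "continuous_on UNIV g"
proof -
 have C0: "C \<ge> 0" using C[of 0] norm_ge_zero order_trans by blast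
 have lip: "cmod (g (x + s *\<^sub>R w) - g x) \<le> 3 * C * s" if s: "s \<ge> 0" for x s
 proof -
  have "cmod (g (x + s *\<^sub>R w) - g (x + 0 *\<^sub>R w) - (s - 0) *\<^sub>R h (x + 0 *\<^sub>R w)) \<le> norm (s - 0) * (2 * C)"
  proof (rule vector_differentiable_bound_linearization[where S = "{0..s}" and f' = "\<lambda>s. h (x + s *\<^sub>R w)" and ?x0.0 = 0])
   show "((\<lambda>s. g (x + s *\<^sub>R w)) has_vector_derivative h (x + r *\<^sub>R w)) (at r within {0..s})" for r
    by (rule has_vector_derivative_at_within) (rule line_derivative_at[OF h])
   show "cmod (h (x + r *\<^sub>R w) - h (x + 0 *\<^sub>R w)) \<le> 2 * C" for r
    using norm_triangle_ineq4[of "h (x + r *\<^sub>R w)" "h (x + 0 *\<^sub>R w)"] C[of "x + r *\<^sub>R w"] C[of "x + 0 *\<^sub>R w"] by linarith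
  qed (use s in \<open>auto simp: closed_segment_eq_real_ivl\<close>)
  then have "cmod ((g (x + s *\<^sub>R w) - g x) - s *\<^sub>R h x) \<le> s * (2 * C)" using s by simp
  moreover have "cmod (s *\<^sub>R h x) \<le> s * C" using s C[of x] by (simp add: mult_left_mono)
  ultimately show ?thesis
   using norm_triangle_ineq2[of "g (x + s *\<^sub>R w) - g x" "s *\<^sub>R h x"] by (simp add: algebra_simps)
 qed
 define q where "q n x = of_nat (Suc n) * (f (x + (1 / real (Suc n)) *\<^sub>R w) - f x)" for n x
 have qb: "cmod (q n x - g x) \<le> 3 * C / real (Suc n)" for n x
 proof -
  let ?s = "1 / real (Suc n)"
  have s: "?s > 0" by simp
  have "cmod (f (x + ?s *\<^sub>R w) - f (x + 0 *\<^sub>R w) - (?s - 0) *\<^sub>R g (x + 0 *\<^sub>R w)) \<le> norm (?s - 0) * (3 * C * ?s)"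
  proof (rule vector_differentiable_bound_linearization[where S = "{0..?s}" and f' = "\<lambda>s. g (x + s *\<^sub>R w)" and ?x0.0 = 0])
   show "((\<lambda>s. f (x + s *\<^sub>R w)) has_vector_derivative g (x + r *\<^sub>R w)) (at r within {0..?s})" for r
    by (rule has_vector_derivative_at_within) (rule line_derivative_at[OF g])
   show "cmod (g (x + r *\<^sub>R w) - g (x + 0 *\<^sub>R w)) \<le> 3 * C * ?s" if "r \<in> {0..?s}" for r
   proof -
    have "3 * C * r \<le> 3 * C * ?s" using that C0 by (intro mult_left_mono) auto
    then show ?thesis using lip[of r x] that by simp
   qed
  qed (use s in \<open>auto simp: closed_segment_eq_real_ivl\<close>)
  then have a: "cmod (f (x + ?s *\<^sub>R w) - f x - ?s *\<^sub>R g x) \<le> ?s * (3 * C * ?s)" by simp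
  have "q n x - g x = of_nat (Suc n) * (f (x + ?s *\<^sub>R w) - f x - ?s *\<^sub>R g x)"
   by (simp add: q_def right_diff_distrib scaleR_conv_of_real del: of_nat_Suc)
  then have "cmod (q n x - g x) = real (Suc n) * cmod (f (x + ?s *\<^sub>R w) - f x - ?s *\<^sub>R g x)"
   by (simp only: norm_mult norm_of_nat)
  also have "\<dots> \<le> real (Suc n) * (?s * (3 * C * ?s))" by (rule mult_left_mono[OF a]) simp
  also have "\<dots> = 3 * C / real (Suc n)" by simp
  finally show ?thesis .
 qed
 have "uniform_limit UNIV q g sequentially"
 proof (rule uniform_limitI)
  fix e :: real assume e: "e > 0"
  obtain N :: nat where N: "real N > 3 * C / e" using reals_Archimedean2 by blast
  have "cmod (q n x - g x) < e" if "n \<ge> N" for n x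
  proof -
   have "3 * C / e < real (Suc n)" using N that by simp
   then have "3 * C / real (Suc n) < e" using e by (simp add: pos_divide_less_eq mult.commute del: of_nat_Suc)
   then show ?thesis using qb[of n x] by linarith
  qed
  then show "\<forall>\<^sub>F n in sequentially. \<forall>x\<in>UNIV. dist (q n x) (g x) < e"
   unfolding eventually_sequentially dist_norm by blast
 qed
 moreover have "continuous_on UNIV (q n)" for n unfolding q_def
  by (intro continuous_intros f continuous_on_compose2[OF f]) auto
 ultimately show ?thesis by (intro uniform_limit_theorem[OF always_eventually]) auto
qed

lemma real_analytic_linear:
 assumes f: "real_analytic f" and L: "bounded_linear L"
 shows "real_analytic (\<lambda>x. L (f x))"
 unfolding real_analytic_def
proof
 fix x
 obtain r c where r: "r > 0" and c: "\<And>y. y \<in> ball x r ==> ((\<lambda>m. (\<Prod>i\<in>UNIV. (y $ i - x $ i) ^ m i) *\<^sub>R c m) has_sum f y) UNIV"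
  using f unfolding real_analytic_def by meson
 have "((\<lambda>m. (\<Prod>i\<in>UNIV. (y $ i - x $ i) ^ m i) *\<^sub>R L (c m)) has_sum L (f y)) UNIV" if "y \<in> ball x r" for y
 proof -
  have e: "(\<Prod>i\<in>UNIV. (y $ i - x $ i) ^ m i) *\<^sub>R L (c m) = L ((\<Prod>i\<in>UNIV. (y $ i - x $ i) ^ m i) *\<^sub>R c m)" for m
   by (rule linear_scale[OF bounded_linear.linear[OF L], symmetric])
  show ?thesis unfolding e by (rule has_sum_bounded_linear[OF L c[OF that]])
 qed
 then show "\<exists>r>0. \<exists>c. \<forall>y\<in>ball x r. ((\<lambda>m. (\<Prod>i\<in>UNIV. (y $ i - x $ i) ^ m i) *\<^sub>R c m) has_sum L (f y)) UNIV"
  by (intro exI[of _ r] conjI exI[of _ "\<lambda>m. L (c m)"] ballI r) auto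
qed

lemma real_analytic_add:
 assumes f: "real_analytic f" and g: "real_analytic g"
 shows "real_analytic (\<lambda>x. f x + g x)"
 unfolding real_analytic_def
proof
 fix x
 obtain r c where r: "r > 0" and c: "\<And>y. y \<in> ball x r ==> ((\<lambda>m. (\<Prod>i\<in>UNIV. (y $ i - x $ i) ^ m i) *\<^sub>R c m) has_sum f y) UNIV"
  using f unfolding real_analytic_def by meson
 obtain r' c' where r': "r' > 0" and c': "\<And>y. y \<in> ball x r' ==> ((\<lambda>m. (\<Prod>i\<in>UNIV. (y $ i - x $ i) ^ m i) *\<^sub>R c' m) has_sum g y) UNIV"
  using g unfolding real_analytic_def by meson
 have "((\<lambda>m. (\<Prod>i\<in>UNIV. (y $ i - x $ i) ^ m i) *\<^sub>R (c m + c' m)) has_sum (f y + g y)) UNIV" if "y \<in> ball x (min r r')" for y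
  unfolding scaleR_add_right using that by (intro has_sum_add c c') auto
 then show "\<exists>r>0. \<exists>c. \<forall>y\<in>ball x r. ((\<lambda>m. (\<Prod>i\<in>UNIV. (y $ i - x $ i) ^ m i) *\<^sub>R c m) has_sum (f y + g y)) UNIV"
  using r r' by (intro exI[of _ "min r r'"] conjI exI[of _ "\<lambda>m. c m + c' m"] ballI) auto
qed

text \<open>Substitute the complex point \<open>y + z w\<close> into the local power series; it converges as it does so at one point with all coordinates
displaced by \<open>\<eta>\<close>. The radius \<open>\<rho>\<close> and the bound \<open>K\<close> serve all \<open>y\<close> near \<open>x0\<close>.\<close>

lemma analytic_line_extension:
 fixes f :: "real^'d \<Rightarrow> complex" and w x0 :: "real^'d"
 assumes f: "real_analytic f"
 shows "\<exists>\<rho>>0. \<exists>K. continuous_on (ball x0 \<rho>) f \<and> (\<forall>y\<in>ball x0 \<rho>. \<exists>\<Phi>. \<Phi> holomorphic_on ball 0 \<rho> \<and>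
   continuous_on (cball 0 \<rho>) \<Phi> \<and> (\<forall>z\<in>cball 0 \<rho>. cmod (\<Phi> z) \<le> K) \<and>
   (\<forall>\<sigma>. \<bar>\<sigma>\<bar> \<le> \<rho> \<longrightarrow> f (y + \<sigma> *\<^sub>R w) = \<Phi> (of_real \<sigma>)))"
proof -
 obtain r c where r: "r > 0" and c: "\<And>y. y \<in> ball x0 r ==> ((\<lambda>m. (\<Prod>i\<in>UNIV. (y $ i - x0 $ i) ^ m i) *\<^sub>R c m) has_sum f y) UNIV"
  using f unfolding real_analytic_def by meson
 define \<eta> where "\<eta> = r / (2 * real CARD('d))"
 \<comment> \<open>\<open>\<rho> + \<rho> * norm w = \<eta> / 2\<close> bounds every coordinate of \<open>y + z w - x0\<close>\<close>
 define \<rho> where "\<rho> = \<eta> / 2 / (1 + norm w)"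
 have n1: "real CARD('d) \<ge> 1" by simp
 have \<eta>: "\<eta> > 0" "real CARD('d) * \<eta> = r / 2" using r by (simp_all add: \<eta>_def)
 have w1: "1 + norm w > 0" by (simp add: add_pos_nonneg)
 have \<rho>: "\<rho> > 0" using \<eta> w1 by (simp add: \<rho>_def)
 have \<rho>w: "\<rho> + \<rho> * norm w = \<eta> / 2"
 proof -
  have "1 + norm w \<noteq> 0" using w1 by simp
  then have "\<rho> * (1 + norm w) = \<eta> / 2" using \<rho>_def nonzero_eq_divide_eq by blast
  then show ?thesis by (simp only: distrib_left mult_1_right)
 qed
 have \<eta>r: "\<eta> < r"
 proof -
  have "1 * \<eta> \<le> real CARD('d) * \<eta>" using n1 \<eta> by (intro mult_right_mono) auto
  then show ?thesis using \<eta> r by simp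
 qed
 define M where "M m = \<eta> ^ (\<Sum>i\<in>UNIV. m i) * cmod (c m)" for m :: "'d \<Rightarrow> nat"
 have Mp: "(\<Prod>i\<in>UNIV. a i ^ m i) * cmod (c m) \<le> M m" if "\<And>i. 0 \<le> a i" "\<And>i. a i \<le> \<eta>" for a :: "'d \<Rightarrow> real" and m
 proof -
  have "(\<Prod>i\<in>UNIV. a i ^ m i) \<le> (\<Prod>i\<in>UNIV. \<eta> ^ m i)" using that by (intro prod_mono) (auto intro: power_mono)
  then show ?thesis unfolding M_def by (simp add: power_sum mult_right_mono)
 qed
 have M: "M summable_on UNIV"
 proof -
  let ?y = "x0 + (\<chi> i. \<eta>)"
  have "norm ((\<chi> i. \<eta>) :: real^'d) \<le> (\<Sum>i\<in>(UNIV::'d set). \<bar>((\<chi> i. \<eta>) :: real^'d) $ i\<bar>)" by (rule norm_le_l1_cart)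
  also have "\<dots> = r / 2" using \<eta> by simp
  finally have "?y \<in> ball x0 r" using r by (simp add: dist_norm)
  from has_sum_imp_summable[OF c[OF this]]
  have "(\<lambda>m. norm ((\<Prod>i\<in>UNIV. (?y $ i - x0 $ i) ^ m i) *\<^sub>R c m)) summable_on UNIV"
   by (simp only: summable_on_iff_abs_summable_on_complex)
  moreover have "norm ((\<Prod>i\<in>UNIV. (?y $ i - x0 $ i) ^ m i) *\<^sub>R c m) = M m" for m
   using \<eta> by (simp add: M_def power_sum prod_nonneg)
  ultimately show ?thesis by simp
 qed
 define K where "K = infsum M UNIV"
 have fin: "finite_subsets_at_top (UNIV :: ('d \<Rightarrow> nat) set) \<noteq> bot" by simp
 have comp: "\<bar>v $ i\<bar> \<le> norm v" for v :: "real^'d" and i by (rule component_le_norm_cart)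
 have fc: "continuous_on (ball x0 \<rho>) f"
 proof -
  let ?t = "\<lambda>m y. (\<Prod>i\<in>UNIV. (y $ i - x0 $ i) ^ m i) *\<^sub>R c m"
  have \<rho>r: "\<rho> \<le> \<eta>"
  proof -
   have "0 \<le> \<rho> * norm w" using \<rho> by simp
   then show ?thesis using \<rho>w \<eta> by linarith
  qed
  have b: "norm (?t m y) \<le> M m" if "y \<in> ball x0 \<rho>" for m y
  proof -
   have "\<bar>y $ i - x0 $ i\<bar> \<le> \<eta>" for i
    using comp[of "y - x0" i] that \<rho>r by (simp add: dist_norm norm_minus_commute)
   then have "(\<Prod>i\<in>UNIV. \<bar>y $ i - x0 $ i\<bar> ^ m i) * cmod (c m) \<le> M m" by (intro Mp) auto
   then show ?thesis by (simp add: abs_prod power_abs)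
  qed
  have "uniform_limit (ball x0 \<rho>) (\<lambda>X y. \<Sum>m\<in>X. ?t m y) (\<lambda>y. \<Sum>\<^sub>\<infinity>m. ?t m y) (finite_subsets_at_top UNIV)"
   by (rule Weierstrass_m_test_general[OF b M])
  then have "continuous_on (ball x0 \<rho>) (\<lambda>y. \<Sum>\<^sub>\<infinity>m. ?t m y)"
   by (intro uniform_limit_theorem[OF always_eventually _ fin]) (auto intro!: continuous_intros)
  moreover have "(\<Sum>\<^sub>\<infinity>m. ?t m y) = f y" if "y \<in> ball x0 \<rho>" for y
   by (rule infsumI[OF c]) (use that \<rho>r \<eta>r in auto)
  ultimately show ?thesis by (rule continuous_on_eq)
 qed
 have "\<exists>\<Phi>. \<Phi> holomorphic_on ball 0 \<rho> \<and> continuous_on (cball 0 \<rho>) \<Phi> \<and> (\<forall>z\<in>cball 0 \<rho>. cmod (\<Phi> z) \<le> K) \<and>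
   (\<forall>\<sigma>. \<bar>\<sigma>\<bar> \<le> \<rho> \<longrightarrow> f (y + \<sigma> *\<^sub>R w) = \<Phi> (of_real \<sigma>))" if y: "y \<in> ball x0 \<rho>" for y
 proof -
  let ?t = "\<lambda>m z. (\<Prod>i\<in>UNIV. (of_real (y $ i - x0 $ i) + z * of_real (w $ i)) ^ m i) * c m"
  define \<Phi> where "\<Phi> z = (\<Sum>\<^sub>\<infinity>m. ?t m z)" for z
  have ny: "norm (y - x0) < \<rho>" using y by (simp add: dist_norm norm_minus_commute)
  have b: "norm (?t m z) \<le> M m" if z: "z \<in> cball 0 \<rho>" for m z
  proof -
   have "cmod (of_real (y $ i - x0 $ i) + z * of_real (w $ i)) \<le> \<eta>" for i
   proof -
    have "cmod (of_real (y $ i - x0 $ i) + z * of_real (w $ i)) \<le> \<bar>(y - x0) $ i\<bar> + cmod z * \<bar>w $ i\<bar>"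
     by (rule order_trans[OF norm_triangle_ineq]) (simp add: norm_mult flip: of_real_diff)
    also have "\<dots> \<le> \<rho> + \<rho> * norm w" using ny comp[of "y - x0" i] z \<rho> comp[of w i]
     by (intro add_mono mult_mono) auto
    finally show ?thesis using \<rho>w \<eta> by linarith
   qed
   then have "(\<Prod>i\<in>UNIV. cmod (of_real (y $ i - x0 $ i) + z * of_real (w $ i)) ^ m i) * cmod (c m) \<le> M m"
    by (intro Mp) auto
   then show ?thesis by (simp only: norm_mult norm_power prod_norm[symmetric])
  qed
  have u: "uniform_limit (cball 0 \<rho>) (\<lambda>X z. \<Sum>m\<in>X. ?t m z) \<Phi> (finite_subsets_at_top UNIV)"
   unfolding \<Phi>_def by (rule Weierstrass_m_test_general[OF b M])
  have "\<forall>\<^sub>F X in finite_subsets_at_top UNIV. continuous_on (cball 0 \<rho>) (\<lambda>z. \<Sum>m\<in>X. ?t m z) \<and> (\<lambda>z. \<Sum>m\<in>X. ?t m z) holomorphic_on ball 0 \<rho>"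
   by (intro always_eventually allI conjI continuous_intros holomorphic_intros)
  then have h: "continuous_on (cball 0 \<rho>) \<Phi>" "\<Phi> holomorphic_on ball 0 \<rho>"
   using holomorphic_uniform_limit[OF _ u fin] by blast+
  have "cmod (\<Phi> z) \<le> K" if z: "z \<in> cball 0 \<rho>" for z
  proof -
   have s: "(\<lambda>m. norm (?t m z)) summable_on UNIV"
    by (rule summable_on_comparison_test[OF M]) (use b[OF z] in auto)
   have "cmod (\<Phi> z) \<le> (\<Sum>\<^sub>\<infinity>m. norm (?t m z))" unfolding \<Phi>_def by (rule norm_infsum_bound[OF s])
   also have "\<dots> \<le> K" unfolding K_def by (rule infsum_mono[OF s M]) (rule b[OF z])
   finally show ?thesis .
  qed
  moreover have "f (y + \<sigma> *\<^sub>R w) = \<Phi> (of_real \<sigma>)" if \<sigma>: "\<bar>\<sigma>\<bar> \<le> \<rho>" for \<sigma>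
  proof -
   have "norm ((y - x0) + \<sigma> *\<^sub>R w) \<le> \<rho> + \<rho> * norm w"
    by (rule order_trans[OF norm_triangle_ineq]) (use ny \<sigma> in \<open>auto intro!: add_mono mult_right_mono\<close>)
   then have "norm ((y + \<sigma> *\<^sub>R w) - x0) < r" using \<rho>w \<eta>(1) \<eta>r by (simp add: algebra_simps)
   then have "y + \<sigma> *\<^sub>R w \<in> ball x0 r" by (simp add: dist_norm norm_minus_commute)
   note fy = infsumI[OF c[OF this], symmetric]
   have "of_real (y $ i - x0 $ i) + of_real \<sigma> * of_real (w $ i) = (of_real ((y + \<sigma> *\<^sub>R w) $ i - x0 $ i) :: complex)" for i
    by (simp add: algebra_simps)
   then have "?t m (of_real \<sigma>) = (\<Prod>i\<in>UNIV. ((y + \<sigma> *\<^sub>R w) $ i - x0 $ i) ^ m i) *\<^sub>R c m" for m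
    by (simp only: scaleR_conv_of_real of_real_prod of_real_power)
   then show ?thesis unfolding \<Phi>_def fy by (rule infsum_cong[symmetric])
  qed
  ultimately show ?thesis using h by blast
 qed
 with fc \<rho> show ?thesis by blast
qed

text \<open>On the line through \<open>y\<close> the directional derivatives are the complex derivatives of the extension, and Cauchy's inequality applies.\<close>

lemma analytic_directional_local:
 fixes f :: "real^'d \<Rightarrow> complex" and w x0 :: "real^'d"
 assumes f: "real_analytic f"
 shows "\<exists>\<rho>>0. \<exists>K. continuous_on (ball x0 \<rho>) f \<and> (\<forall>y\<in>ball x0 \<rho>. \<forall>j.
   cmod ((dird w ^^ j) f y) \<le> K * fact j / \<rho> ^ j \<and>
   ((\<lambda>s. (dird w ^^ j) f (y + s *\<^sub>R w)) has_vector_derivative (dird w ^^ Suc j) f y) (at 0))"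
proof -
 obtain \<rho> K where \<rho>: "\<rho> > 0" and fc: "continuous_on (ball x0 \<rho>) f"
  and ext: "\<And>y. y \<in> ball x0 \<rho> ==> \<exists>\<Phi>. \<Phi> holomorphic_on ball 0 \<rho> \<and>
   continuous_on (cball 0 \<rho>) \<Phi> \<and> (\<forall>z\<in>cball 0 \<rho>. cmod (\<Phi> z) \<le> K) \<and>
   (\<forall>\<sigma>. \<bar>\<sigma>\<bar> \<le> \<rho> \<longrightarrow> f (y + \<sigma> *\<^sub>R w) = \<Phi> (of_real \<sigma>))"
  using analytic_line_extension[OF f, of x0 w] by (elim exE conjE) blast
 have "cmod ((dird w ^^ j) f y) \<le> K * fact j / \<rho> ^ j \<and>
   ((\<lambda>s. (dird w ^^ j) f (y + s *\<^sub>R w)) has_vector_derivative (dird w ^^ Suc j) f y) (at 0)" if y: "y \<in> ball x0 \<rho>" for y j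
 proof -
  obtain \<Phi> where h: "\<Phi> holomorphic_on ball 0 \<rho>" "continuous_on (cball 0 \<rho>) \<Phi>" and b: "\<And>z. z \<in> cball 0 \<rho> ==> cmod (\<Phi> z) \<le> K"
   and e: "\<And>\<sigma>. \<bar>\<sigma>\<bar> \<le> \<rho> ==> f (y + \<sigma> *\<^sub>R w) = \<Phi> (of_real \<sigma>)" using ext[OF y] by blast
  have hj: "(deriv ^^ j) \<Phi> holomorphic_on ball 0 \<rho>" for j
   by (rule holomorphic_higher_deriv[OF h(1)]) simp
  have dj: "((deriv ^^ j) \<Phi> has_field_derivative (deriv ^^ Suc j) \<Phi> z) (at z)" if "z \<in> ball 0 \<rho>" for j z
   using holomorphic_derivI[OF hj open_ball that] by simp
  have rd: "((\<lambda>s. (deriv ^^ j) \<Phi> (of_real (\<sigma> + s))) has_vector_derivative (deriv ^^ Suc j) \<Phi> (of_real \<sigma>)) (at 0)"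
   if \<sigma>: "\<bar>\<sigma>\<bar> < \<rho>" for j \<sigma>
  proof -
   have "((\<lambda>s. of_real (\<sigma> + s) :: complex) has_vector_derivative 1) (at 0)"
    by (auto intro!: derivative_eq_intros has_vector_derivative_of_real)
   from field_vector_diff_chain_at[OF this, of "(deriv ^^ j) \<Phi>" "(deriv ^^ Suc j) \<Phi> (of_real \<sigma>)"]
   show ?thesis using dj[of "of_real \<sigma>" j] \<sigma> by (simp add: o_def del: funpow.simps of_real_add)
  qed
  have step: "((\<lambda>s. (dird w ^^ j) f (y + (\<sigma> + s) *\<^sub>R w)) has_vector_derivative (deriv ^^ Suc j) \<Phi> (of_real \<sigma>)) (at 0)"
   if \<sigma>: "\<bar>\<sigma>\<bar> < \<rho>" and eq: "\<And>\<sigma>. \<bar>\<sigma>\<bar> < \<rho> ==> (dird w ^^ j) f (y + \<sigma> *\<^sub>R w) = (deriv ^^ j) \<Phi> (of_real \<sigma>)" for j \<sigma>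
  proof (rule has_vector_derivative_transform_within_open[OF rd[OF \<sigma>]])
   show "open {s. \<bar>\<sigma> + s\<bar> < \<rho>}" by (intro open_Collect_less continuous_intros)
   show "0 \<in> {s. \<bar>\<sigma> + s\<bar> < \<rho>}" using \<sigma> by simp
   show "(deriv ^^ j) \<Phi> (of_real (\<sigma> + s)) = (dird w ^^ j) f (y + (\<sigma> + s) *\<^sub>R w)" if "s \<in> {s. \<bar>\<sigma> + s\<bar> < \<rho>}" for s
    using eq[of "\<sigma> + s"] that by (simp only: mem_Collect_eq)
  qed
  have sh: "y + (\<sigma> + s) *\<^sub>R w = (y + \<sigma> *\<^sub>R w) + s *\<^sub>R w" for \<sigma> s by (simp add: scaleR_add_left)
  have eq: "(dird w ^^ j) f (y + \<sigma> *\<^sub>R w) = (deriv ^^ j) \<Phi> (of_real \<sigma>)" if "\<bar>\<sigma>\<bar> < \<rho>" for j \<sigma>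
   using that
  proof (induction j arbitrary: \<sigma>)
   case 0
   then show ?case using e[of \<sigma>] by simp
  next
   case (Suc j)
   from step[OF Suc.prems Suc.IH] have "vector_derivative (\<lambda>s. (dird w ^^ j) f ((y + \<sigma> *\<^sub>R w) + s *\<^sub>R w)) (at 0) = (deriv ^^ Suc j) \<Phi> (of_real \<sigma>)"
    unfolding sh by (rule vector_derivative_at)
   then show ?case unfolding dird_def[of w "(dird w ^^ j) f", symmetric] by (simp only: funpow.simps comp_apply)
  qed
  have "cmod ((deriv ^^ j) \<Phi> 0) \<le> fact j * K / \<rho> ^ j"
   by (rule Cauchy_inequality[OF h \<rho>]) (simp add: b)
  then have "cmod ((dird w ^^ j) f y) \<le> K * fact j / \<rho> ^ j" using eq[of 0 j] \<rho> by (simp add: mult.commute)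
  moreover have "((\<lambda>s. (dird w ^^ j) f (y + s *\<^sub>R w)) has_vector_derivative (dird w ^^ Suc j) f y) (at 0)"
   using step[of 0 j, OF _ eq] eq[of 0 "Suc j"] \<rho> by (simp del: funpow.simps)
  ultimately show ?thesis by blast
 qed
 then show ?thesis using \<rho> fc by blast
qed

section \<open>Regularity classes and gauges\<close>

lemma periodic_locally_uniform:
 fixes Q :: "nat \<Rightarrow> real^'d \<Rightarrow> bool"
 assumes loc: "\<And>x. \<exists>m. \<exists>\<rho>>0. \<forall>y\<in>ball x \<rho>. Q m y"
  and mono: "\<And>m n x. m \<le> n ==> Q m x ==> Q n x"
  and per: "\<And>m k x. int_vec k ==> Q m (x + k) ==> Q m x"
  and per': "\<And>m k x. int_vec k ==> Q m x ==> Q m (x + k)"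
 shows "\<exists>m. \<forall>x. Q m x"
proof -
 obtain m \<rho> where m: "\<And>x. \<rho> x > 0" "\<And>x y. y \<in> ball x (\<rho> x) ==> Q (m x) y"
  using loc by metis
 let ?C = "cbox 0 (\<chi> i. 1) :: (real^'d) set"
 have "?C \<subseteq> (\<Union>x\<in>?C. ball x (\<rho> x))" using m(1) by auto
 from compactE_image[OF compact_cbox _ this] obtain X where X: "X \<subseteq> ?C" "finite X" "?C \<subseteq> (\<Union>x\<in>X. ball x (\<rho> x))"
  by auto
 define n where "n = (\<Sum>x\<in>X. m x)"
 have "Q n y" for y
 proof -
  obtain k where k: "int_vec k" "\<And>i. 0 \<le> (y - k) $ i" "\<And>i. (y - k) $ i < 1" using int_vec_floor_decomp by blast
  have "y - k \<in> ?C" using k(2,3) by (auto simp: mem_box_cart less_imp_le)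
  then obtain x where x: "x \<in> X" "y - k \<in> ball x (\<rho> x)" using X(3) by blast
  have "m x \<le> n" unfolding n_def using x(1) X(2) by (intro member_le_sum) auto
  then have "Q n (y - k)" using mono m(2)[OF x(2)] by blast
  then show ?thesis using per'[OF k(1), of n "y - k"] by simp
 qed
 then show ?thesis by blast
qed

lemma periodic_dird_power: "periodic f ==> periodic ((dird w ^^ j) f)"
 by (induction j) (simp_all add: periodic_dird)

lemma analytic_directional:
 fixes f :: "real^'d \<Rightarrow> complex"
 assumes f: "real_analytic f" and p: "periodic f"
 shows "continuous_on UNIV ((dird w ^^ j) f)"
  and "((\<lambda>s. (dird w ^^ j) f (x + s *\<^sub>R w)) has_vector_derivative (dird w ^^ Suc j) f x) (at 0)"
  and "\<exists>K R. R > 0 \<and> (\<forall>j x. cmod ((dird w ^^ j) f x) \<le> K * fact j * R ^ j)"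
proof -
 note per = periodicD[OF periodic_dird_power[OF p]]
 have der: "((\<lambda>s. (dird w ^^ j) f (x + s *\<^sub>R w)) has_vector_derivative (dird w ^^ Suc j) f x) (at 0)" for j x
 proof -
  obtain \<rho> where "\<rho> > 0" "\<And>y j. y \<in> ball x \<rho> ==> ((\<lambda>s. (dird w ^^ j) f (y + s *\<^sub>R w)) has_vector_derivative (dird w ^^ Suc j) f y) (at 0)"
   using analytic_directional_local[OF f, of x w] by meson
  then show ?thesis by (meson centre_in_ball)
 qed
 then show "((\<lambda>s. (dird w ^^ j) f (x + s *\<^sub>R w)) has_vector_derivative (dird w ^^ Suc j) f x) (at 0)" .
 let ?Q = "\<lambda>m y. \<forall>j. cmod ((dird w ^^ j) f y) \<le> real m * fact j * real m ^ j"
 have "\<exists>m. \<forall>x. ?Q m x"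
 proof (rule periodic_locally_uniform)
  fix x
  obtain \<rho> K where \<rho>: "\<rho> > 0" and b: "\<And>y j. y \<in> ball x \<rho> ==> cmod ((dird w ^^ j) f y) \<le> K * fact j / \<rho> ^ j"
   using analytic_directional_local[OF f, of x w] by meson
  obtain m :: nat where "real m > max K (1 / \<rho>)" using reals_Archimedean2 by blast
  then have m: "real m \<ge> K" "real m \<ge> 1 / \<rho>" by auto
  have "?Q m y" if y: "y \<in> ball x \<rho>" for y
  proof
   fix j
   have "(1 / \<rho>) ^ j \<le> real m ^ j" using m \<rho> by (intro power_mono) auto
   then have "(K * fact j) * (1 / \<rho>) ^ j \<le> (real m * fact j) * real m ^ j"
    using m \<rho> by (intro mult_mono mult_right_mono) auto
   then show "cmod ((dird w ^^ j) f y) \<le> real m * fact j * real m ^ j"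
    using b[OF y, of j] by (simp only: power_one_over times_divide_eq_right mult_1_right)
  qed
  then show "\<exists>m. \<exists>\<rho>>0. \<forall>y\<in>ball x \<rho>. ?Q m y" using \<rho> by blast
 next
  fix m n :: nat and x assume mn: "m \<le> n" and q: "?Q m x"
  have "real m * fact j * real m ^ j \<le> real n * fact j * real n ^ j" for j
   using mn by (intro mult_mono power_mono) auto
  then show "?Q n x" using q order_trans by blast
 next
  fix m and k x :: "real^'d" assume "int_vec k"
  then show "?Q m (x + k) ==> ?Q m x" "?Q m x ==> ?Q m (x + k)" using per by simp_all
 qed
 then obtain m where m: "\<And>j x. cmod ((dird w ^^ j) f x) \<le> real m * fact j * real m ^ j" by blast
 have m': "cmod ((dird w ^^ j) f x) \<le> real (Suc m) * fact j * real (Suc m) ^ j" for j x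
 proof -
  have "real m * fact j * real m ^ j \<le> real (Suc m) * fact j * real (Suc m) ^ j"
   by (intro mult_mono power_mono) auto
  then show ?thesis using m[of j x] by linarith
 qed
 then show "\<exists>K R. R > 0 \<and> (\<forall>j x. cmod ((dird w ^^ j) f x) \<le> K * fact j * R ^ j)"
  by (intro exI[of _ "real (Suc m)"]) simp
 show "continuous_on UNIV ((dird w ^^ j) f)"
 proof (induction j)
  case 0
  have "isCont f x" for x
  proof -
   obtain \<rho> where "\<rho> > 0" "continuous_on (ball x \<rho>) f" using analytic_directional_local[OF f, of x w] by meson
   then show ?thesis by (simp add: continuous_on_eq_continuous_at)
  qed
  then show ?case by (simp add: continuous_at_imp_continuous_on)
 next
  case (Suc j)
  show ?case by (rule continuous_directional_derivative[OF Suc der der m'])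
 qed
qed

lemma smooth_dird:
 fixes f :: "real^'d \<Rightarrow> complex"
 assumes f: "smooth f"
 shows "smooth (dird w f)" "((\<lambda>s. f (x + s *\<^sub>R w)) has_vector_derivative dird w f x) (at 0)"
proof -
 have f1: "differentiable_Ck (Suc k) f" for k using f unfolding smooth_def by blast
 have d: "((\<lambda>s. f (x + s *\<^sub>R w)) has_vector_derivative frechet_derivative f (at x) w) (at 0)" for x
 proof -
  have "f differentiable (at x)" using f1[of 0] by simp
  then have fx: "(f has_derivative frechet_derivative f (at x)) (at (x + 0 *\<^sub>R w))"
   by (simp add: frechet_derivative_works)
  have "((\<lambda>s. x + s *\<^sub>R w) has_vector_derivative w) (at 0)" by (auto intro!: derivative_eq_intros)
  from diff_chain_at[OF this[unfolded has_vector_derivative_def] fx]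
  show ?thesis using linear_scale[OF has_derivative_linear[OF fx]]
   by (simp add: has_vector_derivative_def o_def)
 qed
 have eq: "dird w f = (\<lambda>x. frechet_derivative f (at x) w)"
  unfolding dird_def using vector_derivative_at[OF d] by (rule ext)
 show "smooth (dird w f)" unfolding eq smooth_def using f1 by simp
 show "((\<lambda>s. f (x + s *\<^sub>R w)) has_vector_derivative dird w f x) (at 0)" unfolding eq by (rule d)
qed

lemma smooth_dird_power:
 fixes f :: "real^'d \<Rightarrow> complex"
 assumes f: "smooth f" shows "smooth ((dird w ^^ j) f)"
 by (induction j) (simp_all add: f smooth_dird)

lemma smooth_continuous: "smooth f ==> continuous_on UNIV f"
 unfolding smooth_def by (drule spec[of _ 0]) simp

text \<open>Only meant for \<open>C_infinity\<close> and \<open>C_omega\<close>: there it is \<open>of_class\<close> in terms of the lift.\<close>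

definition lift_class :: "regularity \<Rightarrow> (real^'d \<Rightarrow> 'b::real_normed_vector) \<Rightarrow> bool" where
 "lift_class r f \<longleftrightarrow> (if r = C_omega then real_analytic f else smooth f)"

text \<open>The orders of vanishing at \<open>t = 0\<close> that the defect of an extension can have: any power for smooth functions, and no defect for
analytic ones. Phrasing the estimates with a gauge treats both classes at once.\<close>

definition gauges :: "regularity \<Rightarrow> (real \<Rightarrow> real) set" where
 "gauges r = (if r = C_omega then {\<lambda>t. 0} else range (\<lambda>J t. t ^ J))"

definition admits :: "(real \<Rightarrow> real) \<Rightarrow> real^'d \<Rightarrow> (real^'d \<Rightarrow> complex) \<Rightarrow> bool" where
 "admits g w f \<longleftrightarrow> (\<exists>T>0. \<exists>F Fw e C. C \<ge> 0 \<and> dbar_ext w T F Fw e \<and> (\<forall>x. F x 0 = f x) \<and>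
   (\<forall>x. \<forall>t\<in>{0..T}. cmod (e x t) \<le> C * g t))"

lemma lift_class_linear:
 fixes f :: "real^'d \<Rightarrow> 'b::real_normed_vector"
 shows "bounded_linear L ==> lift_class r f ==> lift_class r (\<lambda>x. L (f x))"
 unfolding lift_class_def smooth_def by (auto simp: real_analytic_linear differentiable_Ck_linear)

lemma lift_class_add:
 fixes f g :: "real^'d \<Rightarrow> 'b::real_normed_vector"
 shows "lift_class r f ==> lift_class r g ==> lift_class r (\<lambda>x. f x + g x)"
 unfolding lift_class_def smooth_def by (auto simp: real_analytic_add differentiable_Ck_add)

lemma lift_class_continuous:
 fixes f :: "real^'d \<Rightarrow> complex"
 assumes "lift_class r f" "periodic f" shows "continuous_on UNIV f"
 using assms analytic_directional(1)[of f 0 0] smooth_continuous[of f] by (auto simp: lift_class_def split: if_splits)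

lemma gauges_nonneg: "g \<in> gauges r ==> t \<ge> 0 ==> g t \<ge> 0"
 by (auto simp: gauges_def split: if_splits)

lemma gauges_square:
 assumes g: "g \<in> gauges r" shows "(\<lambda>t. t\<^sup>2 * g t) \<in> gauges r"
proof (cases "r = C_omega")
 case True
 then show ?thesis using g by (simp add: gauges_def)
next
 case False
 then obtain J where J: "g = (\<lambda>t. t ^ J)" using g by (auto simp: gauges_def)
 have "(\<lambda>t. t\<^sup>2 * g t) \<in> range (\<lambda>J t. t ^ J)"
  by (rule range_eqI[where x = "2 + J"]) (simp only: J power_add)
 then show ?thesis using False by (simp only: gauges_def if_False)
qed

lemma lift_class_admits:
 fixes f :: "real^'d \<Rightarrow> complex"
 assumes f: "lift_class r f" and p: "periodic f" and g: "g \<in> gauges r"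
 shows "admits g w f"
proof (cases "r = C_omega")
 case True
 then have an: "real_analytic f" and g0: "g = (\<lambda>t. 0)" using f g by (simp_all add: lift_class_def gauges_def)
 obtain K R where R: "R > 0" and b: "\<And>j x. cmod ((dird w ^^ j) f x) \<le> K * fact j * R ^ j"
  using analytic_directional(3)[OF an p, of w] by blast
 obtain F Fw where F: "dbar_ext w (1 / (2 * R)) F Fw (\<lambda>x t. 0)" "\<And>x. F x 0 = (dird w ^^ 0) f x"
  using holomorphic_extension[where d = "\<lambda>j. (dird w ^^ j) f", OF analytic_directional(1)[OF an p] periodic_dird_power[OF p]
   analytic_directional(2)[OF an p] b R refl] by blast
 show ?thesis unfolding admits_def g0
  by (intro exI[of _ "1 / (2 * R)"] conjI exI[of _ F] exI[of _ Fw] exI[of _ "\<lambda>x t. 0"] exI[of _ 0]) (use R F in auto)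
next
 case False
 then obtain J where sm: "smooth f" and g0: "g = (\<lambda>t. t ^ J)" using f g by (auto simp: lift_class_def gauges_def)
 let ?d = "\<lambda>j. (dird w ^^ j) f"
 have dj: "continuous_on UNIV (?d j)" "periodic (?d j)" for j
  using smooth_continuous[OF smooth_dird_power[OF sm]] periodic_dird_power[OF p] by blast+
 have der: "((\<lambda>s. ?d j (x + s *\<^sub>R w)) has_vector_derivative ?d (Suc j) x) (at 0)" for j x
  using smooth_dird(2)[OF smooth_dird_power[OF sm]] by simp
 note ext = taylor_extension[where d = ?d and T = 1 and J = J, OF dj der]
 obtain C where C: "C > 0" "\<And>x. cmod (?d (Suc J) x) \<le> C" using periodic_bounded[OF dj] by blast
 have e: "cmod (- \<i> * ((\<i> * of_real t) ^ J / fact J * ?d (Suc J) x)) \<le> C * t ^ J" if t: "t \<in> {0..1}" for t x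
 proof -
  have "cmod (- \<i> * ((\<i> * of_real t) ^ J / fact J * ?d (Suc J) x)) = t ^ J / fact J * cmod (?d (Suc J) x)"
   using t by (simp add: norm_mult norm_divide norm_power del: funpow.simps)
  also have "\<dots> \<le> t ^ J / 1 * C"
  proof (intro mult_mono C)
   show "t ^ J / fact J \<le> t ^ J / 1" using t by (intro divide_left_mono) (auto simp: fact_ge_1)
  qed (use t in auto)
  finally show ?thesis by (simp add: mult.commute)
 qed
 have f0: "(\<Sum>j\<le>J. (\<i> * of_real 0) ^ j / fact j * ?d j x) = f x" for x
 proof -
  have "(\<Sum>j\<le>J. (\<i> * of_real 0) ^ j / fact j * ?d j x) = (\<Sum>j\<le>J. if j = 0 then f x else 0)"
   by (intro sum.cong) (auto simp: power_0_left)
  then show ?thesis by simp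
 qed
 show ?thesis unfolding admits_def g0
  by (rule exI[of _ 1], rule conjI, simp, intro exI conjI, rule less_imp_le[OF C(1)], rule ext) (use f0 e in blast)+
qed

lemma admits_const: "g \<in> gauges r ==> admits g w (\<lambda>x. c)"
 unfolding admits_def
 by (rule exI[of _ 1], rule conjI, simp, rule exI[of _ "\<lambda>x t. c"], rule exI[of _ "\<lambda>x t. 0"], rule exI[of _ "\<lambda>x t. 0"], rule exI[of _ 0])
   (simp add: dbar_ext_const)

lemma admits_add:
 assumes "admits g w f" "admits g w f'"
 shows "admits g w (\<lambda>x. f x + f' x)"
proof -
 obtain T1 F1 Fw1 e1 C1 where 1: "T1 > 0" "C1 \<ge> 0" "dbar_ext w T1 F1 Fw1 e1" "\<And>x. F1 x 0 = f x" "\<And>x t. t \<in> {0..T1} ==> cmod (e1 x t) \<le> C1 * g t"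
  using assms(1) unfolding admits_def by blast
 obtain T2 F2 Fw2 e2 C2 where 2: "T2 > 0" "C2 \<ge> 0" "dbar_ext w T2 F2 Fw2 e2" "\<And>x. F2 x 0 = f' x" "\<And>x t. t \<in> {0..T2} ==> cmod (e2 x t) \<le> C2 * g t"
  using assms(2) unfolding admits_def by blast
 let ?T = "min T1 T2"
 note ext = dbar_ext_add[OF dbar_ext_subset[OF 1(3), of ?T] dbar_ext_subset[OF 2(3), of ?T]]
 have "cmod (e1 x t + e2 x t) \<le> (C1 + C2) * g t" if "t \<in> {0..?T}" for x t
  using norm_triangle_ineq[of "e1 x t" "e2 x t"] 1(5)[of t x] 2(5)[of t x] that unfolding distrib_right by fastforce
 then show ?thesis unfolding admits_def
  by (intro exI[of _ ?T] conjI exI[of _ "C1 + C2"] exI[of _ "\<lambda>x t. F1 x t + F2 x t"] exI[of _ "\<lambda>x t. Fw1 x t + Fw2 x t"] exI[of _ "\<lambda>x t. e1 x t + e2 x t"])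
    (use 1 2 ext in auto)
qed

lemma admits_mult:
 assumes "admits g w f" "admits g w f'"
 shows "admits g w (\<lambda>x. f x * f' x)"
proof -
 obtain T1 F1 Fw1 e1 C1 where 1: "T1 > 0" "C1 \<ge> 0" "dbar_ext w T1 F1 Fw1 e1" "\<And>x. F1 x 0 = f x" "\<And>x t. t \<in> {0..T1} ==> cmod (e1 x t) \<le> C1 * g t"
  using assms(1) unfolding admits_def by blast
 obtain T2 F2 Fw2 e2 C2 where 2: "T2 > 0" "C2 \<ge> 0" "dbar_ext w T2 F2 Fw2 e2" "\<And>x. F2 x 0 = f' x" "\<And>x t. t \<in> {0..T2} ==> cmod (e2 x t) \<le> C2 * g t"
  using assms(2) unfolding admits_def by blast
 let ?T = "min T1 T2"
 note ext = dbar_ext_mult[OF dbar_ext_subset[OF 1(3), of ?T] dbar_ext_subset[OF 2(3), of ?T]]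
 obtain B1 where B1: "B1 > 0" "\<And>x t. t \<in> {0..T1} ==> norm (F1 x t) \<le> B1" using cper_bounded[OF dbar_extD(1)[OF 1(3)]] by blast
 obtain B2 where B2: "B2 > 0" "\<And>x t. t \<in> {0..T2} ==> norm (F2 x t) \<le> B2" using cper_bounded[OF dbar_extD(1)[OF 2(3)]] by blast
 have err: "cmod (F1 x t * e2 x t + e1 x t * F2 x t) \<le> (B1 * C2 + C1 * B2) * g t" if t: "t \<in> {0..?T}" for x t
 proof -
  have t': "t \<in> {0..T1}" "t \<in> {0..T2}" using t by auto
  have "cmod (F1 x t) * cmod (e2 x t) \<le> B1 * (C2 * g t)"
   using B1(1) B1(2)[OF t'(1)] 2(5)[OF t'(2)] by (intro mult_mono) auto
  moreover have "cmod (e1 x t) * cmod (F2 x t) \<le> (C1 * g t) * B2"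
   using B2(2)[OF t'(2)] 1(5)[OF t'(1)] order_trans[OF norm_ge_zero 1(5)[OF t'(1)]] by (intro mult_mono) auto
  moreover have "(B1 * C2 + C1 * B2) * g t = B1 * (C2 * g t) + (C1 * g t) * B2" by (simp add: algebra_simps)
  ultimately show ?thesis using norm_triangle_ineq[of "F1 x t * e2 x t" "e1 x t * F2 x t"] unfolding norm_mult by linarith
 qed
 have "B1 * C2 + C1 * B2 \<ge> 0" using 1(2) 2(2) B1(1) B2(1) by simp
 moreover have "F1 x 0 * F2 x 0 = f x * f' x" for x using 1(4) 2(4) by simp
 moreover have "?T > 0" using 1 2 by simp
 moreover have "?T \<le> T1" "?T \<le> T2" by auto
 ultimately show ?thesis unfolding admits_def using ext err by blast
qed

lemma admits_shift:
 assumes "admits g w f" shows "admits g w (\<lambda>x. f (x + b))"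
proof -
 obtain T F Fw e C where 1: "T > 0" "C \<ge> 0" "dbar_ext w T F Fw e" "\<And>x. F x 0 = f x" "\<And>x t. t \<in> {0..T} ==> cmod (e x t) \<le> C * g t"
  using assms(1) unfolding admits_def by blast
 show ?thesis unfolding admits_def
  by (intro exI[of _ T] conjI exI[of _ C] exI[of _ "\<lambda>x t. F (x + b) t"] exI[of _ "\<lambda>x t. Fw (x + b) t"] exI[of _ "\<lambda>x t. e (x + b) t"])
    (use 1 dbar_ext_shift[OF 1(3)] in auto)
qed

text \<open>Near \<open>t = 0\<close> the extension stays in the right half plane, where \<open>h\<close> is holomorphic.\<close>

lemma admits_compose:
 assumes "admits g w f" and \<delta>: "\<delta> > 0" "\<And>x. Re (f x) \<ge> \<delta>"
  and h: "\<And>z. Re z > 0 ==> (h has_field_derivative h' z) (at z)" and h': "continuous_on {z. Re z > 0} h'"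
 shows "admits g w (\<lambda>x. h (f x))"
proof -
 obtain T F Fw e C where 1: "T > 0" "C \<ge> 0" "dbar_ext w T F Fw e" "\<And>x. F x 0 = f x" "\<And>x t. t \<in> {0..T} ==> cmod (e x t) \<le> C * g t"
  using assms(1) unfolding admits_def by blast
 obtain d where d: "d > 0" "\<And>x t x' t'. t \<in> {0..T} ==> t' \<in> {0..T} ==> dist x x' < d ==> dist t t' < d ==> dist (F x t) (F x' t') < \<delta>"
  using cper_uniform[OF dbar_extD(1)[OF 1(3)] \<delta>(1)] by blast
 define T' where "T' = min T (d / 2)"
 have T': "T' > 0" "T' \<le> T" "T' < d" using 1(1) d(1) by (auto simp: T'_def)
 note ext1 = dbar_ext_subset[OF 1(3) T'(2)]
 have pos: "F x t \<in> {z. Re z > 0}" if "t \<in> {0..T'}" for x t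
 proof -
  have "dist (F x t) (F x 0) < \<delta>" using that T' d(1) by (intro d(2)) auto
  then have "\<bar>Re (F x t - f x)\<bar> < \<delta>" using abs_Re_le_cmod[of "F x t - f x"] 1(4) by (simp add: dist_norm)
  then show ?thesis using \<delta>(2)[of x] by simp
 qed
 have ext: "dbar_ext w T' (\<lambda>x t. h (F x t)) (\<lambda>x t. Fw x t * h' (F x t)) (\<lambda>x t. e x t * h' (F x t))"
  by (rule dbar_ext_compose[OF ext1 pos h h']) auto
 have "cper T' (\<lambda>x t. h' (F x t))" by (rule cper_compose[OF dbar_extD(1)[OF ext1] h' pos])
 then obtain B where B: "B > 0" "\<And>x t. t \<in> {0..T'} ==> norm (h' (F x t)) \<le> B" using cper_bounded by blast
 have err: "cmod (e x t * h' (F x t)) \<le> (C * B) * g t" if t: "t \<in> {0..T'}" for x t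
 proof -
  have t': "t \<in> {0..T}" using t T' by auto
  have "cmod (e x t) * cmod (h' (F x t)) \<le> (C * g t) * B"
   using B(2)[OF t] 1(5)[OF t'] order_trans[OF norm_ge_zero 1(5)[OF t']] by (intro mult_mono) auto
  then show ?thesis by (simp add: norm_mult mult_ac)
 qed
 have "h (F x 0) = h (f x)" for x using 1(4) by simp
 moreover have "C * B \<ge> 0" using 1(2) B(1) by simp
 ultimately show ?thesis unfolding admits_def using ext err T'(1) by blast
qed

section \<open>From extensions to decay of Fourier coefficients\<close>

text \<open>The bound that an extension with gauge \<open>g\<close> gives for the coefficients in the half space \<open>k \<bullet> w \<le> 0\<close>; \<open>G\<close> bounds the
weighted defect and is chosen by the user according to \<open>k\<close>.\<close>

definition half_decay :: "(real \<Rightarrow> real) \<Rightarrow> real^'d \<Rightarrow> (real^'d \<Rightarrow> complex) \<Rightarrow> bool" where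
 "half_decay g w c \<longleftrightarrow> (\<exists>T>0. \<exists>K\<ge>0. \<forall>k a G. int_vec k \<longrightarrow> a = - (2 * pi * (k \<bullet> w)) \<longrightarrow> a \<ge> 0 \<longrightarrow> G \<ge> 0 \<longrightarrow>
   (\<forall>t\<in>{0..T}. exp (- a * t) * g t \<le> G) \<longrightarrow> cmod (c k) \<le> K * (exp (- a * T) + G))"

lemma admits_half_decay:
 assumes syn: "syndetic_orbit \<alpha>" and f: "admits g w f"
 shows "half_decay g w (fcoeff \<alpha> f)"
proof -
 obtain T F Fw e C where 1: "T > 0" "C \<ge> 0" "dbar_ext w T F Fw e" "\<And>x. F x 0 = f x" "\<And>x t. t \<in> {0..T} ==> cmod (e x t) \<le> C * g t"
  using f unfolding admits_def by blast
 obtain B where B: "B > 0" "\<And>x t. t \<in> {0..T} ==> norm (F x t) \<le> B" using cper_bounded[OF dbar_extD(1)[OF 1(3)]] by blast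
 have "cmod (fcoeff \<alpha> f k) \<le> (B + C * T) * (exp (- a * T) + G)"
  if k: "int_vec k" and a: "a = - (2 * pi * (k \<bullet> w))" and G: "G \<ge> 0" and Gb: "\<forall>t\<in>{0..T}. exp (- a * t) * g t \<le> G" for k a G
 proof -
  have "norm (fcoeff \<alpha> (\<lambda>x. F x 0) k) \<le> exp (- a * T) * B + ((\<lambda>t. C * G * t) T - (\<lambda>t. C * G * t) 0)"
  proof (rule fcoeff_dbar_bound[OF syn 1(3,1) k a])
   show "norm (F x T) \<le> B" for x using B(2) 1(1) by simp
   show "((\<lambda>t. C * G * t) has_vector_derivative C * G) (at t within {0..T})" for t
    by (auto intro!: derivative_eq_intros simp: has_vector_derivative_def)
   fix x t assume t: "t \<in> {0..T}"
   have "exp (- a * t) * cmod (e x t) \<le> exp (- a * t) * (C * g t)" using 1(5)[OF t] by (intro mult_left_mono) auto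
   also have "\<dots> = C * (exp (- a * t) * g t)" by simp
   also have "\<dots> \<le> C * G" using Gb t 1(2) by (intro mult_left_mono) auto
   finally show "exp (- a * t) * norm (e x t) \<le> C * G" .
  qed
  moreover have "exp (- a * T) * B + C * G * T \<le> (B + C * T) * (exp (- a * T) + G)"
   using B(1) 1(1,2) G by (simp add: algebra_simps)
  ultimately show ?thesis using 1(4) by simp
 qed
 moreover have "B + C * T \<ge> 0" using B(1) 1(1,2) by simp
 ultimately show ?thesis unfolding half_decay_def using 1(1) by blast
qed

lemma half_decay_exp:
 assumes "half_decay (\<lambda>t. 0) w c"
 shows "\<exists>K. \<exists>\<rho>>0. \<forall>k. int_vec k \<longrightarrow> k \<bullet> w \<le> 0 \<longrightarrow> cmod (c k) \<le> K * exp (- \<rho> * \<bar>k \<bullet> w\<bar>)"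
proof -
 obtain T K where T: "T > 0" and h: "\<And>k a G. int_vec k ==> a = - (2 * pi * (k \<bullet> w)) ==> a \<ge> 0 ==> G \<ge> 0 ==>
   (\<forall>t\<in>{0..T}. exp (- a * t) * 0 \<le> G) ==> cmod (c k) \<le> K * (exp (- a * T) + G)"
  using assms unfolding half_decay_def by blast
 have "cmod (c k) \<le> K * exp (- (2 * pi * T) * \<bar>k \<bullet> w\<bar>)" if k: "int_vec k" and kw: "k \<bullet> w \<le> 0" for k
 proof -
  have "0 \<le> 2 * pi * \<bar>k \<bullet> w\<bar>" by simp
  then have a: "- (2 * pi * (k \<bullet> w)) \<ge> 0" using kw by simp
  have eq: "- (- (2 * pi * (k \<bullet> w))) * T = - (2 * pi * T) * \<bar>k \<bullet> w\<bar>" using kw by simp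
  show ?thesis using h[OF k refl a order_refl] unfolding eq by simp
 qed
 then show ?thesis using T by (intro exI[of _ K] exI[of _ "2 * pi * T"]) auto
qed

lemma half_decay_power:
 assumes "half_decay (\<lambda>t. t ^ J) w c"
 shows "\<exists>K. \<forall>k. int_vec k \<longrightarrow> k \<bullet> w \<le> 0 \<longrightarrow> \<bar>k \<bullet> w\<bar> ^ J * cmod (c k) \<le> K"
proof -
 obtain T K where T: "T > 0" and K: "K \<ge> 0" and h: "\<And>k a G. int_vec k ==> a = - (2 * pi * (k \<bullet> w)) ==> a \<ge> 0 ==> G \<ge> 0 ==>
   (\<forall>t\<in>{0..T}. exp (- a * t) * t ^ J \<le> G) ==> cmod (c k) \<le> K * (exp (- a * T) + G)"
  using assms unfolding half_decay_def by blast
 have pe: "(a * t) ^ J * exp (- a * t) \<le> fact J" if "a \<ge> 0" "t \<ge> 0" for a t :: real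
 proof -
  have "(a * t) ^ J * exp (- a * t) \<le> (fact J * exp (a * t)) * exp (- a * t)"
   using that by (intro mult_right_mono power_le_fact_exp) auto
  then show ?thesis by (simp add: mult.assoc flip: exp_add)
 qed
 have "\<bar>k \<bullet> w\<bar> ^ J * cmod (c k) \<le> K * (fact J / T ^ J + fact J)" if k: "int_vec k" and kw: "k \<bullet> w \<le> 0" for k
 proof -
  define a where "a = - (2 * pi * (k \<bullet> w))"
  have a: "a = 2 * pi * \<bar>k \<bullet> w\<bar>" using kw by (simp add: a_def)
  have a0: "a \<ge> 0" unfolding a by simp
  have ka: "\<bar>k \<bullet> w\<bar> ^ J \<le> a ^ J"
  proof (rule power_mono)
   have "1 * \<bar>k \<bullet> w\<bar> \<le> 2 * pi * \<bar>k \<bullet> w\<bar>" using pi_gt3 by (intro mult_right_mono) auto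
   then show "\<bar>k \<bullet> w\<bar> \<le> a" unfolding a by simp
  qed simp
  have "a ^ J * cmod (c k) \<le> K * (fact J / T ^ J + fact J)"
  proof (cases "a ^ J = 0")
   case True
   show ?thesis unfolding True using K T by simp
  next
   case False
   have "a ^ J \<ge> 0" using a0 by (rule zero_le_power)
   then have aJ: "a ^ J > 0" using False by (rule le_neq_trans[OF _ not_sym])
   have "exp (- a * t) * t ^ J \<le> fact J / a ^ J" if "t \<in> {0..T}" for t
   proof -
    have "exp (- a * t) * t ^ J * a ^ J \<le> fact J"
     using pe[OF a0, of t] that unfolding power_mult_distrib by (simp only: mult_ac atLeastAtMost_iff)
    then show ?thesis by (simp only: pos_le_divide_eq[OF aJ])
   qed
   then have "cmod (c k) \<le> K * (exp (- a * T) + fact J / a ^ J)"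
    using aJ by (intro h[OF k a_def a0]) auto
   then have "a ^ J * cmod (c k) \<le> a ^ J * (K * (exp (- a * T) + fact J / a ^ J))"
    using aJ by (intro mult_left_mono) auto
   also have "\<dots> = K * (a ^ J * exp (- a * T) + fact J)"
   proof -
    have "A * (K * (E + F / A)) = K * (A * E + F)" if "A \<noteq> 0" for A E F :: real
     using that by (simp add: field_simps)
    then show ?thesis using False by blast
   qed
   also have "\<dots> \<le> K * (fact J / T ^ J + fact J)"
   proof -
    have "a ^ J * exp (- a * T) \<le> fact J / T ^ J"
    proof -
     have "a ^ J * exp (- a * T) * T ^ J \<le> fact J"
      using pe[OF a0 less_imp_le[OF T]] unfolding power_mult_distrib by (simp only: mult_ac)
     then show ?thesis using T by (simp only: pos_le_divide_eq zero_less_power)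
    qed
    then show ?thesis using K by (intro mult_left_mono) auto
   qed
   finally show ?thesis .
  qed
  then show ?thesis using mult_right_mono[OF ka norm_ge_zero[of "c k"]] by linarith
 qed
 then show ?thesis by blast
qed

text \<open>The decay of coefficients that corresponds to the class \<open>r\<close>.\<close>

definition good_coeffs :: "regularity \<Rightarrow> (real^'d \<Rightarrow> complex) \<Rightarrow> bool" where
 "good_coeffs r c \<longleftrightarrow> (if r = C_omega then \<exists>K. \<exists>\<rho>>0. \<forall>k. int_vec k \<longrightarrow> cmod (c k) \<le> K * exp (- \<rho> * l1 k) else rapid c)"

lemma good_coeffs_rapid:
 fixes c :: "real^'d \<Rightarrow> complex"
 assumes c: "good_coeffs r c" shows "rapid c"
proof (cases "r = C_omega")
 case True
 with c obtain K \<rho> where \<rho>: "\<rho> > 0" and K: "\<And>k. int_vec k ==> cmod (c k) \<le> K * exp (- \<rho> * l1 k)"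
  by (auto simp: good_coeffs_def)
 show "rapid c" unfolding rapid_def
 proof (intro allI exI impI)
  fix J and k :: "real^'d" assume k: "int_vec k"
  have "(1 + l1 k) ^ J * cmod (c k) \<le> (1 + l1 k) ^ J * (\<bar>K\<bar> * exp (- \<rho> * l1 k))"
  proof (rule mult_left_mono)
   have "K * exp (- \<rho> * l1 k) \<le> \<bar>K\<bar> * exp (- \<rho> * l1 k)" by (intro mult_right_mono) auto
   then show "cmod (c k) \<le> \<bar>K\<bar> * exp (- \<rho> * l1 k)" using K[OF k] by linarith
  qed (use l1_nonneg[of k] in simp)
  also have "\<dots> = \<bar>K\<bar> * ((1 + l1 k) ^ J * exp (- \<rho> * l1 k))" by (simp only: mult.left_commute)
  also have "\<dots> \<le> \<bar>K\<bar> * (fact J * exp \<rho> / \<rho> ^ J)" by (intro mult_left_mono lattice_power_exp_le \<rho>) auto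
  finally show "(1 + l1 k) ^ J * cmod (c k) \<le> \<bar>K\<bar> * (fact J * exp \<rho> / \<rho> ^ J)" .
 qed
qed (use c in \<open>simp add: good_coeffs_def\<close>)

lemma both_half_decay_exp:
 assumes "half_decay (\<lambda>t. 0) w c" "half_decay (\<lambda>t. 0) (- w) c"
 shows "\<exists>K. K \<ge> 0 \<and> (\<exists>\<rho>>0. \<forall>k. int_vec k \<longrightarrow> cmod (c k) \<le> K * exp (- \<rho> * \<bar>k \<bullet> w\<bar>))"
proof -
 obtain K1 \<rho>1 where 1: "\<rho>1 > 0" "\<And>k. int_vec k ==> k \<bullet> w \<le> 0 ==> cmod (c k) \<le> K1 * exp (- \<rho>1 * \<bar>k \<bullet> w\<bar>)"
  using half_decay_exp[OF assms(1)] by blast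
 obtain K2 \<rho>2 where 2: "\<rho>2 > 0" "\<And>k. int_vec k ==> k \<bullet> - w \<le> 0 ==> cmod (c k) \<le> K2 * exp (- \<rho>2 * \<bar>k \<bullet> - w\<bar>)"
  using half_decay_exp[OF assms(2)] by blast
 have le: "K' * exp (- \<rho>' * x) \<le> (\<bar>K1\<bar> + \<bar>K2\<bar>) * exp (- min \<rho>1 \<rho>2 * x)"
  if "x \<ge> 0" "K' \<le> \<bar>K1\<bar> + \<bar>K2\<bar>" "min \<rho>1 \<rho>2 \<le> \<rho>'" for x K' \<rho>'
 proof -
  have "K' * exp (- \<rho>' * x) \<le> (\<bar>K1\<bar> + \<bar>K2\<bar>) * exp (- \<rho>' * x)" using that by (intro mult_right_mono) auto
  also have "\<dots> \<le> (\<bar>K1\<bar> + \<bar>K2\<bar>) * exp (- min \<rho>1 \<rho>2 * x)"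
   using mult_right_mono[OF that(3,1)] by (intro mult_left_mono) auto
  finally show ?thesis .
 qed
 have "cmod (c k) \<le> (\<bar>K1\<bar> + \<bar>K2\<bar>) * exp (- min \<rho>1 \<rho>2 * \<bar>k \<bullet> w\<bar>)" if k: "int_vec k" for k
 proof (cases "k \<bullet> w \<le> 0")
  case True
  have "K1 \<le> \<bar>K1\<bar> + \<bar>K2\<bar>" by simp
  from order_trans[OF 1(2)[OF k True] le[OF abs_ge_zero this min.cobounded1]] show ?thesis .
 next
  case False
  then have k2: "k \<bullet> - w \<le> 0" by simp
  have "K2 \<le> \<bar>K1\<bar> + \<bar>K2\<bar>" by simp
  from order_trans[OF 2(2)[OF k k2] le[OF abs_ge_zero this min.cobounded2]] show ?thesis by simp
 qed
 moreover have "min \<rho>1 \<rho>2 > 0" using 1 2 by simp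
 moreover have "\<bar>K1\<bar> + \<bar>K2\<bar> \<ge> 0" by simp
 ultimately show ?thesis by blast
qed

lemma both_half_decay_power:
 assumes "half_decay (\<lambda>t. t ^ J) w c" "half_decay (\<lambda>t. t ^ J) (- w) c"
 shows "\<exists>K. \<forall>k. int_vec k \<longrightarrow> \<bar>k \<bullet> w\<bar> ^ J * cmod (c k) \<le> K"
proof -
 obtain K1 where 1: "\<And>k. int_vec k ==> k \<bullet> w \<le> 0 ==> \<bar>k \<bullet> w\<bar> ^ J * cmod (c k) \<le> K1"
  using half_decay_power[OF assms(1)] by blast
 obtain K2 where 2: "\<And>k. int_vec k ==> k \<bullet> - w \<le> 0 ==> \<bar>k \<bullet> - w\<bar> ^ J * cmod (c k) \<le> K2"
  using half_decay_power[OF assms(2)] by blast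
 have "\<bar>k \<bullet> w\<bar> ^ J * cmod (c k) \<le> max K1 K2" if k: "int_vec k" for k
 proof (cases "k \<bullet> w \<le> 0")
  case True
  then show ?thesis using 1[OF k] by (simp add: le_max_iff_disj)
 next
  case False
  then show ?thesis using 2[OF k] by (simp add: le_max_iff_disj)
 qed
 then show ?thesis by blast
qed

text \<open>The vectors \<open>l\<close> and \<open>l + axis i 1 / 2\<close> do: they have positive product with the integer vector \<open>l\<close>, because \<open>|l $ i| \<le> l \<bullet> l\<close>, and they
span, because \<open>k $ i = 2 * (k \<bullet> (l + axis i 1 / 2) - k \<bullet> l)\<close>.\<close>

lemma cone_directions:
 fixes l :: "real^'d"
 assumes l: "int_vec l" "l \<noteq> 0"
 obtains W where "finite W" "W \<noteq> {}" "\<And>w. w \<in> W ==> l \<bullet> w > 0"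
  "\<And>k. \<exists>w\<in>W. l1 k \<le> 4 * real CARD('d) * \<bar>k \<bullet> w\<bar>"
proof
 let ?v = "\<lambda>i. l + (1/2) *\<^sub>R axis i 1"
 let ?W = "insert l (range ?v)"
 show "finite ?W" "?W \<noteq> {}" by auto
 have kv: "k \<bullet> ?v i = k \<bullet> l + k $ i / 2" for k i by (simp add: inner_add_right inner_axis)
 have ll: "l \<bullet> l > 0" using l by simp
 show "l \<bullet> w > 0" if wW: "w \<in> ?W" for w
 proof (cases "w = l")
  case False
  then obtain i where w: "w = ?v i" using wW False by blast
  have "\<bar>l $ i\<bar> \<le> l \<bullet> l"
  proof -
   have "l $ i * l $ i \<le> (\<Sum>j\<in>UNIV. l $ j * l $ j)" by (rule member_le_sum) auto
   moreover have "\<bar>l $ i\<bar> \<le> l $ i * l $ i"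
   proof -
    obtain z where z: "l $ i = of_int z" using l(1) by (auto simp: int_vec_def elim: Ints_cases)
    have "\<bar>z\<bar> * 1 \<le> \<bar>z\<bar> * \<bar>z\<bar>" if "z \<noteq> 0" using that by (intro mult_left_mono) auto
    then have "\<bar>z\<bar> \<le> z * z" by (cases "z = 0") auto
    then show ?thesis unfolding z by (metis of_int_abs of_int_le_iff of_int_mult)
   qed
   ultimately show ?thesis by (simp add: inner_vec_def)
  qed
  then show ?thesis unfolding w kv using ll by linarith
 qed (use ll in simp)
 show "\<exists>w\<in>?W. l1 k \<le> 4 * real CARD('d) * \<bar>k \<bullet> w\<bar>" for k
 proof (rule ccontr)
  assume "\<not> ?thesis"
  then have a: "4 * real CARD('d) * \<bar>k \<bullet> w\<bar> < l1 k" if "w \<in> ?W" for w using that by (meson not_le)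
  have "real CARD('d) * \<bar>k $ i\<bar> < l1 k" for i
  proof -
   have "\<bar>k $ i\<bar> \<le> 2 * (\<bar>k \<bullet> ?v i\<bar> + \<bar>k \<bullet> l\<bar>)" unfolding kv
    using abs_triangle_ineq4[of "k \<bullet> l + k $ i / 2" "k \<bullet> l"] by simp
   then have "real CARD('d) * \<bar>k $ i\<bar> \<le> real CARD('d) * (2 * (\<bar>k \<bullet> ?v i\<bar> + \<bar>k \<bullet> l\<bar>))" by (intro mult_left_mono) auto
   also have "\<dots> = (4 * real CARD('d) * \<bar>k \<bullet> ?v i\<bar> + 4 * real CARD('d) * \<bar>k \<bullet> l\<bar>) / 2" by (simp add: algebra_simps)
   also have "\<dots> < l1 k" using a[of "?v i"] a[of l] by auto
   finally show ?thesis .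
  qed
  then have "(\<Sum>i\<in>(UNIV::'d set). real CARD('d) * \<bar>k $ i\<bar>) < (\<Sum>i\<in>(UNIV::'d set). l1 k)"
   by (intro sum_strict_mono) auto
  then show False by (simp add: l1_def sum_distrib_left)
 qed
qed

lemma good_coeffs_from_cone:
 fixes l :: "real^'d"
 assumes l: "int_vec l" "l \<noteq> 0"
  and h: "\<And>w g. l \<bullet> w > 0 ==> g \<in> gauges r ==> half_decay g w c \<and> half_decay g (- w) c"
 shows "good_coeffs r c"
proof -
 obtain W where W: "finite W" "W \<noteq> {}" "\<And>w. w \<in> W ==> l \<bullet> w > 0" and sp: "\<And>k. \<exists>w\<in>W. l1 k \<le> 4 * real CARD('d) * \<bar>k \<bullet> w\<bar>"
  using cone_directions[OF l] by blast
 let ?n = "4 * real CARD('d)"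
 have n: "?n > 0" by simp
 show ?thesis
 proof (cases "r = C_omega")
  case True
  have "\<exists>K \<rho>. K \<ge> 0 \<and> \<rho> > 0 \<and> (\<forall>k. int_vec k \<longrightarrow> cmod (c k) \<le> K * exp (- \<rho> * \<bar>k \<bullet> w\<bar>))" if "w \<in> W" for w
   using both_half_decay_exp[of w c] h[OF W(3)[OF that], of "\<lambda>t. 0"] True by (auto simp: gauges_def)
  then obtain K \<rho> where K: "\<And>w. w \<in> W ==> K w \<ge> 0" "\<And>w. w \<in> W ==> \<rho> w > 0"
   "\<And>w k. w \<in> W ==> int_vec k ==> cmod (c k) \<le> K w * exp (- \<rho> w * \<bar>k \<bullet> w\<bar>)" by metis
  define R where "R = Min (\<rho> ` W)"
  have R: "R > 0" "\<And>w. w \<in> W ==> R \<le> \<rho> w" using W K(2) by (auto simp: R_def)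
  have "cmod (c k) \<le> (\<Sum>w\<in>W. K w) * exp (- (R / ?n) * l1 k)" if k: "int_vec k" for k
  proof -
   obtain w where w: "w \<in> W" "l1 k \<le> ?n * \<bar>k \<bullet> w\<bar>" using sp by blast
   have "(R / ?n) * l1 k \<le> (R / ?n) * (?n * \<bar>k \<bullet> w\<bar>)" using w(2) R(1) by (intro mult_left_mono) auto
   also have "\<dots> = R * \<bar>k \<bullet> w\<bar>" by simp
   also have "\<dots> \<le> \<rho> w * \<bar>k \<bullet> w\<bar>" using R(2)[OF w(1)] by (intro mult_right_mono) auto
   finally have "exp (- \<rho> w * \<bar>k \<bullet> w\<bar>) \<le> exp (- (R / ?n) * l1 k)" by simp
   moreover have "K w \<le> (\<Sum>w\<in>W. K w)" using w W(1) K(1) by (intro member_le_sum) auto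
   ultimately have "K w * exp (- \<rho> w * \<bar>k \<bullet> w\<bar>) \<le> (\<Sum>w\<in>W. K w) * exp (- (R / ?n) * l1 k)"
    using K(1) by (intro mult_mono sum_nonneg) auto
   then show ?thesis using K(3)[OF w(1) k] by linarith
  qed
  moreover have "R / ?n > 0" using R(1) n by (rule divide_pos_pos)
  ultimately show ?thesis unfolding good_coeffs_def if_P[OF True] by blast
 next
  case False
  have "\<exists>K. \<forall>k. int_vec k \<longrightarrow> \<bar>k \<bullet> w\<bar> ^ J * cmod (c k) \<le> K" if "w \<in> W" for w J
   using both_half_decay_power[of J w c] h[OF W(3)[OF that], of "\<lambda>t. t ^ J"] False by (simp add: gauges_def)
  then obtain K where K: "\<And>w J k. w \<in> W ==> int_vec k ==> \<bar>k \<bullet> w\<bar> ^ J * cmod (c k) \<le> K w J" by metis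
  have "(1 + l1 k) ^ J * cmod (c k) \<le> 2 ^ J * (\<Sum>w\<in>W. \<bar>K w 0\<bar> + ?n ^ J * \<bar>K w J\<bar>)" if k: "int_vec k" for k J
  proof -
   obtain w where w: "w \<in> W" "l1 k \<le> ?n * \<bar>k \<bullet> w\<bar>" using sp by blast
   have c0: "cmod (c k) \<le> \<bar>K w 0\<bar>" using K[OF w(1) k, of 0] by simp
   have "l1 k ^ J \<le> (?n * \<bar>k \<bullet> w\<bar>) ^ J" using w(2) l1_nonneg by (rule power_mono)
   then have "l1 k ^ J * cmod (c k) \<le> (?n * \<bar>k \<bullet> w\<bar>) ^ J * cmod (c k)" by (intro mult_right_mono) auto
   also have "\<dots> = ?n ^ J * (\<bar>k \<bullet> w\<bar> ^ J * cmod (c k))" by (simp only: power_mult_distrib mult.assoc)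
   also have "\<dots> \<le> ?n ^ J * \<bar>K w J\<bar>"
    using K[OF w(1) k, of J] by (intro mult_left_mono) auto
   finally have cJ: "l1 k ^ J * cmod (c k) \<le> ?n ^ J * \<bar>K w J\<bar>" .
   have "(1 + l1 k) ^ J \<le> 2 ^ J * (1 + l1 k ^ J)"
   proof (cases "l1 k \<le> 1")
    case True
    then have "(1 + l1 k) ^ J \<le> 2 ^ J * 1" using l1_nonneg[of k] by (simp add: power_mono)
    also have "\<dots> \<le> 2 ^ J * (1 + l1 k ^ J)" using l1_nonneg[of k] by (intro mult_left_mono) auto
    finally show ?thesis .
   next
    case False
    then have "(1 + l1 k) ^ J \<le> (2 * l1 k) ^ J" by (intro power_mono) auto
    also have "\<dots> \<le> 2 ^ J * (1 + l1 k ^ J)" by (simp add: power_mult_distrib)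
    finally show ?thesis .
   qed
   then have "(1 + l1 k) ^ J * cmod (c k) \<le> 2 ^ J * (1 + l1 k ^ J) * cmod (c k)" by (intro mult_right_mono) auto
   also have "\<dots> = 2 ^ J * (cmod (c k) + l1 k ^ J * cmod (c k))" by (simp add: algebra_simps)
   also have "\<dots> \<le> 2 ^ J * (\<bar>K w 0\<bar> + ?n ^ J * \<bar>K w J\<bar>)" using c0 cJ by (intro mult_left_mono add_mono) auto
   also have "\<dots> \<le> 2 ^ J * (\<Sum>w\<in>W. \<bar>K w 0\<bar> + ?n ^ J * \<bar>K w J\<bar>)"
    using w(1) W(1) by (intro mult_left_mono member_le_sum[where f = "\<lambda>w. \<bar>K w 0\<bar> + ?n ^ J * \<bar>K w J\<bar>"]) auto
   finally show ?thesis .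
  qed
  then show ?thesis unfolding good_coeffs_def rapid_def using False by auto
 qed
qed

lemma good_coeffs_from_admits:
 fixes l :: "real^'d" and f :: "real^'d \<Rightarrow> complex"
 assumes l: "int_vec l" "l \<noteq> 0" and syn: "syndetic_orbit \<alpha>" and f: "\<And>w g. g \<in> gauges r ==> admits g w f"
 shows "good_coeffs r (fcoeff \<alpha> f)"
 by (rule good_coeffs_from_cone[OF l]) (simp add: admits_half_decay[OF syn f])

lemma good_coeffs_lift_class:
 fixes f :: "real^'d \<Rightarrow> complex" and L :: "complex \<Rightarrow> 'b::real_normed_vector"
 assumes syn: "syndetic_orbit \<alpha>" and f: "continuous_on UNIV f" "periodic f"
  and c: "good_coeffs r (fcoeff \<alpha> f)" and L: "bounded_linear L"
 shows "lift_class r (\<lambda>x. L (f x))"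
proof -
 have eq: "f = series (fcoeff \<alpha> f)"
  by (rule fourier_inversion[OF syn f rapid_summable[OF good_coeffs_rapid[OF c]]])
 show ?thesis
 proof (cases "r = C_omega")
  case True
  then obtain K \<rho> where "\<rho> > 0" "\<And>k. int_vec k ==> cmod (fcoeff \<alpha> f k) \<le> K * exp (- \<rho> * l1 k)"
   using c by (auto simp: good_coeffs_def)
  then have "real_analytic (\<lambda>x. L (series (fcoeff \<alpha> f) x))" using series_real_analytic[OF _ _ L] by blast
  then show ?thesis using True by (simp add: lift_class_def flip: eq)
 next
  case False
  have "smooth (\<lambda>x. L (series (fcoeff \<alpha> f) x))" unfolding smooth_def
   by (intro allI differentiable_Ck_linear[OF L] differentiable_Ck_series good_coeffs_rapid[OF c])
  then show ?thesis using False by (simp add: lift_class_def flip: eq)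
 qed
qed

section \<open>Decay of the invariant section\<close>

lemma syndetic_orbit_minus:
 assumes "syndetic_orbit \<alpha>" shows "syndetic_orbit (- \<alpha>)"
 unfolding syndetic_orbit_def
proof (intro allI impI)
 fix \<delta> :: real assume "\<delta> > 0"
 then obtain K where K: "\<And>z. \<exists>n\<le>K. \<exists>k. int_vec k \<and> norm (of_nat n *\<^sub>R \<alpha> + k - z) < \<delta>"
  using assms unfolding syndetic_orbit_def by blast
 have "\<exists>n\<le>K. \<exists>k. int_vec k \<and> norm (of_nat n *\<^sub>R - \<alpha> + k - z) < \<delta>" for z
 proof -
  obtain n k where n: "n \<le> K" "int_vec k" "norm (of_nat n *\<^sub>R \<alpha> + k - (- z)) < \<delta>" using K[of "- z"] by blast
  have "norm (of_nat n *\<^sub>R - \<alpha> + - k - z) < \<delta>"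
   using n(3) norm_minus_cancel[of "of_nat n *\<^sub>R \<alpha> + k - (- z)"] by simp
  then show ?thesis using n(1) int_vec_minus[OF n(2)] by blast
 qed
 then show "\<exists>K. \<forall>z. \<exists>n\<le>K. \<exists>k. int_vec k \<and> norm (of_nat n *\<^sub>R - \<alpha> + k - z) < \<delta>" by blast
qed

lemma det_one_section:
 assumes "cm_det X = 1" shows "fst X \<noteq> 0" "cmod (- snd X / fst X) < 1"
proof -
 have d: "(cmod (fst X))\<^sup>2 = 1 + (cmod (snd X))\<^sup>2" using assms unfolding cm_det_def by linarith
 then have lt: "(cmod (snd X))\<^sup>2 < (cmod (fst X))\<^sup>2" by simp
 then show n: "fst X \<noteq> 0" using zero_le_power2[of "cmod (snd X)"] by auto
 have "cmod (snd X) < cmod (fst X)" using lt by (rule power2_less_imp_less) simp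
 then show "cmod (- snd X / fst X) < 1" using n by (simp add: norm_divide)
qed

text \<open>A complex factor on the left does not change \<open>- snd X / fst X\<close>, and \<open>- snd X / fst X\<close> is the point of the disc that \<open>X\<close> sends to \<open>0\<close>.\<close>

lemma section_invariance:
 assumes b: "Y \<odot> M = (e, 0) \<odot> X" and X: "fst X \<noteq> 0" and Y: "fst Y \<noteq> 0"
 defines "u \<equiv> - snd X / fst X" and "v \<equiv> - snd Y / fst Y"
 shows "fst M * u + snd M = v * (cnj (snd M) * u + cnj (fst M))"
proof -
 let ?p = "fst M" and ?q = "snd M" and ?b1 = "fst X" and ?b2 = "snd X" and ?c1 = "fst Y" and ?c2 = "snd Y"
 have e1: "?c1 * ?p + ?c2 * cnj ?q = e * ?b1" and e2: "?c1 * ?q + ?c2 * cnj ?p = e * ?b2"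
  using b by (simp_all add: cm_mult_def)
 have u: "?b1 * u = - ?b2" and v: "?c1 * v = - ?c2" using X Y by (simp_all add: u_def v_def)
 have l: "?b1 * (?p * u + ?q) = ?q * ?b1 - ?p * ?b2"
 proof -
  have "?b1 * (?p * u + ?q) = ?p * (?b1 * u) + ?q * ?b1" by (simp only: distrib_left mult_ac)
  then show ?thesis unfolding u by simp
 qed
 have r: "?b1 * (cnj ?q * u + cnj ?p) = cnj ?p * ?b1 - cnj ?q * ?b2"
 proof -
  have "?b1 * (cnj ?q * u + cnj ?p) = cnj ?q * (?b1 * u) + cnj ?p * ?b1" by (simp only: distrib_left mult_ac)
  then show ?thesis unfolding u by simp
 qed
 have "?c1 * (?q * ?b1 - ?p * ?b2) = ?b1 * (?c1 * ?q + ?c2 * cnj ?p) - ?b2 * (?c1 * ?p + ?c2 * cnj ?q) - ?c2 * (cnj ?p * ?b1 - cnj ?q * ?b2)"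
  by (simp add: algebra_simps)
 also have "\<dots> = (?c1 * v) * (cnj ?p * ?b1 - cnj ?q * ?b2)" unfolding e1 e2 v by simp
 finally have "?c1 * (?q * ?b1 - ?p * ?b2) = ?c1 * (v * (cnj ?p * ?b1 - cnj ?q * ?b2))" by (simp only: mult.assoc)
 then have "?q * ?b1 - ?p * ?b2 = v * (cnj ?p * ?b1 - cnj ?q * ?b2)" using mult_left_cancel[OF Y] by blast
 then have "?b1 * (?p * u + ?q) = ?b1 * (v * (cnj ?q * u + cnj ?p))"
  unfolding l mult.left_commute[of ?b1 v] r .
 then show ?thesis using mult_left_cancel[OF X] by blast
qed

context rotation_frame
begin

lemma iter_admits:
 assumes g: "g \<in> gauges r"
  and a: "admits g w (\<lambda>x. fst (A x))" "admits g w (\<lambda>x. snd (A x))"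
   "admits g w (\<lambda>x. cnj (fst (A x)))" "admits g w (\<lambda>x. cnj (snd (A x)))"
 shows "admits g w (\<lambda>x. fst (iter n x)) \<and> admits g w (\<lambda>x. snd (iter n x)) \<and>
  admits g w (\<lambda>x. cnj (fst (iter n x))) \<and> admits g w (\<lambda>x. cnj (snd (iter n x)))"
proof (induction n)
 case 0
 then show ?case by (simp add: admits_const[OF g])
next
 case (Suc n)
 note s = a[THEN admits_shift[where b = "real n *\<^sub>R \<alpha>"]]
 show ?case unfolding iter.simps cm_mult_def fst_conv snd_conv complex_cnj_add complex_cnj_mult complex_cnj_cnj
  using Suc by (intro conjI admits_add admits_mult s) simp_all
qed

text \<open>The contraction argument is applied to a monotone iterate, for which \<open>u\<close> is still invariant.\<close>

lemma section_half_decay: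
 assumes syn0: "syndetic_orbit \<alpha>0" and g: "g \<in> gauges r"
  and a: "\<And>g. g \<in> gauges r ==> admits g w (\<lambda>x. fst (A x))" "\<And>g. g \<in> gauges r ==> admits g w (\<lambda>x. snd (A x))"
   "\<And>g. g \<in> gauges r ==> admits g w (\<lambda>x. cnj (fst (A x)))" "\<And>g. g \<in> gauges r ==> admits g w (\<lambda>x. cnj (snd (A x)))"
 shows "half_decay g w (fcoeff \<alpha>0 (\<lambda>x. - snd (B x) / fst (B x)))"
proof -
 define u where "u x = - snd (B x) / fst (B x)" for x
 note B1 = det_one_section[OF detB]
 obtain N c where N: "N > 0" "c > 0"
  and mono: "\<And>x. Im (fst (cm_inv (iter N x) \<odot> iter' N x)) - cmod (snd (cm_inv (iter N x) \<odot> iter' N x)) \<ge> c"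
  using monotone_iterate by blast
 \<comment> \<open>the contraction argument loses two powers of \<open>t\<close>, so start with a finer gauge\<close>
 let ?g = "\<lambda>t. t\<^sup>2 * g t"
 note g' = gauges_square[OF g]
 note adm = iter_admits[OF g' a[OF g'], of N]
 obtain T1 P Pw eP C1 where P: "T1 > 0" "C1 \<ge> 0" "dbar_ext w T1 P Pw eP" "\<And>x. P x 0 = fst (iter N x)" "\<And>x t. t \<in> {0..T1} ==> cmod (eP x t) \<le> C1 * ?g t"
  using conjunct1[OF adm] unfolding admits_def by blast
 obtain T2 Q Qw eQ C2 where Q: "T2 > 0" "C2 \<ge> 0" "dbar_ext w T2 Q Qw eQ" "\<And>x. Q x 0 = snd (iter N x)" "\<And>x t. t \<in> {0..T2} ==> cmod (eQ x t) \<le> C2 * ?g t"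
  using conjunct1[OF conjunct2[OF adm]] unfolding admits_def by blast
 obtain T3 R Rw eR C3 where R: "T3 > 0" "C3 \<ge> 0" "dbar_ext w T3 R Rw eR" "\<And>x. R x 0 = cnj (snd (iter N x))" "\<And>x t. t \<in> {0..T3} ==> cmod (eR x t) \<le> C3 * ?g t"
  using conjunct2[OF conjunct2[OF conjunct2[OF adm]]] unfolding admits_def by blast
 obtain T4 S Sw eS C4 where S: "T4 > 0" "C4 \<ge> 0" "dbar_ext w T4 S Sw eS" "\<And>x. S x 0 = cnj (fst (iter N x))" "\<And>x t. t \<in> {0..T4} ==> cmod (eS x t) \<le> C4 * ?g t"
  using conjunct1[OF conjunct2[OF conjunct2[OF adm]]] unfolding admits_def by blast
 define T0 where "T0 = min (min T1 T2) (min T3 T4)"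
 have T0: "T0 > 0" "T0 \<le> T1" "T0 \<le> T2" "T0 \<le> T3" "T0 \<le> T4" using P(1) Q(1) R(1) S(1) by (auto simp: T0_def)
 note ext = dbar_ext_subset[OF P(3) T0(2)] dbar_ext_subset[OF Q(3) T0(3)] dbar_ext_subset[OF R(3) T0(4)] dbar_ext_subset[OF S(3) T0(5)]
 have e0: "eP x 0 = 0" "eQ x 0 = 0" "eR x 0 = 0" "eS x 0 = 0" for x
  using P(5)[of 0 x] Q(5)[of 0 x] R(5)[of 0 x] S(5)[of 0 x] P(1) Q(1) R(1) S(1) by simp_all
 have z: "0 \<in> {0..T0}" using T0 by simp
 have pd: "((\<lambda>s. fst (iter N (x + s *\<^sub>R w))) has_vector_derivative fst (iter' N x)) (at 0)"
  "((\<lambda>s. snd (iter N (x + s *\<^sub>R w))) has_vector_derivative snd (iter' N x)) (at 0)" for x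
  using bounded_linear.has_vector_derivative[OF bounded_linear_fst iter_der] bounded_linear.has_vector_derivative[OF bounded_linear_snd iter_der] by blast+
 have Pw0: "Pw x 0 = fst (iter' N x)" for x
  using dbar_extD(4)[OF ext(1) z, of x] pd(1)[of x] unfolding P(4) by (rule vector_derivative_unique_at)
 have Qw0: "Qw x 0 = snd (iter' N x)" for x
  using dbar_extD(4)[OF ext(2) z, of x] pd(2)[of x] unfolding Q(4) by (rule vector_derivative_unique_at)
 have real0: "S x 0 = cnj (P x 0)" "R x 0 = cnj (Q x 0)" for x using P(4) Q(4) R(4) S(4) by simp_all
 have det0: "(cmod (P x 0))\<^sup>2 - (cmod (Q x 0))\<^sup>2 = 1" for x using det_iter[of N x] by (simp add: cm_det_def P(4) Q(4))
 have mono': "Im (cnj (P x 0) * Pw x 0 - Q x 0 * cnj (Qw x 0)) - cmod (cnj (P x 0) * Qw x 0 - Q x 0 * cnj (Pw x 0)) \<ge> c" for x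
  using mono[of x] by (simp add: P(4) Q(4) Pw0 Qw0 cm_mult_def cm_inv_def)
 have "\<exists>T. 0 < T \<and> T \<le> T0 \<and> c * T \<le> 1 \<and> (\<forall>x t v. t \<in> {0..T} \<longrightarrow> cmod v \<le> 1 \<longrightarrow>
    (cmod (R x t * v + S x t))\<^sup>2 - (cmod (P x t * v + Q x t))\<^sup>2 \<ge> 1 - (cmod v)\<^sup>2 + c * t) \<and>
    (\<forall>x t. t \<in> {0..T} \<longrightarrow> cmod (P x t * S x t - Q x t * R x t) \<le> 1 + c / 4 * t)" (is "\<exists>T. ?X T")
  by (rule moebius_contraction[OF ext T0(1) e0 real0 det0 N(2) mono']) blast
 then obtain T where TX: "?X T" ..
 then have T: "0 < T" "T \<le> T0" "c * T \<le> 1" by simp_all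
 have con: "(cmod (R x t * v + S x t))\<^sup>2 - (cmod (P x t * v + Q x t))\<^sup>2 \<ge> 1 - (cmod v)\<^sup>2 + c * t"
  if "t \<in> {0..T}" "cmod v \<le> 1" for x t v
  using TX that by blast
 have detb: "cmod (P x t * S x t - Q x t * R x t) \<le> 1 + c / 4 * t" if "t \<in> {0..T}" for x t
  using TX that by blast
 note extT = ext[THEN dbar_ext_subset[OF _ T(2)]]
 obtain MR where "MR > 0" and MR: "\<And>x t. t \<in> {0..T} ==> norm (R x t) \<le> MR" using cper_bounded[OF dbar_extD(1)[OF extT(3)]] by blast
 obtain MS where "MS > 0" and MS: "\<And>x t. t \<in> {0..T} ==> norm (S x t) \<le> MS" using cper_bounded[OF dbar_extD(1)[OF extT(4)]] by blast
 define C where "C = C1 + C2 + C3 + C4"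
 have C: "C \<ge> 0" "C1 \<le> C" "C2 \<le> C" "C3 \<le> C" "C4 \<le> C" using P(2) Q(2) R(2) S(2) by (auto simp: C_def)
 have gn: "g t \<ge> 0" if "t \<in> {0..T}" for t using gauges_nonneg[OF g] that by simp
 have up: "y \<le> C * t\<^sup>2 * g t" if "y \<le> Ci * ?g t" "Ci \<le> C" "t \<in> {0..T}" for y Ci t
 proof -
  have "Ci * ?g t \<le> C * ?g t" using that gn by (intro mult_right_mono) auto
  then show ?thesis using that(1) by (simp only: mult.assoc)
 qed
 interpret contracting_moebius \<alpha>0 w "real N *\<^sub>R \<alpha>" T c C "MR + MS" g P Pw eP Q Qw eQ R Rw eR S Sw eS u
 proof
  show "cmod (eP x t) \<le> C * t\<^sup>2 * g t" if "t \<in> {0..T}" for x t by (rule up[OF P(5) C(2) that]) (use that T T0 in auto)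
  show "cmod (eQ x t) \<le> C * t\<^sup>2 * g t" if "t \<in> {0..T}" for x t by (rule up[OF Q(5) C(3) that]) (use that T T0 in auto)
  show "cmod (eR x t) \<le> C * t\<^sup>2 * g t" if "t \<in> {0..T}" for x t by (rule up[OF R(5) C(4) that]) (use that T T0 in auto)
  show "cmod (eS x t) \<le> C * t\<^sup>2 * g t" if "t \<in> {0..T}" for x t by (rule up[OF S(5) C(5) that]) (use that T T0 in auto)
  show "cmod (R x t) + cmod (S x t) \<le> MR + MS" if "t \<in> {0..T}" for x t using MR[OF that] MS[OF that] by (rule add_mono)
  show "continuous_on UNIV u" unfolding u_def by (intro continuous_intros B ballI B1(1))
  show "periodic u" using B(2) by (simp add: periodic_def u_def)
  show "cmod (u x) < 1" for x unfolding u_def by (rule B1(2))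
  show "P x 0 * u x + Q x 0 = u (x + real N *\<^sub>R \<alpha>) * (R x 0 * u x + S x 0)" for x
   unfolding P(4) Q(4) R(4) S(4) u_def by (rule section_invariance[OF iter_frame B1(1) B1(1)])
 qed (fact syn0 extT T(1) N(2) T(3) C(1) gn con detb real0 det0)+
 have MM: "MR + MS \<ge> 0" by (rule M_nonneg)
 define K where "K = 1 + 16 * (MR + MS) * C / c\<^sup>2 * T"
 have K1: "16 * (MR + MS) * C / c\<^sup>2 * T \<ge> 0" using MM C(1) T(1) by simp
 have "cmod (fcoeff \<alpha>0 u k) \<le> K * (exp (- a * T) + G)"
  if "int_vec k" "a = - (2 * pi * (k \<bullet> w))" "a \<ge> 0" "G \<ge> 0" "\<forall>t\<in>{0..T}. exp (- a * t) * g t \<le> G" for k a G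
 proof -
  have "cmod (fcoeff \<alpha>0 u k) \<le> exp (- a * T) + 16 * (MR + MS) * C / c\<^sup>2 * T * G"
   using that by (intro fcoeff_decay_one_sided) auto
  also have "\<dots> \<le> K * (exp (- a * T) + G)"
  proof -
   have "D \<ge> 0 ==> E \<ge> 0 ==> E + D * G \<le> (1 + D) * (E + G)" for D E :: real
    using that(4) by (simp add: algebra_simps)
   then show ?thesis unfolding K_def using K1 exp_ge_zero by blast
  qed
  finally show ?thesis .
 qed
 moreover have "K \<ge> 0" using K1 by (simp add: K_def)
 ultimately show ?thesis unfolding half_decay_def u_def using T(1) by blast
qed

end

lemma lift_class_dird:
 fixes f :: "real^'d \<Rightarrow> complex"
 assumes f: "lift_class r f" and p: "periodic f"
 shows "continuous_on UNIV (dird w f)" "((\<lambda>s. f (x + s *\<^sub>R w)) has_vector_derivative dird w f x) (at 0)"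
proof -
 show "continuous_on UNIV (dird w f)"
  using f analytic_directional(1)[OF _ p, where w = w and j = 1] smooth_continuous[OF smooth_dird(1)[of f w]]
  by (auto simp: lift_class_def split: if_splits)
 show "((\<lambda>s. f (x + s *\<^sub>R w)) has_vector_derivative dird w f x) (at 0)"
  using f analytic_directional(2)[OF _ p, where w = w and j = 0] smooth_dird(2)[of f x w]
  by (auto simp: lift_class_def split: if_splits)
qed

text \<open>For \<open>- w\<close> use the inverse cocycle over the translation by \<open>- \<alpha>\<close>: its angle has degree \<open>- l\<close>, positive on \<open>- w\<close>, and \<open>B\<close>, hence the
section, is the same.\<close>

theorem section_good_coeffs:
 fixes \<alpha> l :: "real^'d" and A B :: "real^'d \<Rightarrow> complex \<times> complex" and \<phi> :: "real^'d \<Rightarrow> real"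
 assumes syn: "syndetic_orbit \<alpha>"
  and reg: "lift_class r (\<lambda>x. fst (A x))" "lift_class r (\<lambda>x. snd (A x))"
  and perA: "periodic A" and detA: "\<And>x. cm_det (A x) = 1"
  and B: "continuous_on UNIV B" "periodic B" and detB: "\<And>x. cm_det (B x) = 1"
  and \<phi>: "continuous_on UNIV \<phi>" and frame: "\<And>x. B (x + \<alpha>) \<odot> A x = (cis (\<phi> x), 0) \<odot> B x"
  and \<phi>_per: "\<And>x k. int_vec k ==> \<phi> (x + k) = \<phi> x + 2 * pi * (l \<bullet> k)"
  and l: "int_vec l" "l \<noteq> 0"
 shows "good_coeffs r (fcoeff \<alpha> (\<lambda>x. - snd (B x) / fst (B x)))"
proof (rule good_coeffs_from_cone[OF l])
 fix w g assume lw: "l \<bullet> w > 0" and g: "g \<in> gauges r"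
 have p: "periodic (\<lambda>x. fst (A x))" "periodic (\<lambda>x. snd (A x))" using perA by (auto simp: periodic_def)
 have pc: "periodic (\<lambda>x. cnj (fst (A x)))" "periodic (\<lambda>x. cnj (snd (A x)))" using perA by (auto simp: periodic_def)
 note regc = lift_class_linear[OF bounded_linear_cnj reg(1)] lift_class_linear[OF bounded_linear_cnj reg(2)]
 note adm = lift_class_admits[OF reg(1) p(1)] lift_class_admits[OF reg(2) p(2)] lift_class_admits[OF regc(1) pc(1)] lift_class_admits[OF regc(2) pc(2)]
 have cA: "continuous_on UNIV A"
  using continuous_on_Pair[OF lift_class_continuous[OF reg(1) p(1)] lift_class_continuous[OF reg(2) p(2)]] by simp
 define A' where "A' x = (dird w (\<lambda>x. fst (A x)) x, dird w (\<lambda>x. snd (A x)) x)" for x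
 have A': "continuous_on UNIV A'" "periodic A'"
  using lift_class_dird(1)[OF reg(1) p(1)] lift_class_dird(1)[OF reg(2) p(2)] periodic_dird[OF p(1)] periodic_dird[OF p(2)]
  unfolding A'_def by (auto intro!: continuous_on_Pair simp: periodic_def)
 have der: "((\<lambda>s. A (x + s *\<^sub>R w)) has_vector_derivative A' x) (at 0)" for x
  using has_vector_derivative_Pair[OF lift_class_dird(2)[OF reg(1) p(1), of x w] lift_class_dird(2)[OF reg(2) p(2), of x w]]
  by (simp add: A'_def)
 interpret F: rotation_frame \<alpha> w l A A' B \<phi>
  by unfold_locales (fact syn cA perA A' der detA B detB \<phi> frame \<phi>_per lw)+
 have 1: "half_decay g w (fcoeff \<alpha> (\<lambda>x. - snd (B x) / fst (B x)))"
  by (rule F.section_half_decay[OF syn g adm])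
 \<comment> \<open>the inverse cocycle\<close>
 define Am where "Am x = cm_inv (A (x + - \<alpha>))" for x
 define Am' where "Am' x = - cm_inv (A' (x + - \<alpha>))" for x
 have derm: "((\<lambda>s. Am (x + s *\<^sub>R - w)) has_vector_derivative Am' x) (at 0)" for x
 proof -
  have "((\<lambda>s. cm_inv (A ((x + - \<alpha>) + s *\<^sub>R w))) has_vector_derivative cm_inv (A' (x + - \<alpha>))) (at (- 0))"
   using bounded_linear.has_vector_derivative[OF bounded_linear_cm_inv der] by simp
  moreover have "((\<lambda>s::real. - s) has_vector_derivative - 1) (at 0)" by (auto intro!: derivative_eq_intros)
  ultimately have "((\<lambda>s. cm_inv (A ((x + - \<alpha>) + (- s) *\<^sub>R w))) has_vector_derivative (- 1) *\<^sub>R cm_inv (A' (x + - \<alpha>))) (at 0)"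
   using vector_diff_chain_at[of "\<lambda>s::real. - s" "- 1" 0 "\<lambda>s. cm_inv (A ((x + - \<alpha>) + s *\<^sub>R w))"] by (simp add: o_def)
  moreover have "cm_inv (A ((x + - \<alpha>) + (- s) *\<^sub>R w)) = Am (x + s *\<^sub>R - w)" for s
   by (simp add: Am_def algebra_simps)
  ultimately show ?thesis by (simp add: Am'_def)
 qed
 interpret Fm: rotation_frame "- \<alpha>" "- w" "- l" Am Am' B "\<lambda>x. - \<phi> (x + - \<alpha>)"
 proof
  have sh: "continuous_on UNIV (\<lambda>x. f (x + - \<alpha>))" if "continuous_on UNIV f" for f :: "real^'d \<Rightarrow> 'c::topological_space"
   by (rule continuous_on_compose2[OF that]) (auto intro!: continuous_intros)
  show "continuous_on UNIV Am" unfolding Am_def by (intro continuous_on_cm_inv sh cA)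
  show "continuous_on UNIV Am'" unfolding Am'_def by (intro continuous_on_minus continuous_on_cm_inv sh A')
  show "continuous_on UNIV (\<lambda>x. - \<phi> (x + - \<alpha>))" by (intro continuous_on_minus sh \<phi>)
  show "periodic Am" "periodic Am'"
   using periodic_shift[OF perA, of "- \<alpha>"] periodic_shift[OF A'(2), of "- \<alpha>"] by (simp_all add: periodic_def Am_def Am'_def)
  show "cm_det (Am x) = 1" for x by (simp only: Am_def cm_det_inv detA)
  show "- l \<bullet> - w > 0" using lw by simp
  show "- \<phi> (x + k + - \<alpha>) = - \<phi> (x + - \<alpha>) + 2 * pi * (- l \<bullet> k)" if "int_vec k" for x k
   using \<phi>_per[OF that, of "x + - \<alpha>"] by (simp add: algebra_simps)
  fix x
  let ?y = "x + - \<alpha>"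
  have fr: "B x \<odot> A ?y = (cis (\<phi> ?y), 0) \<odot> B ?y" using frame[of ?y] by simp
  have "B ?y = (cis (- \<phi> ?y), 0) \<odot> ((cis (\<phi> ?y), 0) \<odot> B ?y)"
   unfolding cm_assoc[symmetric] by (simp add: cm_mult_def cis_mult)
  also have "\<dots> = (cis (- \<phi> ?y), 0) \<odot> B x \<odot> A ?y" unfolding fr[symmetric] by (simp only: cm_assoc)
  finally have "B ?y \<odot> Am x = (cis (- \<phi> ?y), 0) \<odot> B x \<odot> (A ?y \<odot> cm_inv (A ?y))"
   unfolding Am_def by (simp only: cm_assoc)
  then show "B ?y \<odot> Am x = (cis (- \<phi> ?y), 0) \<odot> B x" by (simp only: cm_inv_right[OF detA] cm_one)
 qed (fact syndetic_orbit_minus[OF syn] derm B detB)+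
 have "half_decay g (- w) (fcoeff \<alpha> (\<lambda>x. - snd (B x) / fst (B x)))"
 proof (rule Fm.section_half_decay[OF syn g])
  fix h assume h: "h \<in> gauges r"
  note s = adm[OF h, of "- w", THEN admits_shift[where b = "- \<alpha>"]]
  show "admits h (- w) (\<lambda>x. fst (Am x))" using s(3) by (simp add: Am_def cm_inv_def)
  show "admits h (- w) (\<lambda>x. cnj (fst (Am x)))" using s(1) by (simp add: Am_def cm_inv_def)
  show "admits h (- w) (\<lambda>x. snd (Am x))"
   using admits_mult[OF admits_const[OF h, of _ "- 1"] s(2)] by (simp add: Am_def cm_inv_def)
  show "admits h (- w) (\<lambda>x. cnj (snd (Am x)))"
   using admits_mult[OF admits_const[OF h, of _ "- 1"] s(4)] by (simp add: Am_def cm_inv_def)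
 qed
 with 1 show "half_decay g w (fcoeff \<alpha> (\<lambda>x. - snd (B x) / fst (B x))) \<and> half_decay g (- w) (fcoeff \<alpha> (\<lambda>x. - snd (B x) / fst (B x)))" ..
qed

text \<open>Both \<open>u\<close> and \<open>cnj u\<close> admit extensions, so \<open>1 - u * cnj u\<close> does; being bounded below by a positive constant
it can be composed with the inverse square root.\<close>

lemma conjugacy_from_section:
 fixes u :: "real^'d \<Rightarrow> complex"
 assumes syn: "syndetic_orbit \<alpha>" and l: "int_vec l" "(l :: real^'d) \<noteq> 0"
  and u: "continuous_on UNIV u" "periodic u" "\<And>x. cmod (u x) < 1" and c: "good_coeffs r (fcoeff \<alpha> u)"
 obtains b1 b2 :: "real^'d \<Rightarrow> complex" where "periodic b1" "periodic b2"
  "\<And>L :: complex \<Rightarrow> real^2^2. bounded_linear L ==> lift_class r (\<lambda>x. L (b1 x))"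
  "\<And>L :: complex \<Rightarrow> real^2^2. bounded_linear L ==> lift_class r (\<lambda>x. L (b2 x))"
  "\<And>x. cm_det (b1 x, b2 x) = 1" "\<And>x. b2 x = - u x * b1 x"
proof -
 have pc: "periodic (\<lambda>x. cnj (u x))" using u(2) by (simp add: periodic_def)
 have au: "admits g w u" if "g \<in> gauges r" for g w
  by (rule lift_class_admits[OF good_coeffs_lift_class[OF syn u(1,2) c bounded_linear_ident] u(2) that])
 have auc: "admits g w (\<lambda>x. cnj (u x))" if "g \<in> gauges r" for g w
  by (rule lift_class_admits[OF good_coeffs_lift_class[OF syn u(1,2) c bounded_linear_cnj] pc that])
 define v where "v x = 1 + (- 1) * (u x * cnj (u x))" for x
 have vr: "v x = of_real (1 - (cmod (u x))\<^sup>2)" for x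
  by (simp add: v_def complex_norm_square flip: of_real_power)
 obtain \<theta> where \<theta>: "0 \<le> \<theta>" "\<theta> < 1" "\<And>x. cmod (u x) \<le> \<theta>" using periodic_norm_less_one_uniform[OF u] by blast
 have \<theta>2: "1 - \<theta>\<^sup>2 > 0" using \<theta> by (simp add: abs_square_less_1)
 have vlow: "1 - (cmod (u x))\<^sup>2 \<ge> 1 - \<theta>\<^sup>2" for x using \<theta>(3)[of x] by (simp add: power_mono)
 define b1 where "b1 x = inverse (csqrt (v x))" for x
 define b2 where "b2 x = - u x * b1 x" for x
 have np: "z \<notin> \<real>\<^sub>\<le>\<^sub>0" if "Re z > 0" for z using that by (auto simp: complex_nonpos_Reals_iff)
 have nz: "csqrt z \<noteq> 0" if "Re z > 0" for z using that by auto
 have ab1: "admits g w b1" if g: "g \<in> gauges r" for g w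
  unfolding b1_def
 proof (rule admits_compose[where f = v and h = "\<lambda>z. inverse (csqrt z)" and \<delta> = "1 - \<theta>\<^sup>2" and h' = "\<lambda>z. - (inverse (csqrt z) * inverse (2 * csqrt z) * inverse (csqrt z))"])
  show "admits g w v" unfolding v_def by (intro admits_add admits_mult admits_const[OF g] au[OF g] auc[OF g])
  show "1 - \<theta>\<^sup>2 > 0" by (rule \<theta>2)
  show "Re (v x) \<ge> 1 - \<theta>\<^sup>2" for x unfolding vr using vlow[of x] by simp
  show "((\<lambda>z. inverse (csqrt z)) has_field_derivative - (inverse (csqrt z) * inverse (2 * csqrt z) * inverse (csqrt z))) (at z)" if "Re z > 0" for z
   by (rule DERIV_inverse'[OF has_field_derivative_csqrt[OF np[OF that]] nz[OF that]])
  have "continuous_on {z. Re z > 0} csqrt"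
   by (rule continuous_at_imp_continuous_on) (use np continuous_at_csqrt in blast)
  then show "continuous_on {z. Re z > 0} (\<lambda>z. - (inverse (csqrt z) * inverse (2 * csqrt z) * inverse (csqrt z)))"
   using nz by (intro continuous_intros) auto
 qed
 have ab2: "admits g w b2" if g: "g \<in> gauges r" for g w
 proof -
  have "b2 = (\<lambda>x. (- 1) * u x * b1 x)" by (rule ext) (simp add: b2_def)
  then show ?thesis by (simp only: admits_mult admits_const[OF g] au[OF g] ab1[OF g])
 qed
 have pos: "1 - (cmod (u x))\<^sup>2 > 0" for x using vlow[of x] \<theta>2 by linarith
 have b1r: "b1 x = of_real (inverse (sqrt (1 - (cmod (u x))\<^sup>2)))" for x
  unfolding b1_def vr of_real_inverse by (rule arg_cong[where f = inverse]) (rule of_real_sqrt[OF less_imp_le[OF pos], symmetric])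
 have "sqrt (1 - (cmod (u x))\<^sup>2) \<noteq> 0" for x using pos[of x] by simp
 then have "continuous_on UNIV (\<lambda>x. complex_of_real (inverse (sqrt (1 - (cmod (u x))\<^sup>2))))"
  by (intro continuous_intros u(1)) simp
 then have cb1: "continuous_on UNIV b1" unfolding b1r[symmetric] .
 have cb2: "continuous_on UNIV b2" unfolding b2_def by (intro continuous_intros u(1) cb1)
 have pb1: "periodic b1" using u(2) by (simp add: periodic_def b1_def v_def)
 have pb2: "periodic b2" using u(2) pb1 by (simp add: periodic_def b2_def)
 show ?thesis
 proof
  show "periodic b1" "periodic b2" by (rule pb1, rule pb2)
  show "lift_class r (\<lambda>x. L (b1 x))" if "bounded_linear L" for L :: "complex \<Rightarrow> real^2^2"
   by (rule good_coeffs_lift_class[OF syn cb1 pb1 good_coeffs_from_admits[OF l syn ab1] that])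
  show "lift_class r (\<lambda>x. L (b2 x))" if "bounded_linear L" for L :: "complex \<Rightarrow> real^2^2"
   by (rule good_coeffs_lift_class[OF syn cb2 pb2 good_coeffs_from_admits[OF l syn ab2] that])
  show "b2 x = - u x * b1 x" for x by (simp add: b2_def)
  show "cm_det (b1 x, b2 x) = 1" for x
  proof -
   have "cm_det (b1 x, b2 x) = (cmod (b1 x))\<^sup>2 * (1 - (cmod (u x))\<^sup>2)"
    by (simp add: cm_det_def b2_def norm_mult power_mult_distrib algebra_simps)
   also have "(cmod (b1 x))\<^sup>2 = inverse (1 - (cmod (u x))\<^sup>2)"
    unfolding b1r norm_of_real using pos[of x] by (simp add: power_inverse)
   finally show ?thesis using pos[of x] by simp
  qed
 qed
qed

section \<open>Real matrices and their complex coordinates\<close>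

text \<open>The coordinates \<open>(p, q)\<close> of the map \<open>v \<mapsto> p * v + q * cnj v\<close> that the matrix defines on the complex plane.\<close>

definition mat_pair :: "real^2^2 \<Rightarrow> complex \<times> complex" where
 "mat_pair X = (Complex ((X$1$1 + X$2$2) / 2) ((X$2$1 - X$1$2) / 2), Complex ((X$1$1 - X$2$2) / 2) ((X$2$1 + X$1$2) / 2))"

definition pair_mat :: "complex \<times> complex \<Rightarrow> real^2^2" where
 "pair_mat X = vector [vector [Re (fst X) + Re (snd X), Im (snd X) - Im (fst X)],
   vector [Im (fst X) + Im (snd X), Re (fst X) - Re (snd X)]]"

lemma pair_mat_components:
 "pair_mat X $ 1 $ 1 = Re (fst X) + Re (snd X)" "pair_mat X $ 1 $ 2 = Im (snd X) - Im (fst X)"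
 "pair_mat X $ 2 $ 1 = Im (fst X) + Im (snd X)" "pair_mat X $ 2 $ 2 = Re (fst X) - Re (snd X)"
 by (simp_all add: pair_mat_def)

lemma matrix2_eq: "X = Y \<longleftrightarrow> X$1$1 = Y$1$1 \<and> X$1$2 = Y$1$2 \<and> X$2$1 = Y$2$1 \<and> X$2$2 = (Y::real^2^2)$2$2"
 by (auto simp: vec_eq_iff forall_2)

lemma mat_pair_inverse [simp]: "mat_pair (pair_mat X) = X"
 by (simp add: mat_pair_def pair_mat_components prod_eq_iff complex_eq_iff)

lemma pair_mat_inverse [simp]: "pair_mat (mat_pair X) = X"
 by (simp add: matrix2_eq pair_mat_components) (simp add: mat_pair_def field_simps)

lemma mat_pair_mult: "mat_pair (X ** Y) = mat_pair X \<odot> mat_pair Y"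
 by (simp add: mat_pair_def cm_mult_def matrix_matrix_mult_def sum_2 prod_eq_iff complex_eq_iff) (simp add: field_simps)

lemma mat_pair_one: "mat_pair (mat 1) = (1, 0)"
 by (simp add: mat_pair_def mat_def complex_eq_iff)

lemma cm_det_mat_pair: "cm_det (mat_pair X) = det X"
 by (simp add: cm_det_def mat_pair_def det_2 cmod_power2) (simp add: power2_eq_square field_simps)

lemma mat_pair_matrix_inv:
 assumes "det X = 1" shows "mat_pair (matrix_inv X) = cm_inv (mat_pair X)"
proof -
 have "invertible X" using assms by (simp add: invertible_det_nz)
 then have "X ** matrix_inv X = mat 1 \<and> matrix_inv X ** X = mat 1"
  unfolding invertible_def matrix_inv_def by (rule someI_ex)
 then have "matrix_inv X ** X = mat 1" ..
 then have "mat_pair (matrix_inv X) \<odot> mat_pair X = (1, 0)" by (metis mat_pair_mult mat_pair_one)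
 then have "mat_pair (matrix_inv X) \<odot> (mat_pair X \<odot> cm_inv (mat_pair X)) = cm_inv (mat_pair X)"
  unfolding cm_assoc[symmetric] by simp
 then show ?thesis using cm_inv_right[of "mat_pair X"] assms by (simp add: cm_det_mat_pair)
qed

lemma SO2_iff: "X \<in> SO2 \<longleftrightarrow> det X = 1 \<and> snd (mat_pair X) = 0"
proof -
 have s: "snd (mat_pair X) = 0 \<longleftrightarrow> X$1$1 = X$2$2 \<and> X$2$1 = - X$1$2" by (auto simp: mat_pair_def complex_eq_iff)
 have o: "orthogonal_matrix X \<longleftrightarrow> X$1$1 * X$1$1 + X$2$1 * X$2$1 = 1 \<and> X$1$1 * X$1$2 + X$2$1 * X$2$2 = 0 \<and> X$1$2 * X$1$2 + X$2$2 * X$2$2 = 1"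
  by (auto simp: orthogonal_matrix matrix2_eq matrix_matrix_mult_def transpose_def sum_2 mat_def mult.commute)
 have "orthogonal_matrix X \<longleftrightarrow> X$1$1 = X$2$2 \<and> X$2$1 = - X$1$2" if d: "det X = 1"
 proof
  assume "orthogonal_matrix X"
  then have "X$1$1 * X$1$1 + X$2$1 * X$2$1 = 1" "X$1$2 * X$1$2 + X$2$2 * X$2$2 = 1" using o by auto
  moreover have "X$1$1 * X$2$2 - X$1$2 * X$2$1 = 1" using d by (simp add: det_2)
  ultimately have "(X$1$1 - X$2$2)\<^sup>2 + (X$2$1 + X$1$2)\<^sup>2 = 0" by (simp add: power2_eq_square algebra_simps)
  then show "X$1$1 = X$2$2 \<and> X$2$1 = - X$1$2" by (simp add: sum_power2_eq_zero_iff)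
 next
  assume a: "X$1$1 = X$2$2 \<and> X$2$1 = - X$1$2"
  then show "orthogonal_matrix X" using d unfolding o by (simp add: det_2)
 qed
 then show ?thesis unfolding SO2_def rotation_matrix_def mem_Collect_eq s by blast
qed

lemma bounded_linear_mat_pair: "bounded_linear mat_pair"
 unfolding linear_conv_bounded_linear[symmetric]
 by (rule linearI) (simp_all add: mat_pair_def prod_eq_iff complex_eq_iff field_simps)

lemma bounded_linear_pair_mat: "bounded_linear pair_mat"
 unfolding linear_conv_bounded_linear[symmetric]
 by (rule linearI) (simp_all add: matrix2_eq pair_mat_components algebra_simps)

section \<open>The degree of the rotation angle\<close>

text \<open>The increment of a continuous angle over an integer vector is a multiple of \<open>2 * pi\<close>, hence constant in \<open>x\<close> and additive in the vector.\<close>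

lemma continuous_angle_lift:
 fixes e :: "real^'d \<Rightarrow> complex"
 assumes e: "continuous_on UNIV e" "periodic e" "\<And>x. cmod (e x) = 1"
 obtains \<phi> l where "continuous_on UNIV \<phi>" "\<And>x. e x = cis (\<phi> x)" "int_vec l"
  "\<And>x k. int_vec k ==> \<phi> (x + k) = \<phi> x + 2 * pi * (l \<bullet> k)"
proof -
 have nz: "e x \<noteq> 0" for x using e(3)[of x] by auto
 have "\<exists>h. continuous_on UNIV h \<and> (\<forall>x. e x = exp (h x))"
  by (rule continuous_logarithm_on_contractible[OF e(1) convex_imp_contractible[OF convex_UNIV]]) (use nz in auto)
 then obtain h where h: "continuous_on UNIV h" "\<And>x. e x = exp (h x)" by blast
 define \<phi> where "\<phi> x = Im (h x)" for x
 have c: "continuous_on UNIV \<phi>" unfolding \<phi>_def by (intro continuous_intros h)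
 have cis: "e x = cis (\<phi> x)" for x
 proof -
  have "exp (Re (h x)) = 1" using e(3)[of x] unfolding h(2) by simp
  then show ?thesis unfolding h(2) \<phi>_def by (simp add: exp_eq_polar)
 qed
 define D where "D k = (\<phi> k - \<phi> 0) / (2 * pi)" for k
 have Dint: "(\<phi> (x + k) - \<phi> x) / (2 * pi) \<in> \<int>" if "int_vec k" for x k
 proof -
  have "cis (\<phi> (x + k)) = cis (\<phi> x)" using cis[of "x + k"] cis[of x] periodicD[OF e(2) that, of x] by simp
  then have "cis (\<phi> (x + k) - \<phi> x) = 1" by (metis cis_divide cis_neq_zero divide_self)
  then obtain n :: int where "\<phi> (x + k) - \<phi> x = 2 * n * pi" by (auto simp: complex_eq_iff sin_cos_eq_iff cos_one_2pi_int)
  then show ?thesis by simp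
 qed
 have const: "\<phi> (x + k) = \<phi> x + 2 * pi * D k" if k: "int_vec k" for x k
 proof -
  let ?f = "\<lambda>x. (\<phi> (x + k) - \<phi> x) / (2 * pi)"
  have "?f constant_on UNIV"
  proof (rule continuous_discrete_range_constant)
   show "continuous_on UNIV ?f"
    by (intro continuous_intros c continuous_on_compose2[OF c]) auto
   fix x
   show "\<exists>r>0. \<forall>y. y \<in> UNIV \<and> ?f y \<noteq> ?f x \<longrightarrow> r \<le> norm (?f y - ?f x)"
   proof (intro exI[of _ 1] conjI allI impI)
    fix y assume "y \<in> UNIV \<and> ?f y \<noteq> ?f x"
    then have "?f y - ?f x \<in> \<int>" "?f y - ?f x \<noteq> 0" using Dint[OF k] by (auto intro: Ints_diff)
    then show "1 \<le> norm (?f y - ?f x)" unfolding real_norm_def by (rule Ints_nonzero_abs_ge1)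
   qed simp
  qed (rule convex_connected[OF convex_UNIV])
  then obtain y where y: "\<And>x. ?f x = y" unfolding constant_on_def by blast
  have "?f x = ?f 0" unfolding y ..
  also have "\<dots> = D k" by (simp add: D_def)
  finally have "?f x = D k" .
  then show ?thesis by (simp add: field_simps)
 qed
 have add: "D (k + k') = D k + D k'" if "int_vec k" "int_vec k'" for k k'
 proof -
  have "2 * pi * D (k + k') = 2 * pi * D k + 2 * pi * D k'"
   using const[OF that(2), of k] const[OF that(1), of 0] const[OF int_vec_add[OF that], of 0] by simp
  then have "2 * pi * D (k + k') = 2 * pi * (D k + D k')" by (simp only: distrib_left)
  then show ?thesis by simp
 qed
 have D0: "D 0 = 0" by (simp add: D_def)
 have Dm: "D (- k) = - D k" if "int_vec k" for k using add[OF that int_vec_minus[OF that]] D0 by simp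
 have Dn: "D (of_nat n *\<^sub>R k) = of_nat n * D k \<and> int_vec (of_nat n *\<^sub>R k)" if k: "int_vec k" for n :: nat and k
 proof (induction n)
  case 0 then show ?case by (simp add: D0 int_vec_def)
 next
  case (Suc n)
  then show ?case using add[OF k, of "of_nat n *\<^sub>R k"] int_vec_add[OF k, of "of_nat n *\<^sub>R k"] by (simp add: scaleR_add_left algebra_simps)
 qed
 have Dz: "D (of_int z *\<^sub>R k) = of_int z * D k" if k: "int_vec k" for z k
 proof (cases z)
  case (nonneg n)
  then show ?thesis using Dn[OF k, of n] by simp
 next
  case (neg n)
  have "of_int z *\<^sub>R k = - (of_nat (Suc n) *\<^sub>R k)" unfolding neg by (simp del: of_nat_Suc)
  then show ?thesis using Dn[OF k, of "Suc n"] Dm[of "of_nat (Suc n) *\<^sub>R k"] neg by (simp del: of_nat_Suc)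
 qed
 define l where "l = (\<chi> i. D (axis i 1))"
 have "D k = l \<bullet> k" if k: "int_vec k" for k
 proof -
  have ki: "int_vec (k $ i *\<^sub>R axis i 1)" for i using k by (auto simp: int_vec_def axis_def)
  have "D (\<Sum>i\<in>F. k $ i *\<^sub>R axis i 1) = (\<Sum>i\<in>F. D (k $ i *\<^sub>R axis i 1)) \<and> int_vec (\<Sum>i\<in>F. k $ i *\<^sub>R axis i 1)" if "finite F" for F
   using that
  proof (induction F)
   case empty then show ?case by (simp add: D0 int_vec_def)
  next
   case (insert i F)
   then show ?case using add[OF ki] int_vec_add[OF ki] by simp
  qed
  from this[of UNIV] have "D (\<Sum>i\<in>UNIV. k $ i *\<^sub>R axis i 1) = (\<Sum>i\<in>UNIV. D (k $ i *\<^sub>R axis i 1))" by simp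
  moreover have "(\<Sum>i\<in>UNIV. k $ i *\<^sub>R axis i 1) = k" using basis_expansion[of k] by (simp add: scalar_mult_eq_scaleR)
  moreover have "D (k $ i *\<^sub>R axis i 1) = l $ i * k $ i" for i
  proof -
   obtain z where z: "k $ i = of_int z" using k by (auto simp: int_vec_def elim: Ints_cases)
   show ?thesis unfolding z Dz[OF int_vec_axis] by (simp add: l_def)
  qed
  ultimately show ?thesis by (simp add: inner_vec_def)
 qed
 moreover have "int_vec l"
  using Dint[OF int_vec_axis, of 0] by (simp add: int_vec_def l_def D_def)
 ultimately show ?thesis using that[OF c cis] const by simp
qed

text \<open>The product of the identity with the open surjection \<open>torus_proj\<close> is open, hence a quotient map.\<close>

lemma torus_homotopy_continuous:
 fixes H :: "real \<Rightarrow> 'd::finite torus \<Rightarrow> 'b::topological_space"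
 assumes "continuous_on UNIV (\<lambda>(s, x). H s (torus_proj x))"
 shows "continuous_on UNIV (\<lambda>(s, y). H s y)"
proof -
 let ?q = "\<lambda>(s::real, x). (s, torus_proj x)"
 have "open ((\<lambda>(s, y). H s y) -` U)" if U: "open U" for U
 proof -
  let ?V = "(\<lambda>(s, x). H s (torus_proj x)) -` U"
  have V: "open ?V" using assms U by (simp add: continuous_on_open_vimage)
  have im: "(\<lambda>(s, y). H s y) -` U = ?q ` ?V"
  proof (rule set_eqI)
   fix p :: "real \<times> 'd torus"
   obtain s y where p: "p = (s, y)" by (cases p)
   obtain x where x: "torus_proj x = y" using torus_proj_surj by blast
   show "p \<in> (\<lambda>(s, y). H s y) -` U \<longleftrightarrow> p \<in> ?q ` ?V"
    unfolding p x[symmetric] by (auto intro!: image_eqI[where x = "(s, x)"])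
  qed
  have "\<exists>A B. open A \<and> open B \<and> p \<in> A \<times> B \<and> A \<times> B \<subseteq> ?q ` ?V" if "p \<in> ?q ` ?V" for p
  proof -
   from that obtain z where z: "p = ?q z" "z \<in> ?V" by (rule imageE)
   obtain s x where "z = (s, x)" by (cases z)
   with z have sx: "(s, x) \<in> ?V" "p = (s, torus_proj x)" by simp_all
   obtain A B where AB: "open A" "open B" "(s, x) \<in> A \<times> B" "A \<times> B \<subseteq> ?V" using open_prod_elim[OF V sx(1)] by blast
   have "p \<in> A \<times> torus_proj ` B" using AB(3) sx(2) by auto
   moreover have "A \<times> torus_proj ` B \<subseteq> ?q ` ?V" using AB(4) by (force simp: image_iff)
   ultimately show ?thesis using AB(1) open_map_torus_proj[OF AB(2)] by blast
  qed
  then show ?thesis unfolding im open_prod_def by blast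
 qed
 then show ?thesis by (simp add: continuous_on_open_vimage)
qed

text \<open>A periodic angle descends to the torus, so the rotation by \<open>s * \<phi>\<close>, moved back by the frame at the translate by \<open>s \<alpha>\<close>, joins the
identity matrix to \<open>A\<close>.\<close>

lemma degree_zero_homotopic:
 fixes A :: "'d::finite torus \<Rightarrow> real^2^2" and Bp :: "real^'d \<Rightarrow> complex \<times> complex"
 assumes B: "continuous_on UNIV Bp" "periodic Bp" and detB: "\<And>x. cm_det (Bp x) = 1"
  and \<phi>: "continuous_on UNIV \<phi>" "periodic \<phi>"
  and frame: "\<And>x. Bp (x + \<alpha>) \<odot> mat_pair (A (torus_proj x)) = (cis (\<phi> x), 0) \<odot> Bp x"
 shows "homotopic_to_constant A"
proof -
 \<comment> \<open>at \<open>s = 0\<close> the two frames cancel, at \<open>s = 1\<close> this is the cocycle\<close>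
 define Hp where "Hp s x = pair_mat (cm_inv (Bp (x + s *\<^sub>R \<alpha>)) \<odot> ((cis (s * \<phi> x), 0) \<odot> Bp x))" for s x
 define H where "H s y = Hp s (torus_rep y)" for s y
 have Hp_per: "Hp s (x + k) = Hp s x" if "int_vec k" for s x k
  using periodicD[OF B(2) that] periodicD[OF \<phi>(2) that] periodicD[OF periodic_shift[OF B(2), of "s *\<^sub>R \<alpha>"] that] by (simp add: Hp_def)
 have HH: "H s (torus_proj x) = Hp s x" for s x
 proof -
  have "torus_proj (torus_rep (torus_proj x)) = torus_proj x" by (rule Quotient3_abs_rep[OF Quotient3_torus])
  then have "int_vec (torus_rep (torus_proj x) - x)" by (simp add: torus_proj_eq)
  from Hp_per[OF this, of s x] show ?thesis by (simp add: H_def)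
 qed
 have "continuous_on UNIV (\<lambda>p. Hp (fst p) (snd p))"
  unfolding Hp_def
  by (intro bounded_linear.continuous_on[OF bounded_linear_pair_mat] continuous_on_cm_mult continuous_on_cm_inv continuous_on_Pair
    continuous_on_compose2[OF B(1)] continuous_on_cis continuous_on_compose2[OF \<phi>(1)] continuous_intros) auto
 then have "continuous_on UNIV (\<lambda>(s, x). H s (torus_proj x))" by (simp add: HH case_prod_unfold)
 from torus_homotopy_continuous[OF this] have Hc: "continuous_on UNIV (\<lambda>(s, y). H s y)" .
 have Hdet: "det (Hp s x) = 1" for s x
 proof -
  have "cm_det (cis (s * \<phi> x), 0) = 1" by (simp add: cm_det_def)
  then have "cm_det (mat_pair (Hp s x)) = 1" unfolding Hp_def mat_pair_inverse cm_det_mult cm_det_inv detB by simp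
  then show ?thesis by (simp add: cm_det_mat_pair)
 qed
 have H0: "H 0 y = mat 1" for y
 proof -
  obtain x where x: "torus_proj x = y" using torus_proj_surj by blast
  have "mat_pair (Hp 0 x) = mat_pair (mat 1)"
   using cm_inv_left[OF detB, of x] by (simp add: Hp_def mat_pair_one)
  then show ?thesis unfolding x[symmetric] HH by (metis pair_mat_inverse)
 qed
 have H1: "H 1 y = A y" for y
 proof -
  obtain x where x: "torus_proj x = y" using torus_proj_surj by blast
  have "mat_pair (Hp 1 x) = cm_inv (Bp (x + \<alpha>)) \<odot> (Bp (x + \<alpha>) \<odot> mat_pair (A (torus_proj x)))"
   unfolding frame by (simp add: Hp_def)
  also have "\<dots> = mat_pair (A (torus_proj x))" unfolding cm_assoc[symmetric] cm_inv_left[OF detB] by simp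
  finally show ?thesis unfolding x[symmetric] HH by (metis pair_mat_inverse)
 qed
 have "homotopic_with_canon (\<lambda>_. True) UNIV SL2 (\<lambda>_. mat 1) A"
  unfolding homotopic_with_def
 proof (intro exI[of _ "\<lambda>(s, y). H s y"] conjI ballI allI)
  have "continuous_map (top_of_set ({0..1} \<times> UNIV)) (top_of_set SL2) (\<lambda>(s, y). H s y)"
   unfolding continuous_map_in_subtopology continuous_map_iff_continuous
   using continuous_on_subset[OF Hc] torus_proj_surj Hdet HH
   by (auto simp: SL2_def case_prod_unfold H_def)
  then show "continuous_map (prod_topology (top_of_set {0..1}) (top_of_set UNIV)) (top_of_set SL2) (\<lambda>(s, y). H s y)"
   by (simp only: prod_topology_subtopology_eu)
 qed (use H0 H1 in auto)
 moreover have "mat 1 \<in> SL2" by (simp add: SL2_def)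
 ultimately show ?thesis unfolding homotopic_to_constant_def by (meson homotopic_with_sym)
qed

theorem corollary1p2:
 fixes \<alpha> :: "real^'d"
  and A :: "'d torus \<Rightarrow> real^2^2"
  and r :: regularity
 assumes "ergodic_map torus_lebesgue (torus_translation \<alpha>)"
  and "r \<in> {C_infinity, C_omega}"
  and "A \<in> maps_SL2 r"
  and "\<not> homotopic_to_constant A"
  and "conjugate_to_rotations C_zero \<alpha> A"
 shows "conjugate_to_rotations r \<alpha> A"
proof -
 note syn = ergodic_translation_syndetic[OF assms(1)]
 have cls: "of_class r F \<longleftrightarrow> lift_class r (F \<circ> torus_proj)" for F :: "'d torus \<Rightarrow> real^2^2"
  using assms(2) by (auto simp: lift_class_def)
 have lcA: "lift_class r (\<lambda>x. A (torus_proj x))" and SLA: "det (A y) = 1" for y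
  using assms(3) cls[of A] by (auto simp: maps_SL2_def SL2_def o_def)
 obtain B where B: "continuous_on UNIV B" "\<And>y. det (B y) = 1"
  and rot: "\<And>y. B (torus_translation \<alpha> y) ** A y ** matrix_inv (B y) \<in> SO2"
  using assms(5) by (auto simp: conjugate_to_rotations_def maps_SL2_def SL2_def)
 define Ap where "Ap x = mat_pair (A (torus_proj x))" for x
 define Bp where "Bp x = mat_pair (B (torus_proj x))" for x
 have tr: "torus_translation \<alpha> (torus_proj x) = torus_proj (x + \<alpha>)" for x by (rule torus_translation.abs_eq)
 have detA: "cm_det (Ap x) = 1" and detB: "cm_det (Bp x) = 1" for x
  by (simp_all add: Ap_def Bp_def cm_det_mat_pair SLA B(2))
 have reg: "lift_class r (\<lambda>x. fst (Ap x))" "lift_class r (\<lambda>x. snd (Ap x))"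
  unfolding Ap_def
  by (rule lift_class_linear[OF bounded_linear_compose[OF bounded_linear_fst bounded_linear_mat_pair, unfolded o_def] lcA],
    rule lift_class_linear[OF bounded_linear_compose[OF bounded_linear_snd bounded_linear_mat_pair, unfolded o_def] lcA])
 have perA: "periodic Ap" and perB: "periodic Bp" by (auto simp: periodic_def Ap_def Bp_def torus_proj_cong)
 have cA: "continuous_on UNIV Ap"
  using continuous_on_Pair[OF lift_class_continuous[OF reg(1)] lift_class_continuous[OF reg(2)]] perA by (simp add: periodic_def)
 have cB: "continuous_on UNIV Bp" unfolding Bp_def
  by (rule bounded_linear.continuous_on[OF bounded_linear_mat_pair continuous_on_compose2[OF B(1) continuous_torus_proj]]) simp
 define E where "E x = Bp (x + \<alpha>) \<odot> Ap x \<odot> cm_inv (Bp x)" for x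
 have EB: "Bp (x + \<alpha>) \<odot> Ap x = E x \<odot> Bp x" for x
  unfolding E_def by (simp only: cm_assoc cm_inv_left[OF detB] cm_one)
 have E2: "snd (E x) = 0" for x
 proof -
  have "E x = mat_pair (B (torus_translation \<alpha> (torus_proj x)) ** A (torus_proj x) ** matrix_inv (B (torus_proj x)))"
   unfolding E_def Bp_def Ap_def mat_pair_mult mat_pair_matrix_inv[OF B(2)] tr ..
  then show ?thesis using rot[of "torus_proj x"] by (simp add: SO2_iff)
 qed
 have E1: "cmod (fst (E x)) = 1" for x
 proof -
  have "cm_det (E x) = 1" unfolding E_def cm_det_mult cm_det_inv detA detB by simp
  then have "(cmod (fst (E x)))\<^sup>2 = 1" by (simp add: cm_det_def E2)
  then show ?thesis using norm_ge_zero[of "fst (E x)"] by (auto simp: power2_eq_1_iff)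
 qed
 have cE: "continuous_on UNIV (\<lambda>x. fst (E x))" unfolding E_def
  by (intro continuous_on_fst continuous_on_cm_mult continuous_on_cm_inv cA cB continuous_on_compose2[OF cB]) (auto intro!: continuous_intros)
 have pE: "periodic (\<lambda>x. fst (E x))"
  using perA perB periodic_shift[OF perB, of \<alpha>] by (simp add: periodic_def E_def)
 obtain \<phi> l where \<phi>: "continuous_on UNIV \<phi>" "\<And>x. fst (E x) = cis (\<phi> x)" "int_vec l"
  "\<And>x k. int_vec k ==> \<phi> (x + k) = \<phi> x + 2 * pi * (l \<bullet> k)"
  using continuous_angle_lift[OF cE pE E1] by blast
 have frame: "Bp (x + \<alpha>) \<odot> Ap x = (cis (\<phi> x), 0) \<odot> Bp x" for x
  unfolding EB using \<phi>(2)[of x] E2[of x] by (metis prod.collapse)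
 have l0: "l \<noteq> 0"
 proof
  assume "l = 0"
  then have "periodic \<phi>" using \<phi>(4) by (simp add: periodic_def)
  from degree_zero_homotopic[OF cB perB detB \<phi>(1) this, of \<alpha> A] frame assms(4) show False by (simp add: Ap_def)
 qed
 define u where "u x = - snd (Bp x) / fst (Bp x)" for x
 note nz = det_one_section[OF detB]
 have u: "continuous_on UNIV u" "periodic u" "\<And>x. cmod (u x) < 1"
  using nz perB unfolding u_def by (auto intro!: continuous_intros cB simp: periodic_def)
 have good: "good_coeffs r (fcoeff \<alpha> u)"
  unfolding u_def by (rule section_good_coeffs[OF syn reg perA detA cB perB detB \<phi>(1) frame \<phi>(4,3) l0])
 obtain b1 b2 where b: "periodic b1" "periodic b2"
  and Lb: "\<And>L :: complex \<Rightarrow> real^2^2. bounded_linear L ==> lift_class r (\<lambda>x. L (b1 x))"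
   "\<And>L :: complex \<Rightarrow> real^2^2. bounded_linear L ==> lift_class r (\<lambda>x. L (b2 x))"
  and detb: "\<And>x. cm_det (b1 x, b2 x) = 1" and b2: "\<And>x. b2 x = - u x * b1 x"
  using conjugacy_from_section[OF syn \<phi>(3) l0 u good] by blast
 define C where "C y = pair_mat (b1 (torus_rep y), b2 (torus_rep y))" for y
 have Cp: "C (torus_proj x) = pair_mat (b1 x, b2 x)" for x
 proof -
  have "torus_proj (torus_rep (torus_proj x)) = torus_proj x" by (rule Quotient3_abs_rep[OF Quotient3_torus])
  then have k: "int_vec (torus_rep (torus_proj x) - x)" by (simp add: torus_proj_eq)
  show ?thesis using periodicD[OF b(1) k, of x] periodicD[OF b(2) k, of x] by (simp add: C_def)
 qed
 have detC: "det (C y) = 1" for y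
  using detb[of "torus_rep y"] by (simp add: C_def flip: cm_det_mat_pair)
 have "lift_class r (\<lambda>x. pair_mat (b1 x, 0) + pair_mat (0, b2 x))"
  by (intro lift_class_add Lb) (auto intro!: bounded_linear_compose[OF bounded_linear_pair_mat, unfolded o_def] bounded_linear_Pair bounded_linear_ident bounded_linear_zero)
 moreover have "pair_mat (b1 x, 0) + pair_mat (0, b2 x) = (C \<circ> torus_proj) x" for x
  using bounded_linear.linear[OF bounded_linear_pair_mat, THEN linear_add, of "(b1 x, 0)" "(0, b2 x)"] by (simp add: Cp)
 ultimately have "of_class r C" unfolding cls by (simp add: o_def)
 then have C: "C \<in> maps_SL2 r" using detC by (auto simp: maps_SL2_def SL2_def)
 have "C (torus_translation \<alpha> y) ** A y ** matrix_inv (C y) \<in> SO2" for y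
 proof -
  obtain x where x: "torus_proj x = y" using torus_proj_surj by blast
  let ?p = "fst (Ap x)" and ?q = "snd (Ap x)" and ?v = "u (x + \<alpha>)"
  have inv: "?p * u x + ?q = ?v * (cnj ?q * u x + cnj ?p)"
   unfolding u_def by (rule section_invariance[OF frame nz(1) nz(1)])
  have "mat_pair (C (torus_translation \<alpha> y) ** A y ** matrix_inv (C y)) = (b1 (x + \<alpha>), b2 (x + \<alpha>)) \<odot> Ap x \<odot> cm_inv (b1 x, b2 x)"
   unfolding mat_pair_mult mat_pair_matrix_inv[OF detC] x[symmetric] tr Ap_def unfolding Cp mat_pair_inverse ..
  also have "snd \<dots> = b1 (x + \<alpha>) * b1 x * ((?p * u x + ?q) - ?v * (cnj ?q * u x + cnj ?p))"
   unfolding cm_mult_def cm_inv_def fst_conv snd_conv b2 complex_cnj_cnj by (simp add: algebra_simps)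
  finally have s: "snd (mat_pair (C (torus_translation \<alpha> y) ** A y ** matrix_inv (C y))) = 0" unfolding inv by simp
  have "det (matrix_inv (C y)) = 1"
   using detC[of y] by (simp add: mat_pair_matrix_inv cm_det_inv flip: cm_det_mat_pair)
  then have "det (C (torus_translation \<alpha> y) ** A y ** matrix_inv (C y)) = 1"
   by (simp add: det_mul detC SLA)
  then show ?thesis using s by (simp add: SO2_iff)
 qed
 then show ?thesis using C unfolding conjugate_to_rotations_def by blast
qed

end
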